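(* Let $\mathbb{F}$ be an algebraically closed field. Let $n \ge 2$ and let $R_1, \ldots, R_n$ be affine commutative $\mathbb{F}$-algebras which are domains. Fix any $n$ prime ideals $P_i \subseteq R_i$ ($1 \le i \le n$), and consider the expanded ideals $P_i' = P_i T$ in the affine domain $T = R_1 \otimes_{\mathbb{F}} \cdots \otimes_{\mathbb{F}} R_n$. Then for every integer $N \ge 0$, $$\left(\sum_{i=1}^{n} P_i'\right)^{(N)} = \sum_{A_1 + \cdots + A_n = N} \ \prod_{i=1}^n (P_i')^{(A_i)},$$ where the sum on the right is over all $n$-tuples $(A_1, \ldots, A_n)$ of nonnegative integers with $A_1 + \cdots + A_n = N$.
   Context: All rings are Noetherian and commutative with identity. An affine $\mathbb{F}$-algebra is a commutative $\mathbb{F}$-algebra of finite type over $\mathbb{F}$. For a prime ideal $P$ in a Noetherian ring $R$ and an integer $a>0$, the $a$-th symbolic power is $P^{(a)} = P^a R_P \cap R = \{ f \in R : uf \in P^a \text{ for some } u \in R \setminus P\}$; also $P^{(0)} = P^0 = R$. For an ideal $I$ of $R_i$, $IT$ denotes the ideal of $T$ generated by the image of $I$ under the natural map $R_i \to T$. Since $\mathbb{F}$ is algebraically closed, $T$ is a domain, and the ideals $P_i' = P_iT$ and their sum $\sum_{i=1}^n P_i'$ are prime in $T$, so that their symbolic powers are defined: for $\mathfrak{p}$ any one of these prime ideals of $T$, $\mathfrak{p}^{(a)} = \mathfrak{p}^a T_{\mathfrak{p}} \cap T = \{ f \in T : uf \in \mathfrak{p}^a \text{ for some } u \in T \setminus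 \mathfrak{p}\}$ for every integer $a>0$, and $\mathfrak{p}^{(0)} = T$. *)

theory Defs
  imports "HOL-Algebra.Algebra"
begin

text \<open>An \<open>F\<close>-algebra is of finite type if, as a ring, it is generated by the image of \<open>F\<close>
  together with finitely many elements.\<close>

definition affine_algebra :: "('f, 'm) ring_scheme \<Rightarrow> ('f, 'a, 'c) module_scheme \<Rightarrow> bool" where
  "affine_algebra F A \<longleftrightarrow>
     algebra F A \<and>
     (\<exists>S. finite S \<and> S \<subseteq> carrier A \<and>
          generate_ring A ((\<lambda>c. c \<odot>\<^bsub>A\<^esub> \<one>\<^bsub>A\<^esub>) ` carrier F \<union> S) = carrier A)"

text \<open>The monoid algebra \<open>F[M]\<close>. Elements are finitely supported functions, required to vanish
  (rather than to be undefined) outside \<open>carrier M\<close>; \<open>monoid_algebra_single F c x\<close> is the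
  element \<open>c\<cdot>[x]\<close>.\<close>

definition monoid_algebra_single :: "('f, 'k) ring_scheme \<Rightarrow> 'f \<Rightarrow> 'm \<Rightarrow> 'm \<Rightarrow> 'f" where
  "monoid_algebra_single F c x = (\<lambda>m. if m = x then c else \<zero>\<^bsub>F\<^esub>)"

definition monoid_algebra ::
  "('f, 'k) ring_scheme \<Rightarrow> ('m, 'l) monoid_scheme \<Rightarrow> ('m \<Rightarrow> 'f) ring" where
  "monoid_algebra F M =
     \<lparr>carrier = {f. range f \<subseteq> carrier F \<and> finite {m. f m \<noteq> \<zero>\<^bsub>F\<^esub>} \<and>
                    {m. f m \<noteq> \<zero>\<^bsub>F\<^esub>} \<subseteq> carrier M},
      monoid.mult = (\<lambda>f g m. \<Oplus>\<^bsub>F\<^esub>p\<in>{(x, y). f x \<noteq> \<zero>\<^bsub>F\<^esub> \<and> g y \<noteq> \<zero>\<^bsub>F\<^esub> \<and> x \<otimes>\<^bsub>M\<^esub> y = m}.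
                f (fst p) \<otimes>\<^bsub>F\<^esub> g (snd p)),
      one = monoid_algebra_single F \<one>\<^bsub>F\<^esub> \<one>\<^bsub>M\<^esub>,
      ring.zero = (\<lambda>m. \<zero>\<^bsub>F\<^esub>),
      add = (\<lambda>f g m. f m \<oplus>\<^bsub>F\<^esub> g m)\<rparr>"

text \<open>The tensor product over \<open>F\<close> of a finite family of \<open>F\<close>-algebras: the free \<open>F\<close>-module on the
  tuples in the product of the \<open>R i\<close>, modulo the relations that make tuples multilinear, multiplied
  componentwise on pure tensors. The free module with its componentwise multiplication is the monoid
  algebra of the multiplicative monoid \<open>product_group I R\<close> (the definition of
  \<^const>\<open>product_group\<close> makes sense for monoids and does not involve inverses). The
  product of a pure tuple with a multilinearity relation is again such a relation, so the submodule
  spanned by the relations coincides with the ideal they generate.\<close>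

definition tensor_free ::
  "('f, 'k) ring_scheme \<Rightarrow> 'i set \<Rightarrow> ('i \<Rightarrow> ('f, 'a, 'c) module_scheme) \<Rightarrow> (('i \<Rightarrow> 'a) \<Rightarrow> 'f) ring" where
  "tensor_free F I R = monoid_algebra F (product_group I R)"

definition tensor_relations ::
  "('f, 'k) ring_scheme \<Rightarrow> 'i set \<Rightarrow> ('i \<Rightarrow> ('f, 'a, 'c) module_scheme) \<Rightarrow> (('i \<Rightarrow> 'a) \<Rightarrow> 'f) set" where
  "tensor_relations F I R =
     {monoid_algebra_single F \<one>\<^bsub>F\<^esub> (x(i := a \<oplus>\<^bsub>R i\<^esub> b)) \<ominus>\<^bsub>tensor_free F I R\<^esub>
        (monoid_algebra_single F \<one>\<^bsub>F\<^esub> (x(i := a)) \<oplus>\<^bsub>tensor_free F I R\<^esub>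
         monoid_algebra_single F \<one>\<^bsub>F\<^esub> (x(i := b)))
      | x i a b. x \<in> (\<Pi>\<^sub>E j\<in>I. carrier (R j)) \<and> i \<in> I \<and> a \<in> carrier (R i) \<and> b \<in> carrier (R i)} \<union>
     {monoid_algebra_single F \<one>\<^bsub>F\<^esub> (x(i := c \<odot>\<^bsub>R i\<^esub> a)) \<ominus>\<^bsub>tensor_free F I R\<^esub>
        monoid_algebra_single F c (x(i := a))
      | x i c a. x \<in> (\<Pi>\<^sub>E j\<in>I. carrier (R j)) \<and> i \<in> I \<and> c \<in> carrier F \<and> a \<in> carrier (R i)}"

definition tensor_ideal ::
  "('f, 'k) ring_scheme \<Rightarrow> 'i set \<Rightarrow> ('i \<Rightarrow> ('f, 'a, 'c) module_scheme) \<Rightarrow> (('i \<Rightarrow> 'a) \<Rightarrow> 'f) set" where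
  "tensor_ideal F I R = Idl\<^bsub>tensor_free F I R\<^esub> (tensor_relations F I R)"

definition tensor_ring ::
  "('f, 'k) ring_scheme \<Rightarrow> 'i set \<Rightarrow> ('i \<Rightarrow> ('f, 'a, 'c) module_scheme) \<Rightarrow> (('i \<Rightarrow> 'a) \<Rightarrow> 'f) set ring" where
  "tensor_ring F I R = tensor_free F I R Quot tensor_ideal F I R"

text \<open>The natural map \<open>r \<mapsto> 1 \<otimes> \<dots> \<otimes> r \<otimes> \<dots> \<otimes> 1\<close> of the factor \<open>R i\<close> into the tensor product.\<close>

definition tensor_incl ::
  "('f, 'k) ring_scheme \<Rightarrow> 'i set \<Rightarrow> ('i \<Rightarrow> ('f, 'a, 'c) module_scheme) \<Rightarrow> 'i \<Rightarrow>
     'a \<Rightarrow> (('i \<Rightarrow> 'a) \<Rightarrow> 'f) set" where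
  "tensor_incl F I R i r =
     tensor_ideal F I R +>\<^bsub>tensor_free F I R\<^esub>
       monoid_algebra_single F \<one>\<^bsub>F\<^esub> (\<lambda>j\<in>I. if j = i then r else \<one>\<^bsub>R j\<^esub>)"

definition expanded_ideal ::
  "('f, 'k) ring_scheme \<Rightarrow> 'i set \<Rightarrow> ('i \<Rightarrow> ('f, 'a, 'c) module_scheme) \<Rightarrow> 'i \<Rightarrow>
     'a set \<Rightarrow> (('i \<Rightarrow> 'a) \<Rightarrow> 'f) set set" where
  "expanded_ideal F I R i J = Idl\<^bsub>tensor_ring F I R\<^esub> (tensor_incl F I R i ` J)"

text \<open>Powers, sums and products of ideals of \<open>T\<close> are taken in the semiring
  \<^term>\<open>ideals_set T\<close>.\<close>

definition symbolic_power :: "('a, 'b) ring_scheme \<Rightarrow> 'a set \<Rightarrow> nat \<Rightarrow> 'a set" where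
  "symbolic_power R P a =
     (if a = 0 then carrier R
      else {f \<in> carrier R. \<exists>u \<in> carrier R - P. u \<otimes>\<^bsub>R\<^esub> f \<in> P [^]\<^bsub>ideals_set R\<^esub> a})"

end

theory Submission
  imports Defs
begin

text \<open>Write \<open>Q\<close> for the sum of the extended primes \<open>P\<^sub>i' = P\<^sub>i T\<close>. Both sides of the formula are the ideal \<open>D\<close>
generated by the products \<open>x\<^sub>1 \<dots> x\<^sub>n\<close> in which \<open>x\<^sub>i\<close> comes from \<open>P\<^sub>i\<^sup>(\<^sup>a\<^sup>)\<close> with exponents \<open>a = a\<^sub>i\<close> of
sum at least \<open>N\<close>. That \<open>D\<close> is the right-hand side amounts to \<open>(P\<^sub>i')\<^sup>(\<^sup>a\<^sup>) = P\<^sub>i\<^sup>(\<^sup>a\<^sup>) T\<close>. That \<open>D\<close> lies in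
the left-hand side, and that \<open>Q\<^sup>N\<close> lies in \<open>D\<close>, is a matter of multiplying elements. The content of the
theorem is that \<open>D\<close> is saturated with respect to \<open>Q\<close>: if \<open>u \<notin> Q\<close> and \<open>u f \<in> D\<close>, then \<open>f \<in> D\<close>.

The tensor product is over a field, so \<open>T\<close> is free over every factor. Instead of bases, the proof
uses slices: a linear form \<open>\<mu>\<close> on \<open>R\<^sub>i\<close> induces an additive map on \<open>T\<close> that replaces the tensor factor
\<open>x\<^sub>i\<close> by the scalar \<open>\<mu> x\<^sub>i\<close>. Let \<open>G\<close> be an ideal of \<open>T\<close> that all slices along \<open>R\<^sub>i\<close> map into itself, for
instance one that is generated by elements in which the factor \<open>i\<close> does not occur. Then membership in
\<open>J T + G\<close>, for an ideal \<open>J\<close> of \<open>R\<^sub>i\<close>, is detected by the slices along the forms that vanish on \<open>J\<close>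
(\<open>mem_extG_iff\<close>). So \<open>J T + G\<close> can be handled like the kernel of the map from \<open>R\<^sub>i \<otimes> S\<close> onto
\<open>R\<^sub>i/J \<otimes> S/G\<close>, where \<open>S\<close> is the tensor product of the other factors.

Let \<open>u\<close> be a nonzerodivisor modulo \<open>P\<^sub>i T + G\<close>. The quotients of consecutive symbolic powers of \<open>P\<^sub>i\<close> are
torsion-free over the domain \<open>R\<^sub>i/P\<^sub>i\<close>, and elements that are independent over this domain stay
independent after tensoring. It follows that \<open>u\<close> is also a nonzerodivisor modulo every
\<open>P\<^sub>i\<^sup>(\<^sup>k\<^sup>) T + G\<close> (\<open>torsion_free_step\<close>, \<open>symbolic_primary\<close>).

Saturation is now proved by treating the factors one after another (\<open>filt_symbolic\<close>). For a set \<open>Y\<close>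
of factors let \<open>D(Y, N)\<close> be generated by the products as above over the factors in \<open>Y\<close>, together with the
primes of the remaining factors. For empty \<open>Y\<close> this is \<open>Q\<close> or \<open>T\<close>; when \<open>Y\<close> contains all factors, it
is \<open>D\<close>. In the step from \<open>Y\<close> to \<open>Y \<union> {i}\<close>, the element \<open>f\<close> lies in \<open>P\<^sub>i\<^sup>(\<^sup>a\<^sup>) T + G\<^sub>b\<close> for all \<open>a + b = N + 1\<close>,
where \<open>G\<^sub>b\<close> has exponent sum \<open>b\<close> in \<open>Y\<close> and omits the prime of \<open>i\<close>, because \<open>u\<close> is a nonzerodivisor
modulo these ideals. The intersection of these ideals is the sum of the products
\<open>P\<^sub>i\<^sup>(\<^sup>m\<^sup>) \<cdot> G\<^sub>N\<^sub>-\<^sub>m\<close>, as for filtered vector spaces. This is shown by successive approximation: modulo such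
products an element of \<open>P\<^sub>i\<^sup>(\<^sup>m\<^sup>) T\<close> can be moved into \<open>P\<^sub>i\<^sup>(\<^sup>m\<^sup>+\<^sup>1\<^sup>) T\<close> by \<open>slice_criterion\<close>.

The start of the induction needs that \<open>Q\<close> is prime, and this is where the algebraically closed field
enters. By the Nullstellensatz (\<open>separating_point_of_affine_algebra\<close>), an element of \<open>R\<^sub>i\<close> outside \<open>P\<^sub>i\<close>
does not vanish at some \<open>F\<close>-valued point at which \<open>P\<^sub>i\<close> vanishes. Slicing along such a point evaluates
the factor \<open>R\<^sub>i\<close> and is a ring homomorphism. Two elements outside \<open>Q\<close> can be evaluated at all factors so
that both remain outside \<open>Q\<close> (\<open>specialize\<close>); they end as nonzero scalars, whose product is not in \<open>Q\<close>.
The same argument with all primes but one replaced by zero shows that each \<open>P\<^sub>i'\<close> is prime.\<close>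

section \<open>Points of affine algebras\<close>

text \<open>Polynomials over a carrier are lists of coefficients with the leading one first, while the
evaluation of univariate polynomials of type \<open>up_ring\<close> is a sum over ascending exponents. The two
forms meet here.\<close>
lemma (in ring) eval_descending_coeffs:
  assumes c: "\<And>i. c i \<in> carrier R" and x: "x \<in> carrier R"
  shows "ring.eval R (map c (rev [0..<Suc d])) x = (\<Oplus>i\<in>{..d}. c i \<otimes> x [^] i)"
proof (induction d)
  case 0
  show ?case using c x by simp
next
  case (Suc d)
  have "map c (rev [0..<Suc (Suc d)]) = c (Suc d) # map c (rev [0..<Suc d])" by simp
  hence "eval (map c (rev [0..<Suc (Suc d)])) x
      = c (Suc d) \<otimes> x [^] (Suc d) \<oplus> eval (map c (rev [0..<Suc d])) x" by simp
  also have "\<dots> = c (Suc d) \<otimes> x [^] (Suc d) \<oplus> (\<Oplus>i\<in>{..d}. c i \<otimes> x [^] i)" using Suc by simp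
  also have "\<dots> = (\<Oplus>i\<in>{..Suc d}. c i \<otimes> x [^] i)"
    using c x by (subst finsum_Suc) auto
  finally show ?case .
qed

lemma (in algebraically_closed) exists_zero:
  fixes d :: nat
  assumes c: "\<And>i. c i \<in> carrier L" and d: "d \<ge> 1" and cd: "c d \<noteq> \<zero>"
  shows "\<exists>x\<in>carrier L. (\<Oplus>i\<in>{..d}. c i \<otimes> x [^] i) = \<zero>"
proof -
  define p where "p = map c (rev [0..<Suc d])"
  have pne: "p \<noteq> []" and hd: "hd p = c d" and set: "set p \<subseteq> carrier L" and len: "length p = Suc d"
    using c by (auto simp: p_def)
  have pc: "p \<in> carrier (poly_ring L)"
    using pne hd set cd by (simp add: univ_poly_carrier[symmetric] polynomial_def)
  have "splitted p" using roots_over_carrier[OF pc] .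
  hence "size (roots p) = d" unfolding splitted_def using len by simp
  hence "roots p \<noteq> {#}" using d by auto
  then obtain x where "x \<in># roots p" by auto
  hence "is_root p x" using roots_mem_iff_is_root[OF pc] by simp
  hence "x \<in> carrier L" "eval p x = \<zero>" unfolding is_root_def by auto
  thus ?thesis using eval_descending_coeffs[of c x d] c unfolding p_def by auto
qed

text \<open>In positive degree, subtracting 1 from the constant coefficient gives a polynomial that has a root, and there
the original value is 1.\<close>
lemma (in algebraically_closed) exists_nonzero:
  fixes d :: nat
  assumes c: "\<And>i. c i \<in> carrier L" and cd: "c d \<noteq> \<zero>"
  shows "\<exists>x\<in>carrier L. (\<Oplus>i\<in>{..d}. c i \<otimes> x [^] i) \<noteq> \<zero>"
proof (cases "d = 0")
  case True
  have "(\<Oplus>i\<in>{..d}. c i \<otimes> \<one> [^] i) = c 0" unfolding True using c[of 0] by (simp add: Pi_def c)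
  thus ?thesis using cd True by (metis one_closed)
next
  case False
  let ?c = "c(0 := c 0 \<ominus> \<one>)"
  have cc: "?c i \<in> carrier L" for i using c by simp
  obtain x where x: "x \<in> carrier L" and z: "(\<Oplus>i\<in>{..d}. ?c i \<otimes> x [^] i) = \<zero>"
    using exists_zero[of ?c d] cc False cd by auto
  have s: "{..d} = insert 0 {1..d}" by auto
  have "(\<Oplus>i\<in>{..d}. ?c i \<otimes> x [^] i) = (c 0 \<ominus> \<one>) \<oplus> (\<Oplus>i\<in>{1..d}. ?c i \<otimes> x [^] i)"
    unfolding s using c x by (subst finsum_insert) auto
  also have "(\<Oplus>i\<in>{1..d}. ?c i \<otimes> x [^] i) = (\<Oplus>i\<in>{1..d}. c i \<otimes> x [^] i)"
    using c x by (intro finsum_cong') auto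
  finally have e1: "(c 0 \<ominus> \<one>) \<oplus> (\<Oplus>i\<in>{1..d}. c i \<otimes> x [^] i) = \<zero>" using z by simp
  have e2: "(\<Oplus>i\<in>{..d}. c i \<otimes> x [^] i) = c 0 \<oplus> (\<Oplus>i\<in>{1..d}. c i \<otimes> x [^] i)"
    unfolding s using c x by (subst finsum_insert) auto
  have S: "(\<Oplus>i\<in>{1..d}. c i \<otimes> x [^] i) \<in> carrier L" using c x by (intro finsum_closed) auto
  have "c 0 \<oplus> (\<Oplus>i\<in>{1..d}. c i \<otimes> x [^] i) = \<one>"
  proof -
    have "c 0 \<oplus> (\<Oplus>i\<in>{1..d}. c i \<otimes> x [^] i)
        = ((c 0 \<ominus> \<one>) \<oplus> (\<Oplus>i\<in>{1..d}. c i \<otimes> x [^] i)) \<oplus> \<one>"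
      using S c[of 0] a_lcomm[of \<one> "c 0" "\<ominus> \<one> \<oplus> (\<Oplus>i\<in>{1..d}. c i \<otimes> x [^] i)"]
      by (simp add: a_minus_def a_assoc a_comm[of _ \<one>] r_neg2)
    thus ?thesis using e1 by simp
  qed
  thus ?thesis using e2 x by (intro bexI[of _ x]) auto
qed

text \<open>The inductive step of the Nullstellensatz. \<open>B\<close> is a domain contained in the domain \<open>A\<close>, and \<open>x \<in> A\<close>. A
homomorphism \<open>\<phi>\<close> from \<open>B\<close> to \<open>F\<close> extends to \<open>B[x]\<close> by \<open>x \<mapsto> \<xi>\<close> iff every polynomial relation of \<open>x\<close>
holds for \<open>\<xi>\<close>. An extension exists, and can be chosen not to kill the prescribed nonzero element
\<open>h(x)\<close> of \<open>B[x]\<close>, for all \<open>\<phi>\<close> outside the zero set of a single element \<open>a\<close> of \<open>B\<close>.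

If \<open>x\<close> is transcendental, \<open>a\<close> is the leading coefficient of \<open>h\<close>. Otherwise let \<open>p\<close> be a relation of
minimal degree. Division with remainder after multiplication by a power of the leading coefficient
of \<open>p\<close> shows that a root of \<open>p\<close> respects all relations. As \<open>p\<close> is irreducible over the fraction field
of \<open>B\<close> and does not divide \<open>h\<close>, some combination \<open>s h + t p\<close> is a nonzero constant \<open>c\<close>, which prevents \<open>h\<close>
from vanishing at the root. So \<open>a\<close> is the product of \<open>c\<close> and the leading coefficient of \<open>p\<close>.\<close>
lemma extend_hom_by_one_generator:
  fixes F :: "('f,'k) ring_scheme" and A :: "('a,'m) ring_scheme" and B :: "('b,'n) ring_scheme"
  assumes F: "algebraically_closed F" and A: "domain A" and B: "domain B"
    and i: "i \<in> ring_hom B A" and inj: "\<And>c. c \<in> carrier B \<Longrightarrow> i c = \<zero>\<^bsub>A\<^esub> \<Longrightarrow> c = \<zero>\<^bsub>B\<^esub>"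
    and x: "x \<in> carrier A" and h: "h \<in> carrier (UP B)" and hx: "UnivPoly.eval B A i x h \<noteq> \<zero>\<^bsub>A\<^esub>"
  shows "\<exists>a\<in>carrier B. a \<noteq> \<zero>\<^bsub>B\<^esub> \<and> (\<forall>\<phi>\<in>ring_hom B F. \<phi> a \<noteq> \<zero>\<^bsub>F\<^esub> \<longrightarrow>
      (\<exists>\<xi>\<in>carrier F. (\<forall>p\<in>carrier (UP B). UnivPoly.eval B A i x p = \<zero>\<^bsub>A\<^esub> \<longrightarrow> UnivPoly.eval B F \<phi> \<xi> p = \<zero>\<^bsub>F\<^esub>) \<and>
         UnivPoly.eval B F \<phi> \<xi> h \<noteq> \<zero>\<^bsub>F\<^esub>))"
proof -
  interpret F: algebraically_closed F by fact
  interpret A: domain A by fact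
  interpret B: domain B by fact
  interpret UP_domain B "UP B" by (simp_all add: UP_domain_def B)
  interpret E: UP_pre_univ_prop B A i "UP B"
    using i by (intro UP_pre_univ_prop.intro ring_hom_cringI UP_cring.intro) (auto intro: A.cring_axioms B.cring_axioms)
  let ?P = "UP B"
  let ?e = "UnivPoly.eval B A i x"
  let ?lc = "\<lambda>p. up_ring.coeff ?P p (deg B p)"
  have e: "?e \<in> ring_hom ?P A" using E.eval_ring_hom[OF x] .
  interpret e: ring_hom_cring ?P A ?e using e by (intro ring_hom_cringI) (auto intro: A.cring_axioms P.cring_axioms)
  have phiE: "UnivPoly.eval B F \<phi> \<xi> \<in> ring_hom ?P F" if "\<phi> \<in> ring_hom B F" "\<xi> \<in> carrier F" for \<phi> \<xi>
  proof -
    interpret G: UP_pre_univ_prop B F \<phi> "UP B"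
      using that by (intro UP_pre_univ_prop.intro ring_hom_cringI UP_cring.intro) (auto intro: F.cring_axioms B.cring_axioms)
    show ?thesis using G.eval_ring_hom[OF that(2)] .
  qed
  have phiC: "UnivPoly.eval B F \<phi> \<xi> p = (\<Oplus>\<^bsub>F\<^esub> j \<in> {..deg B p}. \<phi> (up_ring.coeff ?P p j) \<otimes>\<^bsub>F\<^esub> \<xi> [^]\<^bsub>F\<^esub> j)"
    if "p \<in> carrier ?P" for \<phi> \<xi> p using that by (simp add: eval_def)
  have evconst: "?e (up_ring.monom ?P r 0) = i r" if "r \<in> carrier B" for r using E.eval_const[OF x that] .
  have phiconst: "UnivPoly.eval B F \<phi> \<xi> (up_ring.monom ?P r 0) = \<phi> r" if "\<phi> \<in> ring_hom B F" "\<xi> \<in> carrier F" "r \<in> carrier B" for \<phi> \<xi> r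
  proof -
    interpret G: UP_pre_univ_prop B F \<phi> "UP B"
      using that by (intro UP_pre_univ_prop.intro ring_hom_cringI UP_cring.intro) (auto intro: F.cring_axioms B.cring_axioms)
    show ?thesis using G.eval_const[OF that(2,3)] .
  qed
  have hne: "h \<noteq> \<zero>\<^bsub>?P\<^esub>" using hx e.hom_zero by metis
  show ?thesis
  proof (cases "\<exists>p\<in>carrier ?P. p \<noteq> \<zero>\<^bsub>?P\<^esub> \<and> ?e p = \<zero>\<^bsub>A\<^esub>")
    case False
    have "\<exists>\<xi>\<in>carrier F. (\<forall>p\<in>carrier ?P. ?e p = \<zero>\<^bsub>A\<^esub> \<longrightarrow> UnivPoly.eval B F \<phi> \<xi> p = \<zero>\<^bsub>F\<^esub>) \<and>
         UnivPoly.eval B F \<phi> \<xi> h \<noteq> \<zero>\<^bsub>F\<^esub>" if phi: "\<phi> \<in> ring_hom B F" "\<phi> (?lc h) \<noteq> \<zero>\<^bsub>F\<^esub>" for \<phi>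
    proof -
      obtain \<xi> where xi: "\<xi> \<in> carrier F" and nz: "UnivPoly.eval B F \<phi> \<xi> h \<noteq> \<zero>\<^bsub>F\<^esub>"
        using F.exists_nonzero[of "\<lambda>j. \<phi> (up_ring.coeff ?P h j)" "deg B h"] phi h
        by (auto simp: phiC ring_hom_closed)
      have "UnivPoly.eval B F \<phi> \<xi> \<zero>\<^bsub>?P\<^esub> = \<zero>\<^bsub>F\<^esub>"
        using ring_hom_zero[OF phiE[OF phi(1) xi] P.ring_axioms F.ring_axioms] .
      thus ?thesis using False xi nz by auto
    qed
    thus ?thesis using lcoeff_nonzero[OF hne h] h by (intro bexI[of _ "?lc h"]) auto
  next
    case True
    define K where "K = {p\<in>carrier ?P. p \<noteq> \<zero>\<^bsub>?P\<^esub> \<and> ?e p = \<zero>\<^bsub>A\<^esub>}"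
    obtain p where pK: "p \<in> K" and pmin: "\<And>q. q \<in> K \<Longrightarrow> deg B p \<le> deg B q"
      using True ex_has_least_nat[of "\<lambda>p. p \<in> K" _ "deg B"] unfolding K_def by blast
    have p: "p \<in> carrier ?P" "p \<noteq> \<zero>\<^bsub>?P\<^esub>" "?e p = \<zero>\<^bsub>A\<^esub>" using pK unfolding K_def by auto
    have small: "q = \<zero>\<^bsub>?P\<^esub>" if "q \<in> carrier ?P" "?e q = \<zero>\<^bsub>A\<^esub>" "deg B q < deg B p" for q
      using pmin[of q] that unfolding K_def by fastforce
    \<comment> \<open>The fraction field is avoided: \<open>D\<close> consists of the nonzero elements of the ideal \<open>(h, p)\<close>, and an
      element \<open>g\<close> of least degree in it plays the role of the greatest common divisor.\<close>
    define D where "D = {g. g \<noteq> \<zero>\<^bsub>?P\<^esub> \<and> (\<exists>s\<in>carrier ?P. \<exists>t\<in>carrier ?P. g = s \<otimes>\<^bsub>?P\<^esub> h \<oplus>\<^bsub>?P\<^esub> t \<otimes>\<^bsub>?P\<^esub> p)}"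
    have h_comb: "h = \<one>\<^bsub>?P\<^esub> \<otimes>\<^bsub>?P\<^esub> h \<oplus>\<^bsub>?P\<^esub> \<zero>\<^bsub>?P\<^esub> \<otimes>\<^bsub>?P\<^esub> p"
      using h p by simp
    have "h \<in> D" unfolding D_def using hne h_comb P.one_closed P.zero_closed by blast
    then obtain g where gD: "g \<in> D" and gmin: "\<And>q. q \<in> D \<Longrightarrow> deg B g \<le> deg B q"
      using ex_has_least_nat[of "\<lambda>p. p \<in> D" _ "deg B"] by blast
    obtain s t where g: "g \<noteq> \<zero>\<^bsub>?P\<^esub>" "s \<in> carrier ?P" "t \<in> carrier ?P" "g = s \<otimes>\<^bsub>?P\<^esub> h \<oplus>\<^bsub>?P\<^esub> t \<otimes>\<^bsub>?P\<^esub> p"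
      using gD unfolding D_def by auto
    have gc: "g \<in> carrier ?P" using g h p by auto
    have lcg: "?lc g \<in> carrier B" "?lc g \<noteq> \<zero>\<^bsub>B\<^esub>" using lcoeff_nonzero[OF g(1) gc] gc by auto
    have powne: "c [^]\<^bsub>B\<^esub> (k::nat) \<noteq> \<zero>\<^bsub>B\<^esub>" if "c \<in> carrier B" "c \<noteq> \<zero>\<^bsub>B\<^esub>" for c k
      by (induction k) (use that B.integral in auto)
    have divides: "\<exists>k::nat. \<exists>q\<in>carrier ?P. (?lc g [^]\<^bsub>B\<^esub> k) \<odot>\<^bsub>?P\<^esub> f = g \<otimes>\<^bsub>?P\<^esub> q"
      if f: "f = s' \<otimes>\<^bsub>?P\<^esub> h \<oplus>\<^bsub>?P\<^esub> t' \<otimes>\<^bsub>?P\<^esub> p" "s' \<in> carrier ?P" "t' \<in> carrier ?P" for f s' t'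
    proof -
      have fc: "f \<in> carrier ?P" using f h p by auto
      obtain q r k where q: "q \<in> carrier ?P" "r \<in> carrier ?P"
        "(?lc g [^]\<^bsub>B\<^esub> (k::nat)) \<odot>\<^bsub>?P\<^esub> f = g \<otimes>\<^bsub>?P\<^esub> q \<oplus>\<^bsub>?P\<^esub> r" "r = \<zero>\<^bsub>?P\<^esub> \<or> deg B r < deg B g"
        using long_div_theorem[OF gc fc g(1)] by blast
      have m: "up_ring.monom ?P (?lc g [^]\<^bsub>B\<^esub> k) 0 \<in> carrier ?P" using lcg by auto
      let ?m = "up_ring.monom ?P (?lc g [^]\<^bsub>B\<^esub> k) 0"
      have r: "r = ?m \<otimes>\<^bsub>?P\<^esub> f \<ominus>\<^bsub>?P\<^esub> g \<otimes>\<^bsub>?P\<^esub> q"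
        using q(1-3) gc fc lcg m
        by (metis B.nat_pow_closed P.add.inv_solve_right' P.m_closed P.minus_eq UP_a_comm monom_mult_is_smult)
      have alg: "m \<otimes>\<^bsub>?P\<^esub> (s' \<otimes>\<^bsub>?P\<^esub> h \<oplus>\<^bsub>?P\<^esub> t' \<otimes>\<^bsub>?P\<^esub> p) \<ominus>\<^bsub>?P\<^esub> (s \<otimes>\<^bsub>?P\<^esub> h \<oplus>\<^bsub>?P\<^esub> t \<otimes>\<^bsub>?P\<^esub> p) \<otimes>\<^bsub>?P\<^esub> q
          = (m \<otimes>\<^bsub>?P\<^esub> s' \<ominus>\<^bsub>?P\<^esub> q \<otimes>\<^bsub>?P\<^esub> s) \<otimes>\<^bsub>?P\<^esub> h \<oplus>\<^bsub>?P\<^esub> (m \<otimes>\<^bsub>?P\<^esub> t' \<ominus>\<^bsub>?P\<^esub> q \<otimes>\<^bsub>?P\<^esub> t) \<otimes>\<^bsub>?P\<^esub> p"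
        if "m \<in> carrier ?P" for m
        using that f(2,3) g(2,3) q(1) h p(1) by algebra
      note r
      also have "?m \<otimes>\<^bsub>?P\<^esub> f \<ominus>\<^bsub>?P\<^esub> g \<otimes>\<^bsub>?P\<^esub> q
          = (?m \<otimes>\<^bsub>?P\<^esub> s' \<ominus>\<^bsub>?P\<^esub> q \<otimes>\<^bsub>?P\<^esub> s) \<otimes>\<^bsub>?P\<^esub> h \<oplus>\<^bsub>?P\<^esub> (?m \<otimes>\<^bsub>?P\<^esub> t' \<ominus>\<^bsub>?P\<^esub> q \<otimes>\<^bsub>?P\<^esub> t) \<otimes>\<^bsub>?P\<^esub> p"
        using alg[OF m] by (simp only: f(1)[symmetric] g(4)[symmetric])
      finally have rD: "r = (?m \<otimes>\<^bsub>?P\<^esub> s' \<ominus>\<^bsub>?P\<^esub> q \<otimes>\<^bsub>?P\<^esub> s) \<otimes>\<^bsub>?P\<^esub> h \<oplus>\<^bsub>?P\<^esub> (?m \<otimes>\<^bsub>?P\<^esub> t' \<ominus>\<^bsub>?P\<^esub> q \<otimes>\<^bsub>?P\<^esub> t) \<otimes>\<^bsub>?P\<^esub> p" .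
      have "?m \<otimes>\<^bsub>?P\<^esub> s' \<ominus>\<^bsub>?P\<^esub> q \<otimes>\<^bsub>?P\<^esub> s \<in> carrier ?P" "?m \<otimes>\<^bsub>?P\<^esub> t' \<ominus>\<^bsub>?P\<^esub> q \<otimes>\<^bsub>?P\<^esub> t \<in> carrier ?P"
        using f(2,3) g(2,3) m q(1) by simp_all
      with rD have "r = \<zero>\<^bsub>?P\<^esub> \<or> r \<in> D" unfolding D_def by blast
      hence "r = \<zero>\<^bsub>?P\<^esub>" using q(4) gmin[of r] by auto
      thus ?thesis using q(1,3) gc by (metis P.m_closed P.r_zero)
    qed
    have smulte: "?e (c \<odot>\<^bsub>?P\<^esub> f) = i c \<otimes>\<^bsub>A\<^esub> ?e f" if "c \<in> carrier B" "f \<in> carrier ?P" for c f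
      using that by (metis e.hom_mult evconst monom_closed monom_mult_is_smult)
    \<comment> \<open>If \<open>g\<close> had positive degree, then, up to constants, \<open>p = g q\<close> with \<open>q\<close> of smaller degree, so that
      \<open>q(x)\<close> is not 0 by minimality. Hence \<open>g(x) = 0\<close>; as \<open>g\<close> divides \<open>h\<close> up to constants, \<open>h(x) = 0\<close>.\<close>
    have "deg B g = 0"
    proof (rule ccontr)
      assume dg: "deg B g \<noteq> 0"
      have "p = \<zero>\<^bsub>?P\<^esub> \<otimes>\<^bsub>?P\<^esub> h \<oplus>\<^bsub>?P\<^esub> \<one>\<^bsub>?P\<^esub> \<otimes>\<^bsub>?P\<^esub> p" using p h by simp
      then obtain k q where q: "q \<in> carrier ?P" "(?lc g [^]\<^bsub>B\<^esub> (k::nat)) \<odot>\<^bsub>?P\<^esub> p = g \<otimes>\<^bsub>?P\<^esub> q"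
        using divides by blast
      obtain k' q' where q': "q' \<in> carrier ?P" "(?lc g [^]\<^bsub>B\<^esub> (k'::nat)) \<odot>\<^bsub>?P\<^esub> h = g \<otimes>\<^bsub>?P\<^esub> q'"
        using divides[OF h_comb] by blast
      have lk: "?lc g [^]\<^bsub>B\<^esub> k \<noteq> \<zero>\<^bsub>B\<^esub>" for k :: nat using powne lcg by auto
      have dp: "deg B ((?lc g [^]\<^bsub>B\<^esub> k) \<odot>\<^bsub>?P\<^esub> p) = deg B p"
        using deg_smult[of "?lc g [^]\<^bsub>B\<^esub> k" p] lk[of k] lcg p by auto
      have qne: "q \<noteq> \<zero>\<^bsub>?P\<^esub>"
      proof
        assume "q = \<zero>\<^bsub>?P\<^esub>"
        hence z: "(?lc g [^]\<^bsub>B\<^esub> k) \<odot>\<^bsub>?P\<^esub> p = \<zero>\<^bsub>?P\<^esub>" using q gc by simp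
        have "up_ring.monom ?P (?lc g [^]\<^bsub>B\<^esub> k) 0 \<otimes>\<^bsub>?P\<^esub> p = \<zero>\<^bsub>?P\<^esub>"
          using z monom_mult_is_smult[of "?lc g [^]\<^bsub>B\<^esub> k" p] lcg p by auto
        hence "up_ring.monom ?P (?lc g [^]\<^bsub>B\<^esub> k) 0 = \<zero>\<^bsub>?P\<^esub>"
          using UP_integral[of "up_ring.monom ?P (?lc g [^]\<^bsub>B\<^esub> k) 0" p] p lcg by auto
        hence "up_ring.coeff ?P (up_ring.monom ?P (?lc g [^]\<^bsub>B\<^esub> k) 0) 0 = \<zero>\<^bsub>B\<^esub>" by simp
        thus False using lk[of k] lcg by simp
      qed
      have "deg B p = deg B g + deg B q" using deg_mult[OF g(1) qne gc q(1)] dp q(2) by simp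
      hence "deg B q < deg B p" using dg by simp
      hence eq: "?e q \<noteq> \<zero>\<^bsub>A\<^esub>" using small q(1) qne by blast
      have "?e g \<otimes>\<^bsub>A\<^esub> ?e q = i (?lc g [^]\<^bsub>B\<^esub> k) \<otimes>\<^bsub>A\<^esub> ?e p"
        using smulte[of "?lc g [^]\<^bsub>B\<^esub> k" p] q gc p lcg by (metis B.nat_pow_closed e.hom_mult)
      also have "\<dots> = \<zero>\<^bsub>A\<^esub>" using p i lcg by (simp add: ring_hom_closed)
      finally have "?e g = \<zero>\<^bsub>A\<^esub>" using A.integral eq gc q(1) by (meson e.hom_closed)
      hence "i (?lc g [^]\<^bsub>B\<^esub> k') \<otimes>\<^bsub>A\<^esub> ?e h = \<zero>\<^bsub>A\<^esub>"
        using smulte[of "?lc g [^]\<^bsub>B\<^esub> k'" h] q' gc h lcg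
        by (metis A.l_null B.nat_pow_closed e.hom_closed e.hom_mult)
      hence "i (?lc g [^]\<^bsub>B\<^esub> k') = \<zero>\<^bsub>A\<^esub>"
        using A.integral hx h lcg i by (meson B.nat_pow_closed e.hom_closed ring_hom_closed)
      thus False using inj[of "?lc g [^]\<^bsub>B\<^esub> k'"] lk lcg by simp
    qed
    then obtain c where c: "c \<in> carrier B" "c \<noteq> \<zero>\<^bsub>B\<^esub>" and gm: "g = up_ring.monom ?P c 0"
      using deg_zero_impl_monom[OF gc] lcg by (metis monom_zero g(1) coeff_closed gc)
    let ?lp = "?lc p"
    have lp: "?lp \<in> carrier B" "?lp \<noteq> \<zero>\<^bsub>B\<^esub>" using lcoeff_nonzero[OF p(2,1)] p by auto
    have dp: "deg B p \<ge> 1"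
    proof (rule ccontr)
      assume "\<not> deg B p \<ge> 1"
      hence d0: "deg B p = 0" by simp
      have "p = up_ring.monom ?P ?lp 0" using deg_zero_impl_monom[OF p(1) d0] unfolding d0 .
      thus False using evconst[OF lp(1)] p(3) inj lp by metis
    qed
    have "\<exists>\<xi>\<in>carrier F. (\<forall>f\<in>carrier ?P. ?e f = \<zero>\<^bsub>A\<^esub> \<longrightarrow> UnivPoly.eval B F \<phi> \<xi> f = \<zero>\<^bsub>F\<^esub>) \<and>
         UnivPoly.eval B F \<phi> \<xi> h \<noteq> \<zero>\<^bsub>F\<^esub>"
      if phi: "\<phi> \<in> ring_hom B F" "\<phi> (c \<otimes>\<^bsub>B\<^esub> ?lp) \<noteq> \<zero>\<^bsub>F\<^esub>" for \<phi>
    proof -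
      have nzc: "\<phi> c \<noteq> \<zero>\<^bsub>F\<^esub>" and nzl: "\<phi> ?lp \<noteq> \<zero>\<^bsub>F\<^esub>"
        using phi lp(1) c(1) by (auto simp: ring_hom_mult ring_hom_closed)
      obtain \<xi> where xi: "\<xi> \<in> carrier F" and rt: "UnivPoly.eval B F \<phi> \<xi> p = \<zero>\<^bsub>F\<^esub>"
        using F.exists_zero[of "\<lambda>j. \<phi> (up_ring.coeff ?P p j)" "deg B p"] phi p nzl dp
        by (auto simp: phiC ring_hom_closed)
      interpret f: ring_hom_cring ?P F "UnivPoly.eval B F \<phi> \<xi>"
        using phiE[OF phi(1) xi] by (intro ring_hom_cringI) (auto intro: F.cring_axioms P.cring_axioms)
      have smultf: "UnivPoly.eval B F \<phi> \<xi> (d \<odot>\<^bsub>?P\<^esub> f) = \<phi> d \<otimes>\<^bsub>F\<^esub> UnivPoly.eval B F \<phi> \<xi> f"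
        if "d \<in> carrier B" "f \<in> carrier ?P" for d f
        using that phiconst[OF phi(1) xi] by (metis f.hom_mult monom_closed monom_mult_is_smult)
      have ker: "UnivPoly.eval B F \<phi> \<xi> f = \<zero>\<^bsub>F\<^esub>" if f: "f \<in> carrier ?P" "?e f = \<zero>\<^bsub>A\<^esub>" for f
      proof -
        obtain q r k where q: "q \<in> carrier ?P" "r \<in> carrier ?P"
          "(?lp [^]\<^bsub>B\<^esub> (k::nat)) \<odot>\<^bsub>?P\<^esub> f = p \<otimes>\<^bsub>?P\<^esub> q \<oplus>\<^bsub>?P\<^esub> r" "r = \<zero>\<^bsub>?P\<^esub> \<or> deg B r < deg B p"
          using long_div_theorem[OF p(1) f(1) p(2)] by blast
        have lpk: "?lp [^]\<^bsub>B\<^esub> k \<in> carrier B" using lp by auto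
        have "i (?lp [^]\<^bsub>B\<^esub> k) \<otimes>\<^bsub>A\<^esub> ?e f = ?e p \<otimes>\<^bsub>A\<^esub> ?e q \<oplus>\<^bsub>A\<^esub> ?e r"
          using q smulte[OF lpk f(1)] p(1) by (metis P.m_closed e.hom_add e.hom_mult)
        hence "?e r = \<zero>\<^bsub>A\<^esub>" using f(2) p(3) q lpk i by (simp add: ring_hom_closed)
        hence r: "r = \<zero>\<^bsub>?P\<^esub>" using small[of r] q by auto
        have "\<phi> (?lp [^]\<^bsub>B\<^esub> k) \<otimes>\<^bsub>F\<^esub> UnivPoly.eval B F \<phi> \<xi> f = UnivPoly.eval B F \<phi> \<xi> p \<otimes>\<^bsub>F\<^esub> UnivPoly.eval B F \<phi> \<xi> q"
          using q(1,3) smultf[OF lpk f(1)] p(1) r by (metis P.m_closed P.r_zero f.hom_mult)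
        hence z: "\<phi> (?lp [^]\<^bsub>B\<^esub> k) \<otimes>\<^bsub>F\<^esub> UnivPoly.eval B F \<phi> \<xi> f = \<zero>\<^bsub>F\<^esub>" using rt q(1) by simp
        interpret ph: ring_hom_cring B F \<phi>
          using phi(1) by (intro ring_hom_cringI) (auto intro: F.cring_axioms B.cring_axioms)
        have "\<phi> (?lp [^]\<^bsub>B\<^esub> k) = \<phi> ?lp [^]\<^bsub>F\<^esub> k" using lp by simp
        moreover have "\<phi> ?lp [^]\<^bsub>F\<^esub> k \<noteq> \<zero>\<^bsub>F\<^esub>" using nzl lp(1) F.integral
          by (induction k) auto
        ultimately show ?thesis using z F.integral f lpk by (metis f.hom_closed ph.hom_closed)
      qed
      have "UnivPoly.eval B F \<phi> \<xi> g = UnivPoly.eval B F \<phi> \<xi> s \<otimes>\<^bsub>F\<^esub> UnivPoly.eval B F \<phi> \<xi> h \<oplus>\<^bsub>F\<^esub> UnivPoly.eval B F \<phi> \<xi> t \<otimes>\<^bsub>F\<^esub> UnivPoly.eval B F \<phi> \<xi> p"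
        using g h p by simp
      hence "\<phi> c = UnivPoly.eval B F \<phi> \<xi> s \<otimes>\<^bsub>F\<^esub> UnivPoly.eval B F \<phi> \<xi> h"
        unfolding gm phiconst[OF phi(1) xi c(1)] using rt g h by simp
      hence "UnivPoly.eval B F \<phi> \<xi> h \<noteq> \<zero>\<^bsub>F\<^esub>" using nzc g(2) by auto
      thus ?thesis using ker xi by blast
    qed
    moreover have "c \<otimes>\<^bsub>B\<^esub> ?lp \<in> carrier B" "c \<otimes>\<^bsub>B\<^esub> ?lp \<noteq> \<zero>\<^bsub>B\<^esub>"
      using c lp B.integral by auto
    ultimately show ?thesis by blast
  qed
qed

lemma ring_hom_field_inj:
  assumes "field F" "domain A" "\<sigma> \<in> ring_hom F A" "c \<in> carrier F" "\<sigma> c = \<zero>\<^bsub>A\<^esub>"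
  shows "c = \<zero>\<^bsub>F\<^esub>"
proof (rule ccontr)
  interpret F: field F by fact
  interpret A: domain A by fact
  assume "c \<noteq> \<zero>\<^bsub>F\<^esub>"
  then obtain d where "d \<in> carrier F" "c \<otimes>\<^bsub>F\<^esub> d = \<one>\<^bsub>F\<^esub>"
    using F.field_Units assms(4) by (metis DiffI F.Units_r_inv_ex empty_iff insert_iff)
  hence "\<sigma> c \<otimes>\<^bsub>A\<^esub> \<sigma> d = \<one>\<^bsub>A\<^esub>" using assms by (metis ring_hom_mult ring_hom_one)
  thus False using assms(5) \<open>d \<in> carrier F\<close> assms(3) A.l_null[of "\<sigma> d"] by (auto simp: ring_hom_closed)
qed

text \<open>Induction on the generators with \<open>extend_hom_by_one_generator\<close>: the element \<open>a\<close> that it produces for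
the last generator becomes the element that must not vanish on the smaller subring.\<close>
lemma separating_point_of_finitely_generated_domain:
  assumes F: "algebraically_closed F" and A: "domain A" and s: "\<sigma> \<in> ring_hom F A"
    and fin: "finite S" and S: "S \<subseteq> carrier A"
    and b: "b \<in> generate_ring A (\<sigma> ` carrier F \<union> S)" "b \<noteq> \<zero>\<^bsub>A\<^esub>"
  shows "\<exists>\<phi>\<in>ring_hom (A\<lparr>carrier := generate_ring A (\<sigma> ` carrier F \<union> S)\<rparr>) F.
           (\<forall>c\<in>carrier F. \<phi> (\<sigma> c) = c) \<and> \<phi> b \<noteq> \<zero>\<^bsub>F\<^esub>"
  using fin S b
proof (induction S arbitrary: b)
  case empty
  interpret F: algebraically_closed F by fact
  interpret A: domain A by fact
  interpret s: ring_hom_ring F A \<sigma> using s by (intro ring_hom_ringI2) (auto intro: F.ring_axioms A.ring_axioms)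
  have sub: "subring (\<sigma> ` carrier F) A" using s.img_is_subring[OF F.carrier_is_subring] .
  have gen: "generate_ring A (\<sigma> ` carrier F \<union> {}) = \<sigma> ` carrier F"
    using A.generate_ringI[of "\<sigma> ` carrier F" "\<sigma> ` carrier F"] sub subringE(1)[OF sub] by simp
  have inj: "inj_on \<sigma> (carrier F)"
  proof (rule inj_onI)
    fix c d assume cd: "c \<in> carrier F" "d \<in> carrier F" "\<sigma> c = \<sigma> d"
    hence "\<sigma> (c \<ominus>\<^bsub>F\<^esub> d) = \<zero>\<^bsub>A\<^esub>" by (simp add: a_minus_def A.r_neg)
    hence "c \<ominus>\<^bsub>F\<^esub> d = \<zero>\<^bsub>F\<^esub>" using ring_hom_field_inj[OF F.field_axioms A s] cd by blast
    thus "c = d" using cd by simp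
  qed
  have inv: "inv_into (carrier F) \<sigma> (\<sigma> c) = c" if "c \<in> carrier F" for c using inj that by simp
  have "inv_into (carrier F) \<sigma> \<in> ring_hom (A\<lparr>carrier := \<sigma> ` carrier F\<rparr>) F"
  proof (rule ring_hom_memI)
    fix x y assume "x \<in> carrier (A\<lparr>carrier := \<sigma> ` carrier F\<rparr>)" "y \<in> carrier (A\<lparr>carrier := \<sigma> ` carrier F\<rparr>)"
    then obtain c d where cd: "c \<in> carrier F" "d \<in> carrier F" "x = \<sigma> c" "y = \<sigma> d" by auto
    show "inv_into (carrier F) \<sigma> (x \<otimes>\<^bsub>A\<lparr>carrier := \<sigma> ` carrier F\<rparr>\<^esub> y)
        = inv_into (carrier F) \<sigma> x \<otimes>\<^bsub>F\<^esub> inv_into (carrier F) \<sigma> y"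
      "inv_into (carrier F) \<sigma> (x \<oplus>\<^bsub>A\<lparr>carrier := \<sigma> ` carrier F\<rparr>\<^esub> y)
        = inv_into (carrier F) \<sigma> x \<oplus>\<^bsub>F\<^esub> inv_into (carrier F) \<sigma> y"
      using cd(1,2)
      by (simp_all add: cd(3,4) inv s.hom_mult[symmetric] s.hom_add[symmetric] del: s.hom_mult s.hom_add)
  next
    have "\<one>\<^bsub>A\<^esub> = \<sigma> \<one>\<^bsub>F\<^esub>" by simp
    thus "inv_into (carrier F) \<sigma> \<one>\<^bsub>A\<lparr>carrier := \<sigma> ` carrier F\<rparr>\<^esub> = \<one>\<^bsub>F\<^esub>"
      using inv[OF F.one_closed] by (metis monoid.select_convs(2) monoid.surjective partial_object.update_convs(1))
  qed (auto simp: inv)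
  moreover obtain c where "c \<in> carrier F" "b = \<sigma> c" using empty gen by auto
  hence "inv_into (carrier F) \<sigma> b \<noteq> \<zero>\<^bsub>F\<^esub>" using inv empty by auto
  ultimately show ?case unfolding gen using inv by blast
next
  case (insert x S)
  interpret F: algebraically_closed F by fact
  interpret A: domain A by fact
  have sF: "\<sigma> ` carrier F \<subseteq> carrier A" using s by (auto simp: ring_hom_closed)
  define G where "G = generate_ring A (\<sigma> ` carrier F \<union> S)"
  define G' where "G' = generate_ring A (\<sigma> ` carrier F \<union> insert x S)"
  define B where "B = A\<lparr>carrier := G\<rparr>"
  have x: "x \<in> carrier A" and SA: "S \<subseteq> carrier A" using insert by auto
  have G: "subring G A" unfolding G_def using A.generate_ring_is_subring sF SA by simp
  have GA: "G \<subseteq> carrier A" using G by (simp add: subringE(1))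
  have G'A: "G' \<subseteq> carrier A" unfolding G'_def using A.generate_ring_incl sF insert by simp
  have Bd: "domain B" unfolding B_def using A.subring_is_domain[OF G] .
  interpret B: domain B by fact
  have idh: "id \<in> ring_hom B A" using GA by (auto intro!: ring_hom_memI simp: B_def)
  interpret UP_domain B "UP B" by (simp_all add: UP_domain_def Bd)
  interpret E: UP_pre_univ_prop B A id "UP B"
    using idh by (intro UP_pre_univ_prop.intro ring_hom_cringI UP_cring.intro) (auto intro: A.cring_axioms B.cring_axioms)
  define e where "e = UnivPoly.eval B A id x"
  interpret e: ring_hom_cring "UP B" A e
    using E.eval_ring_hom[OF x, folded e_def] by (intro ring_hom_cringI) (auto intro: A.cring_axioms P.cring_axioms)
  have img: "\<exists>h\<in>carrier (UP B). e h = y" if "y \<in> G'" for y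
    using that unfolding G'_def
  proof (induction rule: generate_ring.induct)
    case one
    show ?case by (intro bexI[of _ "\<one>\<^bsub>UP B\<^esub>"]) auto
  next
    case (incl y)
    show ?case
    proof (cases "y = x")
      case True
      thus ?thesis using E.eval_monom1[OF x, folded e_def] by (intro bexI[of _ "up_ring.monom (UP B) \<one>\<^bsub>B\<^esub> 1"]) auto
    next
      case False
      hence "y \<in> carrier B" using incl unfolding B_def G_def by (auto intro: generate_ring.incl)
      thus ?thesis using E.eval_const[OF x, folded e_def] by (intro bexI[of _ "up_ring.monom (UP B) y 0"]) auto
    qed
  next
    case (a_inv y)
    then obtain h where "h \<in> carrier (UP B)" "e h = y" by auto
    thus ?case by (intro bexI[of _ "\<ominus>\<^bsub>UP B\<^esub> h"]) auto
  next
    case (eng_add y z)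
    then obtain h k where "h \<in> carrier (UP B)" "e h = y" "k \<in> carrier (UP B)" "e k = z" by auto
    thus ?case by (intro bexI[of _ "h \<oplus>\<^bsub>UP B\<^esub> k"]) auto
  next
    case (eng_mult y z)
    then obtain h k where "h \<in> carrier (UP B)" "e h = y" "k \<in> carrier (UP B)" "e k = z" by auto
    thus ?case by (intro bexI[of _ "h \<otimes>\<^bsub>UP B\<^esub> k"]) auto
  qed
  obtain h where h: "h \<in> carrier (UP B)" "e h = b" using img insert.prems(2) unfolding G'_def by auto
  have "\<exists>a\<in>carrier B. a \<noteq> \<zero>\<^bsub>B\<^esub> \<and> (\<forall>\<phi>\<in>ring_hom B F. \<phi> a \<noteq> \<zero>\<^bsub>F\<^esub> \<longrightarrow>
      (\<exists>\<xi>\<in>carrier F. (\<forall>p\<in>carrier (UP B). e p = \<zero>\<^bsub>A\<^esub> \<longrightarrow> UnivPoly.eval B F \<phi> \<xi> p = \<zero>\<^bsub>F\<^esub>) \<and>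
         UnivPoly.eval B F \<phi> \<xi> h \<noteq> \<zero>\<^bsub>F\<^esub>))"
    using h insert.prems(3) by (intro extend_hom_by_one_generator[OF F A Bd idh _ x h(1), folded e_def]) (auto simp: B_def)
  then obtain a where a: "a \<in> carrier B" "a \<noteq> \<zero>\<^bsub>B\<^esub>" and ext: "\<And>\<phi>. \<phi>\<in>ring_hom B F \<Longrightarrow> \<phi> a \<noteq> \<zero>\<^bsub>F\<^esub> \<Longrightarrow>
      (\<exists>\<xi>\<in>carrier F. (\<forall>p\<in>carrier (UP B). e p = \<zero>\<^bsub>A\<^esub> \<longrightarrow> UnivPoly.eval B F \<phi> \<xi> p = \<zero>\<^bsub>F\<^esub>) \<and>
         UnivPoly.eval B F \<phi> \<xi> h \<noteq> \<zero>\<^bsub>F\<^esub>)" by blast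
  have "a \<in> G" "a \<noteq> \<zero>\<^bsub>A\<^esub>" using a by (auto simp: B_def)
  then obtain \<phi> where phi: "\<phi> \<in> ring_hom B F" "\<And>c. c \<in> carrier F \<Longrightarrow> \<phi> (\<sigma> c) = c" "\<phi> a \<noteq> \<zero>\<^bsub>F\<^esub>"
    using insert.IH[OF SA, of a] unfolding B_def G_def by blast
  obtain \<xi> where xi: "\<xi> \<in> carrier F"
    and ker: "\<And>p. p \<in> carrier (UP B) \<Longrightarrow> e p = \<zero>\<^bsub>A\<^esub> \<Longrightarrow> UnivPoly.eval B F \<phi> \<xi> p = \<zero>\<^bsub>F\<^esub>"
    and nz: "UnivPoly.eval B F \<phi> \<xi> h \<noteq> \<zero>\<^bsub>F\<^esub>" using ext[OF phi(1,3)] by blast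
  let ?f = "UnivPoly.eval B F \<phi> \<xi>"
  interpret H: UP_pre_univ_prop B F \<phi> "UP B"
    using phi(1) by (intro UP_pre_univ_prop.intro ring_hom_cringI UP_cring.intro) (auto intro: F.cring_axioms B.cring_axioms)
  interpret f: ring_hom_cring "UP B" F ?f
    using H.eval_ring_hom[OF xi] by (intro ring_hom_cringI) (auto intro: F.cring_axioms P.cring_axioms)
  \<comment> \<open>The extension sends the value at \<open>x\<close> of a polynomial to its value at \<open>\<xi>\<close>. The choice of the
    polynomial does not matter, since \<open>\<xi>\<close> satisfies all relations of \<open>x\<close>.\<close>
  define \<psi> where "\<psi> y = ?f (SOME p. p \<in> carrier (UP B) \<and> e p = y)" for y
  have psi: "\<psi> (e p) = ?f p" if p: "p \<in> carrier (UP B)" for p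
  proof -
    define q where "q = (SOME q. q \<in> carrier (UP B) \<and> e q = e p)"
    have q: "q \<in> carrier (UP B)" "e q = e p"
      using someI[of "\<lambda>q. q \<in> carrier (UP B) \<and> e q = e p" p] p unfolding q_def by auto
    have "e (q \<ominus>\<^bsub>UP B\<^esub> p) = \<zero>\<^bsub>A\<^esub>" using p q by (simp add: a_minus_def A.r_neg)
    hence "?f (q \<ominus>\<^bsub>UP B\<^esub> p) = \<zero>\<^bsub>F\<^esub>" using ker p q by simp
    hence "?f q \<ominus>\<^bsub>F\<^esub> ?f p = \<zero>\<^bsub>F\<^esub>" using p q by (simp add: a_minus_def)
    hence "?f q = ?f p" using p q by simp
    thus ?thesis unfolding \<psi>_def q_def[symmetric] by simp
  qed
  have "\<psi> \<in> ring_hom (A\<lparr>carrier := G'\<rparr>) F"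
  proof (rule ring_hom_memI)
    fix y assume "y \<in> carrier (A\<lparr>carrier := G'\<rparr>)"
    then obtain p where "p \<in> carrier (UP B)" "e p = y" using img by auto
    thus "\<psi> y \<in> carrier F" using psi by auto
  next
    fix y z assume "y \<in> carrier (A\<lparr>carrier := G'\<rparr>)" "z \<in> carrier (A\<lparr>carrier := G'\<rparr>)"
    then obtain p q where p: "p \<in> carrier (UP B)" "e p = y" and q: "q \<in> carrier (UP B)" "e q = z"
      using img by (metis partial_object.select_convs(1) partial_object.surjective partial_object.update_convs(1))
    have "y \<otimes>\<^bsub>A\<^esub> z = e (p \<otimes>\<^bsub>UP B\<^esub> q)" "y \<oplus>\<^bsub>A\<^esub> z = e (p \<oplus>\<^bsub>UP B\<^esub> q)" using p q by auto
    thus "\<psi> (y \<otimes>\<^bsub>A\<lparr>carrier := G'\<rparr>\<^esub> z) = \<psi> y \<otimes>\<^bsub>F\<^esub> \<psi> z" "\<psi> (y \<oplus>\<^bsub>A\<lparr>carrier := G'\<rparr>\<^esub> z) = \<psi> y \<oplus>\<^bsub>F\<^esub> \<psi> z"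
      using p q psi[of "p \<otimes>\<^bsub>UP B\<^esub> q"] psi[of "p \<oplus>\<^bsub>UP B\<^esub> q"] psi[of p] psi[of q] by simp_all
  next
    show "\<psi> \<one>\<^bsub>A\<lparr>carrier := G'\<rparr>\<^esub> = \<one>\<^bsub>F\<^esub>" using psi[of "\<one>\<^bsub>UP B\<^esub>"] by simp
  qed
  moreover have "\<psi> (\<sigma> c) = c" if "c \<in> carrier F" for c
  proof -
    have "\<sigma> c \<in> carrier B" using that unfolding B_def G_def by (auto intro: generate_ring.incl)
    thus ?thesis using psi[of "up_ring.monom (UP B) (\<sigma> c) 0"] E.eval_const[OF x, folded e_def] H.eval_const[OF xi] phi(2)[OF that]
      by simp
  qed
  moreover have "\<psi> b \<noteq> \<zero>\<^bsub>F\<^esub>" using psi[OF h(1)] h(2) nz by simp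
  ultimately show ?case unfolding G'_def by blast
qed

text \<open>The Nullstellensatz in the form in which it is used: the points of the variety of \<open>P\<close> are dense in the
sense that no element outside \<open>P\<close> vanishes at all of them. The quotient by \<open>P\<close> is a finitely generated
domain over \<open>F\<close>.\<close>
lemma separating_point_of_affine_algebra:
  assumes F: "algebraically_closed F" and R: "affine_algebra F R" and P: "primeideal P R"
    and a: "a \<in> carrier R" "a \<notin> P"
  shows "\<exists>\<phi>\<in>ring_hom R F. (\<forall>c\<in>carrier F. \<phi> (c \<odot>\<^bsub>R\<^esub> \<one>\<^bsub>R\<^esub>) = c) \<and> (\<forall>p\<in>P. \<phi> p = \<zero>\<^bsub>F\<^esub>) \<and> \<phi> a \<noteq> \<zero>\<^bsub>F\<^esub>"
proof -
  interpret F: algebraically_closed F by fact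
  interpret R: algebra F R using R unfolding affine_algebra_def by simp
  interpret P: primeideal P R by fact
  let ?A = "R Quot P"
  let ?p = "\<lambda>r. P +>\<^bsub>R\<^esub> r"
  interpret A: domain ?A using P.quotient_is_domain .
  interpret p: ring_hom_ring R ?A ?p using P.rcos_ring_hom_ring .
  obtain S where S: "finite S" "S \<subseteq> carrier R"
    and gen: "generate_ring R ((\<lambda>c. c \<odot>\<^bsub>R\<^esub> \<one>\<^bsub>R\<^esub>) ` carrier F \<union> S) = carrier R"
    using R unfolding affine_algebra_def by auto
  define \<sigma> where "\<sigma> c = ?p (c \<odot>\<^bsub>R\<^esub> \<one>\<^bsub>R\<^esub>)" for c
  have sc: "(\<lambda>c. c \<odot>\<^bsub>R\<^esub> \<one>\<^bsub>R\<^esub>) \<in> ring_hom F R"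
    by (rule ring_hom_memI) (auto simp: R.smult_l_distr R.smult_assoc1 R.smult_assoc2 R.smult_one)
  have s: "\<sigma> \<in> ring_hom F ?A"
    using ring_hom_trans[OF sc p.homh] by (simp add: \<sigma>_def[abs_def] comp_def)
  have gen': "?p r \<in> generate_ring ?A (\<sigma> ` carrier F \<union> ?p ` S)" if "r \<in> carrier R" for r
    using that unfolding gen[symmetric]
  proof (induction rule: generate_ring.induct)
    case one
    show ?case using p.hom_one generate_ring.one[of ?A] by metis
  next
    case (incl h)
    thus ?case by (auto intro!: generate_ring.incl simp: \<sigma>_def)
  next
    case (a_inv h)
    thus ?case using generate_ring.a_inv[of "?p h" ?A] gen p.hom_a_inv by metis
  next
    case (eng_add h1 h2)
    thus ?case using generate_ring.eng_add[of "?p h1" ?A _ "?p h2"] gen p.hom_add by metis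
  next
    case (eng_mult h1 h2)
    thus ?case using generate_ring.eng_mult[of "?p h1" ?A _ "?p h2"] gen p.hom_mult by metis
  qed
  have pz: "?p r = \<zero>\<^bsub>?A\<^esub> \<longleftrightarrow> r \<in> P" if "r \<in> carrier R" for r
    using that by (metis FactRing_def P.a_rcos_const P.rcos_const_imp_mem ring_record_simps(11))
  have sub: "?p ` S \<subseteq> carrier ?A" "finite (?p ` S)" using S by auto
  obtain \<phi> where phi: "\<phi> \<in> ring_hom (?A\<lparr>carrier := generate_ring ?A (\<sigma> ` carrier F \<union> ?p ` S)\<rparr>) F"
    "\<And>c. c\<in>carrier F \<Longrightarrow> \<phi> (\<sigma> c) = c" "\<phi> (?p a) \<noteq> \<zero>\<^bsub>F\<^esub>"
    using separating_point_of_finitely_generated_domain[OF F A.domain_axioms s sub(2,1) gen'[OF a(1)]] pz a by auto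
  have hom: "(\<lambda>r. \<phi> (?p r)) \<in> ring_hom R F"
    using gen' phi(1) by (auto intro!: ring_hom_memI simp: ring_hom_def)
  have "\<phi> (?p q) = \<zero>\<^bsub>F\<^esub>" if "q \<in> P" for q
  proof -
    have "?p q = ?p \<zero>\<^bsub>R\<^esub>" using pz[of q] pz[of "\<zero>\<^bsub>R\<^esub>"] that by (metis P.Icarr P.zero_closed R.zero_closed)
    thus ?thesis using ring_hom_zero[OF hom R.ring_axioms F.ring_axioms] by simp
  qed
  thus ?thesis using hom phi(2,3) unfolding \<sigma>_def by (intro bexI[of _ "\<lambda>r. \<phi> (?p r)"]) auto
qed

section \<open>Monoid algebras\<close>

locale comm_monoid_algebra = F: cring F + M: comm_monoid M
  for F :: "('f, 'k) ring_scheme" and M :: "('m, 'l) monoid_scheme"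
begin

abbreviation "E \<equiv> monoid_algebra F M"
abbreviation "single \<equiv> monoid_algebra_single F"
abbreviation "supp f \<equiv> {m. f m \<noteq> \<zero>\<^bsub>F\<^esub>}"

lemma memE: "f \<in> carrier E \<longleftrightarrow> range f \<subseteq> carrier F \<and> finite (supp f) \<and> supp f \<subseteq> carrier M"
  by (simp add: monoid_algebra_def)

lemma fun_closed [simp]: "f \<in> carrier E \<Longrightarrow> f m \<in> carrier F" by (auto simp: memE)

lemma zeroE: "\<zero>\<^bsub>E\<^esub> = (\<lambda>m. \<zero>\<^bsub>F\<^esub>)" and oneE: "\<one>\<^bsub>E\<^esub> = single \<one>\<^bsub>F\<^esub> \<one>\<^bsub>M\<^esub>"
  and addE: "f \<oplus>\<^bsub>E\<^esub> g = (\<lambda>m. f m \<oplus>\<^bsub>F\<^esub> g m)"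
  by (simp_all add: monoid_algebra_def)

lemma zero_memE: "\<zero>\<^bsub>E\<^esub> \<in> carrier E" by (auto simp: memE zeroE)

lemma single_memE: "c \<in> carrier F \<Longrightarrow> x \<in> carrier M \<Longrightarrow> single c x \<in> carrier E"
  by (auto simp: memE monoid_algebra_single_def)

lemma add_memE: 
  assumes "f \<in> carrier E" "g \<in> carrier E" shows "f \<oplus>\<^bsub>E\<^esub> g \<in> carrier E"
proof -
  have "supp (f \<oplus>\<^bsub>E\<^esub> g) \<subseteq> supp f \<union> supp g" by (auto simp: addE)
  moreover have "finite (supp f \<union> supp g)" "supp f \<union> supp g \<subseteq> carrier M" using assms by (auto simp: memE)
  ultimately have "finite (supp (f \<oplus>\<^bsub>E\<^esub> g))" "supp (f \<oplus>\<^bsub>E\<^esub> g) \<subseteq> carrier M"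
    by (blast intro: finite_subset)+
  moreover have "range (f \<oplus>\<^bsub>E\<^esub> g) \<subseteq> carrier F" using assms by (auto simp: addE)
  ultimately show ?thesis by (simp add: memE)
qed

lemma abelian_groupE: "abelian_group E"
proof (rule abelian_groupI)
  fix f assume f: "f \<in> carrier E"
  show "\<exists>g\<in>carrier E. g \<oplus>\<^bsub>E\<^esub> f = \<zero>\<^bsub>E\<^esub>"
  proof (intro bexI[of _ "\<lambda>m. \<ominus>\<^bsub>F\<^esub> f m"])
    have "supp (\<lambda>m. \<ominus>\<^bsub>F\<^esub> f m) \<subseteq> supp f" by auto
    thus "(\<lambda>m. \<ominus>\<^bsub>F\<^esub> f m) \<in> carrier E" using f by (auto simp: memE intro: finite_subset)
    show "(\<lambda>m. \<ominus>\<^bsub>F\<^esub> f m) \<oplus>\<^bsub>E\<^esub> f = \<zero>\<^bsub>E\<^esub>" using f by (simp add: addE zeroE F.l_neg)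
  qed
next
  fix f g assume "f \<in> carrier E" "g \<in> carrier E"
  thus "f \<oplus>\<^bsub>E\<^esub> g = g \<oplus>\<^bsub>E\<^esub> f" unfolding addE by (intro ext F.a_comm) auto
qed (simp_all add: zero_memE add_memE, simp_all add: addE zeroE F.a_assoc)

interpretation E: abelian_group E by (rule abelian_groupE)

lemma single_induct [consumes 1, case_names zero add]:
  assumes f: "f \<in> carrier E" and z: "Q \<zero>\<^bsub>E\<^esub>"
    and s: "\<And>c x g. c \<in> carrier F \<Longrightarrow> x \<in> carrier M \<Longrightarrow> g \<in> carrier E \<Longrightarrow> Q g \<Longrightarrow> Q (single c x \<oplus>\<^bsub>E\<^esub> g)"
  shows "Q f"
  using f
proof (induction "card (supp f)" arbitrary: f)
  case 0
  hence "supp f = {}" by (auto simp: memE)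
  hence "f = \<zero>\<^bsub>E\<^esub>" by (auto simp: zeroE)
  thus ?case using z by simp
next
  case (Suc n)
  have "supp f \<noteq> {}" using Suc.hyps(2) by (metis card.empty nat.distinct(1))
  then obtain x where x: "x \<in> supp f" by auto
  let ?g = "f(x := \<zero>\<^bsub>F\<^esub>)"
  have sg: "supp ?g = supp f - {x}" by auto
  have g: "?g \<in> carrier E" unfolding memE sg using Suc.prems by (auto simp: memE)
  have "n = card (supp ?g)" unfolding sg using Suc x by (simp add: memE)
  hence "Q ?g" using Suc.hyps(1) g by blast
  moreover have "f = single (f x) x \<oplus>\<^bsub>E\<^esub> ?g"
    using Suc.prems by (auto simp: addE monoid_algebra_single_def fun_eq_iff)
  moreover have "x \<in> carrier M" using x Suc.prems by (auto simp: memE)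
  ultimately show ?case using s[of "f x" x ?g] g Suc.prems by simp
qed

text \<open>In the definition of the product the range of summation depends on \<open>m\<close> and on the supports. A fixed
rectangle that contains the supports makes bilinearity and commutativity accessible to manipulations
of finite sums.\<close>
lemma mult_eq:
  assumes f: "f \<in> carrier E" and g: "g \<in> carrier E"
    and A: "finite A" "supp f \<subseteq> A" and B: "finite B" "supp g \<subseteq> B"
  shows "(f \<otimes>\<^bsub>E\<^esub> g) m = (\<Oplus>\<^bsub>F\<^esub>p\<in>A \<times> B. if fst p \<otimes>\<^bsub>M\<^esub> snd p = m then f (fst p) \<otimes>\<^bsub>F\<^esub> g (snd p) else \<zero>\<^bsub>F\<^esub>)"
proof -
  have "(f \<otimes>\<^bsub>E\<^esub> g) m = (\<Oplus>\<^bsub>F\<^esub>p\<in>{(x, y). f x \<noteq> \<zero>\<^bsub>F\<^esub> \<and> g y \<noteq> \<zero>\<^bsub>F\<^esub> \<and> x \<otimes>\<^bsub>M\<^esub> y = m}. f (fst p) \<otimes>\<^bsub>F\<^esub> g (snd p))"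
    by (simp add: monoid_algebra_def)
  also have "\<dots> = (\<Oplus>\<^bsub>F\<^esub>p\<in>A \<times> B. if fst p \<otimes>\<^bsub>M\<^esub> snd p = m then f (fst p) \<otimes>\<^bsub>F\<^esub> g (snd p) else \<zero>\<^bsub>F\<^esub>)"
    using A B f g by (intro F.add.finprod_mono_neutral_cong_left) (auto simp: subset_iff)
  finally show ?thesis .
qed

lemma mult_memE:
  assumes "f \<in> carrier E" "g \<in> carrier E" shows "f \<otimes>\<^bsub>E\<^esub> g \<in> carrier E"
proof -
  let ?S = "(\<lambda>p. fst p \<otimes>\<^bsub>M\<^esub> snd p) ` (supp f \<times> supp g)"
  have fin: "finite (supp f)" "finite (supp g)" using assms by (auto simp: memE)
  have eq: "(f \<otimes>\<^bsub>E\<^esub> g) m = (\<Oplus>\<^bsub>F\<^esub>p\<in>supp f \<times> supp g. if fst p \<otimes>\<^bsub>M\<^esub> snd p = m then f (fst p) \<otimes>\<^bsub>F\<^esub> g (snd p) else \<zero>\<^bsub>F\<^esub>)" for m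
    using mult_eq[OF assms fin(1) order_refl fin(2) order_refl] .
  have "supp (f \<otimes>\<^bsub>E\<^esub> g) \<subseteq> ?S"
  proof
    fix m assume "m \<in> supp (f \<otimes>\<^bsub>E\<^esub> g)"
    hence ne: "(f \<otimes>\<^bsub>E\<^esub> g) m \<noteq> \<zero>\<^bsub>F\<^esub>" by simp
    show "m \<in> ?S"
    proof (rule ccontr)
      assume "m \<notin> ?S"
      hence "(\<Oplus>\<^bsub>F\<^esub>p\<in>supp f \<times> supp g. if fst p \<otimes>\<^bsub>M\<^esub> snd p = m then f (fst p) \<otimes>\<^bsub>F\<^esub> g (snd p) else \<zero>\<^bsub>F\<^esub>) = \<zero>\<^bsub>F\<^esub>"
        by (intro F.add.finprod_one_eqI) auto
      thus False using ne eq by simp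
    qed
  qed
  moreover have "finite ?S" using fin by simp
  moreover have "?S \<subseteq> carrier M" using assms by (auto simp: memE intro!: M.m_closed)
  moreover have "range (f \<otimes>\<^bsub>E\<^esub> g) \<subseteq> carrier F"
    unfolding eq using assms by (auto intro!: F.finsum_closed)
  ultimately show ?thesis unfolding memE by (meson finite_subset subset_trans)
qed

lemma single_mult:
  assumes "a \<in> carrier F" "b \<in> carrier F" "x \<in> carrier M" "y \<in> carrier M"
  shows "single a x \<otimes>\<^bsub>E\<^esub> single b y = single (a \<otimes>\<^bsub>F\<^esub> b) (x \<otimes>\<^bsub>M\<^esub> y)"
proof
  fix m
  have "(single a x \<otimes>\<^bsub>E\<^esub> single b y) m = (\<Oplus>\<^bsub>F\<^esub>p\<in>{x} \<times> {y}. if fst p \<otimes>\<^bsub>M\<^esub> snd p = m then single a x (fst p) \<otimes>\<^bsub>F\<^esub> single b y (snd p) else \<zero>\<^bsub>F\<^esub>)"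
    using assms by (intro mult_eq single_memE) (auto simp: monoid_algebra_single_def)
  also have "{x} \<times> {y} = {(x, y)}" by auto
  also have "(\<Oplus>\<^bsub>F\<^esub>p\<in>{(x, y)}. if fst p \<otimes>\<^bsub>M\<^esub> snd p = m then single a x (fst p) \<otimes>\<^bsub>F\<^esub> single b y (snd p) else \<zero>\<^bsub>F\<^esub>)
      = single (a \<otimes>\<^bsub>F\<^esub> b) (x \<otimes>\<^bsub>M\<^esub> y) m"
    using assms by (subst F.finsum_insert) (auto simp: monoid_algebra_single_def)
  finally show "(single a x \<otimes>\<^bsub>E\<^esub> single b y) m = single (a \<otimes>\<^bsub>F\<^esub> b) (x \<otimes>\<^bsub>M\<^esub> y) m" .
qed

lemma mult_commE:
  assumes "f \<in> carrier E" "g \<in> carrier E" shows "f \<otimes>\<^bsub>E\<^esub> g = g \<otimes>\<^bsub>E\<^esub> f"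
proof
  fix m
  have fin: "finite (supp f)" "finite (supp g)" using assms by (auto simp: memE)
  have sM: "x \<in> carrier M" if "x \<in> supp f \<union> supp g" for x using assms that by (auto simp: memE)
  have inj: "inj_on prod.swap (supp f \<times> supp g)" by simp
  have im: "prod.swap ` (supp f \<times> supp g) = supp g \<times> supp f" by auto
  let ?h = "\<lambda>p. if fst p \<otimes>\<^bsub>M\<^esub> snd p = m then g (fst p) \<otimes>\<^bsub>F\<^esub> f (snd p) else \<zero>\<^bsub>F\<^esub>"
  have "(g \<otimes>\<^bsub>E\<^esub> f) m = (\<Oplus>\<^bsub>F\<^esub>p\<in>prod.swap ` (supp f \<times> supp g). ?h p)"
    unfolding im by (rule mult_eq[OF assms(2,1) fin(2) order_refl fin(1) order_refl])
  also have "\<dots> = (\<Oplus>\<^bsub>F\<^esub>p\<in>supp f \<times> supp g. ?h (prod.swap p))"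
    using assms by (intro F.add.finprod_reindex inj) auto
  also have "\<dots> = (\<Oplus>\<^bsub>F\<^esub>p\<in>supp f \<times> supp g. if fst p \<otimes>\<^bsub>M\<^esub> snd p = m then f (fst p) \<otimes>\<^bsub>F\<^esub> g (snd p) else \<zero>\<^bsub>F\<^esub>)"
    using assms sM by (intro F.finsum_cong') (auto simp: F.m_comm M.m_comm)
  also have "\<dots> = (f \<otimes>\<^bsub>E\<^esub> g) m" using mult_eq[OF assms fin(1) order_refl fin(2) order_refl] by simp
  finally show "(f \<otimes>\<^bsub>E\<^esub> g) m = (g \<otimes>\<^bsub>E\<^esub> f) m" by simp
qed

lemma l_distrE:
  assumes f: "f \<in> carrier E" and f': "f' \<in> carrier E" and g: "g \<in> carrier E"
  shows "(f \<oplus>\<^bsub>E\<^esub> f') \<otimes>\<^bsub>E\<^esub> g = f \<otimes>\<^bsub>E\<^esub> g \<oplus>\<^bsub>E\<^esub> f' \<otimes>\<^bsub>E\<^esub> g"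
proof
  fix m
  let ?A = "supp f \<union> supp f'" and ?B = "supp g"
  have fin: "finite ?A" "finite ?B" using assms by (auto simp: memE)
  let ?s = "\<lambda>f. \<Oplus>\<^bsub>F\<^esub>p\<in>?A \<times> ?B. if fst p \<otimes>\<^bsub>M\<^esub> snd p = m then f (fst p) \<otimes>\<^bsub>F\<^esub> g (snd p) else \<zero>\<^bsub>F\<^esub>"
  have "((f \<oplus>\<^bsub>E\<^esub> f') \<otimes>\<^bsub>E\<^esub> g) m = ?s (f \<oplus>\<^bsub>E\<^esub> f')"
    using assms fin by (intro mult_eq add_memE) (auto simp: addE)
  also have "\<dots> = (\<Oplus>\<^bsub>F\<^esub>p\<in>?A \<times> ?B. (if fst p \<otimes>\<^bsub>M\<^esub> snd p = m then f (fst p) \<otimes>\<^bsub>F\<^esub> g (snd p) else \<zero>\<^bsub>F\<^esub>)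
      \<oplus>\<^bsub>F\<^esub> (if fst p \<otimes>\<^bsub>M\<^esub> snd p = m then f' (fst p) \<otimes>\<^bsub>F\<^esub> g (snd p) else \<zero>\<^bsub>F\<^esub>))"
    using assms by (intro F.finsum_cong') (auto simp: addE F.l_distr)
  also have "\<dots> = ?s f \<oplus>\<^bsub>F\<^esub> ?s f'" using assms by (intro F.finsum_addf) auto
  also have "?s f = (f \<otimes>\<^bsub>E\<^esub> g) m" using mult_eq[OF f g fin(1) _ fin(2)] by simp
  also have "?s f' = (f' \<otimes>\<^bsub>E\<^esub> g) m" using mult_eq[OF f' g fin(1) _ fin(2)] by simp
  finally show "((f \<oplus>\<^bsub>E\<^esub> f') \<otimes>\<^bsub>E\<^esub> g) m = (f \<otimes>\<^bsub>E\<^esub> g \<oplus>\<^bsub>E\<^esub> f' \<otimes>\<^bsub>E\<^esub> g) m" by (simp add: addE)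
qed

lemma r_distrE:
  assumes "f \<in> carrier E" and "f' \<in> carrier E" and "g \<in> carrier E"
  shows "g \<otimes>\<^bsub>E\<^esub> (f \<oplus>\<^bsub>E\<^esub> f') = g \<otimes>\<^bsub>E\<^esub> f \<oplus>\<^bsub>E\<^esub> g \<otimes>\<^bsub>E\<^esub> f'"
  using l_distrE[OF assms] assms by (simp add: mult_commE[of g] add_memE)

lemma l_nullE: "g \<in> carrier E \<Longrightarrow> \<zero>\<^bsub>E\<^esub> \<otimes>\<^bsub>E\<^esub> g = \<zero>\<^bsub>E\<^esub>"
  by (simp add: monoid_algebra_def)

lemma r_nullE: "g \<in> carrier E \<Longrightarrow> g \<otimes>\<^bsub>E\<^esub> \<zero>\<^bsub>E\<^esub> = \<zero>\<^bsub>E\<^esub>"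
  by (simp add: monoid_algebra_def)

lemma l_oneE: "g \<in> carrier E \<Longrightarrow> \<one>\<^bsub>E\<^esub> \<otimes>\<^bsub>E\<^esub> g = g"
proof (induction g rule: single_induct)
  case zero show ?case by (simp add: oneE r_nullE single_memE)
next
  case (add c x g)
  thus ?case by (simp add: oneE r_distrE single_memE single_mult)
qed

lemma assocE:
  assumes "f \<in> carrier E" "g \<in> carrier E" "h \<in> carrier E"
  shows "(f \<otimes>\<^bsub>E\<^esub> g) \<otimes>\<^bsub>E\<^esub> h = f \<otimes>\<^bsub>E\<^esub> (g \<otimes>\<^bsub>E\<^esub> h)"
proof -
  have 1: "(single a x \<otimes>\<^bsub>E\<^esub> single b y) \<otimes>\<^bsub>E\<^esub> h = single a x \<otimes>\<^bsub>E\<^esub> (single b y \<otimes>\<^bsub>E\<^esub> h)"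
    if "a \<in> carrier F" "x \<in> carrier M" "b \<in> carrier F" "y \<in> carrier M" for a x b y
    using assms(3)
  proof (induction h rule: single_induct)
    case zero show ?case using that by (simp add: r_nullE mult_memE single_memE)
  next
    case (add c z h)
    thus ?case using that by (simp add: r_distrE mult_memE single_memE single_mult F.m_assoc M.m_assoc)
  qed
  have 2: "(single a x \<otimes>\<^bsub>E\<^esub> g) \<otimes>\<^bsub>E\<^esub> h = single a x \<otimes>\<^bsub>E\<^esub> (g \<otimes>\<^bsub>E\<^esub> h)"
    if "a \<in> carrier F" "x \<in> carrier M" for a x
    using assms(2)
  proof (induction g rule: single_induct)
    case zero show ?case using that assms(3) by (simp add: r_nullE l_nullE single_memE)
  next
    case (add c z g)
    thus ?case using that assms(3) 1 by (simp add: r_distrE l_distrE mult_memE single_memE)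
  qed
  show ?thesis using assms(1)
  proof (induction f rule: single_induct)
    case zero show ?case using assms by (simp add: l_nullE mult_memE)
  next
    case (add c z g)
    thus ?case using assms(2,3) 2 by (simp add: l_distrE mult_memE single_memE)
  qed
qed

lemma cringE: "cring E"
proof (rule cringI[OF abelian_groupE _ l_distrE])
  show "comm_monoid E"
  proof (rule comm_monoidI)
    show "\<one>\<^bsub>E\<^esub> \<in> carrier E" by (simp add: oneE single_memE)
  qed (auto intro: mult_memE assocE l_oneE mult_commE)
qed

text \<open>The functions \<open>\<Psi>\<close> to which this is applied are multilinear and not multiplicative. So the lift is not a ring
homomorphism in general, but it is semilinear along \<open>\<tau>\<close>.\<close>
definition lift_map :: "('v, 'n) ring_scheme \<Rightarrow> ('f \<Rightarrow> 'v) \<Rightarrow> ('m \<Rightarrow> 'v) \<Rightarrow> ('m \<Rightarrow> 'f) \<Rightarrow> 'v" where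
  "lift_map V \<tau> \<Psi> f = (\<Oplus>\<^bsub>V\<^esub>x\<in>supp f. \<tau> (f x) \<otimes>\<^bsub>V\<^esub> \<Psi> x)"

context
  fixes V :: "('v, 'n) ring_scheme" and \<tau> \<Psi>
  assumes V: "cring V" and tau: "\<tau> \<in> ring_hom F V" and Psi: "\<And>x. x \<in> carrier M \<Longrightarrow> \<Psi> x \<in> carrier V"
begin

interpretation V: cring V by (rule V)
interpretation tau: ring_hom_cring F V \<tau> using tau by (intro ring_hom_cringI) (auto intro: F.cring_axioms V.cring_axioms)

lemma lift_map_eq:
  assumes "f \<in> carrier E" "finite A" "supp f \<subseteq> A" "A \<subseteq> carrier M"
  shows "lift_map V \<tau> \<Psi> f = (\<Oplus>\<^bsub>V\<^esub>x\<in>A. \<tau> (f x) \<otimes>\<^bsub>V\<^esub> \<Psi> x)"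
  unfolding lift_map_def using assms Psi
  by (intro V.add.finprod_mono_neutral_cong_left) (auto simp: subset_iff)

lemma lift_map_closed:
  assumes f: "f \<in> carrier E" shows "lift_map V \<tau> \<Psi> f \<in> carrier V"
  unfolding lift_map_def
proof (rule V.finsum_closed, rule Pi_I)
  fix x assume "x \<in> supp f"
  hence "x \<in> carrier M" using f unfolding memE by blast
  thus "\<tau> (f x) \<otimes>\<^bsub>V\<^esub> \<Psi> x \<in> carrier V" using f Psi by simp
qed

lemma lift_map_add:
  assumes "f \<in> carrier E" "g \<in> carrier E"
  shows "lift_map V \<tau> \<Psi> (f \<oplus>\<^bsub>E\<^esub> g) = lift_map V \<tau> \<Psi> f \<oplus>\<^bsub>V\<^esub> lift_map V \<tau> \<Psi> g"
proof -
  let ?A = "supp f \<union> supp g"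
  have A: "finite ?A" "?A \<subseteq> carrier M" using assms by (auto simp: memE)
  have P: "\<Psi> x \<in> carrier V" if "x \<in> ?A" for x using A Psi that by blast
  have "lift_map V \<tau> \<Psi> (f \<oplus>\<^bsub>E\<^esub> g) = (\<Oplus>\<^bsub>V\<^esub>x\<in>?A. \<tau> ((f \<oplus>\<^bsub>E\<^esub> g) x) \<otimes>\<^bsub>V\<^esub> \<Psi> x)"
    using assms A by (intro lift_map_eq add_memE) (auto simp: addE)
  also have "\<dots> = (\<Oplus>\<^bsub>V\<^esub>x\<in>?A. \<tau> (f x) \<otimes>\<^bsub>V\<^esub> \<Psi> x \<oplus>\<^bsub>V\<^esub> \<tau> (g x) \<otimes>\<^bsub>V\<^esub> \<Psi> x)"
    using assms P by (intro V.finsum_cong') (auto simp: addE V.l_distr)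
  also have "\<dots> = (\<Oplus>\<^bsub>V\<^esub>x\<in>?A. \<tau> (f x) \<otimes>\<^bsub>V\<^esub> \<Psi> x) \<oplus>\<^bsub>V\<^esub> (\<Oplus>\<^bsub>V\<^esub>x\<in>?A. \<tau> (g x) \<otimes>\<^bsub>V\<^esub> \<Psi> x)"
    using assms P by (intro V.finsum_addf) auto
  also have "\<dots> = lift_map V \<tau> \<Psi> f \<oplus>\<^bsub>V\<^esub> lift_map V \<tau> \<Psi> g"
    using assms A lift_map_eq[of f ?A] lift_map_eq[of g ?A] by simp
  finally show ?thesis .
qed

lemma lift_map_single:
  assumes "c \<in> carrier F" "x \<in> carrier M"
  shows "lift_map V \<tau> \<Psi> (single c x) = \<tau> c \<otimes>\<^bsub>V\<^esub> \<Psi> x"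
proof -
  have "lift_map V \<tau> \<Psi> (single c x) = (\<Oplus>\<^bsub>V\<^esub>y\<in>{x}. \<tau> (single c x y) \<otimes>\<^bsub>V\<^esub> \<Psi> y)"
    using assms by (intro lift_map_eq single_memE) (auto simp: monoid_algebra_single_def)
  also have "\<dots> = \<tau> c \<otimes>\<^bsub>V\<^esub> \<Psi> x" using assms Psi by (simp add: monoid_algebra_single_def)
  finally show ?thesis .
qed

lemma lift_map_zero: "lift_map V \<tau> \<Psi> \<zero>\<^bsub>E\<^esub> = \<zero>\<^bsub>V\<^esub>"
  by (simp add: lift_map_def zeroE)

interpretation E: cring E by (rule cringE)

lemma lift_map_minus:
  assumes "f \<in> carrier E" "g \<in> carrier E"
  shows "lift_map V \<tau> \<Psi> (f \<ominus>\<^bsub>E\<^esub> g) = lift_map V \<tau> \<Psi> f \<ominus>\<^bsub>V\<^esub> lift_map V \<tau> \<Psi> g"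
proof -
  have "lift_map V \<tau> \<Psi> (f \<ominus>\<^bsub>E\<^esub> g) \<oplus>\<^bsub>V\<^esub> lift_map V \<tau> \<Psi> g = lift_map V \<tau> \<Psi> f"
    using assms by (subst lift_map_add[symmetric]) (auto simp: E.minus_eq E.a_assoc E.l_neg)
  thus ?thesis using assms lift_map_closed
    by (metis E.minus_closed V.add.inv_solve_right' V.minus_eq)
qed

text \<open>An additive map vanishes on the ideal generated by \<open>S\<close> as soon as it vanishes on the multiples of \<open>S\<close> by
elements \<open>c[y]\<close>, because these elements span the monoid algebra.\<close>
lemma lift_map_kills_ideal:
  assumes rel: "\<And>r. r \<in> S \<Longrightarrow> r \<in> carrier E"
    and kill: "\<And>r c y. r \<in> S \<Longrightarrow> c \<in> carrier F \<Longrightarrow> y \<in> carrier M \<Longrightarrow> lift_map V \<tau> \<Psi> (single c y \<otimes>\<^bsub>E\<^esub> r) = \<zero>\<^bsub>V\<^esub>"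
    and f: "f \<in> Idl\<^bsub>E\<^esub> S"
  shows "lift_map V \<tau> \<Psi> f = \<zero>\<^bsub>V\<^esub>"
proof -
  let ?l = "lift_map V \<tau> \<Psi>"
  define K where "K = {f \<in> carrier E. \<forall>g\<in>carrier E. ?l (g \<otimes>\<^bsub>E\<^esub> f) = \<zero>\<^bsub>V\<^esub>}"
  have "ideal K E"
  proof (rule idealI[OF E.ring_axioms])
    show "subgroup K (add_monoid E)"
    proof (rule E.add.subgroupI)
      show "K \<subseteq> carrier E" unfolding K_def by blast
      have "?l (g \<otimes>\<^bsub>E\<^esub> \<zero>\<^bsub>E\<^esub>) = \<zero>\<^bsub>V\<^esub>" if "g \<in> carrier E" for g using that by (simp add: lift_map_zero)
      thus "K \<noteq> {}" unfolding K_def using E.zero_closed by blast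
      fix a assume a: "a \<in> K"
      have "?l (g \<otimes>\<^bsub>E\<^esub> (\<ominus>\<^bsub>E\<^esub> a)) = \<zero>\<^bsub>V\<^esub>" if g: "g \<in> carrier E" for g
      proof -
        have "g \<otimes>\<^bsub>E\<^esub> (\<ominus>\<^bsub>E\<^esub> a) = (\<ominus>\<^bsub>E\<^esub> g) \<otimes>\<^bsub>E\<^esub> a"
          using a g unfolding K_def by (simp add: E.l_minus E.r_minus)
        thus ?thesis using a g unfolding K_def by simp
      qed
      thus "\<ominus>\<^bsub>E\<^esub> a \<in> K" using a unfolding K_def by auto
      fix b assume b: "b \<in> K"
      show "a \<oplus>\<^bsub>E\<^esub> b \<in> K" using a b unfolding K_def by (auto simp: E.r_distr lift_map_add)
    qed
    fix a x assume a: "a \<in> K" and x: "x \<in> carrier E"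
    have "?l (g \<otimes>\<^bsub>E\<^esub> (x \<otimes>\<^bsub>E\<^esub> a)) = \<zero>\<^bsub>V\<^esub>" if g: "g \<in> carrier E" for g
      using a x g unfolding K_def by (simp add: E.m_assoc[symmetric])
    thus "x \<otimes>\<^bsub>E\<^esub> a \<in> K" using a x unfolding K_def by auto
    thus "a \<otimes>\<^bsub>E\<^esub> x \<in> K" using a x unfolding K_def by (simp add: E.m_comm)
  qed
  moreover have "S \<subseteq> K"
  proof
    fix r assume r: "r \<in> S"
    have "?l (g \<otimes>\<^bsub>E\<^esub> r) = \<zero>\<^bsub>V\<^esub>" if "g \<in> carrier E" for g
      using that
    proof (induction g rule: single_induct)
      case zero show ?case using rel[OF r] lift_map_zero by simp
    next
      case (add c x g)
      thus ?case using rel[OF r] kill[OF r] by (simp add: E.l_distr lift_map_add single_memE)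
    qed
    thus "r \<in> K" unfolding K_def using rel[OF r] by auto
  qed
  ultimately have "Idl\<^bsub>E\<^esub> S \<subseteq> K" by (rule E.genideal_minimal)
  hence "f \<in> carrier E" and "?l (\<one>\<^bsub>E\<^esub> \<otimes>\<^bsub>E\<^esub> f) = \<zero>\<^bsub>V\<^esub>" using f unfolding K_def by auto
  thus ?thesis by simp
qed

end

end

section \<open>Tensor products of algebras\<close>

definition linear_form :: "('f, 'k) ring_scheme \<Rightarrow> ('f, 'a, 'c) module_scheme \<Rightarrow> ('a \<Rightarrow> 'f) \<Rightarrow> bool" where
  "linear_form F V \<mu> \<longleftrightarrow> \<mu> \<in> carrier V \<rightarrow> carrier F \<and>
     (\<forall>x\<in>carrier V. \<forall>y\<in>carrier V. \<mu> (x \<oplus>\<^bsub>V\<^esub> y) = \<mu> x \<oplus>\<^bsub>F\<^esub> \<mu> y) \<and>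
     (\<forall>c\<in>carrier F. \<forall>x\<in>carrier V. \<mu> (c \<odot>\<^bsub>V\<^esub> x) = c \<otimes>\<^bsub>F\<^esub> \<mu> x)"

text \<open>With an empty index set the free module on tuples still has scalar multiples of the empty tuple that
are not pure tensors of coefficient 1, so that pure tensors would not span additively.\<close>
locale algebra_family = F: field F
  for F :: "('f, 'k) ring_scheme" and I :: "'i set" and R :: "'i \<Rightarrow> ('f, 'a, 'c) module_scheme" +
  assumes finite_index: "finite I" and index_nonempty: "I \<noteq> {}"
    and factor_algebra: "i \<in> I \<Longrightarrow> algebra F (R i)"
begin

lemma factor_cring: "i \<in> I \<Longrightarrow> cring (R i)"
  using factor_algebra by (simp add: algebra_def)

abbreviation "M \<equiv> product_group I R"

lemma comm_monoid_M: "comm_monoid M"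
proof (rule comm_monoidI)
  have cm: "comm_monoid (R i)" if "i \<in> I" for i using factor_cring[OF that] by (simp add: cring_def)
  show "x \<otimes>\<^bsub>M\<^esub> y \<in> carrier M" if "x \<in> carrier M" "y \<in> carrier M" for x y
    using that cm by (auto simp: PiE_iff comm_monoid_def monoid.m_closed)
  show "\<one>\<^bsub>M\<^esub> \<in> carrier M" using cm by (auto simp: comm_monoid_def)
  show "(x \<otimes>\<^bsub>M\<^esub> y) \<otimes>\<^bsub>M\<^esub> z = x \<otimes>\<^bsub>M\<^esub> (y \<otimes>\<^bsub>M\<^esub> z)"
    if "x \<in> carrier M" "y \<in> carrier M" "z \<in> carrier M" for x y z
    using that cm by (auto simp: PiE_iff comm_monoid_def monoid.m_assoc)
  show "\<one>\<^bsub>M\<^esub> \<otimes>\<^bsub>M\<^esub> x = x" if "x \<in> carrier M" for x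
    using that cm by (auto simp: PiE_iff comm_monoid_def monoid.l_one extensional_def fun_eq_iff)
  show "x \<otimes>\<^bsub>M\<^esub> y = y \<otimes>\<^bsub>M\<^esub> x" if "x \<in> carrier M" "y \<in> carrier M" for x y
    using that cm by (auto simp: PiE_iff comm_monoid.m_comm)
qed

sublocale A: comm_monoid_algebra F M
  using comm_monoid_M by (simp add: comm_monoid_algebra_def F.cring_axioms)

abbreviation "E \<equiv> monoid_algebra F M"
abbreviation "single \<equiv> monoid_algebra_single F"
abbreviation "Jrel \<equiv> tensor_ideal F I R"
abbreviation "T \<equiv> tensor_ring F I R"
abbreviation "PR \<equiv> (\<Pi>\<^sub>E j\<in>I. carrier (R j))"

lemma tensor_free_eq: "tensor_free F I R = E" by (simp add: tensor_free_def)

sublocale E: cring E by (rule A.cringE)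

lemma upd_mem: "x \<in> PR \<Longrightarrow> i \<in> I \<Longrightarrow> a \<in> carrier (R i) \<Longrightarrow> x(i := a) \<in> PR"
  by (auto simp: PiE_iff extensional_def)

lemma relations_subset: "tensor_relations F I R \<subseteq> carrier E"
proof -
  have S: "single c (x(i := a)) \<in> carrier E" if "x \<in> PR" "i \<in> I" "a \<in> carrier (R i)" "c \<in> carrier F" for c x i a
    using upd_mem[OF that(1-3)] that(4) by (intro A.single_memE) auto
  have add: "a \<oplus>\<^bsub>R i\<^esub> b \<in> carrier (R i)" if "i \<in> I" "a \<in> carrier (R i)" "b \<in> carrier (R i)" for i a b
  proof -
    interpret Ri: cring "R i" using factor_cring that by simp
    show ?thesis using that by simp
  qed
  have sm: "c \<odot>\<^bsub>R i\<^esub> a \<in> carrier (R i)" if "i \<in> I" "c \<in> carrier F" "a \<in> carrier (R i)" for i c a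
  proof -
    interpret Ri: algebra F "R i" using factor_algebra that by simp
    show ?thesis using that by simp
  qed
  show ?thesis unfolding tensor_relations_def tensor_free_eq
    by (auto simp: S add sm)
qed

lemma ideal_Jrel: "ideal Jrel E"
  unfolding tensor_ideal_def tensor_free_eq using E.genideal_ideal[OF relations_subset] .

sublocale Jrel: ideal Jrel E by (rule ideal_Jrel)

lemma T_def: "T = E Quot Jrel" by (simp add: tensor_ring_def tensor_free_eq)

sublocale T: cring T unfolding T_def using Jrel.quotient_is_cring[OF E.cring_axioms] .

definition proj where "proj f = Jrel +>\<^bsub>E\<^esub> f"

lemma proj_hom: "proj \<in> ring_hom E T"
  unfolding proj_def[abs_def] T_def using Jrel.rcos_ring_hom .

sublocale proj: ring_hom_cring E T proj
  using proj_hom by (intro ring_hom_cringI) (auto intro: E.cring_axioms T.cring_axioms)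

lemma proj_eqI:
  assumes "f \<in> carrier E" "g \<in> carrier E" "f \<ominus>\<^bsub>E\<^esub> g \<in> Jrel"
  shows "proj f = proj g"
proof -
  have f: "f = (f \<ominus>\<^bsub>E\<^esub> g) \<oplus>\<^bsub>E\<^esub> g" using assms by (simp add: E.minus_eq E.a_assoc E.l_neg)
  have "proj (f \<ominus>\<^bsub>E\<^esub> g) = \<zero>\<^bsub>T\<^esub>"
    unfolding T_def proj_def using assms(3) Jrel.a_rcos_const by (simp add: FactRing_def)
  thus ?thesis using f assms proj.hom_add[of "f \<ominus>\<^bsub>E\<^esub> g" g] by simp
qed

lemma proj_eqD:
  assumes "f \<in> carrier E" "g \<in> carrier E" "proj f = proj g"
  shows "f \<ominus>\<^bsub>E\<^esub> g \<in> Jrel"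
proof -
  have "proj (f \<ominus>\<^bsub>E\<^esub> g) = \<zero>\<^bsub>T\<^esub>" using assms by (simp add: E.minus_eq T.r_neg)
  thus ?thesis unfolding T_def proj_def using assms Jrel.rcos_const_imp_mem by (auto simp: FactRing_def)
qed

lemma proj_surj: "Y \<in> carrier T \<Longrightarrow> \<exists>f\<in>carrier E. Y = proj f"
  unfolding T_def proj_def by (auto simp: FactRing_def A_RCOSETS_def')

definition pure where "pure x = proj (single \<one>\<^bsub>F\<^esub> x)"
definition scal where "scal c = proj (single c \<one>\<^bsub>M\<^esub>)"

lemma pure_closed [simp]: "x \<in> PR \<Longrightarrow> pure x \<in> carrier T"
  unfolding pure_def by (intro proj.hom_closed A.single_memE) auto

lemma oneM_mem: "\<one>\<^bsub>M\<^esub> \<in> PR" using A.M.one_closed by simp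

lemma scal_closed [simp]: "c \<in> carrier F \<Longrightarrow> scal c \<in> carrier T"
  unfolding scal_def using A.M.one_closed by (intro proj.hom_closed A.single_memE) auto

lemma pure_mult: "x \<in> PR \<Longrightarrow> y \<in> PR \<Longrightarrow> pure x \<otimes>\<^bsub>T\<^esub> pure y = pure (x \<otimes>\<^bsub>M\<^esub> y)"
  unfolding pure_def using A.single_mult[of "\<one>\<^bsub>F\<^esub>" "\<one>\<^bsub>F\<^esub>" x y]
  by (subst proj.hom_mult[symmetric]) (auto intro: A.single_memE)

lemma proj_single: "c \<in> carrier F \<Longrightarrow> x \<in> PR \<Longrightarrow> proj (single c x) = scal c \<otimes>\<^bsub>T\<^esub> pure x"
  unfolding pure_def scal_def using A.single_mult[of c "\<one>\<^bsub>F\<^esub>" "\<one>\<^bsub>M\<^esub>" x] A.M.one_closed A.M.l_one[of x]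
  by (subst proj.hom_mult[symmetric]) (auto intro: A.single_memE)

lemma pure_one: "pure \<one>\<^bsub>M\<^esub> = \<one>\<^bsub>T\<^esub>"
  unfolding pure_def A.oneE[symmetric] by simp

lemma scal_hom: "scal \<in> ring_hom F T"
proof (rule ring_hom_memI)
  fix c d assume cd: "c \<in> carrier F" "d \<in> carrier F"
  note o = A.M.one_closed
  show "scal (c \<otimes>\<^bsub>F\<^esub> d) = scal c \<otimes>\<^bsub>T\<^esub> scal d"
    unfolding scal_def using cd o A.single_mult[OF cd o o]
    by (subst proj.hom_mult[symmetric]) (auto intro: A.single_memE simp del: one_product_group mult_product_group carrier_product_group)
  have "single (c \<oplus>\<^bsub>F\<^esub> d) \<one>\<^bsub>M\<^esub> = single c \<one>\<^bsub>M\<^esub> \<oplus>\<^bsub>E\<^esub> single d \<one>\<^bsub>M\<^esub>"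
    using cd by (auto simp: A.addE monoid_algebra_single_def fun_eq_iff)
  thus "scal (c \<oplus>\<^bsub>F\<^esub> d) = scal c \<oplus>\<^bsub>T\<^esub> scal d"
    unfolding scal_def using cd o A.single_memE[of _ "\<one>\<^bsub>M\<^esub>"] by (simp del: one_product_group)
qed (auto simp: pure_one[unfolded pure_def, folded scal_def])

lemma pure_add:
  assumes "x \<in> PR" "i \<in> I" "a \<in> carrier (R i)" "b \<in> carrier (R i)"
  shows "pure (x(i := a \<oplus>\<^bsub>R i\<^esub> b)) = pure (x(i := a)) \<oplus>\<^bsub>T\<^esub> pure (x(i := b))"
proof -
  interpret Ri: cring "R i" using factor_cring assms by simp
  have m: "single \<one>\<^bsub>F\<^esub> (x(i := c)) \<in> carrier E" if "c \<in> carrier (R i)" for c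
    using upd_mem[OF assms(1,2) that] by (intro A.single_memE) auto
  have "single \<one>\<^bsub>F\<^esub> (x(i := a \<oplus>\<^bsub>R i\<^esub> b)) \<ominus>\<^bsub>E\<^esub>
        (single \<one>\<^bsub>F\<^esub> (x(i := a)) \<oplus>\<^bsub>E\<^esub> single \<one>\<^bsub>F\<^esub> (x(i := b))) \<in> tensor_relations F I R"
    unfolding tensor_relations_def tensor_free_eq using assms by blast
  hence "single \<one>\<^bsub>F\<^esub> (x(i := a \<oplus>\<^bsub>R i\<^esub> b)) \<ominus>\<^bsub>E\<^esub>
        (single \<one>\<^bsub>F\<^esub> (x(i := a)) \<oplus>\<^bsub>E\<^esub> single \<one>\<^bsub>F\<^esub> (x(i := b))) \<in> Jrel"
    unfolding tensor_ideal_def tensor_free_eq using E.genideal_self[OF relations_subset] by blast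
  hence "pure (x(i := a \<oplus>\<^bsub>R i\<^esub> b)) = proj (single \<one>\<^bsub>F\<^esub> (x(i := a)) \<oplus>\<^bsub>E\<^esub> single \<one>\<^bsub>F\<^esub> (x(i := b)))"
    unfolding pure_def using assms m by (intro proj_eqI) auto
  thus ?thesis using assms m by (simp add: pure_def)
qed

lemma pure_smult:
  assumes "x \<in> PR" "i \<in> I" "a \<in> carrier (R i)" "c \<in> carrier F"
  shows "pure (x(i := c \<odot>\<^bsub>R i\<^esub> a)) = scal c \<otimes>\<^bsub>T\<^esub> pure (x(i := a))"
proof -
  interpret Ri: algebra F "R i" using factor_algebra assms by simp
  have m: "single d (x(i := b)) \<in> carrier E" if "b \<in> carrier (R i)" "d \<in> carrier F" for b d
    using upd_mem[OF assms(1,2) that(1)] that by (intro A.single_memE) auto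
  have "single \<one>\<^bsub>F\<^esub> (x(i := c \<odot>\<^bsub>R i\<^esub> a)) \<ominus>\<^bsub>E\<^esub> single c (x(i := a)) \<in> tensor_relations F I R"
    unfolding tensor_relations_def tensor_free_eq using assms by blast
  hence "single \<one>\<^bsub>F\<^esub> (x(i := c \<odot>\<^bsub>R i\<^esub> a)) \<ominus>\<^bsub>E\<^esub> single c (x(i := a)) \<in> Jrel"
    unfolding tensor_ideal_def tensor_free_eq using E.genideal_self[OF relations_subset] by blast
  hence "pure (x(i := c \<odot>\<^bsub>R i\<^esub> a)) = proj (single c (x(i := a)))"
    unfolding pure_def using assms m by (intro proj_eqI) auto
  also have "\<dots> = scal c \<otimes>\<^bsub>T\<^esub> pure (x(i := a))" using proj_single[OF assms(4) upd_mem[OF assms(1-3)]] .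
  finally show ?thesis .
qed

definition incl where "incl i r = pure (\<lambda>j\<in>I. if j = i then r else \<one>\<^bsub>R j\<^esub>)"

lemma incl_eq: "tensor_incl F I R i r = incl i r"
  by (simp add: tensor_incl_def incl_def pure_def proj_def tensor_free_eq)

lemma incl_upd: "i \<in> I \<Longrightarrow> incl i r = pure (\<one>\<^bsub>M\<^esub>(i := r))"
  unfolding incl_def by (rule arg_cong[of _ _ pure]) auto

lemma incl_hom: assumes i: "i \<in> I" shows "incl i \<in> ring_hom (R i) T"
proof (rule ring_hom_memI)
  interpret Ri: cring "R i" using factor_cring i by simp
  fix a b assume ab: "a \<in> carrier (R i)" "b \<in> carrier (R i)"
  show "incl i a \<in> carrier T" using upd_mem[OF oneM_mem i ab(1)] unfolding incl_upd[OF i] by (rule pure_closed)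
  show "incl i (a \<oplus>\<^bsub>R i\<^esub> b) = incl i a \<oplus>\<^bsub>T\<^esub> incl i b"
    unfolding incl_upd[OF i] by (rule pure_add[OF oneM_mem i ab])
  have "\<one>\<^bsub>M\<^esub>(i := a) \<otimes>\<^bsub>M\<^esub> \<one>\<^bsub>M\<^esub>(i := b) = \<one>\<^bsub>M\<^esub>(i := a \<otimes>\<^bsub>R i\<^esub> b)"
    using ab factor_cring i by (auto simp: fun_eq_iff cring_def ring_def monoid.l_one)
  thus "incl i (a \<otimes>\<^bsub>R i\<^esub> b) = incl i a \<otimes>\<^bsub>T\<^esub> incl i b"
    unfolding incl_upd[OF i] using pure_mult[OF upd_mem[OF oneM_mem i ab(1)] upd_mem[OF oneM_mem i ab(2)]]
    by (simp only:)
next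
  have "\<one>\<^bsub>M\<^esub>(i := \<one>\<^bsub>R i\<^esub>) = \<one>\<^bsub>M\<^esub>" using i by auto
  thus "incl i \<one>\<^bsub>R i\<^esub> = \<one>\<^bsub>T\<^esub>" unfolding incl_upd[OF i] by (simp only: pure_one)
qed

lemma incl_scal:
  assumes i: "i \<in> I" and c: "c \<in> carrier F" shows "incl i (c \<odot>\<^bsub>R i\<^esub> \<one>\<^bsub>R i\<^esub>) = scal c"
proof -
  interpret Ri: algebra F "R i" using factor_algebra i by simp
  have e: "\<one>\<^bsub>M\<^esub>(i := \<one>\<^bsub>R i\<^esub>) = \<one>\<^bsub>M\<^esub>" using i by auto
  have "incl i (c \<odot>\<^bsub>R i\<^esub> \<one>\<^bsub>R i\<^esub>) = scal c \<otimes>\<^bsub>T\<^esub> pure (\<one>\<^bsub>M\<^esub>(i := \<one>\<^bsub>R i\<^esub>))"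
    unfolding incl_upd[OF i] by (rule pure_smult[OF oneM_mem i _ c]) simp
  thus ?thesis unfolding e pure_one using c by simp
qed

lemma finprod_incl:
  assumes x: "x \<in> PR"
  shows "(\<Otimes>\<^bsub>T\<^esub>j\<in>I. incl j (x j)) = pure x"
proof -
  have xj: "x j \<in> carrier (R j)" if "j \<in> I" for j using x that by auto
  have mem: "(\<lambda>j\<in>I. if j \<in> Y then x j else \<one>\<^bsub>R j\<^esub>) \<in> PR" for Y
    using xj factor_cring by (auto simp: cring_def ring_def monoid.one_closed)
  have "(\<Otimes>\<^bsub>T\<^esub>j\<in>Y. incl j (x j)) = pure (\<lambda>j\<in>I. if j \<in> Y then x j else \<one>\<^bsub>R j\<^esub>)" if "finite Y" "Y \<subseteq> I" for Y
    using that
  proof (induction Y)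
    case empty
    have "(\<lambda>j\<in>I. if j \<in> {} then x j else \<one>\<^bsub>R j\<^esub>) = \<one>\<^bsub>M\<^esub>" by auto
    thus ?case using pure_one by (simp only: T.finprod_empty)
  next
    case (insert i Y)
    have i: "i \<in> I" using insert by simp
    have cl: "incl j (x j) \<in> carrier T" if "j \<in> I" for j
      using incl_hom[OF that] xj[OF that] by (rule ring_hom_closed)
    have "(\<Otimes>\<^bsub>T\<^esub>j\<in>insert i Y. incl j (x j)) = incl i (x i) \<otimes>\<^bsub>T\<^esub> pure (\<lambda>j\<in>I. if j \<in> Y then x j else \<one>\<^bsub>R j\<^esub>)"
    proof -
      have "(\<Otimes>\<^bsub>T\<^esub>j\<in>insert i Y. incl j (x j)) = incl i (x i) \<otimes>\<^bsub>T\<^esub> (\<Otimes>\<^bsub>T\<^esub>j\<in>Y. incl j (x j))"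
        using insert(1,2,4) cl by (intro T.finprod_insert) auto
      moreover have "(\<Otimes>\<^bsub>T\<^esub>j\<in>Y. incl j (x j)) = pure (\<lambda>j\<in>I. if j \<in> Y then x j else \<one>\<^bsub>R j\<^esub>)"
        using insert.IH insert.prems by blast
      ultimately show ?thesis by (simp only:)
    qed
    also have "\<dots> = pure (\<one>\<^bsub>M\<^esub>(i := x i) \<otimes>\<^bsub>M\<^esub> (\<lambda>j\<in>I. if j \<in> Y then x j else \<one>\<^bsub>R j\<^esub>))"
      unfolding incl_upd[OF i] by (rule pure_mult[OF upd_mem[OF oneM_mem i xj[OF i]] mem])
    also have "\<one>\<^bsub>M\<^esub>(i := x i) \<otimes>\<^bsub>M\<^esub> (\<lambda>j\<in>I. if j \<in> Y then x j else \<one>\<^bsub>R j\<^esub>)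
        = (\<lambda>j\<in>I. if j \<in> insert i Y then x j else \<one>\<^bsub>R j\<^esub>)"
      using insert(2) i xj factor_cring by (auto simp: fun_eq_iff cring_def ring_def monoid.l_one monoid.r_one)
    finally show ?case .
  qed
  from this[OF finite_index] have "(\<Otimes>\<^bsub>T\<^esub>j\<in>I. incl j (x j)) = pure (\<lambda>j\<in>I. if j \<in> I then x j else \<one>\<^bsub>R j\<^esub>)" by simp
  also have "(\<lambda>j\<in>I. if j \<in> I then x j else \<one>\<^bsub>R j\<^esub>) = x" using x by (auto simp: fun_eq_iff PiE_iff extensional_def)
  finally show ?thesis .
qed

text \<open>Scalars can be absorbed into one tensor factor by multilinearity; this makes the pure tensors span
additively, not only over \<open>F\<close>.\<close>
lemma pure_span [consumes 1, case_names zero pure add]: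
  assumes t: "t \<in> carrier T" and z: "Q \<zero>\<^bsub>T\<^esub>" and p: "\<And>x. x \<in> PR \<Longrightarrow> Q (pure x)"
    and a: "\<And>s t. s \<in> carrier T \<Longrightarrow> t \<in> carrier T \<Longrightarrow> Q s \<Longrightarrow> Q t \<Longrightarrow> Q (s \<oplus>\<^bsub>T\<^esub> t)"
  shows "Q t"
proof -
  obtain i where i: "i \<in> I" using index_nonempty by auto
  interpret Ri: algebra F "R i" using factor_algebra i by simp
  obtain f where f: "f \<in> carrier E" "t = proj f" using proj_surj[OF t] by auto
  have "Q (proj f)" using f(1)
  proof (induction f rule: A.single_induct)
    case zero
    show ?case using z by simp
  next
    case (add c x g)
    have x: "x \<in> PR" using add by simp
    have xi: "x i \<in> carrier (R i)" using x i by auto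
    have "proj (single c x) = scal c \<otimes>\<^bsub>T\<^esub> pure (x(i := x i))" using proj_single[OF add(1) x] by simp
    also have "\<dots> = pure (x(i := c \<odot>\<^bsub>R i\<^esub> x i))" using pure_smult[OF x i xi add(1)] by simp
    finally have e: "proj (single c x) = pure (x(i := c \<odot>\<^bsub>R i\<^esub> x i))" .
    have m: "x(i := c \<odot>\<^bsub>R i\<^esub> x i) \<in> PR" using upd_mem[OF x i] add(1) xi by simp
    have "proj (single c x \<oplus>\<^bsub>E\<^esub> g) = pure (x(i := c \<odot>\<^bsub>R i\<^esub> x i)) \<oplus>\<^bsub>T\<^esub> proj g"
      using e add A.single_memE[OF add(1,2)] by simp
    thus ?case using a[OF pure_closed[OF m] _ p[OF m] add(4)] add(3) by simp
  qed
  thus ?thesis using f by simp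
qed

text \<open>The universal property of the tensor product as a module. The target is a commutative ring with a
homomorphism from \<open>F\<close> in place of an \<open>F\<close>-module, because both uses have such a target: \<open>T\<close> for slices,
and \<open>F\<close> for nontriviality.

By \<open>lift_map_kills_ideal\<close> it has to be checked that a relation at a tuple \<open>x\<close>, multiplied by \<open>c[y]\<close>, is sent
to zero; this is the multilinearity of \<open>\<Psi>\<close> at the tuple \<open>y x\<close>.\<close>
lemma multilinear_lift:
  assumes V: "cring V" and tau: "\<tau> \<in> ring_hom F V" and Psi: "\<And>x. x \<in> PR \<Longrightarrow> \<Psi> x \<in> carrier V"
    and add: "\<And>x i a b. x \<in> PR \<Longrightarrow> i \<in> I \<Longrightarrow> a \<in> carrier (R i) \<Longrightarrow> b \<in> carrier (R i) \<Longrightarrow>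
       \<Psi> (x(i := a \<oplus>\<^bsub>R i\<^esub> b)) = \<Psi> (x(i := a)) \<oplus>\<^bsub>V\<^esub> \<Psi> (x(i := b))"
    and smult: "\<And>x i a c. x \<in> PR \<Longrightarrow> i \<in> I \<Longrightarrow> a \<in> carrier (R i) \<Longrightarrow> c \<in> carrier F \<Longrightarrow>
       \<Psi> (x(i := c \<odot>\<^bsub>R i\<^esub> a)) = \<tau> c \<otimes>\<^bsub>V\<^esub> \<Psi> (x(i := a))"
  shows "\<exists>L. L \<in> carrier T \<rightarrow> carrier V \<and>
    (\<forall>s\<in>carrier T. \<forall>t\<in>carrier T. L (s \<oplus>\<^bsub>T\<^esub> t) = L s \<oplus>\<^bsub>V\<^esub> L t) \<and> (\<forall>x\<in>PR. L (pure x) = \<Psi> x)"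
proof -
  interpret V: cring V by fact
  interpret tau: ring_hom_cring F V \<tau> using tau by (intro ring_hom_cringI) (auto intro: F.cring_axioms V)
  let ?l = "A.lift_map V \<tau> \<Psi>"
  have Psi': "\<Psi> x \<in> carrier V" if "x \<in> carrier M" for x using Psi that by simp
  have lc: "?l f \<in> carrier V" if "f \<in> carrier E" for f
    by (rule A.lift_map_closed[OF V tau]) (use Psi' that in auto)
  have la: "?l (f \<oplus>\<^bsub>E\<^esub> g) = ?l f \<oplus>\<^bsub>V\<^esub> ?l g" if "f \<in> carrier E" "g \<in> carrier E" for f g
    by (rule A.lift_map_add[OF V tau]) (use Psi' that in auto)
  have lm: "?l (f \<ominus>\<^bsub>E\<^esub> g) = ?l f \<ominus>\<^bsub>V\<^esub> ?l g" if "f \<in> carrier E" "g \<in> carrier E" for f g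
    by (rule A.lift_map_minus[OF V tau]) (use Psi' that in auto)
  have ls: "?l (single c x) = \<tau> c \<otimes>\<^bsub>V\<^esub> \<Psi> x" if "c \<in> carrier F" "x \<in> carrier M" for c x
    using A.lift_map_single[OF V tau Psi' that] .
  have ma: "a \<otimes>\<^bsub>R i\<^esub> b \<in> carrier (R i)" if "i \<in> I" "a \<in> carrier (R i)" "b \<in> carrier (R i)" for i a b
  proof -
    interpret Ri: cring "R i" using factor_cring that by simp
    show ?thesis using that by simp
  qed
  have kill: "?l (single c y \<otimes>\<^bsub>E\<^esub> r) = \<zero>\<^bsub>V\<^esub>"
    if r: "r \<in> tensor_relations F I R" and c: "c \<in> carrier F" and y: "y \<in> carrier M" for r c y
  proof -
    have y': "y \<in> PR" using y by simp
    have yi: "y i \<in> carrier (R i)" if "i \<in> I" for i using y' that by auto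
    have um: "y \<otimes>\<^bsub>M\<^esub> x(i := a) = (y \<otimes>\<^bsub>M\<^esub> x)(i := y i \<otimes>\<^bsub>R i\<^esub> a)" if "i \<in> I" for x i a
      using that by (auto simp: fun_eq_iff)
    have yx: "y \<otimes>\<^bsub>M\<^esub> x \<in> PR" if "x \<in> PR" for x using A.M.m_closed[OF y, of x] that by simp
    have uc: "x(i := a) \<in> carrier M" if "x \<in> PR" "i \<in> I" "a \<in> carrier (R i)" for x i a
      using upd_mem[OF that] by simp
    note sm = A.single_memE
    have sv: "?l (single c y \<otimes>\<^bsub>E\<^esub> single d (x(i := a))) = \<tau> (c \<otimes>\<^bsub>F\<^esub> d) \<otimes>\<^bsub>V\<^esub> \<Psi> ((y \<otimes>\<^bsub>M\<^esub> x)(i := y i \<otimes>\<^bsub>R i\<^esub> a))"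
      if "x \<in> PR" "i \<in> I" "a \<in> carrier (R i)" "d \<in> carrier F" for x i a d
      unfolding A.single_mult[OF c that(4) y uc[OF that(1-3)]]
      using ls[of "c \<otimes>\<^bsub>F\<^esub> d" "y \<otimes>\<^bsub>M\<^esub> x(i := a)"] c that(4) A.M.m_closed[OF y uc[OF that(1-3)]]
      unfolding um[OF that(2)] by simp
    have scl: "single c y \<in> carrier E" using sm[OF c y] .
    from r consider
      (a) x i a b where "x \<in> PR" "i \<in> I" "a \<in> carrier (R i)" "b \<in> carrier (R i)"
        "r = single \<one>\<^bsub>F\<^esub> (x(i := a \<oplus>\<^bsub>R i\<^esub> b)) \<ominus>\<^bsub>E\<^esub> (single \<one>\<^bsub>F\<^esub> (x(i := a)) \<oplus>\<^bsub>E\<^esub> single \<one>\<^bsub>F\<^esub> (x(i := b)))"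
      | (b) x i d a where "x \<in> PR" "i \<in> I" "d \<in> carrier F" "a \<in> carrier (R i)"
        "r = single \<one>\<^bsub>F\<^esub> (x(i := d \<odot>\<^bsub>R i\<^esub> a)) \<ominus>\<^bsub>E\<^esub> single d (x(i := a))"
      unfolding tensor_relations_def tensor_free_eq by blast
    thus ?thesis
    proof cases
      case a
      interpret Ri: cring "R i" using factor_cring a by simp
      let ?u = "single \<one>\<^bsub>F\<^esub> (x(i := a \<oplus>\<^bsub>R i\<^esub> b))" and ?v = "single \<one>\<^bsub>F\<^esub> (x(i := a))" and ?w = "single \<one>\<^bsub>F\<^esub> (x(i := b))"
      have ab: "a \<oplus>\<^bsub>R i\<^esub> b \<in> carrier (R i)" using a by simp
      have uvw: "?u \<in> carrier E" "?v \<in> carrier E" "?w \<in> carrier E"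
        using a ab by (simp_all only: sm[OF F.one_closed uc])
      let ?\<Psi> = "\<lambda>a. \<Psi> ((y \<otimes>\<^bsub>M\<^esub> x)(i := y i \<otimes>\<^bsub>R i\<^esub> a))"
      have "single c y \<otimes>\<^bsub>E\<^esub> r = single c y \<otimes>\<^bsub>E\<^esub> ?u \<ominus>\<^bsub>E\<^esub> (single c y \<otimes>\<^bsub>E\<^esub> ?v \<oplus>\<^bsub>E\<^esub> single c y \<otimes>\<^bsub>E\<^esub> ?w)"
        unfolding a(5) using scl uvw by (simp only: E.r_minus E.minus_eq E.r_distr E.a_closed E.a_inv_closed)
      hence "?l (single c y \<otimes>\<^bsub>E\<^esub> r) = \<tau> c \<otimes>\<^bsub>V\<^esub> ?\<Psi> (a \<oplus>\<^bsub>R i\<^esub> b) \<ominus>\<^bsub>V\<^esub> (\<tau> c \<otimes>\<^bsub>V\<^esub> ?\<Psi> a \<oplus>\<^bsub>V\<^esub> \<tau> c \<otimes>\<^bsub>V\<^esub> ?\<Psi> b)"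
        using lm[OF E.m_closed[OF scl uvw(1)] E.a_closed[OF E.m_closed[OF scl uvw(2)] E.m_closed[OF scl uvw(3)]]]
          la[OF E.m_closed[OF scl uvw(2)] E.m_closed[OF scl uvw(3)]]
          sv[OF a(1,2) ab F.one_closed] sv[OF a(1,2,3) F.one_closed] sv[OF a(1,2,4) F.one_closed] c
        by (simp only: F.r_one)
      also have "?\<Psi> (a \<oplus>\<^bsub>R i\<^esub> b) = ?\<Psi> a \<oplus>\<^bsub>V\<^esub> ?\<Psi> b"
        using add[OF yx[OF a(1)] a(2) ma[OF a(2) yi[OF a(2)] a(3)] ma[OF a(2) yi[OF a(2)] a(4)]]
        using a yi[OF a(2)] by (simp add: Ri.r_distr del: mult_product_group)
      finally have eq: "?l (single c y \<otimes>\<^bsub>E\<^esub> r)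
          = \<tau> c \<otimes>\<^bsub>V\<^esub> (?\<Psi> a \<oplus>\<^bsub>V\<^esub> ?\<Psi> b) \<ominus>\<^bsub>V\<^esub> (\<tau> c \<otimes>\<^bsub>V\<^esub> ?\<Psi> a \<oplus>\<^bsub>V\<^esub> \<tau> c \<otimes>\<^bsub>V\<^esub> ?\<Psi> b)" .
      have "\<tau> c \<otimes>\<^bsub>V\<^esub> (p \<oplus>\<^bsub>V\<^esub> q) \<ominus>\<^bsub>V\<^esub> (\<tau> c \<otimes>\<^bsub>V\<^esub> p \<oplus>\<^bsub>V\<^esub> \<tau> c \<otimes>\<^bsub>V\<^esub> q) = \<zero>\<^bsub>V\<^esub>"
        if "p \<in> carrier V" "q \<in> carrier V" for p q
        using c that by (simp add: V.r_distr V.minus_eq V.r_neg)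
      thus ?thesis unfolding eq
        using Psi[OF upd_mem[OF yx[OF a(1)] a(2) ma[OF a(2) yi[OF a(2)] a(3)]]]
          Psi[OF upd_mem[OF yx[OF a(1)] a(2) ma[OF a(2) yi[OF a(2)] a(4)]]] by blast
    next
      case b
      interpret Ri: algebra F "R i" using factor_algebra b by simp
      let ?u = "single \<one>\<^bsub>F\<^esub> (x(i := d \<odot>\<^bsub>R i\<^esub> a))" and ?v = "single d (x(i := a))"
      have da: "d \<odot>\<^bsub>R i\<^esub> a \<in> carrier (R i)" using b by simp
      have uv: "?u \<in> carrier E" "?v \<in> carrier E"
        using sm[OF F.one_closed uc[OF b(1,2) da]] sm[OF b(3) uc[OF b(1,2,4)]] by auto
      let ?\<Psi> = "\<lambda>a. \<Psi> ((y \<otimes>\<^bsub>M\<^esub> x)(i := y i \<otimes>\<^bsub>R i\<^esub> a))"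
      have "single c y \<otimes>\<^bsub>E\<^esub> r = single c y \<otimes>\<^bsub>E\<^esub> ?u \<ominus>\<^bsub>E\<^esub> single c y \<otimes>\<^bsub>E\<^esub> ?v"
        unfolding b(5) using scl uv by (simp only: E.r_minus E.minus_eq E.r_distr E.a_closed E.a_inv_closed)
      hence "?l (single c y \<otimes>\<^bsub>E\<^esub> r) = \<tau> c \<otimes>\<^bsub>V\<^esub> ?\<Psi> (d \<odot>\<^bsub>R i\<^esub> a) \<ominus>\<^bsub>V\<^esub> \<tau> (c \<otimes>\<^bsub>F\<^esub> d) \<otimes>\<^bsub>V\<^esub> ?\<Psi> a"
        using scl uv sv[OF b(1,2) da F.one_closed] sv[OF b(1,2,4,3)] c
        by (simp add: lm del: mult_product_group)
      also have "?\<Psi> (d \<odot>\<^bsub>R i\<^esub> a) = \<tau> d \<otimes>\<^bsub>V\<^esub> ?\<Psi> a"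
        using smult[OF yx[OF b(1)] b(2) ma[OF b(2) yi[OF b(2)] b(4)] b(3)]
        using b yi[OF b(2)] by (simp add: Ri.m_comm[of "y i"] Ri.smult_assoc2 del: mult_product_group)
      finally have eq: "?l (single c y \<otimes>\<^bsub>E\<^esub> r)
          = \<tau> c \<otimes>\<^bsub>V\<^esub> (\<tau> d \<otimes>\<^bsub>V\<^esub> ?\<Psi> a) \<ominus>\<^bsub>V\<^esub> \<tau> (c \<otimes>\<^bsub>F\<^esub> d) \<otimes>\<^bsub>V\<^esub> ?\<Psi> a" .
      have "\<tau> c \<otimes>\<^bsub>V\<^esub> (\<tau> d \<otimes>\<^bsub>V\<^esub> p) \<ominus>\<^bsub>V\<^esub> \<tau> (c \<otimes>\<^bsub>F\<^esub> d) \<otimes>\<^bsub>V\<^esub> p = \<zero>\<^bsub>V\<^esub>" if "p \<in> carrier V" for p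
        using c b(3) that by (simp add: V.minus_eq V.r_neg V.m_assoc)
      thus ?thesis unfolding eq
        using Psi[OF upd_mem[OF yx[OF b(1)] b(2) ma[OF b(2) yi[OF b(2)] b(4)]]] by blast
    qed
  qed
  have zero: "?l f = \<zero>\<^bsub>V\<^esub>" if "f \<in> Jrel" for f
  proof (rule A.lift_map_kills_ideal[OF V tau, where S = "tensor_relations F I R"])
    show "f \<in> Idl\<^bsub>E\<^esub> (tensor_relations F I R)" using that unfolding tensor_ideal_def tensor_free_eq .
  qed (use relations_subset kill Psi' in auto)
  define L where "L t = ?l (SOME f. f \<in> carrier E \<and> proj f = t)" for t
  have L: "L (proj f) = ?l f" if f: "f \<in> carrier E" for f
  proof -
    define g where "g = (SOME g. g \<in> carrier E \<and> proj g = proj f)"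
    have g: "g \<in> carrier E" "proj g = proj f"
      using someI[of "\<lambda>g. g \<in> carrier E \<and> proj g = proj f" f] f unfolding g_def by auto
    have "?l (g \<ominus>\<^bsub>E\<^esub> f) = \<zero>\<^bsub>V\<^esub>" using zero proj_eqD[OF g(1) f g(2)] by simp
    hence "?l g = ?l f" using lm[of g f] g f lc by simp
    thus ?thesis unfolding L_def g_def .
  qed
  have "L \<in> carrier T \<rightarrow> carrier V" using proj_surj L lc by fastforce
  moreover have "L (s \<oplus>\<^bsub>T\<^esub> t) = L s \<oplus>\<^bsub>V\<^esub> L t" if st: "s \<in> carrier T" "t \<in> carrier T" for s t
  proof -
    obtain f g where fg: "f \<in> carrier E" "s = proj f" "g \<in> carrier E" "t = proj g" using proj_surj st by meson
    have "L (proj (f \<oplus>\<^bsub>E\<^esub> g)) = L (proj f) \<oplus>\<^bsub>V\<^esub> L (proj g)" using fg L[of f] L[of g] L[of "f \<oplus>\<^bsub>E\<^esub> g"] la[of f g] by (simp del: proj.hom_add)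
    thus ?thesis using fg by simp
  qed
  moreover have "L (pure x) = \<Psi> x" if "x \<in> PR" for x
    unfolding pure_def using L[OF A.single_memE[OF F.one_closed]] ls[OF F.one_closed] that Psi[OF that] by simp
  ultimately show ?thesis by blast
qed

text \<open>The multilinear map that defines the slice along \<open>\<mu>\<close>: it replaces the entry \<open>x\<^sub>i\<close> by 1 and remembers only
the scalar \<open>\<mu> x\<^sub>i\<close>.\<close>
lemma slice_exists:
  assumes i: "i \<in> I" and m: "linear_form F (R i) \<mu>"
  shows "\<exists>L. L \<in> carrier T \<rightarrow> carrier T \<and>
    (\<forall>s\<in>carrier T. \<forall>t\<in>carrier T. L (s \<oplus>\<^bsub>T\<^esub> t) = L s \<oplus>\<^bsub>T\<^esub> L t) \<and>
    (\<forall>x\<in>PR. L (pure x) = scal (\<mu> (x i)) \<otimes>\<^bsub>T\<^esub> pure (x(i := \<one>\<^bsub>R i\<^esub>)))"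
proof -
  interpret s: ring_hom_cring F T scal
    using scal_hom by (intro ring_hom_cringI) (auto intro: F.cring_axioms T.cring_axioms)
  interpret Ri: algebra F "R i" using factor_algebra i by simp
  have mc: "\<mu> a \<in> carrier F" if "a \<in> carrier (R i)" for a using m that unfolding linear_form_def by auto
  have xi: "x i \<in> carrier (R i)" if "x \<in> PR" for x using that i by auto
  have pc: "pure (x(i := \<one>\<^bsub>R i\<^esub>)) \<in> carrier T" if "x \<in> PR" for x
    using upd_mem[OF that i] by (intro pure_closed) simp
  show ?thesis
  proof (rule multilinear_lift[OF T.cring_axioms scal_hom])
    fix x assume x: "x \<in> PR"
    show "scal (\<mu> (x i)) \<otimes>\<^bsub>T\<^esub> pure (x(i := \<one>\<^bsub>R i\<^esub>)) \<in> carrier T"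
      using pc[OF x] mc[OF xi[OF x]] by simp
    fix j assume j: "j \<in> I"
    interpret Rj: algebra F "R j" using factor_algebra j by simp
    show "scal (\<mu> ((x(j := a \<oplus>\<^bsub>R j\<^esub> b)) i)) \<otimes>\<^bsub>T\<^esub> pure ((x(j := a \<oplus>\<^bsub>R j\<^esub> b))(i := \<one>\<^bsub>R i\<^esub>)) =
      scal (\<mu> ((x(j := a)) i)) \<otimes>\<^bsub>T\<^esub> pure ((x(j := a))(i := \<one>\<^bsub>R i\<^esub>)) \<oplus>\<^bsub>T\<^esub>
      scal (\<mu> ((x(j := b)) i)) \<otimes>\<^bsub>T\<^esub> pure ((x(j := b))(i := \<one>\<^bsub>R i\<^esub>))"
      if ab: "a \<in> carrier (R j)" "b \<in> carrier (R j)" for a b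
    proof (cases "j = i")
      case True
      have "\<mu> (a \<oplus>\<^bsub>R i\<^esub> b) = \<mu> a \<oplus>\<^bsub>F\<^esub> \<mu> b" using m ab True unfolding linear_form_def by auto
      thus ?thesis using True ab mc pc[OF x] by (simp add: T.l_distr)
    next
      case False
      have x1: "x(i := \<one>\<^bsub>R i\<^esub>) \<in> PR" using upd_mem[OF x i] by simp
      show ?thesis
        using False pure_add[OF x1 j ab] mc[OF xi[OF x]] pure_closed[OF upd_mem[OF x1 j ab(1)]] pure_closed[OF upd_mem[OF x1 j ab(2)]]
        by (simp add: fun_upd_twist[of j i] T.r_distr)
    qed
    show "scal (\<mu> ((x(j := c \<odot>\<^bsub>R j\<^esub> a)) i)) \<otimes>\<^bsub>T\<^esub> pure ((x(j := c \<odot>\<^bsub>R j\<^esub> a))(i := \<one>\<^bsub>R i\<^esub>)) =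
      scal c \<otimes>\<^bsub>T\<^esub> (scal (\<mu> ((x(j := a)) i)) \<otimes>\<^bsub>T\<^esub> pure ((x(j := a))(i := \<one>\<^bsub>R i\<^esub>)))"
      if a: "a \<in> carrier (R j)" and c: "c \<in> carrier F" for a c
    proof (cases "j = i")
      case True
      have "\<mu> (c \<odot>\<^bsub>R i\<^esub> a) = c \<otimes>\<^bsub>F\<^esub> \<mu> a" using m a c True unfolding linear_form_def by auto
      thus ?thesis using True a c mc pc[OF x] by (simp add: T.m_assoc)
    next
      case False
      have x1: "x(i := \<one>\<^bsub>R i\<^esub>) \<in> PR" using upd_mem[OF x i] by simp
      show ?thesis
        using False pure_smult[OF x1 j a c] mc[OF xi[OF x]] c pure_closed[OF upd_mem[OF x1 j a]]
        by (simp add: fun_upd_twist[of j i] T.m_lcomm)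
    qed
  qed
qed

text \<open>The product of the forms \<open>\<mu>\<^sub>j\<close> is multilinear, so it defines an additive map from \<open>T\<close> to \<open>F\<close> with value 1
at the unit.\<close>
lemma tensor_nontrivial:
  assumes m: "\<And>j. j \<in> I \<Longrightarrow> linear_form F (R j) (\<mu> j)" and m1: "\<And>j. j \<in> I \<Longrightarrow> \<mu> j \<one>\<^bsub>R j\<^esub> = \<one>\<^bsub>F\<^esub>"
  shows "\<one>\<^bsub>T\<^esub> \<noteq> \<zero>\<^bsub>T\<^esub>"
proof -
  have mc: "\<mu> j a \<in> carrier F" if "j \<in> I" "a \<in> carrier (R j)" for a j using m[OF that(1)] that unfolding linear_form_def by auto
  let ?P = "\<lambda>x. \<Otimes>\<^bsub>F\<^esub>j\<in>I. \<mu> j (x j)"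
  have upd: "?P (x(i := a)) = \<mu> i a \<otimes>\<^bsub>F\<^esub> (\<Otimes>\<^bsub>F\<^esub>j\<in>I - {i}. \<mu> j (x j))"
    if "x \<in> PR" "i \<in> I" "a \<in> carrier (R i)" for x i a
  proof -
    have "I = insert i (I - {i})" using that by auto
    hence "?P (x(i := a)) = (\<Otimes>\<^bsub>F\<^esub>j\<in>insert i (I - {i}). \<mu> j ((x(i := a)) j))" by simp
    also have "\<dots> = \<mu> i a \<otimes>\<^bsub>F\<^esub> (\<Otimes>\<^bsub>F\<^esub>j\<in>I - {i}. \<mu> j ((x(i := a)) j))"
      using that mc finite_index by (subst F.finprod_insert) (auto simp: PiE_iff)
    also have "(\<Otimes>\<^bsub>F\<^esub>j\<in>I - {i}. \<mu> j ((x(i := a)) j)) = (\<Otimes>\<^bsub>F\<^esub>j\<in>I - {i}. \<mu> j (x j))"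
      using that mc by (intro F.finprod_cong') (auto simp: PiE_iff)
    finally show ?thesis .
  qed
  have rest: "(\<Otimes>\<^bsub>F\<^esub>j\<in>I - {i}. \<mu> j (x j)) \<in> carrier F" if "x \<in> PR" for x i
    using that mc by (intro F.finprod_closed) (auto simp: PiE_iff)
  have "\<exists>L. L \<in> carrier T \<rightarrow> carrier F \<and>
    (\<forall>s\<in>carrier T. \<forall>t\<in>carrier T. L (s \<oplus>\<^bsub>T\<^esub> t) = L s \<oplus>\<^bsub>F\<^esub> L t) \<and> (\<forall>x\<in>PR. L (pure x) = ?P x)"
  proof (rule multilinear_lift[OF F.cring_axioms, of id])
    show "?P x \<in> carrier F" if "x \<in> PR" for x using that mc by (intro F.finprod_closed) (auto simp: PiE_iff)
    fix x i a assume xi: "x \<in> PR" "i \<in> I" "a \<in> carrier (R i)"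
    interpret Ri: algebra F "R i" using factor_algebra xi by simp
    show "?P (x(i := a \<oplus>\<^bsub>R i\<^esub> b)) = ?P (x(i := a)) \<oplus>\<^bsub>F\<^esub> ?P (x(i := b))" if b: "b \<in> carrier (R i)" for b
    proof -
      have "\<mu> i (a \<oplus>\<^bsub>R i\<^esub> b) = \<mu> i a \<oplus>\<^bsub>F\<^esub> \<mu> i b" using m[OF xi(2)] xi b unfolding linear_form_def by auto
      thus ?thesis using xi b mc[OF xi(2)] rest[OF xi(1)]
        by (simp only: upd Ri.a_closed F.l_distr)
    qed
    show "?P (x(i := c \<odot>\<^bsub>R i\<^esub> a)) = id c \<otimes>\<^bsub>F\<^esub> ?P (x(i := a))" if c: "c \<in> carrier F" for c
    proof -
      have "\<mu> i (c \<odot>\<^bsub>R i\<^esub> a) = c \<otimes>\<^bsub>F\<^esub> \<mu> i a" using m[OF xi(2)] xi c unfolding linear_form_def by auto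
      thus ?thesis using xi c mc[OF xi(2)] rest[OF xi(1)]
        by (simp only: upd Ri.smult_closed F.m_assoc id_apply)
    qed
  qed (auto intro: ring_hom_memI)
  then obtain L where L: "L \<in> carrier T \<rightarrow> carrier F"
    "\<And>s t. s \<in> carrier T \<Longrightarrow> t \<in> carrier T \<Longrightarrow> L (s \<oplus>\<^bsub>T\<^esub> t) = L s \<oplus>\<^bsub>F\<^esub> L t" "\<And>x. x \<in> PR \<Longrightarrow> L (pure x) = ?P x"
    by blast
  have "L \<zero>\<^bsub>T\<^esub> = \<zero>\<^bsub>F\<^esub>"
  proof -
    have "L \<zero>\<^bsub>T\<^esub> \<in> carrier F" using L(1) by auto
    moreover have "L \<zero>\<^bsub>T\<^esub> \<oplus>\<^bsub>F\<^esub> L \<zero>\<^bsub>T\<^esub> = L \<zero>\<^bsub>T\<^esub>" using L(2)[of "\<zero>\<^bsub>T\<^esub>" "\<zero>\<^bsub>T\<^esub>"] by simp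
    ultimately show ?thesis by simp
  qed
  moreover have "L \<one>\<^bsub>T\<^esub> = \<one>\<^bsub>F\<^esub>"
  proof -
    have "L \<one>\<^bsub>T\<^esub> = ?P \<one>\<^bsub>M\<^esub>" using L(3)[OF oneM_mem] unfolding pure_one .
    also have "\<dots> = \<one>\<^bsub>F\<^esub>" using m1 by (intro F.finprod_one_eqI) auto
    finally show ?thesis .
  qed
  ultimately show ?thesis by auto
qed

end

section \<open>Ideals and linear forms\<close>

lemma (in ring) genideal_Un:
  assumes S: "S \<subseteq> carrier R" "S' \<subseteq> carrier R"
  shows "Idl (S \<union> S') = Idl S <+> Idl S'"
proof -
  have SS: "S \<union> S' \<subseteq> carrier R" using S by blast
  have sub: "Idl S \<union> Idl S' \<subseteq> carrier R"
    using genideal_minimal[OF oneideal S(1)] genideal_minimal[OF oneideal S(2)] by blast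
  have "Idl (S \<union> S') = Idl (Idl S \<union> Idl S')"
  proof (rule equalityI)
    have "S \<union> S' \<subseteq> Idl S \<union> Idl S'" using S genideal_self by blast
    also have "\<dots> \<subseteq> Idl (Idl S \<union> Idl S')" using sub by (rule genideal_self)
    finally show "Idl (S \<union> S') \<subseteq> Idl (Idl S \<union> Idl S')"
      by (rule genideal_minimal[OF genideal_ideal[OF sub]])
    have "S \<subseteq> Idl (S \<union> S')" "S' \<subseteq> Idl (S \<union> S')" using genideal_self[OF SS] by blast+
    hence "Idl S \<union> Idl S' \<subseteq> Idl (S \<union> S')"
      using genideal_minimal[OF genideal_ideal[OF SS]] by blast
    thus "Idl (Idl S \<union> Idl S') \<subseteq> Idl (S \<union> S')"
      by (rule genideal_minimal[OF genideal_ideal[OF SS]])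
  qed
  thus ?thesis using union_genideal[of "Idl S" "Idl S'"] S genideal_ideal by simp
qed

lemma (in ring) ideal_set_add_iff:
  "x \<in> S <+> S' \<longleftrightarrow> (\<exists>a\<in>S. \<exists>b\<in>S'. x = a \<oplus> b)"
  by (auto simp: set_add_def')

lemma (in ring) ideal_minus_closed:
  assumes "ideal S R" "a \<in> S" "b \<in> S" shows "a \<ominus> b \<in> S"
proof -
  interpret ideal S R by fact
  show ?thesis using assms(2,3) by (simp add: minus_eq)
qed

lemma (in ring) ideal_finsum_closed:
  assumes "ideal S R" "\<And>h. h \<in> H \<Longrightarrow> f h \<in> S" shows "finsum R f H \<in> S"
proof -
  interpret ideal S R by fact
  show ?thesis using assms(2)
  proof (induction H rule: infinite_finite_induct)
    case (insert h H)
    have "f \<in> H \<rightarrow> carrier R" "f h \<in> carrier R" using insert Icarr by auto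
    thus ?case using insert by simp
  qed simp_all
qed

lemma (in cring) finsum_single:
  assumes "finite H" "l \<in> H" "x \<in> carrier R"
  shows "(\<Oplus>h\<in>H. if h = l then x else \<zero>) = x"
  using add.finprod_singleton_swap[of l H "\<lambda>_. x"] assms by simp

text \<open>Linear algebra without bases. \<open>W\<close> is the graph of a linear form on a subspace; it is given as a
relation, since the values in question are naturally indexed by non-unique representations. A maximal
graph above \<open>W\<close> is defined everywhere: otherwise a vector outside its domain could be assigned the
value 0.\<close>
lemma extend_partial_form:
  fixes F :: "('f, 'k) ring_scheme" and V :: "('f, 'a, 'c) module_scheme"
  assumes F: "field F" and V: "module F V" and W: "W \<subseteq> carrier V \<times> carrier F"
    and W0: "(\<zero>\<^bsub>V\<^esub>, \<zero>\<^bsub>F\<^esub>) \<in> W"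
    and Wadd: "\<And>x c y d. (x, c) \<in> W \<Longrightarrow> (y, d) \<in> W \<Longrightarrow> (x \<oplus>\<^bsub>V\<^esub> y, c \<oplus>\<^bsub>F\<^esub> d) \<in> W"
    and Wsm: "\<And>x c k. (x, c) \<in> W \<Longrightarrow> k \<in> carrier F \<Longrightarrow> (k \<odot>\<^bsub>V\<^esub> x, k \<otimes>\<^bsub>F\<^esub> c) \<in> W"
    and Wsv: "\<And>c. (\<zero>\<^bsub>V\<^esub>, c) \<in> W \<Longrightarrow> c = \<zero>\<^bsub>F\<^esub>"
  shows "\<exists>\<mu>. linear_form F V \<mu> \<and> (\<forall>(x, c)\<in>W. \<mu> x = c)"
proof -
  interpret F: field F by fact
  interpret V: module F V by fact
  define good where "good U \<longleftrightarrow> U \<subseteq> carrier V \<times> carrier F \<and> W \<subseteq> U \<and>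
     (\<forall>x c y d. (x, c) \<in> U \<longrightarrow> (y, d) \<in> U \<longrightarrow> (x \<oplus>\<^bsub>V\<^esub> y, c \<oplus>\<^bsub>F\<^esub> d) \<in> U) \<and>
     (\<forall>x c k. (x, c) \<in> U \<longrightarrow> k \<in> carrier F \<longrightarrow> (k \<odot>\<^bsub>V\<^esub> x, k \<otimes>\<^bsub>F\<^esub> c) \<in> U) \<and>
     (\<forall>c. (\<zero>\<^bsub>V\<^esub>, c) \<in> U \<longrightarrow> c = \<zero>\<^bsub>F\<^esub>)" for U
  have "good W" unfolding good_def using W Wadd Wsm Wsv by blast
  hence "\<exists>U\<in>{U. good U}. \<forall>U'\<in>{U. good U}. U \<subseteq> U' \<longrightarrow> U' = U"
  proof (intro subset_Zorn_nonempty)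
    fix C assume C: "C \<noteq> {}" "subset.chain {U. good U} C"
    have g: "good U" if "U \<in> C" for U using C that by (auto simp: subset_chain_def)
    have dir: "\<exists>U\<in>C. p \<in> U \<and> q \<in> U" if "p \<in> \<Union>C" "q \<in> \<Union>C" for p q
      using that C(2) unfolding subset_chain_def by blast
    have "\<Union>C \<subseteq> carrier V \<times> carrier F" using g unfolding good_def by blast
    moreover have "W \<subseteq> \<Union>C" using C(1) g unfolding good_def by blast
    moreover have "(x \<oplus>\<^bsub>V\<^esub> y, c \<oplus>\<^bsub>F\<^esub> d) \<in> \<Union>C" if xy: "(x, c) \<in> \<Union>C" "(y, d) \<in> \<Union>C" for x c y d
    proof -
      obtain U where "U \<in> C" "(x, c) \<in> U" "(y, d) \<in> U" using dir[OF xy] by blast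
      thus ?thesis using g[of U] unfolding good_def by blast
    qed
    moreover have "(k \<odot>\<^bsub>V\<^esub> x, k \<otimes>\<^bsub>F\<^esub> c) \<in> \<Union>C" if "(x, c) \<in> \<Union>C" "k \<in> carrier F" for x c k
      using that g unfolding good_def by blast
    moreover have "c = \<zero>\<^bsub>F\<^esub>" if "(\<zero>\<^bsub>V\<^esub>, c) \<in> \<Union>C" for c using that g unfolding good_def by blast
    ultimately have "good (\<Union>C)" unfolding good_def by blast
    thus "\<Union>C \<in> {U. good U}" by simp
  qed auto
  then obtain U where gU: "good U" and max: "\<And>U'. good U' \<Longrightarrow> U \<subseteq> U' \<Longrightarrow> U' = U" by auto
  have UV: "U \<subseteq> carrier V \<times> carrier F" and WU: "W \<subseteq> U" using gU unfolding good_def by auto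
  have add: "(x, c) \<in> U \<Longrightarrow> (y, d) \<in> U \<Longrightarrow> (x \<oplus>\<^bsub>V\<^esub> y, c \<oplus>\<^bsub>F\<^esub> d) \<in> U" for x c y d using gU unfolding good_def by blast
  have sm: "(x, c) \<in> U \<Longrightarrow> k \<in> carrier F \<Longrightarrow> (k \<odot>\<^bsub>V\<^esub> x, k \<otimes>\<^bsub>F\<^esub> c) \<in> U" for x c k using gU unfolding good_def by blast
  have sv: "(\<zero>\<^bsub>V\<^esub>, c) \<in> U \<Longrightarrow> c = \<zero>\<^bsub>F\<^esub>" for c using gU unfolding good_def by blast
  have cV: "x \<in> carrier V" "c \<in> carrier F" if "(x, c) \<in> U" for x c using UV that by auto
  have total: "\<exists>c. (x, c) \<in> U" if x: "x \<in> carrier V" for x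
  proof (rule ccontr)
    assume no: "\<nexists>c. (x, c) \<in> U"
    define U' where "U' = {(a \<oplus>\<^bsub>V\<^esub> k \<odot>\<^bsub>V\<^esub> x, c) | a k c. (a, c) \<in> U \<and> k \<in> carrier F}"
    have sub: "U \<subseteq> U'"
    proof
      fix p assume "p \<in> U"
      then obtain a c where p: "p = (a, c)" "(a, c) \<in> U" by (cases p) auto
      have "a = a \<oplus>\<^bsub>V\<^esub> \<zero>\<^bsub>F\<^esub> \<odot>\<^bsub>V\<^esub> x" using cV[OF p(2)] x by simp
      thus "p \<in> U'" unfolding U'_def p(1) using p(2) by blast
    qed
    have "good U'" unfolding good_def
    proof (intro conjI allI impI)
      show "U' \<subseteq> carrier V \<times> carrier F" unfolding U'_def using cV x by auto
      show "W \<subseteq> U'" using WU sub by blast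
      fix y c z d assume "(y, c) \<in> U'" "(z, d) \<in> U'"
      then obtain a k b l where y: "y = a \<oplus>\<^bsub>V\<^esub> k \<odot>\<^bsub>V\<^esub> x" "(a, c) \<in> U" "k \<in> carrier F"
        and z: "z = b \<oplus>\<^bsub>V\<^esub> l \<odot>\<^bsub>V\<^esub> x" "(b, d) \<in> U" "l \<in> carrier F" unfolding U'_def by blast
      have "y \<oplus>\<^bsub>V\<^esub> z = (a \<oplus>\<^bsub>V\<^esub> b) \<oplus>\<^bsub>V\<^esub> (k \<oplus>\<^bsub>F\<^esub> l) \<odot>\<^bsub>V\<^esub> x"
        unfolding y(1) z(1) using cV y z x by (simp add: V.smult_l_distr V.a_ac)
      thus "(y \<oplus>\<^bsub>V\<^esub> z, c \<oplus>\<^bsub>F\<^esub> d) \<in> U'" unfolding U'_def using add[OF y(2) z(2)] y z by blast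
    next
      fix y c l assume "(y, c) \<in> U'" and l: "l \<in> carrier F"
      then obtain a k where y: "y = a \<oplus>\<^bsub>V\<^esub> k \<odot>\<^bsub>V\<^esub> x" "(a, c) \<in> U" "k \<in> carrier F" unfolding U'_def by blast
      have "l \<odot>\<^bsub>V\<^esub> y = l \<odot>\<^bsub>V\<^esub> a \<oplus>\<^bsub>V\<^esub> (l \<otimes>\<^bsub>F\<^esub> k) \<odot>\<^bsub>V\<^esub> x"
        unfolding y(1) using cV y l x by (simp add: V.smult_r_distr V.smult_assoc1)
      thus "(l \<odot>\<^bsub>V\<^esub> y, l \<otimes>\<^bsub>F\<^esub> c) \<in> U'" unfolding U'_def using sm[OF y(2) l] y l by blast
    next
      fix c assume "(\<zero>\<^bsub>V\<^esub>, c) \<in> U'"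
      then obtain a k where y: "\<zero>\<^bsub>V\<^esub> = a \<oplus>\<^bsub>V\<^esub> k \<odot>\<^bsub>V\<^esub> x" "(a, c) \<in> U" "k \<in> carrier F" unfolding U'_def by blast
      show "c = \<zero>\<^bsub>F\<^esub>"
      proof (cases "k = \<zero>\<^bsub>F\<^esub>")
        case True
        hence "a = \<zero>\<^bsub>V\<^esub>" using y x cV by simp
        thus ?thesis using y(2) sv by simp
      next
        case False
        then obtain k' where k': "k' \<in> carrier F" "k' \<otimes>\<^bsub>F\<^esub> k = \<one>\<^bsub>F\<^esub>"
          using y(3) F.field_Units F.Units_l_inv_ex by (metis DiffI empty_iff insert_iff)
        have ac: "a \<in> carrier V" using cV y by auto
        have "k \<odot>\<^bsub>V\<^esub> x = \<ominus>\<^bsub>V\<^esub> a" using y(1,3) ac x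
          by (metis V.a_comm V.minus_equality V.smult_closed)
        hence "k' \<odot>\<^bsub>V\<^esub> (k \<odot>\<^bsub>V\<^esub> x) = (\<ominus>\<^bsub>F\<^esub> k') \<odot>\<^bsub>V\<^esub> a"
          using ac k' by (simp add: V.smult_r_minus V.smult_l_minus)
        moreover have "k' \<odot>\<^bsub>V\<^esub> (k \<odot>\<^bsub>V\<^esub> x) = x" using k' y(3) x by (metis V.smult_assoc1 V.smult_one)
        ultimately have "(x, (\<ominus>\<^bsub>F\<^esub> k') \<otimes>\<^bsub>F\<^esub> c) \<in> U" using sm[OF y(2), of "\<ominus>\<^bsub>F\<^esub> k'"] k' by simp
        thus ?thesis using no by blast
      qed
    qed
    hence "U' = U" using max sub by blast
    moreover have "(x, \<zero>\<^bsub>F\<^esub>) \<in> U'"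
    proof -
      have "x = \<zero>\<^bsub>V\<^esub> \<oplus>\<^bsub>V\<^esub> \<one>\<^bsub>F\<^esub> \<odot>\<^bsub>V\<^esub> x" using x by (simp add: V.smult_one)
      thus ?thesis unfolding U'_def using W0 WU by blast
    qed
    ultimately show False using no by blast
  qed
  have uniq: "c = d" if "(x, c) \<in> U" "(x, d) \<in> U" for x c d
  proof -
    have "(x \<oplus>\<^bsub>V\<^esub> (\<ominus>\<^bsub>F\<^esub> \<one>\<^bsub>F\<^esub>) \<odot>\<^bsub>V\<^esub> x, c \<oplus>\<^bsub>F\<^esub> (\<ominus>\<^bsub>F\<^esub> \<one>\<^bsub>F\<^esub>) \<otimes>\<^bsub>F\<^esub> d) \<in> U"
      using add[OF that(1) sm[OF that(2), of "\<ominus>\<^bsub>F\<^esub> \<one>\<^bsub>F\<^esub>"]] by simp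
    moreover have "x \<oplus>\<^bsub>V\<^esub> (\<ominus>\<^bsub>F\<^esub> \<one>\<^bsub>F\<^esub>) \<odot>\<^bsub>V\<^esub> x = \<zero>\<^bsub>V\<^esub>" using cV that by (simp add: V.smult_l_minus V.smult_one V.r_neg)
    ultimately have "c \<ominus>\<^bsub>F\<^esub> d = \<zero>\<^bsub>F\<^esub>" using sv[of "c \<oplus>\<^bsub>F\<^esub> (\<ominus>\<^bsub>F\<^esub> \<one>\<^bsub>F\<^esub>) \<otimes>\<^bsub>F\<^esub> d"] cV that by (simp add: F.l_minus F.minus_eq)
    thus ?thesis using cV that by simp
  qed
  define \<mu> where "\<mu> x = (THE c. (x, c) \<in> U)" for x
  have mu: "\<mu> x = c" if "(x, c) \<in> U" for x c unfolding \<mu>_def using that uniq by (intro the_equality) auto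
  have muU: "(x, \<mu> x) \<in> U" if "x \<in> carrier V" for x using total[OF that] mu by auto
  have "\<mu> (x \<oplus>\<^bsub>V\<^esub> y) = \<mu> x \<oplus>\<^bsub>F\<^esub> \<mu> y" if "x \<in> carrier V" "y \<in> carrier V" for x y
    using mu[OF add[OF muU[OF that(1)] muU[OF that(2)]]] .
  moreover have "\<mu> (k \<odot>\<^bsub>V\<^esub> x) = k \<otimes>\<^bsub>F\<^esub> \<mu> x" if "k \<in> carrier F" "x \<in> carrier V" for k x
    using mu[OF sm[OF muU[OF that(2)] that(1)]] .
  moreover have "\<mu> x \<in> carrier F" if "x \<in> carrier V" for x using cV(2)[OF muU[OF that]] .
  ultimately have "linear_form F V \<mu>" unfolding linear_form_def by auto
  moreover have "\<forall>(x, c)\<in>W. \<mu> x = c" using WU mu by blast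
  ultimately show ?thesis by blast
qed

text \<open>The form \<open>a + k v \<mapsto> k\<close> is well defined on the sum of \<open>U\<close> and the line through \<open>v\<close>.\<close>
lemma separating_form:
  fixes F :: "('f, 'k) ring_scheme" and V :: "('f, 'a, 'c) module_scheme"
  assumes F: "field F" and V: "module F V" and U: "U \<subseteq> carrier V" "\<zero>\<^bsub>V\<^esub> \<in> U"
    and add: "\<And>x y. x \<in> U \<Longrightarrow> y \<in> U \<Longrightarrow> x \<oplus>\<^bsub>V\<^esub> y \<in> U"
    and sm: "\<And>x k. x \<in> U \<Longrightarrow> k \<in> carrier F \<Longrightarrow> k \<odot>\<^bsub>V\<^esub> x \<in> U"
    and v: "v \<in> carrier V" "v \<notin> U"
  shows "\<exists>\<mu>. linear_form F V \<mu> \<and> (\<forall>x\<in>U. \<mu> x = \<zero>\<^bsub>F\<^esub>) \<and> \<mu> v = \<one>\<^bsub>F\<^esub>"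
proof -
  interpret F: field F by fact
  interpret V: module F V by fact
  define W where "W = {(a \<oplus>\<^bsub>V\<^esub> k \<odot>\<^bsub>V\<^esub> v, k) | a k. a \<in> U \<and> k \<in> carrier F}"
  have Uc: "a \<in> carrier V" if "a \<in> U" for a using U that by auto
  have WI: "(a \<oplus>\<^bsub>V\<^esub> k \<odot>\<^bsub>V\<^esub> v, k) \<in> W" if "a \<in> U" "k \<in> carrier F" for a k unfolding W_def using that by blast
  have "\<exists>\<mu>. linear_form F V \<mu> \<and> (\<forall>(x, c)\<in>W. \<mu> x = c)"
  proof (rule extend_partial_form[OF F V])
    show "W \<subseteq> carrier V \<times> carrier F" unfolding W_def using Uc v by auto
    show "(\<zero>\<^bsub>V\<^esub>, \<zero>\<^bsub>F\<^esub>) \<in> W" using WI[OF U(2) F.zero_closed] v by simp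
    fix x c y d assume "(x, c) \<in> W" "(y, d) \<in> W"
    then obtain a b where ab: "x = a \<oplus>\<^bsub>V\<^esub> c \<odot>\<^bsub>V\<^esub> v" "a \<in> U" "c \<in> carrier F" "y = b \<oplus>\<^bsub>V\<^esub> d \<odot>\<^bsub>V\<^esub> v" "b \<in> U" "d \<in> carrier F"
      unfolding W_def by blast
    have "x \<oplus>\<^bsub>V\<^esub> y = (a \<oplus>\<^bsub>V\<^esub> b) \<oplus>\<^bsub>V\<^esub> (c \<oplus>\<^bsub>F\<^esub> d) \<odot>\<^bsub>V\<^esub> v"
      unfolding ab(1,4) using Uc ab(2,3,5,6) v by (simp add: V.smult_l_distr V.a_ac)
    thus "(x \<oplus>\<^bsub>V\<^esub> y, c \<oplus>\<^bsub>F\<^esub> d) \<in> W" using WI[OF add[OF ab(2,5)], of "c \<oplus>\<^bsub>F\<^esub> d"] ab by simp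
  next
    fix x c k assume "(x, c) \<in> W" and k: "k \<in> carrier F"
    then obtain a where ab: "x = a \<oplus>\<^bsub>V\<^esub> c \<odot>\<^bsub>V\<^esub> v" "a \<in> U" "c \<in> carrier F" unfolding W_def by blast
    have "k \<odot>\<^bsub>V\<^esub> x = k \<odot>\<^bsub>V\<^esub> a \<oplus>\<^bsub>V\<^esub> (k \<otimes>\<^bsub>F\<^esub> c) \<odot>\<^bsub>V\<^esub> v"
      unfolding ab(1) using Uc ab(2,3) v k by (simp add: V.smult_r_distr V.smult_assoc1)
    thus "(k \<odot>\<^bsub>V\<^esub> x, k \<otimes>\<^bsub>F\<^esub> c) \<in> W" using WI[OF sm[OF ab(2) k], of "k \<otimes>\<^bsub>F\<^esub> c"] ab k by simp
  next
    fix c assume "(\<zero>\<^bsub>V\<^esub>, c) \<in> W"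
    then obtain a where ab: "\<zero>\<^bsub>V\<^esub> = a \<oplus>\<^bsub>V\<^esub> c \<odot>\<^bsub>V\<^esub> v" "a \<in> U" "c \<in> carrier F" unfolding W_def by blast
    show "c = \<zero>\<^bsub>F\<^esub>"
    proof (rule ccontr)
      assume "c \<noteq> \<zero>\<^bsub>F\<^esub>"
      then obtain k where k: "k \<in> carrier F" "k \<otimes>\<^bsub>F\<^esub> c = \<one>\<^bsub>F\<^esub>"
        using ab(3) F.field_Units F.Units_l_inv_ex by (metis DiffI empty_iff insert_iff)
      have "c \<odot>\<^bsub>V\<^esub> v = \<ominus>\<^bsub>V\<^esub> a" using ab Uc v by (metis V.a_comm V.minus_equality V.smult_closed)
      hence "k \<odot>\<^bsub>V\<^esub> (c \<odot>\<^bsub>V\<^esub> v) = (\<ominus>\<^bsub>F\<^esub> k) \<odot>\<^bsub>V\<^esub> a" using Uc[OF ab(2)] k by (simp add: V.smult_r_minus V.smult_l_minus)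
      moreover have "k \<odot>\<^bsub>V\<^esub> (c \<odot>\<^bsub>V\<^esub> v) = v" using k ab(3) v by (metis V.smult_assoc1 V.smult_one)
      ultimately show False using sm[OF ab(2), of "\<ominus>\<^bsub>F\<^esub> k"] k v by simp
    qed
  qed
  then obtain \<mu> where mu: "linear_form F V \<mu>" and muW: "\<forall>(x, c)\<in>W. \<mu> x = c" by blast
  have mu': "\<mu> (a \<oplus>\<^bsub>V\<^esub> k \<odot>\<^bsub>V\<^esub> v) = k" if "a \<in> U" "k \<in> carrier F" for a k
    using bspec[OF muW WI[OF that]] by simp
  have "\<mu> a = \<zero>\<^bsub>F\<^esub>" if "a \<in> U" for a using mu'[OF that F.zero_closed] v Uc[OF that] by simp
  moreover have "\<mu> v = \<one>\<^bsub>F\<^esub>" using mu'[OF U(2) F.one_closed] v by (simp add: V.smult_one)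
  ultimately show ?thesis using mu by blast
qed

section \<open>Slices along linear forms\<close>

context algebra_family
begin

text \<open>The map \<open>\<mu> \<otimes> id\<close> from \<open>T = R\<^sub>i \<otimes> S\<close> to \<open>S\<close>, followed by the embedding of \<open>S\<close> into \<open>T\<close>, where \<open>S\<close>
is the tensor product of the other factors. Staying inside \<open>T\<close> avoids identifying \<open>T\<close> with a tensor
product of two algebras.\<close>
definition slice where
  "slice i \<mu> = (SOME L. L \<in> carrier T \<rightarrow> carrier T \<and>
    (\<forall>s\<in>carrier T. \<forall>t\<in>carrier T. L (s \<oplus>\<^bsub>T\<^esub> t) = L s \<oplus>\<^bsub>T\<^esub> L t) \<and>
    (\<forall>x\<in>PR. L (pure x) = scal (\<mu> (x i)) \<otimes>\<^bsub>T\<^esub> pure (x(i := \<one>\<^bsub>R i\<^esub>))))"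

abbreviation form where "form i \<equiv> linear_form F (R i)"

lemma slice:
  assumes "i \<in> I" "form i \<mu>"
  shows slice_closed: "t \<in> carrier T \<Longrightarrow> slice i \<mu> t \<in> carrier T"
    and slice_add: "s \<in> carrier T \<Longrightarrow> t \<in> carrier T \<Longrightarrow> slice i \<mu> (s \<oplus>\<^bsub>T\<^esub> t) = slice i \<mu> s \<oplus>\<^bsub>T\<^esub> slice i \<mu> t"
    and slice_pure: "x \<in> PR \<Longrightarrow> slice i \<mu> (pure x) = scal (\<mu> (x i)) \<otimes>\<^bsub>T\<^esub> pure (x(i := \<one>\<^bsub>R i\<^esub>))"
  using someI_ex[OF slice_exists[OF assms], folded slice_def] by blast+

lemma form_closed: "i \<in> I \<Longrightarrow> form i \<mu> \<Longrightarrow> r \<in> carrier (R i) \<Longrightarrow> \<mu> r \<in> carrier F"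
  unfolding linear_form_def by auto

lemma form_add: "form i \<mu> \<Longrightarrow> r \<in> carrier (R i) \<Longrightarrow> s \<in> carrier (R i) \<Longrightarrow> \<mu> (r \<oplus>\<^bsub>R i\<^esub> s) = \<mu> r \<oplus>\<^bsub>F\<^esub> \<mu> s"
  unfolding linear_form_def by auto

lemma form_smult: "form i \<mu> \<Longrightarrow> r \<in> carrier (R i) \<Longrightarrow> c \<in> carrier F \<Longrightarrow> \<mu> (c \<odot>\<^bsub>R i\<^esub> r) = c \<otimes>\<^bsub>F\<^esub> \<mu> r"
  unfolding linear_form_def by auto

lemma incl_closed [simp]: "i \<in> I \<Longrightarrow> r \<in> carrier (R i) \<Longrightarrow> incl i r \<in> carrier T"
  using incl_hom by (rule ring_hom_closed)

lemma incl_mult: "i \<in> I \<Longrightarrow> r \<in> carrier (R i) \<Longrightarrow> s \<in> carrier (R i) \<Longrightarrow> incl i (r \<otimes>\<^bsub>R i\<^esub> s) = incl i r \<otimes>\<^bsub>T\<^esub> incl i s"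
  using ring_hom_mult[OF incl_hom] .

lemma incl_add: "i \<in> I \<Longrightarrow> r \<in> carrier (R i) \<Longrightarrow> s \<in> carrier (R i) \<Longrightarrow> incl i (r \<oplus>\<^bsub>R i\<^esub> s) = incl i r \<oplus>\<^bsub>T\<^esub> incl i s"
  using ring_hom_add[OF incl_hom] .

lemma incl_one: "i \<in> I \<Longrightarrow> incl i \<one>\<^bsub>R i\<^esub> = \<one>\<^bsub>T\<^esub>"
  using ring_hom_one[OF incl_hom] .

lemma incl_zero: "i \<in> I \<Longrightarrow> incl i \<zero>\<^bsub>R i\<^esub> = \<zero>\<^bsub>T\<^esub>"
  using ring_hom_zero[OF incl_hom] factor_cring T.ring_axioms by (simp add: cring_def)

lemma incl_smult: "i \<in> I \<Longrightarrow> r \<in> carrier (R i) \<Longrightarrow> c \<in> carrier F \<Longrightarrow> incl i (c \<odot>\<^bsub>R i\<^esub> r) = scal c \<otimes>\<^bsub>T\<^esub> incl i r"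
proof -
  assume i: "i \<in> I" and r: "r \<in> carrier (R i)" and c: "c \<in> carrier F"
  interpret Ri: algebra F "R i" using factor_algebra i by simp
  have "c \<odot>\<^bsub>R i\<^esub> r = (c \<odot>\<^bsub>R i\<^esub> \<one>\<^bsub>R i\<^esub>) \<otimes>\<^bsub>R i\<^esub> r" using c r by (simp add: Ri.smult_assoc2)
  thus ?thesis using i r c incl_scal[OF i c] by (simp add: incl_mult)
qed

lemma incl_finsum:
  assumes i: "i \<in> I" and f: "\<And>h. h \<in> H \<Longrightarrow> f h \<in> carrier (R i)"
  shows "incl i (finsum (R i) f H) = (\<Oplus>\<^bsub>T\<^esub>h\<in>H. incl i (f h))"
proof -
  interpret h: ring_hom_cring "R i" T "incl i"
    using incl_hom[OF i] factor_cring[OF i] by (intro ring_hom_cringI) (auto intro: T.cring_axioms)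
  have "incl i (finsum (R i) f H) = finsum T (incl i \<circ> f) H" using f by (intro h.hom_finsum) auto
  thus ?thesis by (simp add: comp_def)
qed

text \<open>The elements of \<open>T\<close> that are constant along the factor \<open>i\<close>, expressed by linearity of the slices over
them. They replace the subring \<open>S\<close> generated by the other factors: they form a subring, contain the
other factors and the scalars, and together with \<open>R\<^sub>i\<close> they span \<open>T\<close> (\<open>const_span\<close>).\<close>
definition const where
  "const i = {s \<in> carrier T. \<forall>\<mu>. form i \<mu> \<longrightarrow> (\<forall>t\<in>carrier T. slice i \<mu> (s \<otimes>\<^bsub>T\<^esub> t) = s \<otimes>\<^bsub>T\<^esub> slice i \<mu> t)}"

lemma constD: "s \<in> const i \<Longrightarrow> s \<in> carrier T"
  "s \<in> const i \<Longrightarrow> form i \<mu> \<Longrightarrow> t \<in> carrier T \<Longrightarrow> slice i \<mu> (s \<otimes>\<^bsub>T\<^esub> t) = s \<otimes>\<^bsub>T\<^esub> slice i \<mu> t"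
  unfolding const_def by auto

lemma slice_zero:
  assumes "i \<in> I" "form i \<mu>" shows "slice i \<mu> \<zero>\<^bsub>T\<^esub> = \<zero>\<^bsub>T\<^esub>"
  using slice_add[OF assms, of "\<zero>\<^bsub>T\<^esub>" "\<zero>\<^bsub>T\<^esub>"] slice_closed[OF assms, of "\<zero>\<^bsub>T\<^esub>"] by simp

lemma slice_finsum:
  assumes "i \<in> I" "form i \<mu>" "\<And>h. h \<in> H \<Longrightarrow> f h \<in> carrier T"
  shows "slice i \<mu> (finsum T f H) = (\<Oplus>\<^bsub>T\<^esub>h\<in>H. slice i \<mu> (f h))"
  using assms(3)
proof (induction H rule: infinite_finite_induct)
  case (insert h H)
  have "f \<in> H \<rightarrow> carrier T" "(\<lambda>h. slice i \<mu> (f h)) \<in> H \<rightarrow> carrier T"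
    using insert slice_closed[OF assms(1,2)] by auto
  thus ?case using insert slice_closed[OF assms(1,2)] by (simp add: slice_add[OF assms(1,2)])
qed (simp_all add: slice_zero[OF assms(1,2)])

lemma const_mult:
  assumes "i \<in> I" "s \<in> const i" "s' \<in> const i" shows "s \<otimes>\<^bsub>T\<^esub> s' \<in> const i"
  using assms unfolding const_def by (auto simp: T.m_assoc slice_closed)

lemma const_add:
  assumes "i \<in> I" "s \<in> const i" "s' \<in> const i" shows "s \<oplus>\<^bsub>T\<^esub> s' \<in> const i"
  using assms unfolding const_def by (auto simp: T.l_distr slice_closed slice_add)

lemma const_one: "i \<in> I \<Longrightarrow> \<one>\<^bsub>T\<^esub> \<in> const i"
  unfolding const_def by (auto simp: slice_closed)

lemma const_zero: "i \<in> I \<Longrightarrow> \<zero>\<^bsub>T\<^esub> \<in> const i"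
  unfolding const_def by (auto simp: slice_closed slice_zero)

lemma pure_const:
  assumes i: "i \<in> I" and y: "y \<in> PR" "y i = \<one>\<^bsub>R i\<^esub>"
  shows "pure y \<in> const i"
proof -
  interpret Ri: cring "R i" using factor_cring i by simp
  have "slice i \<mu> (pure y \<otimes>\<^bsub>T\<^esub> t) = pure y \<otimes>\<^bsub>T\<^esub> slice i \<mu> t" if m: "form i \<mu>" and t: "t \<in> carrier T" for \<mu> t
    using t
  proof (induction t rule: pure_span)
    case zero
    show ?case using y by (simp add: slice_zero[OF i m])
  next
    case (pure x)
    have xi: "x i \<in> carrier (R i)" using pure i by auto
    have yx: "y \<otimes>\<^bsub>M\<^esub> x \<in> PR" using A.M.m_closed[of y x] y pure by simp
    have x1: "x(i := \<one>\<^bsub>R i\<^esub>) \<in> PR" using upd_mem[OF pure i] by simp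
    have yxi: "(y \<otimes>\<^bsub>M\<^esub> x) i = x i" using y(2) i xi by simp
    have upd: "y \<otimes>\<^bsub>M\<^esub> x(i := \<one>\<^bsub>R i\<^esub>) = (y \<otimes>\<^bsub>M\<^esub> x)(i := \<one>\<^bsub>R i\<^esub>)" using y(2) i by (auto simp: fun_eq_iff)
    have "slice i \<mu> (pure y \<otimes>\<^bsub>T\<^esub> pure x) = scal (\<mu> (x i)) \<otimes>\<^bsub>T\<^esub> pure (y \<otimes>\<^bsub>M\<^esub> x(i := \<one>\<^bsub>R i\<^esub>))"
      unfolding pure_mult[OF y(1) pure] slice_pure[OF i m yx] yxi upd ..
    also have "\<dots> = pure y \<otimes>\<^bsub>T\<^esub> (scal (\<mu> (x i)) \<otimes>\<^bsub>T\<^esub> pure (x(i := \<one>\<^bsub>R i\<^esub>)))"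
      unfolding pure_mult[OF y(1) x1, symmetric]
      using pure_closed[OF y(1)] pure_closed[OF x1] form_closed[OF i m xi] by (intro T.m_lcomm) auto
    finally show ?case unfolding slice_pure[OF i m pure] .
  next
    case (add s t)
    thus ?case using y slice_closed[OF i m] by (simp add: T.r_distr slice_add[OF i m])
  qed
  thus ?thesis unfolding const_def using y by auto
qed

lemma incl_const:
  assumes "i \<in> I" "j \<in> I" "i \<noteq> j" "r \<in> carrier (R j)" shows "incl j r \<in> const i"
  unfolding incl_upd[OF assms(2)] using assms upd_mem[OF oneM_mem assms(2,4)] by (intro pure_const) auto

lemma scal_const:
  assumes i: "i \<in> I" and c: "c \<in> carrier F" shows "scal c \<in> const i"
proof -
  have "slice i \<mu> (scal c \<otimes>\<^bsub>T\<^esub> t) = scal c \<otimes>\<^bsub>T\<^esub> slice i \<mu> t" if m: "form i \<mu>" and t: "t \<in> carrier T" for \<mu> t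
    using t
  proof (induction t rule: pure_span)
    case zero
    show ?case using c by (simp add: slice_zero[OF i m])
  next
    case (pure x)
    interpret Ri: algebra F "R i" using factor_algebra i by simp
    interpret s: ring_hom_cring F T scal
      using scal_hom by (intro ring_hom_cringI) (auto intro: F.cring_axioms T.cring_axioms)
    have xi: "x i \<in> carrier (R i)" using pure i by auto
    have x1: "x(i := \<one>\<^bsub>R i\<^esub>) \<in> PR" using upd_mem[OF pure i] by simp
    have cx: "x(i := c \<odot>\<^bsub>R i\<^esub> x i) \<in> PR" using upd_mem[OF pure i] xi c by simp
    have "scal c \<otimes>\<^bsub>T\<^esub> pure x = pure (x(i := c \<odot>\<^bsub>R i\<^esub> x i))" using pure_smult[OF pure i xi c] by simp
    hence "slice i \<mu> (scal c \<otimes>\<^bsub>T\<^esub> pure x) = scal (\<mu> (c \<odot>\<^bsub>R i\<^esub> x i)) \<otimes>\<^bsub>T\<^esub> pure (x(i := \<one>\<^bsub>R i\<^esub>))"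
      using slice_pure[OF i m cx] by simp
    also have "\<dots> = scal c \<otimes>\<^bsub>T\<^esub> (scal (\<mu> (x i)) \<otimes>\<^bsub>T\<^esub> pure (x(i := \<one>\<^bsub>R i\<^esub>)))"
      using form_smult[OF m xi c] form_closed[OF i m xi] c pure_closed[OF x1] by (simp add: T.m_assoc)
    finally show ?case unfolding slice_pure[OF i m pure] .
  next
    case (add s t)
    thus ?case using c slice_closed[OF i m] by (simp add: T.r_distr slice_add[OF i m])
  qed
  thus ?thesis unfolding const_def using c by auto
qed

lemma slice_incl:
  assumes "i \<in> I" "form i \<mu>" "r \<in> carrier (R i)"
  shows "slice i \<mu> (incl i r) = scal (\<mu> r)"
proof -
  interpret Ri: cring "R i" using factor_cring assms by simp
  have e: "(\<one>\<^bsub>M\<^esub>(i := r))(i := \<one>\<^bsub>R i\<^esub>) = \<one>\<^bsub>M\<^esub>" using assms(1) by auto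
  show ?thesis
    unfolding incl_upd[OF assms(1)] slice_pure[OF assms(1,2) upd_mem[OF oneM_mem assms(1,3)]] e pure_one
    using form_closed[OF assms] by simp
qed

lemma slice_incl_const:
  assumes "i \<in> I" "form i \<mu>" "r \<in> carrier (R i)" "s \<in> const i"
  shows "slice i \<mu> (incl i r \<otimes>\<^bsub>T\<^esub> s) = scal (\<mu> r) \<otimes>\<^bsub>T\<^esub> s"
proof -
  have "incl i r \<otimes>\<^bsub>T\<^esub> s = s \<otimes>\<^bsub>T\<^esub> incl i r" using assms by (intro T.m_comm) (auto dest: constD)
  thus ?thesis using constD[OF assms(4)] assms slice_incl[OF assms(1-3)] form_closed[OF assms(1-3)]
    by (simp add: T.m_comm[of "scal (\<mu> r)" s])
qed

lemma const_span [consumes 2, case_names zero elem add]: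
  assumes i: "i \<in> I" and t: "t \<in> carrier T" and z: "Q \<zero>\<^bsub>T\<^esub>"
    and p: "\<And>r s. r \<in> carrier (R i) \<Longrightarrow> s \<in> const i \<Longrightarrow> Q (incl i r \<otimes>\<^bsub>T\<^esub> s)"
    and a: "\<And>s t. s \<in> carrier T \<Longrightarrow> t \<in> carrier T \<Longrightarrow> Q s \<Longrightarrow> Q t \<Longrightarrow> Q (s \<oplus>\<^bsub>T\<^esub> t)"
  shows "Q t"
  using t
proof (induction t rule: pure_span)
  case (pure x)
  interpret Ri: cring "R i" using factor_cring i by simp
  have xi: "x i \<in> carrier (R i)" using pure i by auto
  have x1: "x(i := \<one>\<^bsub>R i\<^esub>) \<in> PR" using upd_mem[OF pure i] by simp
  have e: "\<one>\<^bsub>M\<^esub>(i := x i) \<otimes>\<^bsub>M\<^esub> x(i := \<one>\<^bsub>R i\<^esub>) = x"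
    using pure i xi factor_cring by (auto simp: fun_eq_iff PiE_iff extensional_def cring_def ring_def monoid.l_one)
  have "pure x = incl i (x i) \<otimes>\<^bsub>T\<^esub> pure (x(i := \<one>\<^bsub>R i\<^esub>))"
    unfolding incl_upd[OF i] pure_mult[OF upd_mem[OF oneM_mem i xi] x1] e ..
  thus ?case using p[OF xi pure_const[OF i x1]] by simp
qed (use z a in auto)

lemma slice_cong:
  assumes i: "i \<in> I" and m: "form i \<mu>" "form i \<nu>" and t: "t \<in> carrier T"
    and eq: "\<And>r. r \<in> carrier (R i) \<Longrightarrow> \<mu> r = \<nu> r"
  shows "slice i \<mu> t = slice i \<nu> t"
  using i t
proof (induction t rule: const_span)
  case (elem r s)
  thus ?case using eq slice_incl_const[OF i m(1)] slice_incl_const[OF i m(2)] by simp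
qed (simp_all add: slice_zero[OF i m(1)] slice_zero[OF i m(2)] slice_add[OF i m(1)] slice_add[OF i m(2)])

lemma slice_vanish:
  assumes i: "i \<in> I" and m: "form i \<mu>" and t: "t \<in> carrier T"
    and eq: "\<And>r. r \<in> carrier (R i) \<Longrightarrow> \<mu> r = \<zero>\<^bsub>F\<^esub>"
  shows "slice i \<mu> t = \<zero>\<^bsub>T\<^esub>"
  using i t
proof (induction t rule: const_span)
  case (elem r s)
  have "scal \<zero>\<^bsub>F\<^esub> = \<zero>\<^bsub>T\<^esub>" using ring_hom_zero[OF scal_hom F.ring_axioms T.ring_axioms] .
  thus ?case using elem eq slice_incl_const[OF i m] constD(1)[of s i] by simp
qed (simp_all add: slice_zero[OF i m] slice_add[OF i m])

lemma form_mult: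
  assumes i: "i \<in> I" and m: "form i \<mu>" and e: "e \<in> carrier (R i)"
  shows "form i (\<lambda>r. \<mu> (e \<otimes>\<^bsub>R i\<^esub> r))"
proof -
  interpret Ri: algebra F "R i" using factor_algebra i by simp
  have "e \<otimes>\<^bsub>R i\<^esub> (c \<odot>\<^bsub>R i\<^esub> r) = c \<odot>\<^bsub>R i\<^esub> (e \<otimes>\<^bsub>R i\<^esub> r)" if "c \<in> carrier F" "r \<in> carrier (R i)" for c r
    using that e by (metis Ri.m_comm Ri.smult_assoc2 Ri.smult_closed)
  thus ?thesis using m e unfolding linear_form_def by (auto simp: Ri.r_distr)
qed

text \<open>\<open>R\<^sub>i\<close> acts on forms by \<open>(e \<mu>) r = \<mu> (e r)\<close>, and slicing is compatible with this action.\<close>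
lemma slice_mult_incl:
  assumes i: "i \<in> I" and m: "form i \<mu>" and e: "e \<in> carrier (R i)" and t: "t \<in> carrier T"
  shows "slice i \<mu> (incl i e \<otimes>\<^bsub>T\<^esub> t) = slice i (\<lambda>r. \<mu> (e \<otimes>\<^bsub>R i\<^esub> r)) t"
  using i t
proof (induction t rule: const_span)
  case zero
  show ?case using i e by (simp add: slice_zero[OF i m] slice_zero[OF i form_mult[OF i m e]])
next
  case (elem r s)
  interpret Ri: cring "R i" using factor_cring i by simp
  have "incl i e \<otimes>\<^bsub>T\<^esub> (incl i r \<otimes>\<^bsub>T\<^esub> s) = incl i (e \<otimes>\<^bsub>R i\<^esub> r) \<otimes>\<^bsub>T\<^esub> s"
    using i e elem constD(1)[of s i] by (simp add: incl_mult T.m_assoc)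
  thus ?case using slice_incl_const[OF i m _ elem(2), of "e \<otimes>\<^bsub>R i\<^esub> r"] slice_incl_const[OF i form_mult[OF i m e] elem] e elem
    by simp
next
  case (add s t)
  thus ?case using i e by (simp add: T.r_distr slice_add[OF i m] slice_add[OF i form_mult[OF i m e]])
qed

lemma slice_const:
  assumes i: "i \<in> I" and m: "form i \<mu>" and t: "t \<in> carrier T"
  shows "slice i \<mu> t \<in> const i"
  using i t
proof (induction t rule: const_span)
  case zero
  show ?case by (simp add: slice_zero[OF i m] const_zero[OF i])
next
  case (elem r s)
  thus ?case by (simp add: slice_incl_const[OF i m] const_mult[OF i] scal_const[OF i] form_closed[OF i m])
next
  case (add s t)
  thus ?case by (simp add: slice_add[OF i m] const_add[OF i])
qed

text \<open>Ideals of the form \<open>R\<^sub>i \<otimes> G\<^sub>0\<close> with \<open>G\<^sub>0\<close> an ideal of the tensor product of the other factors.\<close>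
definition stable where
  "stable i G \<longleftrightarrow> ideal G T \<and> (\<forall>\<mu>. form i \<mu> \<longrightarrow> (\<forall>g\<in>G. slice i \<mu> g \<in> G))"

lemma slice_preimage_ideal:
  assumes i: "i \<in> I" and m: "form i \<mu>" and G: "ideal G T"
  shows "ideal {g \<in> carrier T. \<forall>t\<in>carrier T. slice i \<mu> (t \<otimes>\<^bsub>T\<^esub> g) \<in> G} T" (is "ideal ?K T")
proof (rule idealI[OF T.ring_axioms])
  interpret G: ideal G T by fact
  show "subgroup ?K (add_monoid T)"
  proof (rule T.add.subgroupI)
    show "?K \<subseteq> carrier T" by blast
    have "slice i \<mu> (t \<otimes>\<^bsub>T\<^esub> \<zero>\<^bsub>T\<^esub>) \<in> G" if "t \<in> carrier T" for t using that by (simp add: slice_zero[OF i m])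
    thus "?K \<noteq> {}" using T.zero_closed by blast
    fix a assume a: "a \<in> ?K"
    have "slice i \<mu> (t \<otimes>\<^bsub>T\<^esub> \<ominus>\<^bsub>T\<^esub> a) \<in> G" if t: "t \<in> carrier T" for t
    proof -
      have "t \<otimes>\<^bsub>T\<^esub> \<ominus>\<^bsub>T\<^esub> a = \<ominus>\<^bsub>T\<^esub> t \<otimes>\<^bsub>T\<^esub> a" using a t by (simp add: T.l_minus T.r_minus)
      thus ?thesis using a t by simp
    qed
    thus "\<ominus>\<^bsub>T\<^esub> a \<in> ?K" using a by simp
    fix b assume b: "b \<in> ?K"
    show "a \<oplus>\<^bsub>T\<^esub> b \<in> ?K" using a b by (auto simp: T.r_distr slice_add[OF i m])
  qed
  fix a x assume a: "a \<in> ?K" and x: "x \<in> carrier T"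
  have "slice i \<mu> (t \<otimes>\<^bsub>T\<^esub> (x \<otimes>\<^bsub>T\<^esub> a)) \<in> G" if t: "t \<in> carrier T" for t
    using a x t by (simp add: T.m_assoc[symmetric])
  thus "x \<otimes>\<^bsub>T\<^esub> a \<in> ?K" using a x by simp
  thus "a \<otimes>\<^bsub>T\<^esub> x \<in> ?K" using a x by (simp add: T.m_comm)
qed

text \<open>A slice is not linear over \<open>T\<close>, so the preimage of an ideal under it need not be an ideal. The largest ideal
inside the preimage serves instead, and it contains \<open>S\<close> under the stated condition.\<close>
lemma slice_genideal:
  assumes i: "i \<in> I" and m: "form i \<mu>" and G: "ideal G T" and S: "S \<subseteq> carrier T"
    and s: "\<And>y t. y \<in> S \<Longrightarrow> t \<in> carrier T \<Longrightarrow> slice i \<mu> (t \<otimes>\<^bsub>T\<^esub> y) \<in> G"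
    and g: "g \<in> Idl\<^bsub>T\<^esub> S"
  shows "slice i \<mu> g \<in> G"
proof -
  have "Idl\<^bsub>T\<^esub> S \<subseteq> {g \<in> carrier T. \<forall>t\<in>carrier T. slice i \<mu> (t \<otimes>\<^bsub>T\<^esub> g) \<in> G}"
    using S s by (intro T.genideal_minimal slice_preimage_ideal[OF i m G]) auto
  hence "g \<in> carrier T" "slice i \<mu> (\<one>\<^bsub>T\<^esub> \<otimes>\<^bsub>T\<^esub> g) \<in> G" using g by auto
  thus ?thesis by simp
qed

lemma stable_genideal:
  assumes i: "i \<in> I" and S: "S \<subseteq> const i"
  shows "stable i (Idl\<^bsub>T\<^esub> S)"
proof -
  have ST: "S \<subseteq> carrier T" using S constD(1) by blast
  have id: "ideal (Idl\<^bsub>T\<^esub> S) T" using T.genideal_ideal[OF ST] .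
  interpret G: ideal "Idl\<^bsub>T\<^esub> S" T by fact
  have "slice i \<mu> g \<in> Idl\<^bsub>T\<^esub> S" if m: "form i \<mu>" and g: "g \<in> Idl\<^bsub>T\<^esub> S" for \<mu> g
  proof (rule slice_genideal[OF i m id ST _ g])
    fix y t assume y: "y \<in> S" and t: "t \<in> carrier T"
    have yc: "y \<in> const i" "y \<in> carrier T" using y S ST by auto
    have "slice i \<mu> (t \<otimes>\<^bsub>T\<^esub> y) = y \<otimes>\<^bsub>T\<^esub> slice i \<mu> t"
      using constD(2)[OF yc(1) m t] T.m_comm[OF t yc(2)] by simp
    moreover have "y \<in> Idl\<^bsub>T\<^esub> S" using T.genideal_self[OF ST] y by auto
    ultimately show "slice i \<mu> (t \<otimes>\<^bsub>T\<^esub> y) \<in> Idl\<^bsub>T\<^esub> S" using slice_closed[OF i m t] G.I_r_closed by simp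
  qed
  thus ?thesis unfolding stable_def using id by blast
qed

abbreviation ext where "ext i J \<equiv> Idl\<^bsub>T\<^esub> (incl i ` J)"

lemma ext_sub: "i \<in> I \<Longrightarrow> J \<subseteq> carrier (R i) \<Longrightarrow> incl i ` J \<subseteq> carrier T"
  by auto

lemma ext_ideal: "i \<in> I \<Longrightarrow> J \<subseteq> carrier (R i) \<Longrightarrow> ideal (ext i J) T"
  using T.genideal_ideal[OF ext_sub] .

lemma slice_ext_zero:
  assumes i: "i \<in> I" and m: "form i \<mu>" and J: "ideal J (R i)"
    and v: "\<And>j. j \<in> J \<Longrightarrow> \<mu> j = \<zero>\<^bsub>F\<^esub>" and x: "x \<in> ext i J"
  shows "slice i \<mu> x = \<zero>\<^bsub>T\<^esub>"
proof -
  interpret J: ideal J "R i" by fact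
  have sub: "incl i ` J \<subseteq> carrier T" using ext_sub[OF i J.a_subset] .
  have sz: "scal \<zero>\<^bsub>F\<^esub> = \<zero>\<^bsub>T\<^esub>" using ring_hom_zero[OF scal_hom F.ring_axioms T.ring_axioms] .
  have "slice i \<mu> x \<in> {\<zero>\<^bsub>T\<^esub>}"
  proof (rule slice_genideal[OF i m T.zeroideal sub _ x])
    fix y t assume "y \<in> incl i ` J" and t: "t \<in> carrier T"
    then obtain j where j: "j \<in> J" "y = incl i j" by auto
    have jc: "j \<in> carrier (R i)" using j J.Icarr by auto
    show "slice i \<mu> (t \<otimes>\<^bsub>T\<^esub> y) \<in> {\<zero>\<^bsub>T\<^esub>}"
      using i t
    proof (induction t rule: const_span)
      case zero
      show ?case using j jc i by (simp add: slice_zero[OF i m])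
    next
      case (elem r s)
      have sc: "s \<in> carrier T" using elem constD by auto
      have rj: "r \<otimes>\<^bsub>R i\<^esub> j \<in> J" using J.I_l_closed j elem by auto
      have "incl i r \<otimes>\<^bsub>T\<^esub> s \<otimes>\<^bsub>T\<^esub> y = incl i (r \<otimes>\<^bsub>R i\<^esub> j) \<otimes>\<^bsub>T\<^esub> s"
        using elem j jc sc i by (simp add: incl_mult T.m_assoc T.m_comm[of s])
      thus ?case using slice_incl_const[OF i m J.Icarr[OF rj] elem(2)] v[OF rj] sc sz by simp
    next
      case (add s t)
      thus ?case using j jc i slice_closed[OF i m] by (simp add: T.l_distr slice_add[OF i m])
    qed
  qed
  thus ?thesis by simp
qed

end

section \<open>Membership in extended ideals\<close>

context algebra_family
begin

text \<open>Elements of \<open>J T\<close> as elements of \<open>J \<otimes> S\<close>. Indexing the terms by the elements of \<open>J\<close> that occur, rather than by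
numbers, forces coinciding terms to be merged when sums are formed.\<close>
lemma ext_terms:
  assumes i: "i \<in> I" and J: "ideal J (R i)" and x: "x \<in> ext i J"
  shows "\<exists>H s. finite H \<and> H \<subseteq> J \<and> (\<forall>p. s p \<in> const i) \<and> x = (\<Oplus>\<^bsub>T\<^esub>p\<in>H. incl i p \<otimes>\<^bsub>T\<^esub> s p)"
proof -
  interpret J: ideal J "R i" by fact
  define S where "S H s = (\<Oplus>\<^bsub>T\<^esub>p\<in>H. incl i p \<otimes>\<^bsub>T\<^esub> s p)" for H s
  define K where "K = {x. \<exists>H s. finite H \<and> H \<subseteq> J \<and> (\<forall>p. s p \<in> const i) \<and> x = S H s}"
  have KE: "\<exists>H s. finite H \<and> H \<subseteq> J \<and> (\<forall>p. s p \<in> const i) \<and> x = S H s" if "x \<in> K" for x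
    using that by (simp add: K_def)
  have Sc: "S H s \<in> carrier T" if "H \<subseteq> J" "\<And>p. s p \<in> const i" for H s
    unfolding S_def using that constD(1)[OF that(2)] J.Icarr i by (intro T.finsum_closed) auto
  have K1: "incl i p \<otimes>\<^bsub>T\<^esub> s0 \<oplus>\<^bsub>T\<^esub> y \<in> K" if p: "p \<in> J" and s0: "s0 \<in> const i" and y: "y \<in> K" for p s0 y
  proof -
    obtain H s where "finite H \<and> H \<subseteq> J \<and> (\<forall>p. s p \<in> const i) \<and> y = S H s"
      using KE[OF y] by (elim exE)
    hence H: "finite H" "H \<subseteq> J" "\<And>p. s p \<in> const i" "y = S H s" by auto
    have tm: "incl i q \<otimes>\<^bsub>T\<^esub> s' \<in> carrier T" if "q \<in> J" "s' \<in> const i" for q s'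
      using that constD(1)[OF that(2)] J.Icarr i by auto
    define s' where "s' = (\<lambda>q. if q = p then (if p \<in> H then s0 \<oplus>\<^bsub>T\<^esub> s p else s0) else s q)"
    have sc: "s' q \<in> const i" for q unfolding s'_def using H(3) s0 const_add[OF i] by auto
    have t': "incl i q \<otimes>\<^bsub>T\<^esub> s' q \<in> carrier T" if "q \<in> insert p H" for q
      using that p H(2) sc by (intro tm) auto
    have rest: "S (H - {p}) s' = S (H - {p}) s" unfolding S_def
      using H tm by (intro T.finsum_cong') (auto simp: s'_def)
    have Sc': "S (H - {p}) s \<in> carrier T" using H by (intro Sc) auto
    have "S (insert p (H - {p})) s' = incl i p \<otimes>\<^bsub>T\<^esub> s' p \<oplus>\<^bsub>T\<^esub> S (H - {p}) s'"
      unfolding S_def using H(1) t' by (intro T.finsum_insert) auto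
    also have "\<dots> = incl i p \<otimes>\<^bsub>T\<^esub> s0 \<oplus>\<^bsub>T\<^esub> y"
    proof (cases "p \<in> H")
      case True
      have "insert p (H - {p}) = H" using True by auto
      hence "y = S (insert p (H - {p})) s" using H(4) by simp
      also have "\<dots> = incl i p \<otimes>\<^bsub>T\<^esub> s p \<oplus>\<^bsub>T\<^esub> S (H - {p}) s"
        unfolding S_def using H p tm by (intro T.finsum_insert) auto
      finally have y': "y = incl i p \<otimes>\<^bsub>T\<^esub> s p \<oplus>\<^bsub>T\<^esub> S (H - {p}) s" .
      have "s' p = s0 \<oplus>\<^bsub>T\<^esub> s p" using True by (simp add: s'_def)
      thus ?thesis unfolding rest y'
        using i J.Icarr[OF p] constD(1)[OF s0] constD(1)[OF H(3)[of p]] Sc' by (simp add: T.r_distr T.a_assoc)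
    next
      case False
      hence "H - {p} = H" "s' p = s0" by (auto simp: s'_def)
      thus ?thesis using rest H(4) by simp
    qed
    finally have "incl i p \<otimes>\<^bsub>T\<^esub> s0 \<oplus>\<^bsub>T\<^esub> y = S (insert p H) s'" by simp
    moreover have "finite (insert p H)" "insert p H \<subseteq> J" using H p by auto
    ultimately show ?thesis unfolding K_def using sc by blast
  qed
  have K0: "\<zero>\<^bsub>T\<^esub> \<in> K" unfolding K_def S_def using const_zero[OF i] by (auto intro!: exI[of _ "{}"] exI[of _ "\<lambda>_. \<zero>\<^bsub>T\<^esub>"])
  have Kc: "y \<in> carrier T" if "y \<in> K" for y using that Sc unfolding K_def by auto
  have Ksum: "(\<Oplus>\<^bsub>T\<^esub>p\<in>H. incl i (q p) \<otimes>\<^bsub>T\<^esub> s p) \<oplus>\<^bsub>T\<^esub> y \<in> K"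
    if "finite H" "\<And>p. p \<in> H \<Longrightarrow> q p \<in> J" "\<And>p. p \<in> H \<Longrightarrow> s p \<in> const i" "y \<in> K" for H q s y
    using that
  proof (induction H)
    case empty
    thus ?case using Kc by simp
  next
    case (insert p H)
    have tm: "incl i (q h) \<otimes>\<^bsub>T\<^esub> s h \<in> carrier T" if "h \<in> insert p H" for h
      using insert.prems(1,2)[OF that] constD(1)[OF insert.prems(2)[OF that]] J.Icarr i by auto
    have c: "(\<Oplus>\<^bsub>T\<^esub>p\<in>H. incl i (q p) \<otimes>\<^bsub>T\<^esub> s p) \<in> carrier T" using tm by (intro T.finsum_closed) auto
    have "(\<Oplus>\<^bsub>T\<^esub>p\<in>insert p H. incl i (q p) \<otimes>\<^bsub>T\<^esub> s p) = incl i (q p) \<otimes>\<^bsub>T\<^esub> s p \<oplus>\<^bsub>T\<^esub> (\<Oplus>\<^bsub>T\<^esub>p\<in>H. incl i (q p) \<otimes>\<^bsub>T\<^esub> s p)"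
      using insert(1,2) tm by (intro T.finsum_insert) auto
    moreover have "incl i (q p) \<otimes>\<^bsub>T\<^esub> s p \<oplus>\<^bsub>T\<^esub> ((\<Oplus>\<^bsub>T\<^esub>p\<in>H. incl i (q p) \<otimes>\<^bsub>T\<^esub> s p) \<oplus>\<^bsub>T\<^esub> y) \<in> K"
      using insert by (intro K1) auto
    ultimately show ?case using tm[of p] c Kc[OF insert.prems(3)] by (simp add: T.a_assoc)
  qed
  have Kadd: "y \<oplus>\<^bsub>T\<^esub> z \<in> K" if y: "y \<in> K" and z: "z \<in> K" for y z
  proof -
    obtain H s where "finite H \<and> H \<subseteq> J \<and> (\<forall>p. s p \<in> const i) \<and> y = S H s"
      using KE[OF y] by (elim exE)
    hence H: "finite H" "H \<subseteq> J" "\<And>p. s p \<in> const i" "y = S H s" by auto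
    have "(\<Oplus>\<^bsub>T\<^esub>p\<in>H. incl i p \<otimes>\<^bsub>T\<^esub> s p) \<oplus>\<^bsub>T\<^esub> z \<in> K"
      by (rule Ksum[of H "\<lambda>p. p" s z, OF H(1) _ H(3) z]) (use H(2) in auto)
    thus ?thesis by (simp only: H(4) S_def)
  qed
  have Kmult: "t \<otimes>\<^bsub>T\<^esub> y \<in> K" if t: "t \<in> carrier T" and y: "y \<in> K" for t y
    using i t
  proof (induction t rule: const_span)
    case zero
    show ?case using K0 Kc[OF y] by simp
  next
    case (elem r s')
    obtain H s where "finite H \<and> H \<subseteq> J \<and> (\<forall>p. s p \<in> const i) \<and> y = S H s"
      using KE[OF y] by (elim exE)
    hence H: "finite H" "H \<subseteq> J" "\<And>p. s p \<in> const i" "y = S H s" by auto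
    have sc: "s' \<in> carrier T" "\<And>p. s p \<in> carrier T" using elem constD(1) H(3) by auto
    have pc: "p \<in> carrier (R i)" if "p \<in> H" for p using that H(2) J.Icarr by auto
    have "incl i r \<otimes>\<^bsub>T\<^esub> s' \<otimes>\<^bsub>T\<^esub> y = (\<Oplus>\<^bsub>T\<^esub>p\<in>H. incl i r \<otimes>\<^bsub>T\<^esub> s' \<otimes>\<^bsub>T\<^esub> (incl i p \<otimes>\<^bsub>T\<^esub> s p))"
      unfolding H(4) S_def using H(1) sc pc elem i by (intro T.finsum_rdistr) auto
    also have "\<dots> = (\<Oplus>\<^bsub>T\<^esub>p\<in>H. incl i (r \<otimes>\<^bsub>R i\<^esub> p) \<otimes>\<^bsub>T\<^esub> (s' \<otimes>\<^bsub>T\<^esub> s p))"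
    proof (rule T.finsum_cong')
      show "(\<lambda>p. incl i (r \<otimes>\<^bsub>R i\<^esub> p) \<otimes>\<^bsub>T\<^esub> (s' \<otimes>\<^bsub>T\<^esub> s p)) \<in> H \<rightarrow> carrier T"
        using sc pc elem i by auto
      fix p assume p: "p \<in> H"
      show "incl i r \<otimes>\<^bsub>T\<^esub> s' \<otimes>\<^bsub>T\<^esub> (incl i p \<otimes>\<^bsub>T\<^esub> s p) = incl i (r \<otimes>\<^bsub>R i\<^esub> p) \<otimes>\<^bsub>T\<^esub> (s' \<otimes>\<^bsub>T\<^esub> s p)"
        using sc pc[OF p] elem i by (simp add: incl_mult T.m_ac)
    qed simp
    finally have e: "incl i r \<otimes>\<^bsub>T\<^esub> s' \<otimes>\<^bsub>T\<^esub> y = (\<Oplus>\<^bsub>T\<^esub>p\<in>H. incl i (r \<otimes>\<^bsub>R i\<^esub> p) \<otimes>\<^bsub>T\<^esub> (s' \<otimes>\<^bsub>T\<^esub> s p))" .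
    have "(\<Oplus>\<^bsub>T\<^esub>p\<in>H. incl i (r \<otimes>\<^bsub>R i\<^esub> p) \<otimes>\<^bsub>T\<^esub> (s' \<otimes>\<^bsub>T\<^esub> s p)) \<oplus>\<^bsub>T\<^esub> \<zero>\<^bsub>T\<^esub> \<in> K"
      using H(1,2) const_mult[OF i elem(2) H(3)] elem(1) J.I_l_closed K0 by (intro Ksum) auto
    moreover have "(\<Oplus>\<^bsub>T\<^esub>p\<in>H. incl i (r \<otimes>\<^bsub>R i\<^esub> p) \<otimes>\<^bsub>T\<^esub> (s' \<otimes>\<^bsub>T\<^esub> s p)) \<in> carrier T"
      using sc pc elem i by (intro T.finsum_closed) auto
    ultimately show ?case unfolding e by simp
  next
    case (add s t)
    thus ?case using Kc[OF y] Kadd by (simp add: T.l_distr)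
  qed
  have "ideal K T"
  proof (rule idealI[OF T.ring_axioms])
    show "subgroup K (add_monoid T)"
    proof (rule T.add.subgroupI)
      show "K \<subseteq> carrier T" using Kc by blast
      show "K \<noteq> {}" using K0 by blast
      fix y assume y: "y \<in> K"
      have "\<ominus>\<^bsub>T\<^esub> y = \<ominus>\<^bsub>T\<^esub> \<one>\<^bsub>T\<^esub> \<otimes>\<^bsub>T\<^esub> y" using Kc[OF y] by (simp add: T.l_minus)
      thus "\<ominus>\<^bsub>T\<^esub> y \<in> K" using Kmult[OF _ y] by simp
    qed (use Kadd in auto)
    fix y t assume y: "y \<in> K" and t: "t \<in> carrier T"
    show "t \<otimes>\<^bsub>T\<^esub> y \<in> K" using Kmult[OF t y] .
    thus "y \<otimes>\<^bsub>T\<^esub> t \<in> K" using T.m_comm[OF t Kc[OF y]] by simp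
  qed
  moreover have "incl i ` J \<subseteq> K"
  proof
    fix y assume "y \<in> incl i ` J"
    then obtain j where j: "j \<in> J" "y = incl i j" by auto
    show "y \<in> K" using K1[OF j(1) const_one[OF i] K0] j J.Icarr[OF j(1)] i by simp
  qed
  ultimately have "x \<in> K" using T.genideal_minimal x by blast
  from KE[OF this] show ?thesis unfolding S_def .
qed

lemma stableD: "stable i G \<Longrightarrow> ideal G T" "stable i G \<Longrightarrow> form i \<mu> \<Longrightarrow> g \<in> G \<Longrightarrow> slice i \<mu> g \<in> G"
  unfolding stable_def by auto

text \<open>Modulo \<open>J'\<close> the finitely many \<open>p \<in> H\<close> may be assumed linearly independent over \<open>F\<close>. In that case there is, for
each of them, a form that vanishes on \<open>J'\<close>, is 1 on this \<open>p\<close> and 0 on the others; slicing along it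
returns the coefficient \<open>s p\<close>, which therefore lies in \<open>G\<close>, and all terms lie in \<open>W\<close>. Linear dependence
is used to decrease the number of terms.\<close>
lemma slice_criterion_sum:
  assumes i: "i \<in> I" and J': "ideal J' (R i)" and G: "stable i G" and W: "ideal W T" and JW: "incl i ` J' \<subseteq> W"
    and H: "finite H" "H \<subseteq> carrier (R i)" "\<And>p. s p \<in> const i"
    and GW: "\<And>p g. p \<in> H \<Longrightarrow> g \<in> G \<Longrightarrow> incl i p \<otimes>\<^bsub>T\<^esub> g \<in> W"
    and sl: "\<And>\<mu>. form i \<mu> \<Longrightarrow> (\<And>j. j \<in> J' \<Longrightarrow> \<mu> j = \<zero>\<^bsub>F\<^esub>) \<Longrightarrow>
      slice i \<mu> (\<Oplus>\<^bsub>T\<^esub>p\<in>H. incl i p \<otimes>\<^bsub>T\<^esub> s p) \<in> G"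
  shows "(\<Oplus>\<^bsub>T\<^esub>p\<in>H. incl i p \<otimes>\<^bsub>T\<^esub> s p) \<in> W"
  using H GW sl
proof (induction H arbitrary: s)
  case empty
  interpret W: ideal W T by fact
  show ?case by simp
next
  case (insert p0 H)
  interpret J': ideal J' "R i" by fact
  interpret Ri: algebra F "R i" using factor_algebra i by simp
  interpret W: ideal W T by fact
  interpret G: ideal G T using stableD(1)[OF G] .
  have sc: "s p \<in> carrier T" for p using insert.prems(2) constD(1) by auto
  define x where "x s = (\<Oplus>\<^bsub>T\<^esub>p\<in>H. incl i p \<otimes>\<^bsub>T\<^esub> s p)" for s
  have p0: "p0 \<in> carrier (R i)" and Hc: "\<And>p. p \<in> H \<Longrightarrow> p \<in> carrier (R i)" using insert by auto
  have xc: "x s \<in> carrier T" if "\<And>p. s p \<in> carrier T" for s unfolding x_def using that Hc i by (intro T.finsum_closed) auto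
  have tot: "(\<Oplus>\<^bsub>T\<^esub>p\<in>insert p0 H. incl i p \<otimes>\<^bsub>T\<^esub> s p) = incl i p0 \<otimes>\<^bsub>T\<^esub> s p0 \<oplus>\<^bsub>T\<^esub> x s"
    unfolding x_def using insert(1,2) sc Hc p0 i by (intro T.finsum_insert) auto
  have xadd: "x (\<lambda>p. s p \<oplus>\<^bsub>T\<^esub> s' p) = x s \<oplus>\<^bsub>T\<^esub> x s'" if "\<And>p. s p \<in> carrier T" "\<And>p. s' p \<in> carrier T" for s s'
  proof -
    have "x (\<lambda>p. s p \<oplus>\<^bsub>T\<^esub> s' p) = (\<Oplus>\<^bsub>T\<^esub>p\<in>H. incl i p \<otimes>\<^bsub>T\<^esub> s p \<oplus>\<^bsub>T\<^esub> incl i p \<otimes>\<^bsub>T\<^esub> s' p)"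
      unfolding x_def using that Hc i by (intro T.finsum_cong') (auto simp: T.r_distr)
    also have "\<dots> = x s \<oplus>\<^bsub>T\<^esub> x s'" unfolding x_def using that Hc i by (intro T.finsum_addf) auto
    finally show ?thesis .
  qed
  have extW: "ext i J' \<subseteq> W" using T.genideal_minimal[OF W JW] .
  have extI: "ideal (ext i J') T" using ext_ideal[OF i J'.a_subset] .
  interpret X: ideal "ext i J'" T by fact
  let ?s0 = "s p0"
  \<comment> \<open>\<open>U\<close> consists of those \<open>v\<close> whose term \<open>v s\<^sub>0\<close> can be rewritten modulo \<open>J' T\<close> with the remaining elements
    of \<open>H\<close>. It is a subspace that contains \<open>J'\<close> and \<open>H\<close>. If it contains the new element \<open>p\<^sub>0\<close>, its term can
    be eliminated; otherwise a form separates \<open>p\<^sub>0\<close> from it.\<close>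
  define U where "U = {v \<in> carrier (R i). \<exists>s'. (\<forall>p. s' p \<in> const i) \<and> incl i v \<otimes>\<^bsub>T\<^esub> ?s0 \<ominus>\<^bsub>T\<^esub> x s' \<in> ext i J'}"
  show ?case
  proof (cases "p0 \<in> U")
    case True
    then obtain s' where s': "\<And>p. s' p \<in> const i" "incl i p0 \<otimes>\<^bsub>T\<^esub> ?s0 \<ominus>\<^bsub>T\<^esub> x s' \<in> ext i J'" unfolding U_def by auto
    have s'c: "s' p \<in> carrier T" for p using s' constD(1) by auto
    let ?y = "x (\<lambda>p. s p \<oplus>\<^bsub>T\<^esub> s' p)" and ?d = "incl i p0 \<otimes>\<^bsub>T\<^esub> ?s0 \<ominus>\<^bsub>T\<^esub> x s'"
    have tc: "incl i p0 \<otimes>\<^bsub>T\<^esub> ?s0 \<in> carrier T" using i p0 sc by simp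
    have dec: "incl i p0 \<otimes>\<^bsub>T\<^esub> ?s0 \<oplus>\<^bsub>T\<^esub> x s = ?d \<oplus>\<^bsub>T\<^esub> ?y"
      unfolding xadd[OF sc s'c] using tc xc[OF s'c] xc[OF sc] by algebra
    have yc: "?y \<in> carrier T" using xc sc s'c by simp
    have "?y \<in> W" unfolding x_def
    proof (rule insert.IH)
      fix \<mu> assume m: "form i \<mu>" and v: "\<And>j. j \<in> J' \<Longrightarrow> \<mu> j = \<zero>\<^bsub>F\<^esub>"
      have "slice i \<mu> (?d \<oplus>\<^bsub>T\<^esub> ?y) \<in> G" using insert.prems(4)[OF m v] unfolding tot dec .
      moreover have "slice i \<mu> (?d \<oplus>\<^bsub>T\<^esub> ?y) = slice i \<mu> ?y"
        using slice_add[OF i m, of ?d ?y] slice_ext_zero[OF i m J' v s'(2)] X.Icarr[OF s'(2)] yc slice_closed[OF i m yc] by simp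
      ultimately show "slice i \<mu> (\<Oplus>\<^bsub>T\<^esub>p\<in>H. incl i p \<otimes>\<^bsub>T\<^esub> (s p \<oplus>\<^bsub>T\<^esub> s' p)) \<in> G" unfolding x_def by simp
    qed (use insert.prems const_add[OF i insert.prems(2) s'(1)] in auto)
    moreover have "?d \<in> W" using s'(2) extW by blast
    ultimately show ?thesis unfolding tot dec by simp
  next
    case False
    have zc: "x (\<lambda>_. \<zero>\<^bsub>T\<^esub>) = \<zero>\<^bsub>T\<^esub>" unfolding x_def using Hc i by (intro T.add.finprod_one_eqI) auto
    have UI: "v \<in> U" if "v \<in> carrier (R i)" "\<And>p. s' p \<in> const i" "incl i v \<otimes>\<^bsub>T\<^esub> ?s0 \<ominus>\<^bsub>T\<^esub> x s' \<in> ext i J'" for v s'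
      unfolding U_def using that by blast
    have J'U: "j \<in> U" if j: "j \<in> J'" for j
    proof (rule UI[of j "\<lambda>_. \<zero>\<^bsub>T\<^esub>"])
      have "incl i j \<in> ext i J'" using T.genideal_self[OF ext_sub[OF i J'.a_subset]] j by auto
      thus "incl i j \<otimes>\<^bsub>T\<^esub> ?s0 \<ominus>\<^bsub>T\<^esub> x (\<lambda>_. \<zero>\<^bsub>T\<^esub>) \<in> ext i J'"
        unfolding zc using X.I_r_closed sc i J'.Icarr[OF j] by (simp add: T.minus_eq)
    qed (use J'.Icarr[OF j] const_zero[OF i] in auto)
    have HU: "p \<in> U" if p: "p \<in> H" for p
    proof (rule UI[of p "\<lambda>q. if q = p then ?s0 else \<zero>\<^bsub>T\<^esub>"])
      have "x (\<lambda>q. if q = p then ?s0 else \<zero>\<^bsub>T\<^esub>) = (\<Oplus>\<^bsub>T\<^esub>q\<in>H. if q = p then incl i p \<otimes>\<^bsub>T\<^esub> ?s0 else \<zero>\<^bsub>T\<^esub>)"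
        unfolding x_def using Hc i sc by (intro T.finsum_cong') auto
      also have "\<dots> = incl i p \<otimes>\<^bsub>T\<^esub> ?s0" using Hc[OF p] i sc insert(1) p by (intro T.finsum_single) auto
      finally show "incl i p \<otimes>\<^bsub>T\<^esub> ?s0 \<ominus>\<^bsub>T\<^esub> x (\<lambda>q. if q = p then ?s0 else \<zero>\<^bsub>T\<^esub>) \<in> ext i J'"
        using Hc[OF p] i sc by (simp add: T.minus_eq T.r_neg)
    qed (use Hc[OF p] const_zero[OF i] insert.prems(2) in auto)
    have "\<exists>\<mu>. form i \<mu> \<and> (\<forall>x\<in>U. \<mu> x = \<zero>\<^bsub>F\<^esub>) \<and> \<mu> p0 = \<one>\<^bsub>F\<^esub>"
    proof (rule separating_form[OF F.field_axioms Ri.module _ _ _ _ p0 False])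
      show "U \<subseteq> carrier (R i)" unfolding U_def by blast
      show "\<zero>\<^bsub>R i\<^esub> \<in> U" using J'U[OF additive_subgroup.zero_closed[OF ideal.axioms(1)[OF J']]] .
      fix v assume v: "v \<in> U"
      then obtain a where a: "v \<in> carrier (R i)" "\<And>p. a p \<in> const i" "incl i v \<otimes>\<^bsub>T\<^esub> ?s0 \<ominus>\<^bsub>T\<^esub> x a \<in> ext i J'" unfolding U_def by auto
      have ac: "a p \<in> carrier T" for p using a(2) constD(1) by auto
      show "v \<oplus>\<^bsub>R i\<^esub> w \<in> U" if w: "w \<in> U" for w
      proof -
        obtain b where b: "w \<in> carrier (R i)" "\<And>p. b p \<in> const i" "incl i w \<otimes>\<^bsub>T\<^esub> ?s0 \<ominus>\<^bsub>T\<^esub> x b \<in> ext i J'" using w unfolding U_def by auto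
        have bc: "b p \<in> carrier T" for p using b(2) constD(1) by auto
        have alg: "(u \<oplus>\<^bsub>T\<^esub> u') \<otimes>\<^bsub>T\<^esub> z \<ominus>\<^bsub>T\<^esub> (y \<oplus>\<^bsub>T\<^esub> y') = (u \<otimes>\<^bsub>T\<^esub> z \<ominus>\<^bsub>T\<^esub> y) \<oplus>\<^bsub>T\<^esub> (u' \<otimes>\<^bsub>T\<^esub> z \<ominus>\<^bsub>T\<^esub> y')"
          if "u \<in> carrier T" "u' \<in> carrier T" "z \<in> carrier T" "y \<in> carrier T" "y' \<in> carrier T" for u u' z y y'
          using that by algebra
        have "incl i (v \<oplus>\<^bsub>R i\<^esub> w) \<otimes>\<^bsub>T\<^esub> ?s0 \<ominus>\<^bsub>T\<^esub> x (\<lambda>p. a p \<oplus>\<^bsub>T\<^esub> b p)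
            = (incl i v \<otimes>\<^bsub>T\<^esub> ?s0 \<ominus>\<^bsub>T\<^esub> x a) \<oplus>\<^bsub>T\<^esub> (incl i w \<otimes>\<^bsub>T\<^esub> ?s0 \<ominus>\<^bsub>T\<^esub> x b)"
          unfolding xadd[OF ac bc] incl_add[OF i a(1) b(1)]
          using alg[OF incl_closed[OF i a(1)] incl_closed[OF i b(1)] sc xc[OF ac] xc[OF bc]] .
        thus ?thesis using a b const_add[OF i] by (intro UI[of _ "\<lambda>p. a p \<oplus>\<^bsub>T\<^esub> b p"]) auto
      qed
      show "k \<odot>\<^bsub>R i\<^esub> v \<in> U" if k: "k \<in> carrier F" for k
      proof -
        have xs: "x (\<lambda>p. scal k \<otimes>\<^bsub>T\<^esub> a p) = scal k \<otimes>\<^bsub>T\<^esub> x a"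
        proof -
          have "x (\<lambda>p. scal k \<otimes>\<^bsub>T\<^esub> a p) = (\<Oplus>\<^bsub>T\<^esub>p\<in>H. scal k \<otimes>\<^bsub>T\<^esub> (incl i p \<otimes>\<^bsub>T\<^esub> a p))"
            unfolding x_def using Hc i ac k by (intro T.finsum_cong') (auto simp: T.m_lcomm)
          thus ?thesis unfolding x_def using Hc i ac k insert(1) by (subst T.finsum_rdistr) auto
        qed
        have alg: "(c \<otimes>\<^bsub>T\<^esub> u) \<otimes>\<^bsub>T\<^esub> z \<ominus>\<^bsub>T\<^esub> c \<otimes>\<^bsub>T\<^esub> y = c \<otimes>\<^bsub>T\<^esub> (u \<otimes>\<^bsub>T\<^esub> z \<ominus>\<^bsub>T\<^esub> y)"
          if "u \<in> carrier T" "c \<in> carrier T" "z \<in> carrier T" "y \<in> carrier T" for u c z y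
          using that by algebra
        have "incl i (k \<odot>\<^bsub>R i\<^esub> v) \<otimes>\<^bsub>T\<^esub> ?s0 \<ominus>\<^bsub>T\<^esub> x (\<lambda>p. scal k \<otimes>\<^bsub>T\<^esub> a p)
            = scal k \<otimes>\<^bsub>T\<^esub> (incl i v \<otimes>\<^bsub>T\<^esub> ?s0 \<ominus>\<^bsub>T\<^esub> x a)"
          unfolding xs incl_smult[OF i a(1) k]
          using alg[OF incl_closed[OF i a(1)] scal_closed[OF k] sc xc[OF ac]] .
        thus ?thesis using a k const_mult[OF i scal_const[OF i k]] X.I_l_closed[OF a(3) scal_closed[OF k]]
          by (intro UI[of _ "\<lambda>p. scal k \<otimes>\<^bsub>T\<^esub> a p"]) auto
      qed
    qed
    then obtain \<nu> where nu: "form i \<nu>" "\<And>v. v \<in> U \<Longrightarrow> \<nu> v = \<zero>\<^bsub>F\<^esub>" "\<nu> p0 = \<one>\<^bsub>F\<^esub>" by blast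
    interpret sh: ring_hom_cring F T scal
      using scal_hom by (intro ring_hom_cringI) (auto intro: F.cring_axioms T.cring_axioms)
    have slx: "slice i \<mu> (x s) = (\<Oplus>\<^bsub>T\<^esub>p\<in>H. scal (\<mu> p) \<otimes>\<^bsub>T\<^esub> s p)" if m: "form i \<mu>" for \<mu>
    proof -
      have "slice i \<mu> (x s) = (\<Oplus>\<^bsub>T\<^esub>p\<in>H. slice i \<mu> (incl i p \<otimes>\<^bsub>T\<^esub> s p))"
        unfolding x_def using Hc i sc by (intro slice_finsum[OF i m]) auto
      also have "\<dots> = (\<Oplus>\<^bsub>T\<^esub>p\<in>H. scal (\<mu> p) \<otimes>\<^bsub>T\<^esub> s p)"
        using Hc i sc form_closed[OF i m] slice_incl_const[OF i m _ insert.prems(2)] by (intro T.finsum_cong') auto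
      finally show ?thesis .
    qed
    have sltot: "slice i \<mu> (incl i p0 \<otimes>\<^bsub>T\<^esub> ?s0 \<oplus>\<^bsub>T\<^esub> x s) = scal (\<mu> p0) \<otimes>\<^bsub>T\<^esub> ?s0 \<oplus>\<^bsub>T\<^esub> slice i \<mu> (x s)" if m: "form i \<mu>" for \<mu>
      using slice_add[OF i m] slice_incl_const[OF i m p0 insert.prems(2)] p0 i sc xc[OF sc] by simp
    have "slice i \<nu> (x s) = \<zero>\<^bsub>T\<^esub>"
      unfolding slx[OF nu(1)] using nu(2)[OF HU] sc by (intro T.add.finprod_one_eqI) auto
    hence s0G: "?s0 \<in> G"
      using insert.prems(4)[OF nu(1) nu(2)[OF J'U]] unfolding tot sltot[OF nu(1)] nu(3) using sc by simp
    have "x s \<in> W" unfolding x_def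
    proof (rule insert.IH)
      fix \<mu> assume m: "form i \<mu>" and v: "\<And>j. j \<in> J' \<Longrightarrow> \<mu> j = \<zero>\<^bsub>F\<^esub>"
      have a: "scal (\<mu> p0) \<otimes>\<^bsub>T\<^esub> ?s0 \<oplus>\<^bsub>T\<^esub> slice i \<mu> (x s) \<in> G" using insert.prems(4)[OF m v] unfolding tot sltot[OF m] .
      have b: "scal (\<mu> p0) \<otimes>\<^bsub>T\<^esub> ?s0 \<in> G" using G.I_l_closed[OF s0G] form_closed[OF i m p0] by simp
      have "slice i \<mu> (x s) = (scal (\<mu> p0) \<otimes>\<^bsub>T\<^esub> ?s0 \<oplus>\<^bsub>T\<^esub> slice i \<mu> (x s)) \<ominus>\<^bsub>T\<^esub> scal (\<mu> p0) \<otimes>\<^bsub>T\<^esub> ?s0"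
        using G.Icarr[OF b] slice_closed[OF i m xc[OF sc]] by algebra
      thus "slice i \<mu> (\<Oplus>\<^bsub>T\<^esub>p\<in>H. incl i p \<otimes>\<^bsub>T\<^esub> s p) \<in> G"
        using T.ideal_minus_closed[OF stableD(1)[OF G] a b] unfolding x_def by simp
    qed (use insert.prems in auto)
    moreover have "incl i p0 \<otimes>\<^bsub>T\<^esub> ?s0 \<in> W" using insert.prems(3)[OF _ s0G, of p0] by simp
    ultimately show ?thesis unfolding tot by simp
  qed
qed

text \<open>An element of \<open>J T\<close> that lies in \<open>J' T + G\<close>, as far as slices can tell, lies in \<open>J' T + J G\<close>. The ideal \<open>W\<close>
stands for any ideal containing the latter; in the induction over the factors it is larger.\<close>
lemma slice_criterion:
  assumes i: "i \<in> I" and J: "ideal J (R i)" and J': "ideal J' (R i)" and G: "stable i G" and W: "ideal W T" and JW: "incl i ` J' \<subseteq> W"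
    and GW: "\<And>p g. p \<in> J \<Longrightarrow> g \<in> G \<Longrightarrow> incl i p \<otimes>\<^bsub>T\<^esub> g \<in> W" and x: "x \<in> ext i J"
    and sl: "\<And>\<mu>. form i \<mu> \<Longrightarrow> (\<And>j. j \<in> J' \<Longrightarrow> \<mu> j = \<zero>\<^bsub>F\<^esub>) \<Longrightarrow> slice i \<mu> x \<in> G"
  shows "x \<in> W"
proof -
  interpret J: ideal J "R i" by fact
  obtain H s where H: "finite H" "H \<subseteq> J" "\<And>p. s p \<in> const i" "x = (\<Oplus>\<^bsub>T\<^esub>p\<in>H. incl i p \<otimes>\<^bsub>T\<^esub> s p)"
    using ext_terms[OF i J x] by blast
  show ?thesis unfolding H(4)
    by (rule slice_criterion_sum[OF i J' G W JW]) (use H J.a_subset GW sl in auto)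
qed

lemma ext_carrier: "i \<in> I \<Longrightarrow> ext i (carrier (R i)) = carrier T"
proof -
  assume i: "i \<in> I"
  interpret Ri: cring "R i" using factor_cring i by simp
  interpret X: ideal "ext i (carrier (R i))" T using ext_ideal[OF i] by simp
  have "incl i \<one>\<^bsub>R i\<^esub> \<in> ext i (carrier (R i))" using T.genideal_self[OF ext_sub[OF i order_refl]] by auto
  hence "\<one>\<^bsub>T\<^esub> \<in> ext i (carrier (R i))" using incl_one[OF i] by simp
  thus ?thesis using X.one_imp_carrier by simp
qed

lemma extG_ideal:
  assumes "i \<in> I" "ideal J (R i)" "stable i G"
  shows "ideal (ext i J <+>\<^bsub>T\<^esub> G) T"
  using T.add_ideals[OF ext_ideal[OF assms(1)] stableD(1)[OF assms(3)]] assms(2) additive_subgroup.a_subset ideal.axioms(1) by blast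

lemma ext_subset_extG:
  assumes i: "i \<in> I" "ideal J (R i)" "stable i G"
  shows "ext i J \<subseteq> ext i J <+>\<^bsub>T\<^esub> G" "G \<subseteq> ext i J <+>\<^bsub>T\<^esub> G"
proof -
  interpret J: ideal J "R i" by fact
  interpret X: ideal "ext i J" T using ext_ideal[OF i(1) J.a_subset] .
  interpret G: ideal G T using stableD(1)[OF i(3)] .
  show "ext i J \<subseteq> ext i J <+>\<^bsub>T\<^esub> G"
  proof
    fix x assume x: "x \<in> ext i J"
    thus "x \<in> ext i J <+>\<^bsub>T\<^esub> G" unfolding T.ideal_set_add_iff
      using X.Icarr G.zero_closed by (intro bexI[of _ x] bexI[of _ "\<zero>\<^bsub>T\<^esub>"]) auto
  qed
  show "G \<subseteq> ext i J <+>\<^bsub>T\<^esub> G"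
  proof
    fix x assume x: "x \<in> G"
    thus "x \<in> ext i J <+>\<^bsub>T\<^esub> G" unfolding T.ideal_set_add_iff
      using X.zero_closed G.Icarr by (intro bexI[of _ "\<zero>\<^bsub>T\<^esub>"] bexI[of _ x]) auto
  qed
qed

text \<open>In the notation \<open>T = R\<^sub>i \<otimes> S\<close> and \<open>G = R\<^sub>i \<otimes> G\<^sub>0\<close>, this says that linear forms on \<open>R\<^sub>i/J\<close> separate the
elements of \<open>R\<^sub>i/J \<otimes> S/G\<^sub>0\<close>. It is \<open>slice_criterion\<close> with the whole ring in place of the larger ideal.\<close>
lemma mem_extG_iff:
  assumes i: "i \<in> I" and J: "ideal J (R i)" and G: "stable i G" and x: "x \<in> carrier T"
  shows "x \<in> ext i J <+>\<^bsub>T\<^esub> G \<longleftrightarrow> (\<forall>\<mu>. form i \<mu> \<longrightarrow> (\<forall>j\<in>J. \<mu> j = \<zero>\<^bsub>F\<^esub>) \<longrightarrow> slice i \<mu> x \<in> G)"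
proof
  interpret J: ideal J "R i" by fact
  interpret Ri: cring "R i" using factor_cring i by simp
  assume "x \<in> ext i J <+>\<^bsub>T\<^esub> G"
  then obtain a g where a: "a \<in> ext i J" "g \<in> G" "x = a \<oplus>\<^bsub>T\<^esub> g" unfolding T.ideal_set_add_iff by blast
  interpret X: ideal "ext i J" T using ext_ideal[OF i J.a_subset] .
  interpret G: ideal G T using stableD(1)[OF G] .
  have "slice i \<mu> x \<in> G" if m: "form i \<mu>" and v: "\<And>j. j \<in> J \<Longrightarrow> \<mu> j = \<zero>\<^bsub>F\<^esub>" for \<mu>
    using slice_add[OF i m X.Icarr[OF a(1)] G.Icarr[OF a(2)]] slice_ext_zero[OF i m J v a(1)] stableD(2)[OF G m a(2)]
    unfolding a(3) by simp
  thus "\<forall>\<mu>. form i \<mu> \<longrightarrow> (\<forall>j\<in>J. \<mu> j = \<zero>\<^bsub>F\<^esub>) \<longrightarrow> slice i \<mu> x \<in> G" by blast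
next
  interpret Ri: cring "R i" using factor_cring i by simp
  interpret J: ideal J "R i" by fact
  interpret XG: ideal "ext i J <+>\<^bsub>T\<^esub> G" T using extG_ideal[OF i J G] .
  assume sl: "\<forall>\<mu>. form i \<mu> \<longrightarrow> (\<forall>j\<in>J. \<mu> j = \<zero>\<^bsub>F\<^esub>) \<longrightarrow> slice i \<mu> x \<in> G"
  show "x \<in> ext i J <+>\<^bsub>T\<^esub> G"
  proof (rule slice_criterion[OF i Ri.oneideal J G XG.ideal_axioms])
    have "incl i ` J \<subseteq> ext i J" using T.genideal_self[OF ext_sub[OF i J.a_subset]] .
    thus "incl i ` J \<subseteq> ext i J <+>\<^bsub>T\<^esub> G" using ext_subset_extG[OF i J G] by blast
    show "incl i p \<otimes>\<^bsub>T\<^esub> g \<in> ext i J <+>\<^bsub>T\<^esub> G" if "p \<in> carrier (R i)" "g \<in> G" for p g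
      using that ext_subset_extG(2)[OF i J G] XG.I_l_closed i by auto
  qed (use sl x ext_carrier[OF i] in auto)
qed

end

section \<open>Torsion-free quotients after extension\<close>

context algebra_family
begin

text \<open>Let the \<open>e h\<close> be independent in the sense that a combination in \<open>J'\<close> has all its coefficients in \<open>J\<close>. Thus
\<open>r \<mapsto> \<Sum> e h r h\<close> induces an injection of copies of \<open>R\<^sub>i/J\<close> into \<open>R\<^sub>i/J'\<close>, and the lemma says that it
remains injective after tensoring over \<open>F\<close>. By \<open>mem_extG_iff\<close> it suffices to slice \<open>t l\<close> along forms \<open>\<mu>\<close>
that vanish on \<open>J\<close>; such a \<open>\<mu>\<close> on the copy with index \<open>l\<close> extends to a form \<open>\<nu>\<close> on \<open>R\<^sub>i/J'\<close>.\<close>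
lemma independent_cancel:
  fixes H :: "'h set"
  assumes i: "i \<in> I" and J: "ideal J (R i)" and J': "ideal J' (R i)" and G: "stable i G"
    and H: "finite H" "\<And>h. h \<in> H \<Longrightarrow> e h \<in> carrier (R i)" "\<And>h. h \<in> H \<Longrightarrow> t h \<in> carrier T"
    and indep: "\<And>r h. (\<And>h. r h \<in> carrier (R i)) \<Longrightarrow> (\<Oplus>\<^bsub>R i\<^esub>h\<in>H. e h \<otimes>\<^bsub>R i\<^esub> r h) \<in> J' \<Longrightarrow> h \<in> H \<Longrightarrow> r h \<in> J"
    and mem: "(\<Oplus>\<^bsub>T\<^esub>h\<in>H. incl i (e h) \<otimes>\<^bsub>T\<^esub> t h) \<in> ext i J' <+>\<^bsub>T\<^esub> G"
    and l: "l \<in> H"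
  shows "t l \<in> ext i J <+>\<^bsub>T\<^esub> G"
proof -
  interpret Ri: algebra F "R i" using factor_algebra i by simp
  interpret J': ideal J' "R i" by fact
  interpret J: ideal J "R i" by fact
  define S where "S r = (\<Oplus>\<^bsub>R i\<^esub>h\<in>H. e h \<otimes>\<^bsub>R i\<^esub> r h)" for r
  have Sc: "S r \<in> carrier (R i)" if "\<And>h. r h \<in> carrier (R i)" for r
    unfolding S_def using that H by (intro Ri.finsum_closed) auto
  have tot: "(\<Oplus>\<^bsub>T\<^esub>h\<in>H. incl i (e h) \<otimes>\<^bsub>T\<^esub> t h) \<in> carrier T" using H i by (intro T.finsum_closed) auto
  have zJ': "\<zero>\<^bsub>R i\<^esub> \<in> J'" using additive_subgroup.zero_closed[OF ideal.axioms(1)[OF J']] .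
  show ?thesis
    unfolding mem_extG_iff[OF i J G H(3)[OF l]]
  proof (intro allI impI)
    fix \<mu> assume m: "form i \<mu>" and v: "\<forall>j\<in>J. \<mu> j = \<zero>\<^bsub>F\<^esub>"
    \<comment> \<open>The graph of the partial form \<open>\<nu>\<close>: the value at \<open>\<Sum> e h r h\<close> modulo \<open>J'\<close> is \<open>\<mu> (r l)\<close>. Independence
      makes it single-valued.\<close>
    define W where "W = {(S r \<oplus>\<^bsub>R i\<^esub> j, \<mu> (r l)) | r j. (\<forall>h. r h \<in> carrier (R i)) \<and> j \<in> J'}"
    have WI: "(S r \<oplus>\<^bsub>R i\<^esub> j, \<mu> (r l)) \<in> W" if "\<And>h. r h \<in> carrier (R i)" "j \<in> J'" for r j
      unfolding W_def using that by blast
    have WE: "\<exists>r j. (\<forall>h. r h \<in> carrier (R i)) \<and> j \<in> J' \<and> x = S r \<oplus>\<^bsub>R i\<^esub> j \<and> c = \<mu> (r l)" if "(x, c) \<in> W" for x c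
      using that unfolding W_def by blast
    have mu0: "\<mu> \<zero>\<^bsub>R i\<^esub> = \<zero>\<^bsub>F\<^esub>" using v additive_subgroup.zero_closed[OF ideal.axioms(1)[OF J]] by blast
    have S0: "S (\<lambda>_. \<zero>\<^bsub>R i\<^esub>) = \<zero>\<^bsub>R i\<^esub>" unfolding S_def using H by (intro Ri.add.finprod_one_eqI) auto
    have "\<exists>\<nu>. form i \<nu> \<and> (\<forall>(x, c)\<in>W. \<nu> x = c)"
    proof (rule extend_partial_form[OF F.field_axioms Ri.module])
      show "W \<subseteq> carrier (R i) \<times> carrier F"
      proof (rule subrelI)
        fix x c assume xc: "(x, c) \<in> W"
        obtain r j where r: "\<forall>h. r h \<in> carrier (R i)" "j \<in> J'" "x = S r \<oplus>\<^bsub>R i\<^esub> j" "c = \<mu> (r l)" using WE[OF xc] by (elim exE conjE)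
        have "S r \<in> carrier (R i)" "j \<in> carrier (R i)" "\<mu> (r l) \<in> carrier F"
          using Sc[of r] J'.Icarr[OF r(2)] form_closed[OF i m, of "r l"] r(1) by auto
        thus "(x, c) \<in> carrier (R i) \<times> carrier F" using r(3,4) by simp
      qed
      show "(\<zero>\<^bsub>R i\<^esub>, \<zero>\<^bsub>F\<^esub>) \<in> W" using WI[of "\<lambda>_. \<zero>\<^bsub>R i\<^esub>" "\<zero>\<^bsub>R i\<^esub>"] zJ' mu0 S0 by simp
      fix x c assume xc: "(x, c) \<in> W"
      obtain r j where r: "\<forall>h. r h \<in> carrier (R i)" "j \<in> J'" "x = S r \<oplus>\<^bsub>R i\<^esub> j" "c = \<mu> (r l)" using WE[OF xc] by (elim exE conjE)
      have jc: "j \<in> carrier (R i)" using J'.Icarr r by simp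
      have rc: "S r \<in> carrier (R i)" using Sc r by simp
      show "(x \<oplus>\<^bsub>R i\<^esub> y, c \<oplus>\<^bsub>F\<^esub> d) \<in> W" if yd: "(y, d) \<in> W" for y d
      proof -
        obtain r' j' where r': "\<forall>h. r' h \<in> carrier (R i)" "j' \<in> J'" "y = S r' \<oplus>\<^bsub>R i\<^esub> j'" "d = \<mu> (r' l)" using WE[OF yd] by (elim exE conjE)
        have "S (\<lambda>h. r h \<oplus>\<^bsub>R i\<^esub> r' h) = (\<Oplus>\<^bsub>R i\<^esub>h\<in>H. e h \<otimes>\<^bsub>R i\<^esub> r h \<oplus>\<^bsub>R i\<^esub> e h \<otimes>\<^bsub>R i\<^esub> r' h)"
          unfolding S_def using r r' H by (intro Ri.finsum_cong') (auto simp: Ri.r_distr)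
        also have "\<dots> = S r \<oplus>\<^bsub>R i\<^esub> S r'" unfolding S_def using r r' H by (intro Ri.finsum_addf) auto
        finally have "x \<oplus>\<^bsub>R i\<^esub> y = S (\<lambda>h. r h \<oplus>\<^bsub>R i\<^esub> r' h) \<oplus>\<^bsub>R i\<^esub> (j \<oplus>\<^bsub>R i\<^esub> j')"
          unfolding r(3) r'(3) using rc jc Sc[of r'] r' J'.Icarr[OF r'(2)] by (simp add: Ri.a_ac)
        moreover have "c \<oplus>\<^bsub>F\<^esub> d = \<mu> (r l \<oplus>\<^bsub>R i\<^esub> r' l)" using form_add[OF m] r r' by simp
        ultimately show ?thesis using WI[of "\<lambda>h. r h \<oplus>\<^bsub>R i\<^esub> r' h" "j \<oplus>\<^bsub>R i\<^esub> j'"] r r' J'.a_closed by simp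
      qed
      show "(k \<odot>\<^bsub>R i\<^esub> x, k \<otimes>\<^bsub>F\<^esub> c) \<in> W" if k: "k \<in> carrier F" for k
      proof -
        have sm: "k \<odot>\<^bsub>R i\<^esub> (a \<otimes>\<^bsub>R i\<^esub> b) = a \<otimes>\<^bsub>R i\<^esub> (k \<odot>\<^bsub>R i\<^esub> b)" if ab: "a \<in> carrier (R i)" "b \<in> carrier (R i)" for a b
          using Ri.smult_assoc2[OF k ab(2,1)] ab k by (metis Ri.m_comm Ri.smult_closed)
        have "k \<odot>\<^bsub>R i\<^esub> S r = (\<Oplus>\<^bsub>R i\<^esub>h\<in>H. k \<odot>\<^bsub>R i\<^esub> (e h \<otimes>\<^bsub>R i\<^esub> r h))"
          unfolding S_def using r H k by (intro Ri.finsum_smult_ldistr) auto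
        also have "\<dots> = S (\<lambda>h. k \<odot>\<^bsub>R i\<^esub> r h)"
          unfolding S_def using r H k sm by (intro Ri.finsum_cong') auto
        finally have "k \<odot>\<^bsub>R i\<^esub> x = S (\<lambda>h. k \<odot>\<^bsub>R i\<^esub> r h) \<oplus>\<^bsub>R i\<^esub> k \<odot>\<^bsub>R i\<^esub> j"
          unfolding r(3) using rc jc k by (simp add: Ri.smult_r_distr)
        moreover have "k \<otimes>\<^bsub>F\<^esub> c = \<mu> (k \<odot>\<^bsub>R i\<^esub> r l)" using form_smult[OF m] r k by simp
        moreover have "k \<odot>\<^bsub>R i\<^esub> j \<in> J'"
        proof -
          have "k \<odot>\<^bsub>R i\<^esub> j = (k \<odot>\<^bsub>R i\<^esub> \<one>\<^bsub>R i\<^esub>) \<otimes>\<^bsub>R i\<^esub> j" using k jc by (simp add: Ri.smult_assoc2)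
          thus ?thesis using J'.I_l_closed[OF r(2)] k by simp
        qed
        ultimately show ?thesis using WI[of "\<lambda>h. k \<odot>\<^bsub>R i\<^esub> r h" "k \<odot>\<^bsub>R i\<^esub> j"] r k by simp
      qed
    next
      fix c assume xc: "(\<zero>\<^bsub>R i\<^esub>, c) \<in> W"
      obtain r j where r: "\<forall>h. r h \<in> carrier (R i)" "j \<in> J'" "\<zero>\<^bsub>R i\<^esub> = S r \<oplus>\<^bsub>R i\<^esub> j" "c = \<mu> (r l)" using WE[OF xc] by (elim exE conjE)
      have jc: "j \<in> carrier (R i)" using J'.Icarr r by simp
      have rc: "S r \<in> carrier (R i)" using Sc r by simp
      have "S r = \<ominus>\<^bsub>R i\<^esub> j" using r(3) rc jc by (metis Ri.minus_equality)
      hence "S r \<in> J'" using J'.a_inv_closed[OF r(2)] by simp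
      hence "r l \<in> J" using indep[of r l] r l unfolding S_def by blast
      thus "c = \<zero>\<^bsub>F\<^esub>" using v r(4) by simp
    qed
    then obtain \<nu> where nu: "form i \<nu>" "\<forall>(x, c)\<in>W. \<nu> x = c" by (elim exE conjE)
    have nuW: "\<nu> (S r \<oplus>\<^bsub>R i\<^esub> j) = \<mu> (r l)" if rj: "\<And>h. r h \<in> carrier (R i)" "j \<in> J'" for r j
      using bspec[OF nu(2) WI[OF rj]] by simp
    have nuJ: "\<nu> j = \<zero>\<^bsub>F\<^esub>" if "j \<in> J'" for j
      using nuW[of "\<lambda>_. \<zero>\<^bsub>R i\<^esub>" j] that J'.Icarr[OF that] mu0 S0 by simp
    have nue: "\<nu> (e h \<otimes>\<^bsub>R i\<^esub> r) = (if h = l then \<mu> r else \<zero>\<^bsub>F\<^esub>)" if h: "h \<in> H" and r: "r \<in> carrier (R i)" for h r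
    proof -
      let ?r = "\<lambda>g. if g = h then r else \<zero>\<^bsub>R i\<^esub>"
      have "S ?r = (\<Oplus>\<^bsub>R i\<^esub>g\<in>H. if g = h then e h \<otimes>\<^bsub>R i\<^esub> r else \<zero>\<^bsub>R i\<^esub>)"
        unfolding S_def using H r by (intro Ri.finsum_cong') auto
      also have "\<dots> = e h \<otimes>\<^bsub>R i\<^esub> r" using H h r by (intro cring.finsum_single factor_cring i) auto
      finally show ?thesis using nuW[of ?r "\<zero>\<^bsub>R i\<^esub>"] r H(2)[OF h] zJ' mu0 by (auto split: if_splits)
    qed
    have "slice i \<nu> (\<Oplus>\<^bsub>T\<^esub>h\<in>H. incl i (e h) \<otimes>\<^bsub>T\<^esub> t h) = (\<Oplus>\<^bsub>T\<^esub>h\<in>H. slice i \<nu> (incl i (e h) \<otimes>\<^bsub>T\<^esub> t h))"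
      using H i by (intro slice_finsum[OF i nu(1)]) auto
    also have "\<dots> = (\<Oplus>\<^bsub>T\<^esub>h\<in>H. if h = l then slice i \<mu> (t l) else \<zero>\<^bsub>T\<^esub>)"
    proof (rule T.finsum_cong')
      fix h assume h: "h \<in> H"
      have "slice i \<nu> (incl i (e h) \<otimes>\<^bsub>T\<^esub> t h) = slice i (\<lambda>r. \<nu> (e h \<otimes>\<^bsub>R i\<^esub> r)) (t h)"
        using slice_mult_incl[OF i nu(1) H(2,3)[OF h]] .
      also have "\<dots> = (if h = l then slice i \<mu> (t l) else \<zero>\<^bsub>T\<^esub>)"
        using slice_cong[OF i form_mult[OF i nu(1) H(2)[OF h]] m H(3)[OF h]]
          slice_vanish[OF i form_mult[OF i nu(1) H(2)[OF h]] H(3)[OF h]] nue[OF h] by auto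
      finally show "slice i \<nu> (incl i (e h) \<otimes>\<^bsub>T\<^esub> t h) = (if h = l then slice i \<mu> (t l) else \<zero>\<^bsub>T\<^esub>)" .
    qed (use slice_closed[OF i m H(3)[OF l]] in auto)
    also have "\<dots> = slice i \<mu> (t l)" using H(1) l slice_closed[OF i m H(3)[OF l]] by (intro T.finsum_single) auto
    finally have "slice i \<mu> (t l) = slice i \<nu> (\<Oplus>\<^bsub>T\<^esub>h\<in>H. incl i (e h) \<otimes>\<^bsub>T\<^esub> t h)" by simp
    thus "slice i \<mu> (t l) \<in> G" using mem nu(1) nuJ unfolding mem_extG_iff[OF i J' G tot] by auto
  qed
qed

text \<open>The hypotheses on \<open>J\<close> and \<open>J'\<close> say that \<open>J/J'\<close> (for \<open>J' \<subseteq> J\<close>) is a torsion-free module over \<open>R\<^sub>i/P\<close>, and \<open>u\<close> is a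
nonzerodivisor on \<open>R\<^sub>i/P \<otimes> S/G\<^sub>0\<close>. A finitely generated torsion-free module becomes free over the field
of fractions, so \<open>u\<close> is a nonzerodivisor on \<open>J/J' \<otimes> S/G\<^sub>0\<close> as well.

Fractions are avoided by induction on the number of terms \<open>p t\<^sub>p\<close> of the element. When the elements \<open>p\<close> are
independent over \<open>R\<^sub>i/P\<close> modulo \<open>J'\<close>, the coefficients can be compared. Otherwise a relation with
a coefficient \<open>d \<notin> P\<close> eliminates a term after multiplication by \<open>d\<close>, and \<open>d\<close> can be cancelled.\<close>
lemma torsion_free_step:
  assumes i: "i \<in> I" and P: "ideal P (R i)" and J: "ideal J (R i)" and J': "ideal J' (R i)"
    and JP: "\<And>p q. p \<in> J \<Longrightarrow> q \<in> P \<Longrightarrow> p \<otimes>\<^bsub>R i\<^esub> q \<in> J'"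
    and canc: "\<And>d r. d \<in> carrier (R i) \<Longrightarrow> d \<notin> P \<Longrightarrow> r \<in> carrier (R i) \<Longrightarrow> d \<otimes>\<^bsub>R i\<^esub> r \<in> J' \<Longrightarrow> r \<in> J'"
    and G: "stable i G" and u: "u \<in> carrier T"
    and uP: "\<And>g. g \<in> carrier T \<Longrightarrow> u \<otimes>\<^bsub>T\<^esub> g \<in> ext i P <+>\<^bsub>T\<^esub> G \<Longrightarrow> g \<in> ext i P <+>\<^bsub>T\<^esub> G"
    and x: "x \<in> ext i J <+>\<^bsub>T\<^esub> G" and ux: "u \<otimes>\<^bsub>T\<^esub> x \<in> ext i J' <+>\<^bsub>T\<^esub> G"
  shows "x \<in> ext i J' <+>\<^bsub>T\<^esub> G"
proof -
  interpret Ri: algebra F "R i" using factor_algebra i by simp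
  interpret J: ideal J "R i" by fact
  interpret J': ideal J' "R i" by fact
  interpret P: ideal P "R i" by fact
  let ?E = "ext i J' <+>\<^bsub>T\<^esub> G"
  interpret W: ideal ?E T using extG_ideal[OF i J' G] .
  interpret G: ideal G T using stableD(1)[OF G] .
  have extE: "incl i j \<in> ?E" if "j \<in> J'" for j
    using that ext_subset_extG(1)[OF i J' G] T.genideal_self[OF ext_sub[OF i J'.a_subset]] by blast
  have GE: "g \<in> ?E" if "g \<in> G" for g using that ext_subset_extG(2)[OF i J' G] by blast
  \<comment> \<open>Multiplication by \<open>d \<notin> P\<close> is injective on \<open>R\<^sub>i/J'\<close>, hence also modulo \<open>J' T + G\<close>: the single element \<open>d\<close> is
    independent in the sense of \<open>independent_cancel\<close>.\<close>
  have cancE: "y \<in> ?E" if d: "d \<in> carrier (R i)" "d \<notin> P" and y: "y \<in> carrier T" and dy: "incl i d \<otimes>\<^bsub>T\<^esub> y \<in> ?E" for d y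
  proof (rule independent_cancel[OF i J' J' G, of "{()}" "\<lambda>_. d" "\<lambda>_. y" "()"])
    show "r h \<in> J'" if rc: "\<And>h. r h \<in> carrier (R i)" and rs: "(\<Oplus>\<^bsub>R i\<^esub>h\<in>{()}. d \<otimes>\<^bsub>R i\<^esub> r h) \<in> J'" for r and h :: unit
    proof -
      have "d \<otimes>\<^bsub>R i\<^esub> r () \<in> J'" using rs d rc[of "()"] by simp
      thus ?thesis using canc[OF d rc[of "()"]] by simp
    qed
    show "(\<Oplus>\<^bsub>T\<^esub>h\<in>{()}. incl i d \<otimes>\<^bsub>T\<^esub> y) \<in> ?E" using dy d y i by simp
  qed (use d y in auto)
  \<comment> \<open>Coefficients matter only modulo \<open>P T + G\<close>, because \<open>J P \<subseteq> J'\<close>.\<close>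
  have PE: "incl i p \<otimes>\<^bsub>T\<^esub> t \<in> ?E" if p: "p \<in> J" and t: "t \<in> ext i P <+>\<^bsub>T\<^esub> G" for p t
  proof -
    have pc: "incl i p \<in> carrier T" using J.Icarr[OF p] i by simp
    obtain a g where a: "a \<in> ext i P" "g \<in> G" "t = a \<oplus>\<^bsub>T\<^esub> g" using t unfolding T.ideal_set_add_iff by blast
    obtain H s where H: "finite H" "H \<subseteq> P" "\<And>p. s p \<in> const i" "a = (\<Oplus>\<^bsub>T\<^esub>q\<in>H. incl i q \<otimes>\<^bsub>T\<^esub> s q)"
      using ext_terms[OF i P a(1)] by blast
    have sc: "s q \<in> carrier T" for q using H(3) constD(1) by blast
    have qc: "q \<in> carrier (R i)" if "q \<in> H" for q using that H(2) P.Icarr by blast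
    have "incl i p \<otimes>\<^bsub>T\<^esub> a = (\<Oplus>\<^bsub>T\<^esub>q\<in>H. incl i p \<otimes>\<^bsub>T\<^esub> (incl i q \<otimes>\<^bsub>T\<^esub> s q))"
      unfolding H(4) using H(1) sc qc i pc by (intro T.finsum_rdistr) auto
    moreover have "\<dots> \<in> ?E"
    proof (rule T.ideal_finsum_closed[OF W.ideal_axioms])
      fix q assume q: "q \<in> H"
      have "incl i p \<otimes>\<^bsub>T\<^esub> (incl i q \<otimes>\<^bsub>T\<^esub> s q) = incl i (p \<otimes>\<^bsub>R i\<^esub> q) \<otimes>\<^bsub>T\<^esub> s q"
        using qc[OF q] J.Icarr[OF p] sc i by (simp add: incl_mult T.m_assoc)
      moreover have "p \<otimes>\<^bsub>R i\<^esub> q \<in> J'" using JP[OF p] q H(2) by blast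
      ultimately show "incl i p \<otimes>\<^bsub>T\<^esub> (incl i q \<otimes>\<^bsub>T\<^esub> s q) \<in> ?E" using W.I_r_closed[OF extE sc] by simp
    qed
    moreover have "incl i p \<otimes>\<^bsub>T\<^esub> g \<in> ?E" using G.I_l_closed[OF a(2) pc] GE by blast
    moreover have "a \<in> carrier T" unfolding H(4) using sc qc i by (intro T.finsum_closed) auto
    ultimately show ?thesis unfolding a(3) using pc G.Icarr[OF a(2)] by (simp add: T.r_distr)
  qed
  have claim: "y \<in> ?E"
    if "finite H" "H \<subseteq> J" "\<And>p. p \<in> H \<Longrightarrow> t p \<in> carrier T" "y = (\<Oplus>\<^bsub>T\<^esub>p\<in>H. incl i p \<otimes>\<^bsub>T\<^esub> t p)" "u \<otimes>\<^bsub>T\<^esub> y \<in> ?E" for H t y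
    using that
  proof (induction "card H" arbitrary: H t y rule: less_induct)
    case less
    note fin = less.prems(1) and HJ = less.prems(2) and tc = less.prems(3) and y = less.prems(4) and uy = less.prems(5)
    have pc: "p \<in> carrier (R i)" if "p \<in> H" for p using HJ that J.Icarr by blast
    have yc: "y \<in> carrier T" unfolding y using pc tc i by (intro T.finsum_closed) auto
    show ?case
    proof (cases "\<exists>r. (\<forall>h. r h \<in> carrier (R i)) \<and> (\<Oplus>\<^bsub>R i\<^esub>p\<in>H. p \<otimes>\<^bsub>R i\<^esub> r p) \<in> J' \<and> (\<exists>h\<in>H. r h \<notin> P)")
      case False
      have "t l \<in> ext i P <+>\<^bsub>T\<^esub> G" if l: "l \<in> H" for l
      proof (rule uP[OF tc[OF l]], rule independent_cancel[OF i P J' G fin, of "\<lambda>p. p" "\<lambda>p. u \<otimes>\<^bsub>T\<^esub> t p" l])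
        have "u \<otimes>\<^bsub>T\<^esub> y = (\<Oplus>\<^bsub>T\<^esub>p\<in>H. u \<otimes>\<^bsub>T\<^esub> (incl i p \<otimes>\<^bsub>T\<^esub> t p))"
          unfolding y using fin pc tc i u by (intro T.finsum_rdistr) auto
        also have "\<dots> = (\<Oplus>\<^bsub>T\<^esub>p\<in>H. incl i p \<otimes>\<^bsub>T\<^esub> (u \<otimes>\<^bsub>T\<^esub> t p))"
          using pc tc i u by (intro T.finsum_cong') (auto simp: T.m_lcomm)
        finally show "(\<Oplus>\<^bsub>T\<^esub>p\<in>H. incl i p \<otimes>\<^bsub>T\<^esub> (u \<otimes>\<^bsub>T\<^esub> t p)) \<in> ?E" using uy by simp
      qed (use False pc tc u l in auto)
      thus ?thesis unfolding y using PE HJ by (intro T.ideal_finsum_closed[OF W.ideal_axioms]) auto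
    next
      case True
      then obtain r l where r: "\<forall>h. r h \<in> carrier (R i)" "(\<Oplus>\<^bsub>R i\<^esub>p\<in>H. p \<otimes>\<^bsub>R i\<^esub> r p) \<in> J'" "l \<in> H" "r l \<notin> P" by blast
      have rc: "r h \<in> carrier (R i)" for h using r(1) by simp
      \<comment> \<open>The relation \<open>\<Sum> p r\<^sub>p \<in> J'\<close>, multiplied by \<open>t\<^sub>l\<close>, is subtracted from the element times \<open>r\<^sub>l\<close>; this makes
        the coefficient of \<open>l\<close> vanish.\<close>
      define t' where "t' p = incl i (r l) \<otimes>\<^bsub>T\<^esub> t p \<ominus>\<^bsub>T\<^esub> incl i (r p) \<otimes>\<^bsub>T\<^esub> t l" for p
      have t'c: "t' p \<in> carrier T" if "p \<in> H" for p unfolding t'_def using tc[OF that] tc[OF r(3)] rc i by simp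
      define y' where "y' = (\<Oplus>\<^bsub>T\<^esub>p\<in>H - {l}. incl i p \<otimes>\<^bsub>T\<^esub> t' p)"
      have y'c: "y' \<in> carrier T" unfolding y'_def using pc t'c i by (intro T.finsum_closed) auto
      have t'l: "t' l = \<zero>\<^bsub>T\<^esub>" unfolding t'_def using tc[OF r(3)] rc i by (simp add: T.minus_eq T.r_neg)
      have Hl: "H = insert l (H - {l})" using r(3) by auto
      have "(\<Oplus>\<^bsub>T\<^esub>p\<in>insert l (H - {l}). incl i p \<otimes>\<^bsub>T\<^esub> t' p) = incl i l \<otimes>\<^bsub>T\<^esub> t' l \<oplus>\<^bsub>T\<^esub> y'"
        unfolding y'_def using fin pc t'c r(3) i by (intro T.finsum_insert) auto
      hence yy: "(\<Oplus>\<^bsub>T\<^esub>p\<in>H. incl i p \<otimes>\<^bsub>T\<^esub> t' p) = y'" using Hl t'l y'c pc[OF r(3)] i by simp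
      define z where "z = incl i (\<Oplus>\<^bsub>R i\<^esub>p\<in>H. p \<otimes>\<^bsub>R i\<^esub> r p) \<otimes>\<^bsub>T\<^esub> t l"
      have zE: "z \<in> ?E" unfolding z_def using W.I_r_closed[OF extE[OF r(2)] tc[OF r(3)]] .
      have zs: "z = (\<Oplus>\<^bsub>T\<^esub>p\<in>H. incl i p \<otimes>\<^bsub>T\<^esub> (incl i (r p) \<otimes>\<^bsub>T\<^esub> t l))"
      proof -
        have "z = (\<Oplus>\<^bsub>T\<^esub>p\<in>H. incl i (p \<otimes>\<^bsub>R i\<^esub> r p)) \<otimes>\<^bsub>T\<^esub> t l"
          unfolding z_def using pc rc by (subst incl_finsum[OF i]) auto
        also have "\<dots> = (\<Oplus>\<^bsub>T\<^esub>p\<in>H. incl i (p \<otimes>\<^bsub>R i\<^esub> r p) \<otimes>\<^bsub>T\<^esub> t l)"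
          using fin pc rc tc[OF r(3)] i by (intro T.finsum_ldistr) auto
        also have "\<dots> = (\<Oplus>\<^bsub>T\<^esub>p\<in>H. incl i p \<otimes>\<^bsub>T\<^esub> (incl i (r p) \<otimes>\<^bsub>T\<^esub> t l))"
          using pc rc tc[OF r(3)] i by (intro T.finsum_cong') (auto simp: incl_mult T.m_assoc)
        finally show ?thesis .
      qed
      have zc: "z \<in> carrier T" using W.Icarr[OF zE] .
      have dy: "incl i (r l) \<otimes>\<^bsub>T\<^esub> y = y' \<oplus>\<^bsub>T\<^esub> z"
      proof -
        have "incl i (r l) \<otimes>\<^bsub>T\<^esub> y = (\<Oplus>\<^bsub>T\<^esub>p\<in>H. incl i (r l) \<otimes>\<^bsub>T\<^esub> (incl i p \<otimes>\<^bsub>T\<^esub> t p))"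
          unfolding y using fin pc tc rc i by (intro T.finsum_rdistr) auto
        also have "\<dots> = (\<Oplus>\<^bsub>T\<^esub>p\<in>H. incl i p \<otimes>\<^bsub>T\<^esub> t' p \<oplus>\<^bsub>T\<^esub> incl i p \<otimes>\<^bsub>T\<^esub> (incl i (r p) \<otimes>\<^bsub>T\<^esub> t l))"
        proof (rule T.finsum_cong')
          show "(\<lambda>p. incl i p \<otimes>\<^bsub>T\<^esub> t' p \<oplus>\<^bsub>T\<^esub> incl i p \<otimes>\<^bsub>T\<^esub> (incl i (r p) \<otimes>\<^bsub>T\<^esub> t l)) \<in> H \<rightarrow> carrier T"
            using pc t'c rc tc[OF r(3)] i by auto
          fix p assume p: "p \<in> H"
          have alg: "d \<otimes>\<^bsub>T\<^esub> (a \<otimes>\<^bsub>T\<^esub> b) = a \<otimes>\<^bsub>T\<^esub> (d \<otimes>\<^bsub>T\<^esub> b \<ominus>\<^bsub>T\<^esub> c) \<oplus>\<^bsub>T\<^esub> a \<otimes>\<^bsub>T\<^esub> c"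
            if "a \<in> carrier T" "b \<in> carrier T" "c \<in> carrier T" "d \<in> carrier T" for a b c d
            using that by algebra
          show "incl i (r l) \<otimes>\<^bsub>T\<^esub> (incl i p \<otimes>\<^bsub>T\<^esub> t p) = incl i p \<otimes>\<^bsub>T\<^esub> t' p \<oplus>\<^bsub>T\<^esub> incl i p \<otimes>\<^bsub>T\<^esub> (incl i (r p) \<otimes>\<^bsub>T\<^esub> t l)"
            unfolding t'_def using pc[OF p] rc tc[OF p] tc[OF r(3)] i by (intro alg) auto
        qed simp
        also have "\<dots> = (\<Oplus>\<^bsub>T\<^esub>p\<in>H. incl i p \<otimes>\<^bsub>T\<^esub> t' p) \<oplus>\<^bsub>T\<^esub> z"
          unfolding zs using pc t'c rc tc[OF r(3)] i by (intro T.finsum_addf) auto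
        finally show ?thesis unfolding yy .
      qed
      have y'eq: "y' = incl i (r l) \<otimes>\<^bsub>T\<^esub> y \<ominus>\<^bsub>T\<^esub> z" unfolding dy using y'c zc by algebra
      have "y' \<in> ?E"
      proof (rule less.hyps[of "H - {l}" t' y'])
        show "card (H - {l}) < card H" using fin r(3) by (meson card_Diff1_less)
        show "y' = (\<Oplus>\<^bsub>T\<^esub>p\<in>H - {l}. incl i p \<otimes>\<^bsub>T\<^esub> t' p)" unfolding y'_def ..
        have "u \<otimes>\<^bsub>T\<^esub> y' = incl i (r l) \<otimes>\<^bsub>T\<^esub> (u \<otimes>\<^bsub>T\<^esub> y) \<ominus>\<^bsub>T\<^esub> u \<otimes>\<^bsub>T\<^esub> z"
          unfolding y'eq using u yc zc incl_closed[OF i rc[of l]] by algebra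
        moreover have "incl i (r l) \<otimes>\<^bsub>T\<^esub> (u \<otimes>\<^bsub>T\<^esub> y) \<in> ?E" using W.I_l_closed[OF uy] rc i by simp
        moreover have "u \<otimes>\<^bsub>T\<^esub> z \<in> ?E" using W.I_l_closed[OF zE u] .
        ultimately show "u \<otimes>\<^bsub>T\<^esub> y' \<in> ?E" using T.ideal_minus_closed[OF W.ideal_axioms] by simp
      qed (use fin HJ t'c in auto)
      hence "incl i (r l) \<otimes>\<^bsub>T\<^esub> y \<in> ?E" unfolding dy using zE by simp
      thus ?thesis using cancE[OF rc r(4) yc] by simp
    qed
  qed
  obtain a g where a: "a \<in> ext i J" "g \<in> G" "x = a \<oplus>\<^bsub>T\<^esub> g" using x unfolding T.ideal_set_add_iff by blast
  obtain H s where H: "finite H" "H \<subseteq> J" "\<And>p. s p \<in> const i" "a = (\<Oplus>\<^bsub>T\<^esub>q\<in>H. incl i q \<otimes>\<^bsub>T\<^esub> s q)"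
    using ext_terms[OF i J a(1)] by blast
  have ac: "a \<in> carrier T"
    unfolding H(4) using H(2) J.Icarr i constD(1)[OF H(3)] by (intro T.finsum_closed) auto
  have "u \<otimes>\<^bsub>T\<^esub> a = u \<otimes>\<^bsub>T\<^esub> x \<ominus>\<^bsub>T\<^esub> u \<otimes>\<^bsub>T\<^esub> g" unfolding a(3) using u ac G.Icarr[OF a(2)] by algebra
  hence "u \<otimes>\<^bsub>T\<^esub> a \<in> ?E" using T.ideal_minus_closed[OF W.ideal_axioms ux GE[OF G.I_l_closed[OF a(2) u]]] by simp
  hence "a \<in> ?E" using claim[OF H(1,2) constD(1)[OF H(3)] H(4)] by simp
  thus ?thesis unfolding a(3) using GE[OF a(2)] by simp
qed

end

section \<open>Evaluation at points and primality\<close>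

context algebra_family
begin

text \<open>The \<open>F\<close>-valued points of \<open>R\<^sub>i\<close>.\<close>
definition character where
  "character i \<phi> \<longleftrightarrow> \<phi> \<in> ring_hom (R i) F \<and> (\<forall>c\<in>carrier F. \<phi> (c \<odot>\<^bsub>R i\<^esub> \<one>\<^bsub>R i\<^esub>) = c)"

lemma character_form:
  assumes i: "i \<in> I" and c: "character i \<phi>" shows "form i \<phi>"
proof -
  interpret Ri: algebra F "R i" using factor_algebra i by simp
  have h: "\<phi> \<in> ring_hom (R i) F" using c unfolding character_def by simp
  have "\<phi> (k \<odot>\<^bsub>R i\<^esub> x) = k \<otimes>\<^bsub>F\<^esub> \<phi> x" if "k \<in> carrier F" "x \<in> carrier (R i)" for k x
  proof -
    have "k \<odot>\<^bsub>R i\<^esub> x = (k \<odot>\<^bsub>R i\<^esub> \<one>\<^bsub>R i\<^esub>) \<otimes>\<^bsub>R i\<^esub> x" using that by (simp add: Ri.smult_assoc2)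
    thus ?thesis using that c ring_hom_mult[OF h] unfolding character_def by simp
  qed
  thus ?thesis unfolding linear_form_def using ring_hom_closed[OF h] ring_hom_add[OF h] by auto
qed

lemma slice_character_one:
  assumes i: "i \<in> I" and c: "character i \<phi>" shows "slice i \<phi> \<one>\<^bsub>T\<^esub> = \<one>\<^bsub>T\<^esub>"
proof -
  interpret Ri: algebra F "R i" using factor_algebra i by simp
  have "\<phi> \<one>\<^bsub>R i\<^esub> = \<one>\<^bsub>F\<^esub>" using c ring_hom_one unfolding character_def by blast
  thus ?thesis using slice_incl[OF i character_form[OF i c] Ri.one_closed] incl_one[OF i] ring_hom_one[OF scal_hom] by simp
qed

lemma slice_character_const:
  assumes i: "i \<in> I" and c: "character i \<phi>" and s: "s \<in> const i" shows "slice i \<phi> s = s"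
  using constD(2)[OF s character_form[OF i c], of "\<one>\<^bsub>T\<^esub>"] constD(1)[OF s] slice_character_one[OF i c] by simp

text \<open>The map \<open>\<phi> \<otimes> id\<close> is multiplicative because \<open>\<phi>\<close> is. It evaluates the factor \<open>R\<^sub>i\<close> at the point \<open>\<phi>\<close>.\<close>
lemma slice_character_hom:
  assumes i: "i \<in> I" and c: "character i \<phi>" shows "slice i \<phi> \<in> ring_hom T T"
proof (rule ring_hom_memI)
  note f = character_form[OF i c]
  interpret sh: ring_hom_cring F T scal
    using scal_hom by (intro ring_hom_cringI) (auto intro: F.cring_axioms T.cring_axioms)
  interpret Ri: algebra F "R i" using factor_algebra i by simp
  have h: "\<phi> \<in> ring_hom (R i) F" using c unfolding character_def by simp
  fix x y assume x: "x \<in> carrier T" and y: "y \<in> carrier T"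
  show "slice i \<phi> x \<in> carrier T" using slice_closed[OF i f x] .
  show "slice i \<phi> (x \<oplus>\<^bsub>T\<^esub> y) = slice i \<phi> x \<oplus>\<^bsub>T\<^esub> slice i \<phi> y" using slice_add[OF i f x y] .
  show "slice i \<phi> (x \<otimes>\<^bsub>T\<^esub> y) = slice i \<phi> x \<otimes>\<^bsub>T\<^esub> slice i \<phi> y"
    using i x
  proof (induction x rule: const_span)
    case zero
    show ?case using y slice_zero[OF i f] slice_closed[OF i f y] by simp
  next
    case (elem r s)
    have sc: "s \<in> carrier T" using elem constD by auto
    have "slice i \<phi> (incl i r \<otimes>\<^bsub>T\<^esub> y) = scal (\<phi> r) \<otimes>\<^bsub>T\<^esub> slice i \<phi> y"
      using i y
    proof (induction y rule: const_span)
      case zero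
      show ?case using elem i slice_zero[OF i f] form_closed[OF i f] by simp
    next
      case (elem r' s')
      have rc: "r \<in> carrier (R i)" by fact
      have sc': "s' \<in> carrier T" using elem constD by auto
      have "incl i r \<otimes>\<^bsub>T\<^esub> (incl i r' \<otimes>\<^bsub>T\<^esub> s') = incl i (r \<otimes>\<^bsub>R i\<^esub> r') \<otimes>\<^bsub>T\<^esub> s'"
        using elem rc sc' i by (simp add: incl_mult T.m_assoc)
      hence "slice i \<phi> (incl i r \<otimes>\<^bsub>T\<^esub> (incl i r' \<otimes>\<^bsub>T\<^esub> s')) = scal (\<phi> (r \<otimes>\<^bsub>R i\<^esub> r')) \<otimes>\<^bsub>T\<^esub> s'"
        using slice_incl_const[OF i f _ elem(2), of "r \<otimes>\<^bsub>R i\<^esub> r'"] elem rc by simp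
      thus ?case using slice_incl_const[OF i f elem] ring_hom_mult[OF h rc elem(1)] form_closed[OF i f] rc elem(1) sc'
        by (simp add: T.m_assoc)
    next
      case (add s t)
      thus ?case using elem i slice_closed[OF i f] form_closed[OF i f] by (simp add: T.r_distr slice_add[OF i f])
    qed
    moreover have "incl i r \<otimes>\<^bsub>T\<^esub> s \<otimes>\<^bsub>T\<^esub> y = s \<otimes>\<^bsub>T\<^esub> (incl i r \<otimes>\<^bsub>T\<^esub> y)"
      using elem sc y i by (simp add: T.m_ac)
    ultimately have "slice i \<phi> (incl i r \<otimes>\<^bsub>T\<^esub> s \<otimes>\<^bsub>T\<^esub> y) = s \<otimes>\<^bsub>T\<^esub> (scal (\<phi> r) \<otimes>\<^bsub>T\<^esub> slice i \<phi> y)"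
      using constD(2)[OF elem(2) f, of "incl i r \<otimes>\<^bsub>T\<^esub> y"] elem y i by simp
    thus ?case using slice_incl_const[OF i f elem] form_closed[OF i f elem(1)] sc slice_closed[OF i f y]
      by (simp add: T.m_ac)
  next
    case (add s t)
    thus ?case using y slice_closed[OF i f] by (simp add: T.l_distr slice_add[OF i f])
  qed
qed (rule slice_character_one[OF i c])

text \<open>A section over \<open>R\<^sub>i\<close> with values in \<open>S/G\<^sub>0\<close> that is nonzero modulo \<open>P\<close> has a nonzero value at every point of
a basic open set that meets the variety of \<open>P\<close>. When \<open>u\<close> is written as \<open>\<Sum> q\<^sub>h s\<^sub>h\<close> with \<open>s\<^sub>h\<close> linearly
independent over \<open>F\<close> modulo \<open>K\<close>, some \<open>q\<^sub>h\<close> is not in \<open>P\<close> and can serve as \<open>a\<close>: the value of \<open>u\<close> at \<open>\<phi>\<close> has \<open>\<phi> (q\<^sub>h)\<close> as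
a coefficient. A linear dependence among the \<open>s\<^sub>h\<close> modulo \<open>K\<close> decreases the number of terms; for this
purpose the representation is modulo \<open>K\<close>, with a summand \<open>k\<close>.\<close>
lemma character_nonvanishing:
  assumes i: "i \<in> I" and P: "ideal P (R i)" and K: "stable i K" and u: "u \<in> carrier T" "u \<notin> ext i P <+>\<^bsub>T\<^esub> K"
  shows "\<exists>a\<in>carrier (R i). a \<notin> P \<and> (\<forall>\<phi>. character i \<phi> \<longrightarrow> \<phi> a \<noteq> \<zero>\<^bsub>F\<^esub> \<longrightarrow> slice i \<phi> u \<notin> K)"
proof -
  interpret Ri: algebra F "R i" using factor_algebra i by simp
  interpret P: ideal P "R i" by fact
  interpret K: ideal K T using stableD(1)[OF K] .
  let ?E = "ext i P <+>\<^bsub>T\<^esub> K"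
  interpret W: ideal ?E T using extG_ideal[OF i P K] .
  interpret sh: ring_hom_cring F T scal
    using scal_hom by (intro ring_hom_cringI) (auto intro: F.cring_axioms T.cring_axioms)
  have extE: "incl i j \<in> ?E" if "j \<in> P" for j
    using that ext_subset_extG(1)[OF i P K] T.genideal_self[OF ext_sub[OF i P.a_subset]] by blast
  have KE: "g \<in> ?E" if "g \<in> K" for g using that ext_subset_extG(2)[OF i P K] by blast
  have claim: "\<exists>a\<in>carrier (R i). a \<notin> P \<and> (\<forall>\<phi>. character i \<phi> \<longrightarrow> \<phi> a \<noteq> \<zero>\<^bsub>F\<^esub> \<longrightarrow> slice i \<phi> u \<notin> K)"
    if "finite H" "\<And>h. h \<in> H \<Longrightarrow> q h \<in> carrier (R i)" "\<And>h. h \<in> H \<Longrightarrow> s h \<in> const i" "k \<in> K"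
      "u = (\<Oplus>\<^bsub>T\<^esub>h\<in>H. incl i (q h) \<otimes>\<^bsub>T\<^esub> s h) \<oplus>\<^bsub>T\<^esub> k" for H :: "'a set" and q s k
    using that
  proof (induction "card H" arbitrary: H q k rule: less_induct)
    case less
    note fin = less.prems(1) and qc = less.prems(2) and sc = less.prems(3) and k = less.prems(4) and ueq = less.prems(5)
    have sT: "s h \<in> carrier T" if "h \<in> H" for h using sc[OF that] constD(1) by blast
    have tot: "(\<Oplus>\<^bsub>T\<^esub>h\<in>H. incl i (q h) \<otimes>\<^bsub>T\<^esub> s h) \<in> carrier T" using qc sT i by (intro T.finsum_closed) auto
    show ?case
    proof (cases "\<exists>c. (\<forall>h. c h \<in> carrier F) \<and> (\<Oplus>\<^bsub>T\<^esub>h\<in>H. scal (c h) \<otimes>\<^bsub>T\<^esub> s h) \<in> K \<and> (\<exists>h\<in>H. c h \<noteq> \<zero>\<^bsub>F\<^esub>)")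
      case False
      have "\<exists>l\<in>H. q l \<notin> P"
      proof (rule ccontr)
        assume "\<not> (\<exists>l\<in>H. q l \<notin> P)"
        hence "(\<Oplus>\<^bsub>T\<^esub>h\<in>H. incl i (q h) \<otimes>\<^bsub>T\<^esub> s h) \<in> ?E"
          using W.I_r_closed[OF extE sT] by (intro T.ideal_finsum_closed[OF W.ideal_axioms]) auto
        thus False using u(2) KE[OF k] unfolding ueq by simp
      qed
      then obtain l where l: "l \<in> H" "q l \<notin> P" by blast
      have "slice i \<phi> u \<notin> K" if c: "character i \<phi>" and nz: "\<phi> (q l) \<noteq> \<zero>\<^bsub>F\<^esub>" for \<phi>
      proof
        note f = character_form[OF i c]
        assume inK: "slice i \<phi> u \<in> K"
        let ?c = "\<lambda>h. if h \<in> H then \<phi> (q h) else \<zero>\<^bsub>F\<^esub>"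
        have cc: "?c h \<in> carrier F" for h using form_closed[OF i f qc] by simp
        have S: "(\<Oplus>\<^bsub>T\<^esub>h\<in>H. scal (?c h) \<otimes>\<^bsub>T\<^esub> s h) = slice i \<phi> (\<Oplus>\<^bsub>T\<^esub>h\<in>H. incl i (q h) \<otimes>\<^bsub>T\<^esub> s h)"
        proof -
          have "slice i \<phi> (\<Oplus>\<^bsub>T\<^esub>h\<in>H. incl i (q h) \<otimes>\<^bsub>T\<^esub> s h) = (\<Oplus>\<^bsub>T\<^esub>h\<in>H. slice i \<phi> (incl i (q h) \<otimes>\<^bsub>T\<^esub> s h))"
            using qc sT i by (intro slice_finsum[OF i f]) auto
          also have "\<dots> = (\<Oplus>\<^bsub>T\<^esub>h\<in>H. scal (?c h) \<otimes>\<^bsub>T\<^esub> s h)"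
            using slice_incl_const[OF i f qc sc] sT form_closed[OF i f qc] by (intro T.finsum_cong') auto
          finally show ?thesis by simp
        qed
        have sk: "slice i \<phi> k \<in> K" using stableD(2)[OF K f k] .
        have "(\<Oplus>\<^bsub>T\<^esub>h\<in>H. scal (?c h) \<otimes>\<^bsub>T\<^esub> s h) = slice i \<phi> u \<ominus>\<^bsub>T\<^esub> slice i \<phi> k"
        proof -
          have alg: "a = a \<oplus>\<^bsub>T\<^esub> b \<ominus>\<^bsub>T\<^esub> b" if "a \<in> carrier T" "b \<in> carrier T" for a b using that by algebra
          show ?thesis unfolding S ueq slice_add[OF i f tot K.Icarr[OF k]]
            by (rule alg[OF slice_closed[OF i f tot] K.Icarr[OF sk]])
        qed
        hence "(\<Oplus>\<^bsub>T\<^esub>h\<in>H. scal (?c h) \<otimes>\<^bsub>T\<^esub> s h) \<in> K"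
          using T.ideal_minus_closed[OF K.ideal_axioms inK sk] by simp
        moreover have "?c l \<noteq> \<zero>\<^bsub>F\<^esub>" using l(1) nz by simp
        ultimately have "(\<forall>h. ?c h \<in> carrier F) \<and> (\<Oplus>\<^bsub>T\<^esub>h\<in>H. scal (?c h) \<otimes>\<^bsub>T\<^esub> s h) \<in> K \<and> (\<exists>h\<in>H. ?c h \<noteq> \<zero>\<^bsub>F\<^esub>)"
          using cc l(1) by (intro conjI allI bexI[of _ l])
        from False[THEN notE, OF exI[of _ ?c], OF this] show False .
      qed
      thus ?thesis using l qc by blast
    next
      case True
      then obtain c l where c: "\<forall>h. c h \<in> carrier F" "(\<Oplus>\<^bsub>T\<^esub>h\<in>H. scal (c h) \<otimes>\<^bsub>T\<^esub> s h) \<in> K" "l \<in> H" "c l \<noteq> \<zero>\<^bsub>F\<^esub>" by blast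
      obtain e where e: "e \<in> carrier F" "e \<otimes>\<^bsub>F\<^esub> c l = \<one>\<^bsub>F\<^esub>"
        using c F.field_Units F.Units_l_inv_ex by (metis DiffI empty_iff insert_iff)
      define c' where "c' h = e \<otimes>\<^bsub>F\<^esub> c h" for h
      have c'c: "c' h \<in> carrier F" for h unfolding c'_def using c e by simp
      have c'l: "c' l = \<one>\<^bsub>F\<^esub>" unfolding c'_def using e by simp
      define z where "z = (\<Oplus>\<^bsub>T\<^esub>h\<in>H. scal (c' h) \<otimes>\<^bsub>T\<^esub> s h)"
      have zK: "z \<in> K"
      proof -
        have "z = (\<Oplus>\<^bsub>T\<^esub>h\<in>H. scal e \<otimes>\<^bsub>T\<^esub> (scal (c h) \<otimes>\<^bsub>T\<^esub> s h))"
          unfolding z_def c'_def using c(1) e sT by (intro T.finsum_cong') (auto simp: T.m_assoc)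
        also have "\<dots> = scal e \<otimes>\<^bsub>T\<^esub> (\<Oplus>\<^bsub>T\<^esub>h\<in>H. scal (c h) \<otimes>\<^bsub>T\<^esub> s h)"
          using c(1) e sT fin by (intro T.finsum_rdistr[symmetric]) auto
        finally show ?thesis using K.I_l_closed[OF c(2)] e by simp
      qed
      \<comment> \<open>Adding the multiple \<open>q\<^sub>l z \<in> K\<close> to the summand in \<open>K\<close> removes the term with index \<open>l\<close>.\<close>
      define q' where "q' h = q h \<ominus>\<^bsub>R i\<^esub> c' h \<odot>\<^bsub>R i\<^esub> q l" for h
      have ql: "q l \<in> carrier (R i)" using qc c(3) by simp
      have q'c: "q' h \<in> carrier (R i)" if "h \<in> H" for h unfolding q'_def using qc[OF that] ql c'c by simp
      have q'l: "q' l = \<zero>\<^bsub>R i\<^esub>" unfolding q'_def c'l using ql by (simp add: Ri.smult_one Ri.minus_eq Ri.r_neg)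
      have iq: "incl i (q h) = incl i (q' h) \<oplus>\<^bsub>T\<^esub> scal (c' h) \<otimes>\<^bsub>T\<^esub> incl i (q l)" if h: "h \<in> H" for h
      proof -
        have "q h = q' h \<oplus>\<^bsub>R i\<^esub> c' h \<odot>\<^bsub>R i\<^esub> q l"
          unfolding q'_def using qc[OF h] ql c'c by (simp add: Ri.minus_eq Ri.a_assoc Ri.l_neg)
        hence "incl i (q h) = incl i (q' h \<oplus>\<^bsub>R i\<^esub> c' h \<odot>\<^bsub>R i\<^esub> q l)" by simp
        thus ?thesis using incl_add[OF i q'c[OF h]] incl_smult[OF i ql c'c] ql c'c by simp
      qed
      have rest: "(\<Oplus>\<^bsub>T\<^esub>h\<in>H - {l}. incl i (q' h) \<otimes>\<^bsub>T\<^esub> s h) \<in> carrier T"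
        using q'c sT i by (intro T.finsum_closed) auto
      have "(\<Oplus>\<^bsub>T\<^esub>h\<in>insert l (H - {l}). incl i (q' h) \<otimes>\<^bsub>T\<^esub> s h)
          = incl i (q' l) \<otimes>\<^bsub>T\<^esub> s l \<oplus>\<^bsub>T\<^esub> (\<Oplus>\<^bsub>T\<^esub>h\<in>H - {l}. incl i (q' h) \<otimes>\<^bsub>T\<^esub> s h)"
        using fin q'c sT c(3) i by (intro T.finsum_insert) auto
      moreover have "insert l (H - {l}) = H" using c(3) by auto
      ultimately have drop: "(\<Oplus>\<^bsub>T\<^esub>h\<in>H. incl i (q' h) \<otimes>\<^bsub>T\<^esub> s h) = (\<Oplus>\<^bsub>T\<^esub>h\<in>H - {l}. incl i (q' h) \<otimes>\<^bsub>T\<^esub> s h)"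
        using q'l incl_zero[OF i] sT[OF c(3)] rest by simp
      have "(\<Oplus>\<^bsub>T\<^esub>h\<in>H. incl i (q h) \<otimes>\<^bsub>T\<^esub> s h)
          = (\<Oplus>\<^bsub>T\<^esub>h\<in>H. incl i (q' h) \<otimes>\<^bsub>T\<^esub> s h \<oplus>\<^bsub>T\<^esub> incl i (q l) \<otimes>\<^bsub>T\<^esub> (scal (c' h) \<otimes>\<^bsub>T\<^esub> s h))"
      proof (rule T.finsum_cong')
        show "(\<lambda>h. incl i (q' h) \<otimes>\<^bsub>T\<^esub> s h \<oplus>\<^bsub>T\<^esub> incl i (q l) \<otimes>\<^bsub>T\<^esub> (scal (c' h) \<otimes>\<^bsub>T\<^esub> s h)) \<in> H \<rightarrow> carrier T"
          using q'c sT ql c'c i by auto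
        fix h assume h: "h \<in> H"
        have alg: "(a \<oplus>\<^bsub>T\<^esub> b \<otimes>\<^bsub>T\<^esub> d) \<otimes>\<^bsub>T\<^esub> y = a \<otimes>\<^bsub>T\<^esub> y \<oplus>\<^bsub>T\<^esub> d \<otimes>\<^bsub>T\<^esub> (b \<otimes>\<^bsub>T\<^esub> y)"
          if "a \<in> carrier T" "b \<in> carrier T" "d \<in> carrier T" "y \<in> carrier T" for a b d y using that by algebra
        show "incl i (q h) \<otimes>\<^bsub>T\<^esub> s h = incl i (q' h) \<otimes>\<^bsub>T\<^esub> s h \<oplus>\<^bsub>T\<^esub> incl i (q l) \<otimes>\<^bsub>T\<^esub> (scal (c' h) \<otimes>\<^bsub>T\<^esub> s h)"
          unfolding iq[OF h] using q'c[OF h] sT[OF h] ql c'c i by (intro alg) auto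
      qed simp
      also have "\<dots> = (\<Oplus>\<^bsub>T\<^esub>h\<in>H. incl i (q' h) \<otimes>\<^bsub>T\<^esub> s h) \<oplus>\<^bsub>T\<^esub> (\<Oplus>\<^bsub>T\<^esub>h\<in>H. incl i (q l) \<otimes>\<^bsub>T\<^esub> (scal (c' h) \<otimes>\<^bsub>T\<^esub> s h))"
        using q'c sT ql c'c i by (intro T.finsum_addf) auto
      also have "(\<Oplus>\<^bsub>T\<^esub>h\<in>H. incl i (q l) \<otimes>\<^bsub>T\<^esub> (scal (c' h) \<otimes>\<^bsub>T\<^esub> s h)) = incl i (q l) \<otimes>\<^bsub>T\<^esub> z"
        unfolding z_def using fin sT ql c'c i by (intro T.finsum_rdistr[symmetric]) auto
      finally have ueq': "u = (\<Oplus>\<^bsub>T\<^esub>h\<in>H - {l}. incl i (q' h) \<otimes>\<^bsub>T\<^esub> s h) \<oplus>\<^bsub>T\<^esub> (incl i (q l) \<otimes>\<^bsub>T\<^esub> z \<oplus>\<^bsub>T\<^esub> k)"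
        unfolding ueq drop using rest ql i K.Icarr[OF zK] K.Icarr[OF k] by (simp add: T.a_assoc)
      show ?thesis
      proof (rule less.hyps[of "H - {l}" q' "incl i (q l) \<otimes>\<^bsub>T\<^esub> z \<oplus>\<^bsub>T\<^esub> k"])
        show "card (H - {l}) < card H" using fin c(3) by (meson card_Diff1_less)
        show "incl i (q l) \<otimes>\<^bsub>T\<^esub> z \<oplus>\<^bsub>T\<^esub> k \<in> K" using K.I_l_closed[OF zK incl_closed[OF i ql]] k by simp
      qed (use fin q'c sc ueq' in auto)
    qed
  qed
  have ue: "u \<in> ext i (carrier (R i))" using ext_carrier[OF i] u by simp
  obtain H s where H: "finite H" "H \<subseteq> carrier (R i)" "\<And>p. s p \<in> const i" "u = (\<Oplus>\<^bsub>T\<^esub>p\<in>H. incl i p \<otimes>\<^bsub>T\<^esub> s p)"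
    using ext_terms[OF i ring.oneideal[OF Ri.ring_axioms] ue] by blast
  show ?thesis
    by (rule claim[of H "\<lambda>p. p" s "\<zero>\<^bsub>T\<^esub>"]) (use H u in auto)
qed

end

text \<open>The assumption \<open>point\<close> is the conclusion of the Nullstellensatz; it is the only way in which the base field
being algebraically closed and the factors being of finite type enter.\<close>
locale separated_prime_family = algebra_family F I R
  for F :: "('f, 'k) ring_scheme" and I :: "'i set" and R :: "'i \<Rightarrow> ('f, 'a, 'c) module_scheme" +
  fixes P :: "'i \<Rightarrow> 'a set"
  assumes prime: "i \<in> I \<Longrightarrow> primeideal (P i) (R i)"
    and point: "i \<in> I \<Longrightarrow> a \<in> carrier (R i) \<Longrightarrow> a \<notin> P i \<Longrightarrow>
      \<exists>\<phi>. character i \<phi> \<and> (\<forall>p\<in>P i. \<phi> p = \<zero>\<^bsub>F\<^esub>) \<and> \<phi> a \<noteq> \<zero>\<^bsub>F\<^esub>"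
begin

lemma P_ideal: "i \<in> I \<Longrightarrow> ideal (P i) (R i)"
  using prime primeideal.axioms(1) by blast

lemma P_sub: "i \<in> I \<Longrightarrow> P i \<subseteq> carrier (R i)"
  using P_ideal additive_subgroup.a_subset ideal.axioms(1) by blast

definition expand where "expand Y = Idl\<^bsub>T\<^esub> (\<Union>j\<in>Y. incl j ` P j)"

lemma gens_sub:
  assumes Y: "Y \<subseteq> I" shows "(\<Union>j\<in>Y. incl j ` P j) \<subseteq> carrier T"
proof (intro UN_least image_subsetI)
  fix j p assume j: "j \<in> Y" and p: "p \<in> P j"
  have "j \<in> I" using j Y by blast
  thus "incl j p \<in> carrier T" using P_sub[of j] p by (intro incl_closed) auto
qed

lemma expand_ideal: "Y \<subseteq> I \<Longrightarrow> ideal (expand Y) T"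
  unfolding expand_def using T.genideal_ideal[OF gens_sub] .

lemma expand_mem: "Y \<subseteq> I \<Longrightarrow> j \<in> Y \<Longrightarrow> p \<in> P j \<Longrightarrow> incl j p \<in> expand Y"
  unfolding expand_def using T.genideal_self[OF gens_sub] by blast

lemma expand_stable:
  assumes "i \<in> I" "Y \<subseteq> I" "i \<notin> Y" shows "stable i (expand Y)"
  unfolding expand_def
proof (rule stable_genideal[OF assms(1)])
  show "(\<Union>j\<in>Y. incl j ` P j) \<subseteq> const i"
  proof (intro UN_least image_subsetI)
    fix j p assume j: "j \<in> Y" and p: "p \<in> P j"
    have "j \<in> I" "i \<noteq> j" using j assms by auto
    thus "incl j p \<in> const i" using P_sub[of j] p by (intro incl_const[OF assms(1)]) auto
  qed
qed

lemma expand_insert: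
  assumes "i \<in> I" "Y \<subseteq> I" shows "expand (insert i Y) = ext i (P i) <+>\<^bsub>T\<^esub> expand Y"
  unfolding expand_def using T.genideal_Un[OF ext_sub[OF assms(1) P_sub[OF assms(1)]] gens_sub[OF assms(2)]] by simp

lemma expand_mono:
  assumes "Y \<subseteq> Z" "Z \<subseteq> I" shows "expand Y \<subseteq> expand Z"
  unfolding expand_def
proof (rule T.genideal_minimal[OF expand_ideal[OF assms(2), unfolded expand_def]])
  show "(\<Union>j\<in>Y. incl j ` P j) \<subseteq> Idl\<^bsub>T\<^esub> (\<Union>j\<in>Z. incl j ` P j)"
    using T.genideal_self[OF gens_sub[OF assms(2)]] assms(1) by blast
qed

text \<open>A point of the variety of \<open>P\<^sub>i\<close> removes the factor \<open>i\<close> from the sum and fixes 1. Without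
factors, the claim is that \<open>T\<close> is not the zero ring.\<close>
lemma one_notin_expand:
  assumes "Y \<subseteq> I" shows "\<one>\<^bsub>T\<^esub> \<notin> expand Y"
proof -
  have ch: "\<exists>\<phi>. character i \<phi> \<and> (\<forall>p\<in>P i. \<phi> p = \<zero>\<^bsub>F\<^esub>)" if i: "i \<in> I" for i
  proof -
    interpret Pi: primeideal "P i" "R i" using prime[OF i] .
    have "\<one>\<^bsub>R i\<^esub> \<notin> P i" using Pi.I_notcarr Pi.one_imp_carrier by blast
    thus ?thesis using point[OF i] Pi.one_closed by blast
  qed
  have "finite Y" using assms finite_index finite_subset by blast
  thus ?thesis using assms
  proof (induction Y)
    case empty
    define \<phi> where "\<phi> i = (SOME \<phi>. character i \<phi> \<and> (\<forall>p\<in>P i. \<phi> p = \<zero>\<^bsub>F\<^esub>))" for i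
    have c: "character i (\<phi> i)" if "i \<in> I" for i using someI_ex[OF ch[OF that]] unfolding \<phi>_def by blast
    have "\<one>\<^bsub>T\<^esub> \<noteq> \<zero>\<^bsub>T\<^esub>"
    proof (rule tensor_nontrivial[of \<phi>])
      fix j assume j: "j \<in> I"
      show "form j (\<phi> j)" using character_form[OF j c[OF j]] .
      show "\<phi> j \<one>\<^bsub>R j\<^esub> = \<one>\<^bsub>F\<^esub>" using c[OF j] ring_hom_one unfolding character_def by blast
    qed
    moreover have "expand {} \<subseteq> {\<zero>\<^bsub>T\<^esub>}" unfolding expand_def by (rule T.genideal_minimal[OF T.zeroideal]) auto
    ultimately show ?case by blast
  next
    case (insert i Y)
    have i: "i \<in> I" and Y: "Y \<subseteq> I" using insert by auto
    obtain \<phi> where phi: "character i \<phi>" "\<forall>p\<in>P i. \<phi> p = \<zero>\<^bsub>F\<^esub>" using ch[OF i] by blast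
    show ?case
    proof
      assume "\<one>\<^bsub>T\<^esub> \<in> expand (insert i Y)"
      hence "slice i \<phi> \<one>\<^bsub>T\<^esub> \<in> expand Y"
        using phi character_form[OF i phi(1)]
        unfolding expand_insert[OF i Y] mem_extG_iff[OF i P_ideal[OF i] expand_stable[OF i Y insert(2)] T.one_closed] by blast
      thus False using insert.IH[OF Y] slice_character_one[OF i phi(1)] by simp
    qed
  qed
qed

text \<open>One factor is evaluated at a point of the variety of its prime. Each of \<open>u\<close> and \<open>g\<close> excludes only the
points where a certain element outside the prime vanishes; the product of the two elements is still
outside the prime, so a common point exists.\<close>
lemma specialize:
  assumes i: "i \<in> I" and u: "u \<in> carrier T" "u \<notin> expand I" and g: "g \<in> carrier T" "g \<notin> expand I"
  shows "\<exists>\<phi>. character i \<phi> \<and> slice i \<phi> u \<notin> expand I \<and> slice i \<phi> g \<notin> expand I \<and> slice i \<phi> ` expand I \<subseteq> expand I"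
proof -
  let ?K = "expand (I - {i})"
  have ins: "insert i (I - {i}) = I" using i by auto
  have st: "stable i ?K" using expand_stable[OF i] by auto
  have Q: "expand I = ext i (P i) <+>\<^bsub>T\<^esub> ?K" using expand_insert[OF i, of "I - {i}"] ins by auto
  interpret Pi: primeideal "P i" "R i" using prime[OF i] .
  obtain a where a: "a \<in> carrier (R i)" "a \<notin> P i" "\<And>\<phi>. character i \<phi> \<Longrightarrow> \<phi> a \<noteq> \<zero>\<^bsub>F\<^esub> \<Longrightarrow> slice i \<phi> u \<notin> ?K"
    using character_nonvanishing[OF i P_ideal[OF i] st u(1)] u(2) unfolding Q by blast
  obtain b where b: "b \<in> carrier (R i)" "b \<notin> P i" "\<And>\<phi>. character i \<phi> \<Longrightarrow> \<phi> b \<noteq> \<zero>\<^bsub>F\<^esub> \<Longrightarrow> slice i \<phi> g \<notin> ?K"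
    using character_nonvanishing[OF i P_ideal[OF i] st g(1)] g(2) unfolding Q by blast
  have ab: "a \<otimes>\<^bsub>R i\<^esub> b \<in> carrier (R i)" "a \<otimes>\<^bsub>R i\<^esub> b \<notin> P i" using a b Pi.I_prime by auto
  obtain \<phi> where phi: "character i \<phi>" "\<forall>p\<in>P i. \<phi> p = \<zero>\<^bsub>F\<^esub>" "\<phi> (a \<otimes>\<^bsub>R i\<^esub> b) \<noteq> \<zero>\<^bsub>F\<^esub>" using point[OF i ab] by blast
  note f = character_form[OF i phi(1)]
  have h: "\<phi> \<in> ring_hom (R i) F" using phi(1) unfolding character_def by simp
  have "\<phi> (a \<otimes>\<^bsub>R i\<^esub> b) = \<phi> a \<otimes>\<^bsub>F\<^esub> \<phi> b" using ring_hom_mult[OF h a(1) b(1)] .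
  hence nz: "\<phi> a \<noteq> \<zero>\<^bsub>F\<^esub>" "\<phi> b \<noteq> \<zero>\<^bsub>F\<^esub>"
    using phi(3) form_closed[OF i f a(1)] form_closed[OF i f b(1)] by auto
  have toK: "slice i \<phi> x \<in> ?K" if "x \<in> expand I" "x \<in> carrier T" for x
    using that phi(2) f unfolding Q mem_extG_iff[OF i P_ideal[OF i] st that(2)] by blast
  have notQ: "slice i \<phi> x \<notin> expand I" if x: "x \<in> carrier T" "slice i \<phi> x \<notin> ?K" for x
  proof
    assume "slice i \<phi> x \<in> expand I"
    hence "slice i \<phi> (slice i \<phi> x) \<in> ?K" using toK slice_closed[OF i f x(1)] by blast
    thus False using x(2) slice_character_const[OF i phi(1) slice_const[OF i f x(1)]] by simp
  qed
  have "slice i \<phi> ` expand I \<subseteq> expand I"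
  proof
    fix y assume "y \<in> slice i \<phi> ` expand I"
    then obtain x where x: "x \<in> expand I" "y = slice i \<phi> x" by blast
    have "x \<in> carrier T" using x(1) ideal.Icarr[OF expand_ideal] by blast
    thus "y \<in> expand I" using toK[OF x(1)] x(2) expand_mono[of "I - {i}" I] by blast
  qed
  thus ?thesis using phi(1) notQ[OF u(1) a(3)[OF phi(1) nz(1)]] notQ[OF g(1) b(3)[OF phi(1) nz(2)]] by blast
qed

text \<open>Evaluation of all factors at suitable points gives a ring homomorphism \<open>\<theta>\<close> of \<open>T\<close> into the scalars that maps
the ideal into itself and keeps \<open>u\<close> and \<open>g\<close> outside of it. Then \<open>\<theta> u\<close> and \<open>\<theta> g\<close> are nonzero elements of a
field; if \<open>u g\<close> were in the ideal, their product, a unit, would be as well.\<close>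
lemma expand_prime:
  assumes u: "u \<in> carrier T" "u \<notin> expand I" and g: "g \<in> carrier T" and ug: "u \<otimes>\<^bsub>T\<^esub> g \<in> expand I"
  shows "g \<in> expand I"
proof (rule ccontr)
  assume gn: "g \<notin> expand I"
  interpret Q: ideal "expand I" T using expand_ideal by simp
  interpret sh: ring_hom_cring F T scal
    using scal_hom by (intro ring_hom_cringI) (auto intro: F.cring_axioms T.cring_axioms)
  \<comment> \<open>The factors are evaluated one at a time; those in \<open>Y\<close> already have scalar values, and the others are
    still untouched.\<close>
  have "\<exists>\<theta>. \<theta> \<in> ring_hom T T \<and> (\<forall>c\<in>carrier F. \<theta> (scal c) = scal c) \<and>
      (\<forall>i\<in>Y. \<forall>r\<in>carrier (R i). \<theta> (incl i r) \<in> scal ` carrier F) \<and>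
      (\<forall>i\<in>I - Y. \<forall>r\<in>carrier (R i). \<theta> (incl i r) = incl i r) \<and>
      \<theta> ` expand I \<subseteq> expand I \<and> \<theta> u \<notin> expand I \<and> \<theta> g \<notin> expand I"
    if "finite Y" "Y \<subseteq> I" for Y
    using that
  proof (induction Y)
    case empty
    show ?case using u(2) gn by (intro exI[of _ id]) (auto intro: ring_hom_memI)
  next
    case (insert i Y)
    have i: "i \<in> I" and Y: "Y \<subseteq> I" using insert by auto
    obtain \<theta> where th: "\<theta> \<in> ring_hom T T" "\<forall>c\<in>carrier F. \<theta> (scal c) = scal c"
      "\<forall>j\<in>Y. \<forall>r\<in>carrier (R j). \<theta> (incl j r) \<in> scal ` carrier F"
      "\<forall>j\<in>I - Y. \<forall>r\<in>carrier (R j). \<theta> (incl j r) = incl j r"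
      "\<theta> ` expand I \<subseteq> expand I" "\<theta> u \<notin> expand I" "\<theta> g \<notin> expand I" using insert.IH[OF Y] by (elim exE conjE)
    obtain \<phi> where phi: "character i \<phi>" "slice i \<phi> (\<theta> u) \<notin> expand I" "slice i \<phi> (\<theta> g) \<notin> expand I"
      "slice i \<phi> ` expand I \<subseteq> expand I"
      using specialize[OF i ring_hom_closed[OF th(1) u(1)] th(6) ring_hom_closed[OF th(1) g] th(7)] by (elim exE conjE)
    note f = character_form[OF i phi(1)]
    have ss: "slice i \<phi> (scal c) = scal c" if "c \<in> carrier F" for c
      using slice_character_const[OF i phi(1) scal_const[OF i that]] .
    have hom: "slice i \<phi> \<circ> \<theta> \<in> ring_hom T T" using ring_hom_trans[OF th(1) slice_character_hom[OF i phi(1)]] .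
    have a: "(slice i \<phi> \<circ> \<theta>) (scal c) = scal c" if "c \<in> carrier F" for c using that th(2) ss by simp
    have b: "(slice i \<phi> \<circ> \<theta>) (incl j r) \<in> scal ` carrier F" if j: "j \<in> insert i Y" "r \<in> carrier (R j)" for j r
    proof (cases "j = i")
      case True
      hence "\<theta> (incl j r) = incl i r" using th(4) i insert(2) j by auto
      thus ?thesis using slice_incl[OF i f] form_closed[OF i f] j True by auto
    next
      case False
      hence "\<theta> (incl j r) \<in> scal ` carrier F" using th(3) j by blast
      then obtain c where "c \<in> carrier F" "\<theta> (incl j r) = scal c" by blast
      thus ?thesis using ss by auto
    qed
    have d: "(slice i \<phi> \<circ> \<theta>) (incl j r) = incl j r" if j: "j \<in> I - insert i Y" "r \<in> carrier (R j)" for j r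
    proof -
      have "\<theta> (incl j r) = incl j r" using th(4) j by auto
      thus ?thesis using slice_character_const[OF i phi(1) incl_const[OF i _ _ j(2)]] j by auto
    qed
    have e: "(slice i \<phi> \<circ> \<theta>) ` expand I \<subseteq> expand I" using th(5) phi(4) by (auto simp: image_subset_iff)
    have "(slice i \<phi> \<circ> \<theta>) u \<notin> expand I" "(slice i \<phi> \<circ> \<theta>) g \<notin> expand I" using phi(2,3) by simp_all
    thus ?case by (intro exI[of _ "slice i \<phi> \<circ> \<theta>"] conjI ballI hom a b d e)
  qed
  from this[OF finite_index order_refl] obtain \<theta> where th: "\<theta> \<in> ring_hom T T" "\<forall>c\<in>carrier F. \<theta> (scal c) = scal c"
      "\<forall>j\<in>I. \<forall>r\<in>carrier (R j). \<theta> (incl j r) \<in> scal ` carrier F"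
      "\<forall>j\<in>I - I. \<forall>r\<in>carrier (R j). \<theta> (incl j r) = incl j r"
      "\<theta> ` expand I \<subseteq> expand I" "\<theta> u \<notin> expand I" "\<theta> g \<notin> expand I" by (elim exE conjE)
  interpret th: ring_hom_cring T T \<theta> using th(1) by (intro ring_hom_cringI) (auto intro: T.cring_axioms)
  have sprod: "(\<Otimes>\<^bsub>T\<^esub>j\<in>Y. incl j (x j)) \<in> carrier T \<and> \<theta> (\<Otimes>\<^bsub>T\<^esub>j\<in>Y. incl j (x j)) \<in> scal ` carrier F"
    if "finite Y" "Y \<subseteq> I" "x \<in> PR" for Y x
    using that
  proof (induction Y)
    case empty
    have "scal \<one>\<^bsub>F\<^esub> = \<one>\<^bsub>T\<^esub>" by simp
    thus ?case using F.one_closed by (auto simp: image_iff intro!: bexI[of _ "\<one>\<^bsub>F\<^esub>"])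
  next
    case (insert i Y)
    have xc: "x j \<in> carrier (R j)" if "j \<in> I" for j using insert.prems(2) that by auto
    have eq: "(\<Otimes>\<^bsub>T\<^esub>j\<in>insert i Y. incl j (x j)) = incl i (x i) \<otimes>\<^bsub>T\<^esub> (\<Otimes>\<^bsub>T\<^esub>j\<in>Y. incl j (x j))"
      using insert(1,2,4) xc by (intro T.finprod_insert) auto
    have IH: "(\<Otimes>\<^bsub>T\<^esub>j\<in>Y. incl j (x j)) \<in> carrier T" "\<theta> (\<Otimes>\<^bsub>T\<^esub>j\<in>Y. incl j (x j)) \<in> scal ` carrier F"
      using insert.IH insert.prems by auto
    obtain c where c: "c \<in> carrier F" "\<theta> (\<Otimes>\<^bsub>T\<^esub>j\<in>Y. incl j (x j)) = scal c" using IH by blast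
    have "\<theta> (incl i (x i)) \<in> scal ` carrier F" using th(3) insert.prems xc by auto
    then obtain d where d: "d \<in> carrier F" "\<theta> (incl i (x i)) = scal d" by blast
    have "\<theta> (incl i (x i) \<otimes>\<^bsub>T\<^esub> (\<Otimes>\<^bsub>T\<^esub>j\<in>Y. incl j (x j))) = scal (d \<otimes>\<^bsub>F\<^esub> c)"
      using c d IH(1) insert.prems xc by simp
    moreover have "scal (d \<otimes>\<^bsub>F\<^esub> c) \<in> scal ` carrier F" using c d by (intro imageI) simp
    moreover have "incl i (x i) \<otimes>\<^bsub>T\<^esub> (\<Otimes>\<^bsub>T\<^esub>j\<in>Y. incl j (x j)) \<in> carrier T"
      using IH(1) insert.prems xc by simp
    ultimately show ?case by (simp only: eq)
  qed
  have sc: "\<theta> t \<in> scal ` carrier F" if "t \<in> carrier T" for t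
    using that
  proof (induction t rule: pure_span)
    case zero
    have "scal \<zero>\<^bsub>F\<^esub> = \<zero>\<^bsub>T\<^esub>" by simp
    thus ?case using F.zero_closed by (auto simp: image_iff intro!: bexI[of _ "\<zero>\<^bsub>F\<^esub>"])
  next
    case (pure x)
    thus ?case using sprod[OF finite_index order_refl pure] finprod_incl[OF pure] by simp
  next
    case (add s t)
    then obtain c d where "c \<in> carrier F" "\<theta> s = scal c" "d \<in> carrier F" "\<theta> t = scal d" by blast
    hence "\<theta> (s \<oplus>\<^bsub>T\<^esub> t) = scal (c \<oplus>\<^bsub>F\<^esub> d)" using add by simp
    moreover have "scal (c \<oplus>\<^bsub>F\<^esub> d) \<in> scal ` carrier F" using \<open>c \<in> carrier F\<close> \<open>d \<in> carrier F\<close> by (intro imageI) simp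
    ultimately show ?case by (simp only:)
  qed
  obtain c d where cd: "c \<in> carrier F" "\<theta> u = scal c" "d \<in> carrier F" "\<theta> g = scal d" using sc[OF u(1)] sc[OF g] by blast
  have "c \<noteq> \<zero>\<^bsub>F\<^esub>" "d \<noteq> \<zero>\<^bsub>F\<^esub>" using cd th(6,7) Q.zero_closed by auto
  hence "c \<otimes>\<^bsub>F\<^esub> d \<noteq> \<zero>\<^bsub>F\<^esub>" using F.integral cd by blast
  then obtain e where e: "e \<in> carrier F" "e \<otimes>\<^bsub>F\<^esub> (c \<otimes>\<^bsub>F\<^esub> d) = \<one>\<^bsub>F\<^esub>"
    using cd F.field_Units F.Units_l_inv_ex by (metis DiffI F.m_closed empty_iff insert_iff)
  have "\<theta> (u \<otimes>\<^bsub>T\<^esub> g) \<in> expand I" using ug th(5) by blast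
  hence "scal (c \<otimes>\<^bsub>F\<^esub> d) \<in> expand I" using u(1) g cd by simp
  hence "scal e \<otimes>\<^bsub>T\<^esub> scal (c \<otimes>\<^bsub>F\<^esub> d) \<in> expand I" using Q.I_l_closed e(1) by simp
  moreover have "scal e \<otimes>\<^bsub>T\<^esub> scal (c \<otimes>\<^bsub>F\<^esub> d) = \<one>\<^bsub>T\<^esub>"
    using sh.hom_mult[of e "c \<otimes>\<^bsub>F\<^esub> d"] e cd by simp
  ultimately show False using one_notin_expand[OF order_refl] by simp
qed

text \<open>If \<open>r\<close> is not in \<open>P\<^sub>i\<close>, a point of the variety of \<open>P\<^sub>i\<close> evaluates it to a unit, while it maps the ideal into the sum
of the other extended primes, which is proper.\<close>
lemma incl_mem_expand:
  assumes i: "i \<in> I" and r: "r \<in> carrier (R i)" and q: "incl i r \<in> expand I"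
  shows "r \<in> P i"
proof (rule ccontr)
  assume "r \<notin> P i"
  then obtain \<phi> where phi: "character i \<phi>" "\<forall>p\<in>P i. \<phi> p = \<zero>\<^bsub>F\<^esub>" "\<phi> r \<noteq> \<zero>\<^bsub>F\<^esub>" using point[OF i r] by blast
  note f = character_form[OF i phi(1)]
  let ?K = "expand (I - {i})"
  have ins: "insert i (I - {i}) = I" using i by auto
  have st: "stable i ?K" using expand_stable[OF i] by auto
  interpret K: ideal ?K T using expand_ideal by auto
  interpret sh: ring_hom_cring F T scal
    using scal_hom by (intro ring_hom_cringI) (auto intro: F.cring_axioms T.cring_axioms)
  have Q: "expand I = ext i (P i) <+>\<^bsub>T\<^esub> ?K" using expand_insert[OF i, of "I - {i}"] ins by auto
  have "slice i \<phi> (incl i r) \<in> ?K"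
    using q phi(2) f unfolding Q mem_extG_iff[OF i P_ideal[OF i] st incl_closed[OF i r]] by blast
  hence "scal (\<phi> r) \<in> ?K" using slice_incl[OF i f r] by simp
  moreover obtain e where e: "e \<in> carrier F" "e \<otimes>\<^bsub>F\<^esub> \<phi> r = \<one>\<^bsub>F\<^esub>"
    using phi(3) form_closed[OF i f r] F.field_Units F.Units_l_inv_ex by (metis DiffI empty_iff insert_iff)
  ultimately have "scal e \<otimes>\<^bsub>T\<^esub> scal (\<phi> r) \<in> ?K" using K.I_l_closed by simp
  moreover have "scal e \<otimes>\<^bsub>T\<^esub> scal (\<phi> r) = \<one>\<^bsub>T\<^esub>"
    using sh.hom_mult[of e "\<phi> r"] e form_closed[OF i f r] by simp
  ultimately show False using one_notin_expand[of "I - {i}"] by auto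
qed

end

section \<open>Powers and symbolic powers of ideals\<close>

lemma ideals_set_simps:
  "carrier (ideals_set R) = {I. ideal I R}" "\<one>\<^bsub>ideals_set R\<^esub> = carrier R" "\<zero>\<^bsub>ideals_set R\<^esub> = {\<zero>\<^bsub>R\<^esub>}"
  "I \<otimes>\<^bsub>ideals_set R\<^esub> J = I \<cdot>\<^bsub>R\<^esub> J" "I \<oplus>\<^bsub>ideals_set R\<^esub> J = I <+>\<^bsub>R\<^esub> J"
  by (simp_all add: ideals_set_def)

lemma (in cring) ideal_pow_simps:
  "I [^]\<^bsub>ideals_set R\<^esub> (0::nat) = carrier R"
  "I [^]\<^bsub>ideals_set R\<^esub> (Suc k) = (I [^]\<^bsub>ideals_set R\<^esub> k) \<cdot> I"
  by (simp_all add: nat_pow_def ideals_set_def)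

lemma (in cring) ideal_pow_ideal:
  assumes "ideal I R" shows "ideal (I [^]\<^bsub>ideals_set R\<^esub> (k::nat)) R"
  by (induction k) (simp_all add: ideals_set_simps oneideal ideal_prod_is_ideal assms)

lemma (in cring) ideal_pow_mult_mem:
  assumes I: "ideal I R" and a: "a \<in> I [^]\<^bsub>ideals_set R\<^esub> (m::nat)" and b: "b \<in> I [^]\<^bsub>ideals_set R\<^esub> (n::nat)"
  shows "a \<otimes> b \<in> I [^]\<^bsub>ideals_set R\<^esub> (m + n)"
proof -
  interpret S: semiring "ideals_set R" by (rule ideals_set_is_semiring)
  have "I \<in> carrier (ideals_set R)" using I by (simp add: ideals_set_def)
  hence "I [^]\<^bsub>ideals_set R\<^esub> (m + n) = (I [^]\<^bsub>ideals_set R\<^esub> m) \<otimes>\<^bsub>ideals_set R\<^esub> (I [^]\<^bsub>ideals_set R\<^esub> n)"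
    by (simp add: S.nat_pow_mult)
  also have "\<dots> = (I [^]\<^bsub>ideals_set R\<^esub> m) \<cdot> (I [^]\<^bsub>ideals_set R\<^esub> n)" by (simp add: ideals_set_def)
  finally show ?thesis using ideal_prod.prod[OF a b] by simp
qed

lemma (in cring) ideal_pow_antimono:
  assumes I: "ideal I R" and "(k::nat) \<le> m" shows "I [^]\<^bsub>ideals_set R\<^esub> m \<subseteq> I [^]\<^bsub>ideals_set R\<^esub> k"
  using assms(2)
proof (induction m rule: dec_induct)
  case (step m)
  thus ?case unfolding ideal_pow_simps using ideal_prod_inter[OF ideal_pow_ideal[OF I, of m] I] by blast
qed simp

lemma (in cring) hom_ideal_pow:
  assumes S: "cring S" and h: "h \<in> ring_hom R S" and I: "ideal I R" and J: "ideal J S" and sub: "h ` I \<subseteq> J"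
    and x: "x \<in> I [^]\<^bsub>ideals_set R\<^esub> (k::nat)"
  shows "h x \<in> J [^]\<^bsub>ideals_set S\<^esub> k"
  using x
proof (induction k arbitrary: x)
  case 0
  thus ?case using h by (simp add: ideals_set_simps ring_hom_closed)
next
  case (Suc k)
  interpret S: cring S by fact
  interpret Ik: ideal "I [^]\<^bsub>ideals_set R\<^esub> k" R by (rule ideal_pow_ideal[OF I])
  interpret II: ideal I R by (rule I)
  have "x \<in> (I [^]\<^bsub>ideals_set R\<^esub> k) \<cdot> I" using Suc.prems by (simp add: ideals_set_simps)
  hence "h x \<in> (J [^]\<^bsub>ideals_set S\<^esub> k) \<cdot>\<^bsub>S\<^esub> J \<and> x \<in> carrier R"
  proof (induction x rule: ideal_prod.induct)
    case (prod a b)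
    have "h (a \<otimes> b) = h a \<otimes>\<^bsub>S\<^esub> h b" using ring_hom_mult[OF h] Ik.Icarr II.Icarr prod by blast
    moreover have "h b \<in> J" using sub prod(2) by blast
    ultimately show ?case
      using ideal_prod.prod[OF Suc.IH[OF prod(1)], of "h b" J S] Ik.Icarr[OF prod(1)] II.Icarr[OF prod(2)] by simp
  next
    case (sum a b)
    thus ?case using ring_hom_add[OF h, of a b] ideal_prod.sum[of "h a" S _ _ "h b"] by auto
  qed
  thus ?case by (simp add: ideals_set_simps)
qed

text \<open>For exponent 0 the symbolic power is defined separately as the whole ring; since \<open>P\<close> is proper, the
unit is an admissible multiplier, and the description by multipliers holds uniformly.\<close>
lemma (in cring) symbolic_power_iff:
  assumes P: "primeideal P R"
  shows "f \<in> symbolic_power R P k \<longleftrightarrow> f \<in> carrier R \<and> (\<exists>u\<in>carrier R - P. u \<otimes> f \<in> P [^]\<^bsub>ideals_set R\<^esub> k)"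
proof (cases "k = 0")
  case True
  interpret P: primeideal P R by fact
  have "\<one> \<in> carrier R - P" using P.I_notcarr P.one_imp_carrier by auto
  thus ?thesis using True by (auto simp: symbolic_power_def ideals_set_simps intro!: bexI[of _ \<one>])
qed (simp add: symbolic_power_def)

lemma (in cring) symbolic_power_0: "symbolic_power R P 0 = carrier R"
  by (simp add: symbolic_power_def)

lemma (in cring) symbolic_power_sub: "symbolic_power R P k \<subseteq> carrier R"
  by (auto simp: symbolic_power_def)

lemma (in cring) symbolic_power_ideal:
  assumes P: "primeideal P R" shows "ideal (symbolic_power R P k) R"
proof (rule idealI[OF ring_axioms])
  interpret P: primeideal P R by fact
  interpret Pk: ideal "P [^]\<^bsub>ideals_set R\<^esub> k" R by (rule ideal_pow_ideal[OF P.ideal_axioms])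
  note iff = symbolic_power_iff[OF P]
  have abs: "x \<otimes> a \<in> symbolic_power R P k" if a: "a \<in> symbolic_power R P k" and x: "x \<in> carrier R" for a x
  proof -
    obtain u where u: "a \<in> carrier R" "u \<in> carrier R - P" "u \<otimes> a \<in> P [^]\<^bsub>ideals_set R\<^esub> k" using a unfolding iff by blast
    have "u \<otimes> (x \<otimes> a) = x \<otimes> (u \<otimes> a)" using u x by (simp add: m_lcomm)
    hence "u \<otimes> (x \<otimes> a) \<in> P [^]\<^bsub>ideals_set R\<^esub> k" using Pk.I_l_closed[OF u(3) x] by simp
    thus ?thesis unfolding iff using u x by auto
  qed
  show "subgroup (symbolic_power R P k) (add_monoid R)"
  proof (rule add.subgroupI)
    show "symbolic_power R P k \<subseteq> carrier R" by (rule symbolic_power_sub)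
    have "\<one> \<otimes> \<zero> \<in> P [^]\<^bsub>ideals_set R\<^esub> k" by simp
    moreover have "\<one> \<in> carrier R - P" using P.I_notcarr P.one_imp_carrier by auto
    ultimately have "\<zero> \<in> symbolic_power R P k" unfolding iff by blast
    thus "symbolic_power R P k \<noteq> {}" by blast
    fix a assume a: "a \<in> symbolic_power R P k"
    have ac: "a \<in> carrier R" using a unfolding iff by blast
    have "\<ominus> a = \<ominus> \<one> \<otimes> a" using ac by (simp add: l_minus)
    thus "\<ominus> a \<in> symbolic_power R P k" using abs[OF a] by simp
    fix b assume b: "b \<in> symbolic_power R P k"
    obtain u where u: "u \<in> carrier R - P" "u \<otimes> a \<in> P [^]\<^bsub>ideals_set R\<^esub> k" using a unfolding iff by blast
    obtain v where v: "b \<in> carrier R" "v \<in> carrier R - P" "v \<otimes> b \<in> P [^]\<^bsub>ideals_set R\<^esub> k" using b unfolding iff by blast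
    have "u \<otimes> v \<in> carrier R - P" using u v P.I_prime by auto
    moreover have "(u \<otimes> v) \<otimes> (a \<oplus> b) = v \<otimes> (u \<otimes> a) \<oplus> u \<otimes> (v \<otimes> b)"
      using u v ac by (simp add: r_distr m_ac)
    hence "(u \<otimes> v) \<otimes> (a \<oplus> b) \<in> P [^]\<^bsub>ideals_set R\<^esub> k"
      using Pk.I_l_closed[OF u(2), of v] Pk.I_l_closed[OF v(3), of u] u v by simp
    ultimately show "a \<oplus> b \<in> symbolic_power R P k" unfolding iff using ac v by auto
  qed
  fix a x assume a: "a \<in> symbolic_power R P k" and x: "x \<in> carrier R"
  show "x \<otimes> a \<in> symbolic_power R P k" using abs[OF a x] .
  moreover have "a \<in> carrier R" using a symbolic_power_sub by blast
  ultimately show "a \<otimes> x \<in> symbolic_power R P k" using x by (simp add: m_comm)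
qed

lemma (in cring) symbolic_power_cancel:
  assumes P: "primeideal P R" and d: "d \<in> carrier R" "d \<notin> P" and r: "r \<in> carrier R" and dr: "d \<otimes> r \<in> symbolic_power R P k"
  shows "r \<in> symbolic_power R P k"
proof -
  interpret P: primeideal P R by fact
  obtain u where u: "u \<in> carrier R - P" "u \<otimes> (d \<otimes> r) \<in> P [^]\<^bsub>ideals_set R\<^esub> k" using dr unfolding symbolic_power_iff[OF P] by blast
  have "u \<otimes> d \<in> carrier R - P" using u d P.I_prime by auto
  moreover have "(u \<otimes> d) \<otimes> r \<in> P [^]\<^bsub>ideals_set R\<^esub> k" using u d r by (simp add: m_assoc)
  ultimately show ?thesis unfolding symbolic_power_iff[OF P] using r by blast
qed

lemma (in cring) symbolic_power_antimono:
  assumes P: "primeideal P R" and km: "k \<le> m" shows "symbolic_power R P m \<subseteq> symbolic_power R P k"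
  using symbolic_power_iff[OF P] ideal_pow_antimono[OF primeideal.axioms(1)[OF P] km] by blast

lemma (in cring) symbolic_power_mult:
  assumes P: "primeideal P R" and a: "a \<in> symbolic_power R P k" and q: "q \<in> P"
  shows "a \<otimes> q \<in> symbolic_power R P (Suc k)"
proof -
  interpret P: primeideal P R by fact
  obtain u where u: "a \<in> carrier R" "u \<in> carrier R - P" "u \<otimes> a \<in> P [^]\<^bsub>ideals_set R\<^esub> k" using a unfolding symbolic_power_iff[OF P] by blast
  have "(u \<otimes> a) \<otimes> q \<in> P [^]\<^bsub>ideals_set R\<^esub> (Suc k)" unfolding ideal_pow_simps using ideal_prod.prod[OF u(3) q] .
  moreover have "(u \<otimes> a) \<otimes> q = u \<otimes> (a \<otimes> q)" using u P.Icarr[OF q] by (simp add: m_assoc)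
  ultimately show ?thesis unfolding symbolic_power_iff[OF P] using u P.Icarr[OF q] by auto
qed

text \<open>The elements whose product with \<open>c\<close> is in \<open>W\<close> form an ideal.\<close>
lemma (in cring) mult_genideal_mem:
  assumes W: "ideal W R" and S: "S \<subseteq> carrier R" and c: "c \<in> carrier R"
    and y: "\<And>y. y \<in> S \<Longrightarrow> c \<otimes> y \<in> W" and g: "g \<in> Idl S"
  shows "c \<otimes> g \<in> W"
proof -
  interpret W: ideal W R by fact
  have "ideal {g \<in> carrier R. c \<otimes> g \<in> W} R" (is "ideal ?K R")
  proof (rule idealI[OF ring_axioms])
    show "subgroup ?K (add_monoid R)"
    proof (rule add.subgroupI)
      have "c \<otimes> \<zero> \<in> W" using c by simp
      thus "?K \<noteq> {}" by blast
    qed (use c in \<open>auto simp: r_distr r_minus\<close>)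
    fix a x assume a: "a \<in> ?K" and x: "x \<in> carrier R"
    have "c \<otimes> (x \<otimes> a) = x \<otimes> (c \<otimes> a)" using a x c by (simp add: m_lcomm)
    thus "x \<otimes> a \<in> ?K" using a x W.I_l_closed by simp
    thus "a \<otimes> x \<in> ?K" using a x by (simp add: m_comm)
  qed
  hence "Idl S \<subseteq> ?K" using S y by (intro genideal_minimal) auto
  thus ?thesis using g by blast
qed

lemma (in cring) genideal_mult_mem:
  assumes W: "ideal W R" and S: "S \<subseteq> carrier R" "S' \<subseteq> carrier R"
    and y: "\<And>y z. y \<in> S \<Longrightarrow> z \<in> S' \<Longrightarrow> y \<otimes> z \<in> W" and a: "a \<in> Idl S" and b: "b \<in> Idl S'"
  shows "a \<otimes> b \<in> W"
proof -
  have bc: "b \<in> carrier R" using b genideal_minimal[OF oneideal S(2)] by blast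
  have ac: "a \<in> carrier R" using a genideal_minimal[OF oneideal S(1)] by blast
  have "b \<otimes> a \<in> W"
  proof (rule mult_genideal_mem[OF W S(1) bc _ a])
    fix y assume yS: "y \<in> S"
    have yc: "y \<in> carrier R" using yS S by blast
    have "y \<otimes> b \<in> W" by (rule mult_genideal_mem[OF W S(2) yc y[OF yS] b])
    thus "b \<otimes> y \<in> W" using bc yc by (simp add: m_comm)
  qed
  thus ?thesis using ac bc by (simp add: m_comm)
qed

lemma exists_smaller_with_sum:
  assumes "finite Y" "(\<Sum>i\<in>Y. f i) \<ge> (n::nat)"
  shows "\<exists>g. (\<forall>i\<in>Y. g i \<le> f i) \<and> (\<Sum>i\<in>Y. g i) = n"
  using assms
proof (induction Y arbitrary: n)
  case (insert i Y)
  let ?k = "min n (f i)"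
  have "(\<Sum>j\<in>Y. f j) \<ge> n - ?k" using insert by auto
  then obtain g where g: "\<forall>j\<in>Y. g j \<le> f j" "(\<Sum>j\<in>Y. g j) = n - ?k" using insert.IH by blast
  have "(\<Sum>j\<in>Y. (g(i := ?k)) j) = (\<Sum>j\<in>Y. g j)" using insert(2) by (intro sum.cong) auto
  hence "(\<Sum>j\<in>insert i Y. (g(i := ?k)) j) = n" using insert(1,2) g by simp
  thus ?case using g by (intro exI[of _ "g(i := ?k)"]) auto
qed simp

section \<open>A filtration of the tensor product\<close>

context separated_prime_family
begin

abbreviation sp where "sp i k \<equiv> symbolic_power (R i) (P i) k"

lemma sp_ideal: "i \<in> I \<Longrightarrow> ideal (sp i k) (R i)"
  using cring.symbolic_power_ideal[OF factor_cring prime] .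

lemma sp_sub: "i \<in> I \<Longrightarrow> sp i k \<subseteq> carrier (R i)"
  using cring.symbolic_power_sub[OF factor_cring] .

lemma sp_mem: "i \<in> I \<Longrightarrow> r \<in> sp i k \<Longrightarrow> r \<in> carrier (R i)"
  using sp_sub by blast

lemma sp_antimono: "i \<in> I \<Longrightarrow> k \<le> m \<Longrightarrow> sp i m \<subseteq> sp i k"
  using cring.symbolic_power_antimono[OF factor_cring prime] .

text \<open>Induction on \<open>k\<close> along the filtration by symbolic powers; each quotient is torsion-free over \<open>R\<^sub>i/P\<^sub>i\<close>, which is
what \<open>torsion_free_step\<close> requires.\<close>
lemma symbolic_primary:
  assumes i: "i \<in> I" and G: "stable i G" and u: "u \<in> carrier T"
    and uP: "\<And>g. g \<in> carrier T \<Longrightarrow> u \<otimes>\<^bsub>T\<^esub> g \<in> ext i (P i) <+>\<^bsub>T\<^esub> G \<Longrightarrow> g \<in> ext i (P i) <+>\<^bsub>T\<^esub> G"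
    and x: "x \<in> carrier T" and ux: "u \<otimes>\<^bsub>T\<^esub> x \<in> ext i (sp i k) <+>\<^bsub>T\<^esub> G"
  shows "x \<in> ext i (sp i k) <+>\<^bsub>T\<^esub> G"
  using ux
proof (induction k)
  case 0
  have s0: "sp i 0 = carrier (R i)" using cring.symbolic_power_0[OF factor_cring[OF i]] .
  have "x \<in> ext i (sp i 0)" unfolding s0 ext_carrier[OF i] using x .
  thus ?case using ext_subset_extG(1)[OF i sp_ideal[OF i] G] by blast
next
  case (Suc k)
  have "ext i (sp i (Suc k)) \<subseteq> ext i (sp i k)"
  proof (rule T.genideal_minimal[OF ext_ideal[OF i sp_sub[OF i]]])
    show "incl i ` sp i (Suc k) \<subseteq> ext i (sp i k)"
      using T.genideal_self[OF ext_sub[OF i sp_sub[OF i]], of k] sp_antimono[OF i, of k "Suc k"] by auto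
  qed
  hence "ext i (sp i (Suc k)) <+>\<^bsub>T\<^esub> G \<subseteq> ext i (sp i k) <+>\<^bsub>T\<^esub> G" unfolding subset_iff T.ideal_set_add_iff by blast
  hence xk: "x \<in> ext i (sp i k) <+>\<^bsub>T\<^esub> G" using Suc by blast
  show ?case
  proof (rule torsion_free_step[OF i P_ideal[OF i] sp_ideal[OF i] sp_ideal[OF i] _ _ G u uP xk Suc.prems])
    show "p \<otimes>\<^bsub>R i\<^esub> q \<in> sp i (Suc k)" if "p \<in> sp i k" "q \<in> P i" for p q
      using cring.symbolic_power_mult[OF factor_cring[OF i] prime[OF i] that] .
    show "r \<in> sp i (Suc k)" if "d \<in> carrier (R i)" "d \<notin> P i" "r \<in> carrier (R i)" "d \<otimes>\<^bsub>R i\<^esub> r \<in> sp i (Suc k)" for d r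
      using cring.symbolic_power_cancel[OF factor_cring[OF i] prime[OF i] that] .
  qed
qed

text \<open>The factors in \<open>Y\<close> carry a filtration by exponent sums, the factors in \<open>Z\<close> are reduced modulo their primes, and
all other factors do not occur, so that the ideals are stable under slices along these. Allowing exponent sums larger
than \<open>N\<close> makes the family decreasing in \<open>N\<close> without further argument.\<close>
definition gens where
  "gens Y N = {\<Otimes>\<^bsub>T\<^esub>j\<in>Y. incl j (r j) | r a. (\<forall>j\<in>Y. r j \<in> sp j (a j)) \<and> (\<Sum>j\<in>Y. a j) \<ge> N}"

definition filt where
  "filt Y Z N = Idl\<^bsub>T\<^esub> (gens Y N \<union> (\<Union>j\<in>Z. incl j ` P j))"

lemma gensI: "(\<And>j. j \<in> Y \<Longrightarrow> r j \<in> sp j (a j)) \<Longrightarrow> (\<Sum>j\<in>Y. a j) \<ge> N \<Longrightarrow> (\<Otimes>\<^bsub>T\<^esub>j\<in>Y. incl j (r j)) \<in> gens Y N"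
  unfolding gens_def by blast

lemma gensE:
  assumes "y \<in> gens Y N"
  obtains r a where "\<And>j. j \<in> Y \<Longrightarrow> r j \<in> sp j (a j)" "(\<Sum>j\<in>Y. a j) \<ge> N" "y = (\<Otimes>\<^bsub>T\<^esub>j\<in>Y. incl j (r j))"
  using assms unfolding gens_def by blast

lemma prod_const:
  assumes i: "i \<in> I" and Y: "finite Y" "Y \<subseteq> I" "i \<notin> Y" and r: "\<And>j. j \<in> Y \<Longrightarrow> r j \<in> carrier (R j)"
  shows "(\<Otimes>\<^bsub>T\<^esub>j\<in>Y. incl j (r j)) \<in> const i"
  using Y r
proof (induction Y)
  case empty
  show ?case using const_one[OF i] by simp
next
  case (insert k Y)
  have k: "k \<in> I" "i \<noteq> k" "r k \<in> carrier (R k)" using insert by auto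
  have c: "incl j (r j) \<in> carrier T" if j: "j \<in> insert k Y" for j
  proof -
    have "j \<in> I" using j insert.prems(1) by blast
    thus ?thesis using insert.prems(3)[OF j] by (intro incl_closed)
  qed
  have "(\<Otimes>\<^bsub>T\<^esub>j\<in>insert k Y. incl j (r j)) = incl k (r k) \<otimes>\<^bsub>T\<^esub> (\<Otimes>\<^bsub>T\<^esub>j\<in>Y. incl j (r j))"
    using insert(1,2) c by (intro T.finprod_insert) auto
  thus ?case using const_mult[OF i incl_const[OF i k] insert.IH] insert.prems by simp
qed

lemma gens_const: "i \<in> I \<Longrightarrow> Y \<subseteq> I \<Longrightarrow> i \<notin> Y \<Longrightarrow> gens Y N \<subseteq> const i"
proof
  fix y assume i: "i \<in> I" and Y: "Y \<subseteq> I" "i \<notin> Y" and y: "y \<in> gens Y N"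
  obtain r a where r: "\<And>j. j \<in> Y \<Longrightarrow> r j \<in> sp j (a j)" "(\<Sum>j\<in>Y. a j) \<ge> N"
    "y = (\<Otimes>\<^bsub>T\<^esub>j\<in>Y. incl j (r j))" using gensE[OF y] by blast
  have "r j \<in> carrier (R j)" if "j \<in> Y" for j using r(1)[OF that] sp_mem[of j] Y that by blast
  thus "y \<in> const i" unfolding r(3) using prod_const[OF i finite_subset[OF Y(1) finite_index] Y] by blast
qed

lemma incl_sp_closed: "Y \<subseteq> I \<Longrightarrow> (\<And>j. j \<in> Y \<Longrightarrow> r j \<in> sp j (a j)) \<Longrightarrow> j \<in> Y \<Longrightarrow> incl j (r j) \<in> carrier T"
  by (rule incl_closed) (use sp_mem in blast)+

lemma gens_sub_T: assumes Y: "Y \<subseteq> I" shows "gens Y N \<subseteq> carrier T"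
proof
  fix y assume y: "y \<in> gens Y N"
  obtain r a where r: "\<And>j. j \<in> Y \<Longrightarrow> r j \<in> sp j (a j)" "(\<Sum>j\<in>Y. a j) \<ge> N"
    "y = (\<Otimes>\<^bsub>T\<^esub>j\<in>Y. incl j (r j))" using gensE[OF y] by blast
  show "y \<in> carrier T" unfolding r(3) using incl_sp_closed[OF Y r(1)] by (intro T.finprod_closed) auto
qed

lemma filt_gens_sub: "Y \<subseteq> I \<Longrightarrow> Z \<subseteq> I \<Longrightarrow> gens Y N \<union> (\<Union>j\<in>Z. incl j ` P j) \<subseteq> carrier T"
  using gens_sub_T gens_sub by blast

lemma filt_ideal: "Y \<subseteq> I \<Longrightarrow> Z \<subseteq> I \<Longrightarrow> ideal (filt Y Z N) T"
  unfolding filt_def using T.genideal_ideal[OF filt_gens_sub] .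

lemma filt_mem: "Y \<subseteq> I \<Longrightarrow> Z \<subseteq> I \<Longrightarrow> y \<in> gens Y N \<Longrightarrow> y \<in> filt Y Z N"
  "Y \<subseteq> I \<Longrightarrow> Z \<subseteq> I \<Longrightarrow> j \<in> Z \<Longrightarrow> p \<in> P j \<Longrightarrow> incl j p \<in> filt Y Z N"
  unfolding filt_def using T.genideal_self[OF filt_gens_sub[of Y Z N]] by blast+

lemma filt_stable:
  assumes i: "i \<in> I" and Y: "Y \<subseteq> I" "i \<notin> Y" and Z: "Z \<subseteq> I" "i \<notin> Z"
  shows "stable i (filt Y Z N)"
  unfolding filt_def
proof (rule stable_genideal[OF i], rule Un_least[OF gens_const[OF i Y]], intro UN_least image_subsetI)
  fix j p assume j: "j \<in> Z" and p: "p \<in> P j"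
  have "j \<in> I" "i \<noteq> j" using j Z by auto
  thus "incl j p \<in> const i" using P_sub[of j] p by (intro incl_const[OF i]) auto
qed

lemma filt_insert_prime:
  assumes i: "i \<in> I" and Y: "Y \<subseteq> I" and Z: "Z \<subseteq> I"
  shows "filt Y (insert i Z) N = ext i (P i) <+>\<^bsub>T\<^esub> filt Y Z N"
proof -
  have "gens Y N \<union> (\<Union>j\<in>insert i Z. incl j ` P j) = incl i ` P i \<union> (gens Y N \<union> (\<Union>j\<in>Z. incl j ` P j))" by auto
  thus ?thesis unfolding filt_def
    using T.genideal_Un[OF ext_sub[OF i P_sub[OF i]] filt_gens_sub[OF Y Z]] by simp
qed

lemma prod_insert:
  assumes "i \<in> I" "Y \<subseteq> I" "i \<notin> Y" "\<And>j. j \<in> insert i Y \<Longrightarrow> r j \<in> sp j (a j)"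
  shows "(\<Otimes>\<^bsub>T\<^esub>j\<in>insert i Y. incl j (r j)) = incl i (r i) \<otimes>\<^bsub>T\<^esub> (\<Otimes>\<^bsub>T\<^esub>j\<in>Y. incl j (r j))"
proof -
  have iY: "insert i Y \<subseteq> I" using assms(1,2) by simp
  have c: "incl j (r j) \<in> carrier T" if j: "j \<in> insert i Y" for j
    by (rule incl_sp_closed[OF iY assms(4) j])
  show ?thesis using finite_subset[OF assms(2) finite_index] assms(3) c by (intro T.finprod_insert) auto
qed

text \<open>In a generator, the exponent \<open>c\<close> of the factor \<open>i\<close> is at least \<open>a\<close>, or else the other exponents add up to at
least \<open>N - c > N - a\<close>, that is, to at least \<open>b = N + 1 - a\<close>.\<close>
lemma filt_le_ext:
  assumes i: "i \<in> I" and Y: "Y \<subseteq> I" "i \<notin> Y" and Z: "Z \<subseteq> I" "i \<notin> Z" and ab: "a + b = Suc N"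
  shows "filt (insert i Y) Z N \<subseteq> ext i (sp i a) <+>\<^bsub>T\<^esub> filt Y Z b"
  unfolding filt_def[of "insert i Y"]
proof (rule T.genideal_minimal)
  note st = filt_stable[OF i Y Z, of b]
  let ?E = "ext i (sp i a) <+>\<^bsub>T\<^esub> filt Y Z b"
  show id: "ideal ?E T" using extG_ideal[OF i sp_ideal[OF i] st] .
  interpret W: ideal ?E T by (rule id)
  have GE: "filt Y Z b \<subseteq> ?E" and XE: "ext i (sp i a) \<subseteq> ?E" using ext_subset_extG[OF i sp_ideal[OF i] st] by auto
  show "gens (insert i Y) N \<union> (\<Union>j\<in>Z. incl j ` P j) \<subseteq> ?E"
  proof (intro Un_least UN_least image_subsetI)
    fix j p assume "j \<in> Z" "p \<in> P j"
    thus "incl j p \<in> ?E" using filt_mem(2)[OF Y(1) Z(1), of j p b] GE by blast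
  next
    show "gens (insert i Y) N \<subseteq> ?E"
    proof
      fix y assume y: "y \<in> gens (insert i Y) N"
      obtain r c where r: "\<And>j. j \<in> insert i Y \<Longrightarrow> r j \<in> sp j (c j)" "(\<Sum>j\<in>insert i Y. c j) \<ge> N"
        "y = (\<Otimes>\<^bsub>T\<^esub>j\<in>insert i Y. incl j (r j))" using gensE[OF y] by blast
      let ?t = "\<Otimes>\<^bsub>T\<^esub>j\<in>Y. incl j (r j)"
      have y': "y = incl i (r i) \<otimes>\<^bsub>T\<^esub> ?t" unfolding r(3) by (rule prod_insert[OF i Y r(1)])
      have ri: "r i \<in> sp i (c i)" using r(1) by simp
      have tc: "?t \<in> carrier T" using incl_sp_closed[OF Y(1), of r c] r(1) by (intro T.finprod_closed) auto
      have sum: "c i + (\<Sum>j\<in>Y. c j) \<ge> N" using r(2) Y finite_subset[OF Y(1) finite_index] by simp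
      show "y \<in> ?E"
      proof (cases "c i \<ge> a")
        case True
        hence "r i \<in> sp i a" using ri sp_antimono[OF i] by blast
        hence "incl i (r i) \<in> ?E" using T.genideal_self[OF ext_sub[OF i sp_sub[OF i]], of a] XE by blast
        thus ?thesis unfolding y' using W.I_r_closed tc by simp
      next
        case False
        hence "(\<Sum>j\<in>Y. c j) \<ge> b" using sum ab by simp
        hence "?t \<in> gens Y b" using r(1) by (intro gensI[of Y r c]) auto
        hence "?t \<in> ?E" using filt_mem(1)[OF Y(1) Z(1)] GE by blast
        thus ?thesis unfolding y' using W.I_l_closed incl_closed[OF i sp_mem[OF i ri]] by simp
      qed
    qed
  qed
qed

lemma incl_mult_filt:
  assumes i: "i \<in> I" and Y: "Y \<subseteq> I" "i \<notin> Y" and Z: "Z \<subseteq> I" and p: "p \<in> sp i m" and g: "g \<in> filt Y Z b"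
    and N: "N \<le> m + b"
  shows "incl i p \<otimes>\<^bsub>T\<^esub> g \<in> filt (insert i Y) Z N"
proof (rule T.mult_genideal_mem[OF _ filt_gens_sub[OF Y(1) Z] _ _ g[unfolded filt_def]])
  have iY: "insert i Y \<subseteq> I" using i Y by auto
  show id: "ideal (filt (insert i Y) Z N) T" using filt_ideal[OF iY Z] .
  interpret W: ideal "filt (insert i Y) Z N" T by (rule id)
  show pc: "incl i p \<in> carrier T" using incl_closed[OF i sp_mem[OF i p]] .
  fix y assume "y \<in> gens Y b \<union> (\<Union>j\<in>Z. incl j ` P j)"
  thus "incl i p \<otimes>\<^bsub>T\<^esub> y \<in> filt (insert i Y) Z N"
  proof
    assume y: "y \<in> gens Y b"
    obtain r c where r: "\<And>j. j \<in> Y \<Longrightarrow> r j \<in> sp j (c j)" "(\<Sum>j\<in>Y. c j) \<ge> b"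
      "y = (\<Otimes>\<^bsub>T\<^esub>j\<in>Y. incl j (r j))" using gensE[OF y] by blast
    have r': "(r(i := p)) j \<in> sp j ((c(i := m)) j)" if "j \<in> insert i Y" for j using that r(1) p by auto
    have eqY: "(\<Otimes>\<^bsub>T\<^esub>j\<in>Y. incl j ((r(i := p)) j)) = y"
      unfolding r(3) using Y(2) incl_sp_closed[OF Y(1) r(1)] by (intro T.finprod_cong') auto
    have "(\<Sum>j\<in>Y. (c(i := m)) j) = (\<Sum>j\<in>Y. c j)" using Y(2) by (intro sum.cong) auto
    hence "(\<Sum>j\<in>insert i Y. (c(i := m)) j) \<ge> N" using r(2) N Y finite_subset[OF Y(1) finite_index] by simp
    hence "(\<Otimes>\<^bsub>T\<^esub>j\<in>insert i Y. incl j ((r(i := p)) j)) \<in> gens (insert i Y) N" using r' by (intro gensI)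
    moreover have "(\<Otimes>\<^bsub>T\<^esub>j\<in>insert i Y. incl j ((r(i := p)) j)) = incl i p \<otimes>\<^bsub>T\<^esub> y"
      using prod_insert[where r = "r(i := p)" and a = "c(i := m)", OF i Y r'] unfolding eqY by simp
    ultimately show ?thesis using filt_mem(1)[OF iY Z] by simp
  next
    assume "y \<in> (\<Union>j\<in>Z. incl j ` P j)"
    then obtain j q where "j \<in> Z" "q \<in> P j" "y = incl j q" by blast
    hence "y \<in> filt (insert i Y) Z N" using filt_mem(2)[OF iY Z] by simp
    thus ?thesis using W.I_l_closed pc by simp
  qed
qed

lemma one_mem_filt:
  assumes Y: "Y \<subseteq> I" and Z: "Z \<subseteq> I" shows "\<one>\<^bsub>T\<^esub> \<in> filt Y Z 0"
proof -
  have r: "\<one>\<^bsub>R j\<^esub> \<in> sp j 0" if "j \<in> Y" for j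
  proof -
    have j: "j \<in> I" using that Y by blast
    interpret Rj: cring "R j" using factor_cring[OF j] .
    show ?thesis using Rj.symbolic_power_0 by simp
  qed
  have "(\<Otimes>\<^bsub>T\<^esub>j\<in>Y. incl j \<one>\<^bsub>R j\<^esub>) = \<one>\<^bsub>T\<^esub>" using Y incl_one by (intro T.finprod_one_eqI) auto
  moreover have "(\<Otimes>\<^bsub>T\<^esub>j\<in>Y. incl j \<one>\<^bsub>R j\<^esub>) \<in> gens Y 0" using r by (intro gensI[of _ _ "\<lambda>_. 0"]) auto
  ultimately show ?thesis using filt_mem(1)[OF Y Z] by simp
qed

text \<open>The factors in \<open>Y\<close> carry their symbolic powers, all others only their primes; the step trades the prime of one
factor for its symbolic powers. By the induction hypothesis, \<open>u\<close> is a nonzerodivisor modulo the ideal of \<open>Y\<close>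
for every exponent sum, and this ideal is \<open>P\<^sub>i T + G\<close> with \<open>G\<close> stable under slices along \<open>i\<close>.\<close>
lemma filt_symbolic:
  assumes u: "u \<in> carrier T" "u \<notin> expand I" and Y: "finite Y" "Y \<subseteq> I" and f: "f \<in> carrier T"
    and uf: "u \<otimes>\<^bsub>T\<^esub> f \<in> filt Y (I - Y) N"
  shows "f \<in> filt Y (I - Y) N"
  using Y f uf
proof (induction Y arbitrary: N f)
  case empty
  show ?case
  proof (cases "N = 0")
    case True
    interpret W: ideal "filt {} (I - {}) N" T using filt_ideal by simp
    have "\<one>\<^bsub>T\<^esub> \<in> filt {} (I - {}) N" using one_mem_filt[of "{}" "I - {}"] True by simp
    thus ?thesis using W.one_imp_carrier empty by simp
  next
    case False
    hence "gens {} N = {}" unfolding gens_def by auto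
    hence "filt {} (I - {}) N = expand I" unfolding filt_def expand_def by simp
    thus ?thesis using expand_prime[OF u] empty by simp
  qed
next
  case (insert i Y)
  define Z where "Z = I - insert i Y"
  have i: "i \<in> I" and Y: "Y \<subseteq> I" "i \<notin> Y" and Z: "Z \<subseteq> I" "i \<notin> Z" using insert unfolding Z_def by auto
  have IY: "I - Y = insert i Z" using i Y unfolding Z_def by auto
  note st = filt_stable[OF i Y Z]
  let ?D = "filt (insert i Y) Z N"
  have iY: "insert i Y \<subseteq> I" using insert by simp
  interpret D: ideal ?D T using filt_ideal[OF iY Z(1)] .
  have uP: "g \<in> ext i (P i) <+>\<^bsub>T\<^esub> filt Y Z b"
    if "g \<in> carrier T" "u \<otimes>\<^bsub>T\<^esub> g \<in> ext i (P i) <+>\<^bsub>T\<^esub> filt Y Z b" for g b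
    using insert.IH[OF Y(1) that(1), of b] that(2) unfolding IY filt_insert_prime[OF i Y(1) Z(1)] by blast
  have pr: "f \<in> ext i (sp i a) <+>\<^bsub>T\<^esub> filt Y Z b" if "a + b = Suc N" for a b
    using symbolic_primary[OF i st u(1) uP insert.prems(2)] insert.prems(3) filt_le_ext[OF i Y Z that]
    unfolding Z_def[symmetric] by blast
  \<comment> \<open>Successive approximation: modulo the target ideal, \<open>f\<close> is congruent to an element \<open>x\<close> of the extension of the
    \<open>m\<close>-th symbolic power.\<close>
  have fin: "\<exists>x\<in>ext i (sp i m). f \<ominus>\<^bsub>T\<^esub> x \<in> ?D" if "m \<le> N" for m
    using that
  proof (induction m)
    case 0
    have "sp i 0 = carrier (R i)" using cring.symbolic_power_0[OF factor_cring[OF i]] .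
    hence "f \<in> ext i (sp i 0)" using ext_carrier[OF i] insert.prems(2) by simp
    moreover have "f \<ominus>\<^bsub>T\<^esub> f \<in> ?D" using insert.prems(2) by (simp add: T.minus_eq T.r_neg)
    ultimately show ?case by blast
  next
    case (Suc m)
    then obtain x where x: "x \<in> ext i (sp i m)" "f \<ominus>\<^bsub>T\<^esub> x \<in> ?D" by auto
    have xc: "x \<in> carrier T" using ideal.Icarr[OF ext_ideal[OF i sp_sub[OF i]] x(1)] .
    let ?G = "filt Y Z (N - m)"
    have ab: "Suc m + (N - m) = Suc N" using Suc.prems by simp
    interpret E: ideal "ext i (sp i (Suc m)) <+>\<^bsub>T\<^esub> ?G" T using extG_ideal[OF i sp_ideal[OF i] st] .
    have fx: "f \<ominus>\<^bsub>T\<^esub> x \<in> ext i (sp i (Suc m)) <+>\<^bsub>T\<^esub> ?G" using x(2) filt_le_ext[OF i Y Z ab] by blast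
    have "x = f \<ominus>\<^bsub>T\<^esub> (f \<ominus>\<^bsub>T\<^esub> x)" using xc insert.prems(2) by algebra
    \<comment> \<open>Both \<open>f\<close> and \<open>f - x\<close> are in this ideal. So \<open>x\<close> is in the extension of the \<open>m\<close>-th power and also in the sum of that of
      the next power and \<open>G\<close> of exponent sum \<open>N - m\<close>; the products of the two have the right exponent sum \<open>N\<close>.\<close>
    hence xE: "x \<in> ext i (sp i (Suc m)) <+>\<^bsub>T\<^esub> ?G"
      using T.ideal_minus_closed[OF E.ideal_axioms pr[OF ab] fx] by simp
    let ?W = "ext i (sp i (Suc m)) <+>\<^bsub>T\<^esub> ?D"
    interpret X: ideal "ext i (sp i (Suc m))" T using ext_ideal[OF i sp_sub[OF i]] .
    have W: "ideal ?W T" using T.add_ideals[OF X.ideal_axioms D.ideal_axioms] .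
    have XW: "a \<in> ?W" if "a \<in> ext i (sp i (Suc m))" for a
      unfolding T.ideal_set_add_iff using that X.Icarr[OF that] D.zero_closed by (intro bexI[of _ a] bexI[of _ "\<zero>\<^bsub>T\<^esub>"]) auto
    have DW: "a \<in> ?W" if "a \<in> ?D" for a
      unfolding T.ideal_set_add_iff using that D.Icarr[OF that] X.zero_closed by (intro bexI[of _ "\<zero>\<^bsub>T\<^esub>"] bexI[of _ a]) auto
    have "x \<in> ?W"
    proof (rule slice_criterion[OF i sp_ideal[OF i] sp_ideal[OF i] st W _ _ x(1)])
      show "incl i ` sp i (Suc m) \<subseteq> ?W" using XW T.genideal_self[OF ext_sub[OF i sp_sub[OF i]], of "Suc m"] by blast
      show "incl i p \<otimes>\<^bsub>T\<^esub> g \<in> ?W" if "p \<in> sp i m" "g \<in> ?G" for p g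
        by (rule DW, rule incl_mult_filt[OF i Y Z(1) that]) (use Suc.prems in simp)
      show "slice i \<mu> x \<in> ?G" if "form i \<mu>" "\<And>j. j \<in> sp i (Suc m) \<Longrightarrow> \<mu> j = \<zero>\<^bsub>F\<^esub>" for \<mu>
        using xE that unfolding mem_extG_iff[OF i sp_ideal[OF i] st xc] by blast
    qed
    then obtain x' d where x': "x' \<in> ext i (sp i (Suc m))" "d \<in> ?D" "x = x' \<oplus>\<^bsub>T\<^esub> d" unfolding T.ideal_set_add_iff by blast
    have "f \<ominus>\<^bsub>T\<^esub> x' = (f \<ominus>\<^bsub>T\<^esub> x) \<oplus>\<^bsub>T\<^esub> d"
      unfolding x'(3) using X.Icarr[OF x'(1)] D.Icarr[OF x'(2)] insert.prems(2) by algebra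
    hence "f \<ominus>\<^bsub>T\<^esub> x' \<in> ?D" using x(2) x'(2) by simp
    thus ?case using x'(1) by blast
  qed
  obtain x where x: "x \<in> ext i (sp i N)" "f \<ominus>\<^bsub>T\<^esub> x \<in> ?D" using fin[of N] by auto
  have "ext i (sp i N) \<subseteq> ?D"
  proof (rule T.genideal_minimal[OF D.ideal_axioms], rule image_subsetI)
    fix p assume p: "p \<in> sp i N"
    have "\<one>\<^bsub>T\<^esub> \<in> filt Y Z 0" by (rule one_mem_filt[OF Y(1) Z(1)])
    hence "incl i p \<otimes>\<^bsub>T\<^esub> \<one>\<^bsub>T\<^esub> \<in> ?D" by (intro incl_mult_filt[OF i Y Z(1) p]) auto
    thus "incl i p \<in> ?D" using incl_closed[OF i sp_mem[OF i p]] by simp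
  qed
  hence "x \<in> ?D" using x by blast
  hence "(f \<ominus>\<^bsub>T\<^esub> x) \<oplus>\<^bsub>T\<^esub> x \<in> ?D" using x(2) by simp
  moreover have "(f \<ominus>\<^bsub>T\<^esub> x) \<oplus>\<^bsub>T\<^esub> x = f" using D.Icarr[OF \<open>x \<in> ?D\<close>] insert.prems(2) by algebra
  ultimately show ?case unfolding Z_def by simp
qed

lemma expand_primeideal: "primeideal (expand I) T"
proof (rule primeidealI)
  show "ideal (expand I) T" using expand_ideal by simp
  show "carrier T \<noteq> expand I" using one_notin_expand[OF order_refl] T.one_closed by metis
  show "a \<in> expand I \<or> b \<in> expand I" if "a \<in> carrier T" "b \<in> carrier T" "a \<otimes>\<^bsub>T\<^esub> b \<in> expand I" for a b
    using expand_prime[of a b] that by blast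
qed (rule T.cring_axioms)

end

section \<open>The binomial formula for symbolic powers\<close>

lemma (in cring) ideals_finsum_closed:
  assumes "\<And>a. a \<in> S \<Longrightarrow> ideal (f a) R" shows "ideal (finsum (ideals_set R) f S) R"
proof -
  interpret S: semiring "ideals_set R" by (rule ideals_set_is_semiring)
  have "finsum (ideals_set R) f S \<in> carrier (ideals_set R)"
    using assms by (intro S.finsum_closed) (auto simp: ideals_set_simps)
  thus ?thesis by (simp add: ideals_set_simps)
qed

lemma (in cring) ideals_finprod_closed:
  assumes "\<And>a. a \<in> S \<Longrightarrow> ideal (f a) R" shows "ideal (finprod (ideals_set R) f S) R"
proof -
  interpret S: comm_monoid "ideals_set R" by (rule ideals_set_is_comm_monoid)
  have "finprod (ideals_set R) f S \<in> carrier (ideals_set R)"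
    using assms by (intro S.finprod_closed) (auto simp: ideals_set_simps)
  thus ?thesis by (simp add: ideals_set_simps)
qed

lemma (in cring) ideals_finsum_insert:
  assumes "finite S" "a \<notin> S" "\<And>b. b \<in> insert a S \<Longrightarrow> ideal (f b) R"
  shows "finsum (ideals_set R) f (insert a S) = f a <+> finsum (ideals_set R) f S"
proof -
  interpret S: semiring "ideals_set R" by (rule ideals_set_is_semiring)
  have "finsum (ideals_set R) f (insert a S) = f a \<oplus>\<^bsub>ideals_set R\<^esub> finsum (ideals_set R) f S"
    using assms by (intro S.finsum_insert) (auto simp: ideals_set_simps)
  thus ?thesis by (simp add: ideals_set_simps)
qed

lemma (in cring) ideals_finprod_insert:
  assumes "finite S" "a \<notin> S" "\<And>b. b \<in> insert a S \<Longrightarrow> ideal (f b) R"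
  shows "finprod (ideals_set R) f (insert a S) = f a \<cdot> finprod (ideals_set R) f S"
proof -
  interpret S: comm_monoid "ideals_set R" by (rule ideals_set_is_comm_monoid)
  have "finprod (ideals_set R) f (insert a S) = f a \<otimes>\<^bsub>ideals_set R\<^esub> finprod (ideals_set R) f S"
    using assms by (intro S.finprod_insert) (auto simp: ideals_set_simps)
  thus ?thesis by (simp add: ideals_set_simps)
qed

lemma (in cring) ideals_empty:
  "finsum (ideals_set R) f {} = {\<zero>}" "finprod (ideals_set R) f {} = carrier R"
proof -
  interpret S: semiring "ideals_set R" by (rule ideals_set_is_semiring)
  interpret C: comm_monoid "ideals_set R" by (rule ideals_set_is_comm_monoid)
  show "finsum (ideals_set R) f {} = {\<zero>}" using S.finsum_empty by (simp add: ideals_set_simps)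
  show "finprod (ideals_set R) f {} = carrier R" using C.finprod_empty by (simp add: ideals_set_simps)
qed

lemma (in cring) ideals_finsum_subset:
  assumes "finite S" and W: "ideal W R" and f: "\<And>a. a \<in> S \<Longrightarrow> ideal (f a) R" "\<And>a. a \<in> S \<Longrightarrow> f a \<subseteq> W"
  shows "finsum (ideals_set R) f S \<subseteq> W"
  using assms(1) f
proof (induction S)
  case empty
  interpret W: ideal W R by fact
  show ?case by (simp add: ideals_empty)
next
  case (insert a S)
  interpret W: ideal W R by fact
  have sub: "finsum (ideals_set R) f S \<subseteq> W" "f a \<subseteq> W" using insert by auto
  show ?case
  proof
    fix x assume "x \<in> finsum (ideals_set R) f (insert a S)"
    moreover have "finsum (ideals_set R) f (insert a S) = f a <+> finsum (ideals_set R) f S"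
      using insert.prems(1) by (intro ideals_finsum_insert insert.hyps) auto
    ultimately have "x \<in> f a <+> finsum (ideals_set R) f S" by simp
    then obtain y z where "y \<in> f a" "z \<in> finsum (ideals_set R) f S" "x = y \<oplus> z"
      unfolding ideal_set_add_iff by blast
    thus "x \<in> W" using sub W.a_closed by auto
  qed
qed

lemma (in cring) subset_ideals_finsum:
  assumes "finite S" and a: "a \<in> S" and f: "\<And>a. a \<in> S \<Longrightarrow> ideal (f a) R"
  shows "f a \<subseteq> finsum (ideals_set R) f S"
proof
  fix x assume x: "x \<in> f a"
  have ins: "insert a (S - {a}) = S" using a by auto
  interpret G: ideal "finsum (ideals_set R) f (S - {a})" R using f by (intro ideals_finsum_closed) auto
  have "finsum (ideals_set R) f (insert a (S - {a})) = f a <+> finsum (ideals_set R) f (S - {a})"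
    using assms by (intro ideals_finsum_insert) auto
  moreover have "x = x \<oplus> \<zero>" using ideal.Icarr[OF f[OF a] x] by simp
  ultimately show "x \<in> finsum (ideals_set R) f S"
    unfolding ins using x G.zero_closed ideal_set_add_iff by metis
qed

lemma (in cring) finprod_mem_ideals_finprod:
  assumes "finite S" "\<And>a. a \<in> S \<Longrightarrow> ideal (f a) R" "\<And>a. a \<in> S \<Longrightarrow> x a \<in> f a"
  shows "(\<Otimes>a\<in>S. x a) \<in> finprod (ideals_set R) f S"
  using assms
proof (induction S)
  case empty
  show ?case by (simp add: ideals_empty)
next
  case (insert a S)
  have xc: "x b \<in> carrier R" if "b \<in> insert a S" for b using ideal.Icarr[OF insert.prems(1)[OF that] insert.prems(2)[OF that]] .
  have "(\<Otimes>b\<in>insert a S. x b) = x a \<otimes> (\<Otimes>b\<in>S. x b)" using insert(1,2) xc by (intro finprod_insert) auto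
  moreover have "(\<Otimes>b\<in>S. x b) \<in> finprod (ideals_set R) f S" using insert by auto
  hence "x a \<otimes> (\<Otimes>b\<in>S. x b) \<in> f a \<cdot> finprod (ideals_set R) f S"
    using insert.prems(2)[of a] by (intro ideal_prod.prod) auto
  moreover have "finprod (ideals_set R) f (insert a S) = f a \<cdot> finprod (ideals_set R) f S"
    using insert.prems(1) by (intro ideals_finprod_insert insert.hyps) auto
  ultimately show ?case by simp
qed

lemma (in cring) finprod_mem_ideal_pow:
  assumes Q: "ideal Q R" and "finite S" "\<And>a. a \<in> S \<Longrightarrow> x a \<in> Q [^]\<^bsub>ideals_set R\<^esub> (c a :: nat)"
  shows "(\<Otimes>a\<in>S. x a) \<in> Q [^]\<^bsub>ideals_set R\<^esub> (\<Sum>a\<in>S. c a)"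
  using assms(2,3)
proof (induction S)
  case empty
  show ?case by (simp add: ideals_set_simps)
next
  case (insert a S)
  have xc: "x b \<in> carrier R" if "b \<in> insert a S" for b
    using ideal.Icarr[OF ideal_pow_ideal[OF Q] insert.prems[OF that]] .
  have "(\<Otimes>b\<in>insert a S. x b) = x a \<otimes> (\<Otimes>b\<in>S. x b)" using insert(1,2) xc by (intro finprod_insert) auto
  thus ?case using ideal_pow_mult_mem[OF Q insert.prems[of a] insert.IH] insert by simp
qed

lemma (in ring) set_add_zero: "S \<subseteq> carrier R \<Longrightarrow> S <+> {\<zero>} = S"
  by (force simp: set_add_def')

context separated_prime_family
begin

lemma finsum_ext: "finsum (ideals_set T) (\<lambda>i. ext i (P i)) I = expand I"
proof -
  have "finsum (ideals_set T) (\<lambda>i. ext i (P i)) Y = expand Y" if "finite Y" "Y \<subseteq> I" for Y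
    using that
  proof (induction Y)
    case empty
    have "expand {} = {\<zero>\<^bsub>T\<^esub>}"
    proof
      show "expand {} \<subseteq> {\<zero>\<^bsub>T\<^esub>}" unfolding expand_def by (rule T.genideal_minimal[OF T.zeroideal]) simp
      interpret W: ideal "expand {}" T using expand_ideal by simp
      show "{\<zero>\<^bsub>T\<^esub>} \<subseteq> expand {}" by simp
    qed
    thus ?case by (simp add: T.ideals_empty)
  next
    case (insert i Y)
    have id: "ideal (ext j (P j)) T" if "j \<in> insert i Y" for j
      using insert.prems that ext_ideal[OF _ P_sub] by blast
    have "finsum (ideals_set T) (\<lambda>i. ext i (P i)) (insert i Y) =
        ext i (P i) <+>\<^bsub>T\<^esub> finsum (ideals_set T) (\<lambda>i. ext i (P i)) Y"
      using id by (intro T.ideals_finsum_insert insert.hyps) auto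
    moreover have "i \<in> I" "Y \<subseteq> I" using insert.prems by auto
    ultimately show ?case using insert.IH expand_insert[of i Y] by simp
  qed
  thus ?thesis using finite_index by blast
qed

text \<open>Together with \<open>symbolic_ext_le\<close> and \<open>incl_sp_mem\<close>, this gives that taking symbolic powers commutes with the
extension to \<open>T\<close>.\<close>
lemma ext_pow_le: assumes i: "i \<in> I" shows "(ext i (P i)) [^]\<^bsub>ideals_set T\<^esub> (k::nat) \<subseteq> ext i (sp i k)"
proof (induction k)
  case 0
  have "sp i 0 = carrier (R i)" using cring.symbolic_power_0[OF factor_cring[OF i]] .
  thus ?case using ext_carrier[OF i] by (simp add: ideals_set_simps)
next
  case (Suc k)
  interpret W: ideal "ext i (sp i (Suc k))" T using ext_ideal[OF i sp_sub[OF i]] .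
  have m: "x \<otimes>\<^bsub>T\<^esub> y \<in> ext i (sp i (Suc k))" if "x \<in> ext i (sp i k)" "y \<in> ext i (P i)" for x y
  proof (rule T.genideal_mult_mem[OF W.ideal_axioms ext_sub[OF i sp_sub[OF i]] ext_sub[OF i P_sub[OF i]] _ that])
    fix y z assume "y \<in> incl i ` sp i k" "z \<in> incl i ` P i"
    then obtain p q where p: "p \<in> sp i k" "y = incl i p" and q: "q \<in> P i" "z = incl i q" by blast
    have "p \<otimes>\<^bsub>R i\<^esub> q \<in> sp i (Suc k)" using cring.symbolic_power_mult[OF factor_cring[OF i] prime[OF i] p(1) q(1)] .
    moreover have "y \<otimes>\<^bsub>T\<^esub> z = incl i (p \<otimes>\<^bsub>R i\<^esub> q)"
      unfolding p(2) q(2) using incl_mult[OF i sp_mem[OF i p(1)]] P_sub[OF i] q(1) by auto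
    ultimately show "y \<otimes>\<^bsub>T\<^esub> z \<in> ext i (sp i (Suc k))" using T.genideal_self[OF ext_sub[OF i sp_sub[OF i]], of "Suc k"] by auto
  qed
  show ?case
  proof
    fix x assume "x \<in> (ext i (P i)) [^]\<^bsub>ideals_set T\<^esub> (Suc k)"
    hence "x \<in> ((ext i (P i)) [^]\<^bsub>ideals_set T\<^esub> k) \<cdot>\<^bsub>T\<^esub> ext i (P i)" by (simp add: ideals_set_simps)
    thus "x \<in> ext i (sp i (Suc k))"
      by (induction x rule: ideal_prod.induct) (use m Suc W.a_closed in auto)
  qed
qed

lemma ext_subset_expand: "i \<in> I \<Longrightarrow> ext i (P i) \<subseteq> expand I"
  using T.genideal_minimal[of "expand I" "incl i ` P i"] expand_ideal[of I] expand_mem[of I] by blast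

text \<open>A multiplier \<open>u \<notin> P\<^sub>i\<close> for \<open>r\<close> is also a multiplier in \<open>T\<close>, since its image lies outside the sum of the extended
primes and a fortiori outside the extension of \<open>P\<^sub>i\<close>.\<close>
lemma incl_sp_mem:
  assumes i: "i \<in> I" and pr: "primeideal (ext i (P i)) T" and r: "r \<in> sp i k"
  shows "incl i r \<in> symbolic_power T (ext i (P i)) k"
proof -
  interpret Ri: cring "R i" using factor_cring[OF i] .
  obtain u where u: "r \<in> carrier (R i)" "u \<in> carrier (R i)" "u \<notin> P i" "u \<otimes>\<^bsub>R i\<^esub> r \<in> P i [^]\<^bsub>ideals_set (R i)\<^esub> k"
    using r unfolding Ri.symbolic_power_iff[OF prime[OF i]] by blast
  have "incl i (u \<otimes>\<^bsub>R i\<^esub> r) \<in> ext i (P i) [^]\<^bsub>ideals_set T\<^esub> k"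
    by (rule Ri.hom_ideal_pow[OF T.cring_axioms incl_hom[OF i] P_ideal[OF i] ext_ideal[OF i P_sub[OF i]]
          T.genideal_self[OF ext_sub[OF i P_sub[OF i]]] u(4)])
  hence "incl i u \<otimes>\<^bsub>T\<^esub> incl i r \<in> ext i (P i) [^]\<^bsub>ideals_set T\<^esub> k" using incl_mult[OF i u(2,1)] by simp
  moreover have "incl i u \<notin> ext i (P i)"
    using incl_mem_expand[OF i u(2)] u(3) ext_subset_expand[OF i] by blast
  ultimately show ?thesis unfolding T.symbolic_power_iff[OF pr] using incl_closed[OF i] u(1,2) by blast
qed

text \<open>The case \<open>G = 0\<close> of \<open>symbolic_primary\<close>: an element outside the prime \<open>P\<^sub>i T\<close> is a nonzerodivisor modulo it, hence
modulo the extensions of all symbolic powers of \<open>P\<^sub>i\<close>.\<close>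
lemma symbolic_ext_le:
  assumes i: "i \<in> I" and pr: "primeideal (ext i (P i)) T"
  shows "symbolic_power T (ext i (P i)) k \<subseteq> ext i (sp i k)"
proof
  fix x assume "x \<in> symbolic_power T (ext i (P i)) k"
  then obtain u where u: "x \<in> carrier T" "u \<in> carrier T" "u \<notin> ext i (P i)" "u \<otimes>\<^bsub>T\<^esub> x \<in> ext i (P i) [^]\<^bsub>ideals_set T\<^esub> k"
    unfolding T.symbolic_power_iff[OF pr] by blast
  interpret pr: primeideal "ext i (P i)" T by (rule pr)
  have st: "stable i {\<zero>\<^bsub>T\<^esub>}" unfolding stable_def using T.zeroideal slice_zero[OF i] by simp
  have sub: "ext i J \<subseteq> carrier T" if "J \<subseteq> carrier (R i)" for J using ideal.Icarr[OF ext_ideal[OF i that]] by blast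
  have z: "ext i J <+>\<^bsub>T\<^esub> {\<zero>\<^bsub>T\<^esub>} = ext i J" if "J \<subseteq> carrier (R i)" for J using T.set_add_zero[OF sub[OF that]] .
  have "u \<otimes>\<^bsub>T\<^esub> x \<in> ext i (sp i k)" using u(4) ext_pow_le[OF i] by blast
  hence "x \<in> ext i (sp i k) <+>\<^bsub>T\<^esub> {\<zero>\<^bsub>T\<^esub>}"
    using pr.I_prime[OF u(2)] u(3)
    by (intro symbolic_primary[OF i st u(2) _ u(1)]) (auto simp: z[OF P_sub[OF i]] z[OF sp_sub[OF i]])
  thus "x \<in> ext i (sp i k)" unfolding z[OF sp_sub[OF i]] .
qed

lemma finprod_le_filt:
  assumes pr: "\<And>i. i \<in> I \<Longrightarrow> primeideal (ext i (P i)) T" and Y: "finite Y" "Y \<subseteq> I"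
  shows "finprod (ideals_set T) (\<lambda>i. symbolic_power T (ext i (P i)) (a i)) Y \<subseteq> filt Y {} (\<Sum>i\<in>Y. a i)"
  using Y
proof (induction Y)
  case empty
  interpret W: ideal "filt {} {} 0" T using filt_ideal by simp
  have "filt {} {} 0 = carrier T" using W.one_imp_carrier one_mem_filt[of "{}" "{}"] by simp
  thus ?case by (simp add: T.ideals_empty)
next
  case (insert i Y)
  have i: "i \<in> I" and Y: "Y \<subseteq> I" "i \<notin> Y" and iY: "insert i Y \<subseteq> I" using insert by auto
  let ?S = "\<lambda>i. symbolic_power T (ext i (P i)) (a i)"
  have id: "ideal (?S j) T" if "j \<in> insert i Y" for j using T.symbolic_power_ideal[OF pr] that iY by blast
  let ?W = "filt (insert i Y) {} (a i + (\<Sum>j\<in>Y. a j))"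
  interpret W: ideal ?W T using filt_ideal[OF iY] by simp
  show ?case
  proof
    fix x assume "x \<in> finprod (ideals_set T) ?S (insert i Y)"
    moreover have "finprod (ideals_set T) ?S (insert i Y) = ?S i \<cdot>\<^bsub>T\<^esub> finprod (ideals_set T) ?S Y"
      using id by (intro T.ideals_finprod_insert insert.hyps) auto
    ultimately have "x \<in> ?S i \<cdot>\<^bsub>T\<^esub> finprod (ideals_set T) ?S Y" by simp
    hence "x \<in> ?W"
    proof (induction x rule: ideal_prod.induct)
      case (prod s t)
      have s: "s \<in> ext i (sp i (a i))" using symbolic_ext_le[OF i pr[OF i]] prod(1) by blast
      have t: "t \<in> filt Y {} (\<Sum>j\<in>Y. a j)" using insert.IH[OF Y(1)] prod(2) by blast
      have tc: "t \<in> carrier T" using ideal.Icarr[OF filt_ideal[OF Y(1)] t] by simp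
      have sc: "s \<in> carrier T" using ideal.Icarr[OF ext_ideal[OF i sp_sub[OF i]] s] .
      have "t \<otimes>\<^bsub>T\<^esub> s \<in> ?W"
      proof (rule T.mult_genideal_mem[OF W.ideal_axioms ext_sub[OF i sp_sub[OF i]] tc _ s])
        fix y assume "y \<in> incl i ` sp i (a i)"
        then obtain p where p: "p \<in> sp i (a i)" "y = incl i p" by blast
        have "incl i p \<otimes>\<^bsub>T\<^esub> t \<in> ?W" by (rule incl_mult_filt[OF i Y _ p(1) t]) auto
        thus "t \<otimes>\<^bsub>T\<^esub> y \<in> ?W" unfolding p(2) using T.m_comm[OF tc incl_closed[OF i sp_mem[OF i p(1)]]] by simp
      qed
      thus ?case using T.m_comm[OF sc tc] by simp
    next
      case (sum s t)
      thus ?case using W.a_closed by simp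
    qed
    thus "x \<in> filt (insert i Y) {} (\<Sum>j\<in>insert i Y. a j)" using insert(1,2) by simp
  qed
qed

lemma expand_pow_le_filt: "(expand I) [^]\<^bsub>ideals_set T\<^esub> N \<subseteq> filt I {} N"
proof (induction N)
  case 0
  interpret W: ideal "filt I {} 0" T using filt_ideal by simp
  have "filt I {} 0 = carrier T" using W.one_imp_carrier one_mem_filt[of I "{}"] by simp
  thus ?case by (simp add: ideals_set_simps)
next
  case (Suc N)
  interpret W: ideal "filt I {} (Suc N)" T using filt_ideal by simp
  have m: "x \<otimes>\<^bsub>T\<^esub> y \<in> filt I {} (Suc N)" if "x \<in> filt I {} N" "y \<in> expand I" for x y
  proof (rule T.genideal_mult_mem[OF W.ideal_axioms _ gens_sub _ that[unfolded filt_def expand_def]])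
    show "gens I N \<union> (\<Union>j\<in>{}. incl j ` P j) \<subseteq> carrier T" using filt_gens_sub[of I "{}"] by simp
    fix y z assume "y \<in> gens I N \<union> (\<Union>j\<in>{}. incl j ` P j)" "z \<in> (\<Union>j\<in>I. incl j ` P j)"
    hence y: "y \<in> gens I N" and "\<exists>j\<in>I. \<exists>p\<in>P j. z = incl j p" by auto
    then obtain j p where j: "j \<in> I" and p: "p \<in> P j" "z = incl j p" by blast
    obtain r a where r: "\<And>j. j \<in> I \<Longrightarrow> r j \<in> sp j (a j)" "(\<Sum>j\<in>I. a j) \<ge> N"
      "y = (\<Otimes>\<^bsub>T\<^esub>j\<in>I. incl j (r j))" using gensE[OF y] by blast
    let ?Y = "I - {j}"
    have ins: "insert j ?Y = I" using j by auto
    \<comment> \<open>A further factor from \<open>P\<^sub>j\<close> is absorbed into the \<open>j\<close>-th entry and raises its exponent by one.\<close>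
    define r' where "r' = r(j := r j \<otimes>\<^bsub>R j\<^esub> p)"
    define a' where "a' = a(j := Suc (a j))"
    have r': "r' k \<in> sp k (a' k)" if "k \<in> insert j ?Y" for k
      using that r(1) cring.symbolic_power_mult[OF factor_cring[OF j] prime[OF j] r(1)[OF j] p(1)] ins
      unfolding r'_def a'_def by auto
    have r0: "r k \<in> sp k (a k)" if "k \<in> insert j ?Y" for k using that r(1) ins by auto
    have same: "(\<Otimes>\<^bsub>T\<^esub>k\<in>?Y. incl k (r' k)) = (\<Otimes>\<^bsub>T\<^esub>k\<in>?Y. incl k (r k))"
      using incl_sp_closed[OF _ r0, of "insert j ?Y"] j unfolding r'_def by (intro T.finprod_cong') auto
    have cl: "(\<Otimes>\<^bsub>T\<^esub>k\<in>?Y. incl k (r k)) \<in> carrier T"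
      using incl_sp_closed[OF _ r0, of "insert j ?Y"] j by (intro T.finprod_closed) auto
    have rj: "r j \<in> carrier (R j)" and pj: "p \<in> carrier (R j)" using sp_mem[OF j r(1)[OF j]] P_sub[OF j] p(1) by auto
    have "(\<Otimes>\<^bsub>T\<^esub>k\<in>I. incl k (r' k)) = incl j (r' j) \<otimes>\<^bsub>T\<^esub> (\<Otimes>\<^bsub>T\<^esub>k\<in>?Y. incl k (r k))"
      using prod_insert[of j ?Y r' a', OF j _ _ r'] unfolding same ins by blast
    also have "\<dots> = incl j (r j) \<otimes>\<^bsub>T\<^esub> (\<Otimes>\<^bsub>T\<^esub>k\<in>?Y. incl k (r k)) \<otimes>\<^bsub>T\<^esub> incl j p"
      unfolding r'_def using cl rj pj j by (simp add: incl_mult T.m_ac)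
    also have "incl j (r j) \<otimes>\<^bsub>T\<^esub> (\<Otimes>\<^bsub>T\<^esub>k\<in>?Y. incl k (r k)) = y"
      using prod_insert[of j ?Y r a, OF j _ _ r0] unfolding r(3) ins by auto
    finally have yz: "y \<otimes>\<^bsub>T\<^esub> z = (\<Otimes>\<^bsub>T\<^esub>k\<in>I. incl k (r' k))" unfolding p(2) by simp
    have "(\<Sum>k\<in>I. a' k) = Suc (a j) + (\<Sum>k\<in>?Y. a' k)" using sum.remove[OF finite_index j, of a'] by (simp add: a'_def)
    also have "(\<Sum>k\<in>?Y. a' k) = (\<Sum>k\<in>?Y. a k)" by (intro sum.cong) (auto simp: a'_def)
    also have "Suc (a j) + \<dots> = Suc (\<Sum>k\<in>I. a k)" using sum.remove[OF finite_index j, of a] by simp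
    finally have "(\<Sum>k\<in>I. a' k) \<ge> Suc N" using r(2) by simp
    hence "y \<otimes>\<^bsub>T\<^esub> z \<in> gens I (Suc N)" unfolding yz using r' ins by (intro gensI[of I r' a']) auto
    thus "y \<otimes>\<^bsub>T\<^esub> z \<in> filt I {} (Suc N)" using filt_mem(1)[of I "{}"] by simp
  qed simp
  show ?case
  proof
    fix x assume "x \<in> (expand I) [^]\<^bsub>ideals_set T\<^esub> (Suc N)"
    hence "x \<in> ((expand I) [^]\<^bsub>ideals_set T\<^esub> N) \<cdot>\<^bsub>T\<^esub> expand I" by (simp add: ideals_set_simps)
    thus "x \<in> filt I {} (Suc N)"
      by (induction x rule: ideal_prod.induct) (use m Suc W.a_closed in auto)
  qed
qed

text \<open>The entries of a generator have multipliers outside the primes \<open>P\<^sub>j\<close>, and the product of these is outside the prime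
sum of the extended primes.\<close>
lemma filt_le_symbolic: "filt I {} N \<subseteq> symbolic_power T (expand I) N"
  unfolding filt_def
proof (rule T.genideal_minimal[OF T.symbolic_power_ideal[OF expand_primeideal]])
  interpret Q: primeideal "expand I" T by (rule expand_primeideal)
  have "gens I N \<subseteq> symbolic_power T (expand I) N"
  proof
    fix y assume y: "y \<in> gens I N"
    obtain r a where r: "\<And>j. j \<in> I \<Longrightarrow> r j \<in> sp j (a j)" "(\<Sum>j\<in>I. a j) \<ge> N"
      "y = (\<Otimes>\<^bsub>T\<^esub>j\<in>I. incl j (r j))" using gensE[OF y] by blast
    have "\<forall>j\<in>I. \<exists>v. v \<in> carrier (R j) \<and> v \<notin> P j \<and> v \<otimes>\<^bsub>R j\<^esub> r j \<in> P j [^]\<^bsub>ideals_set (R j)\<^esub> a j"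
      using r(1) cring.symbolic_power_iff[OF factor_cring prime] by blast
    from bchoice[OF this] obtain v where
      v: "\<And>j. j \<in> I \<Longrightarrow> v j \<in> carrier (R j) \<and> v j \<notin> P j \<and> v j \<otimes>\<^bsub>R j\<^esub> r j \<in> P j [^]\<^bsub>ideals_set (R j)\<^esub> a j" by blast
    have rc: "r j \<in> carrier (R j)" if "j \<in> I" for j using sp_mem[OF that r(1)[OF that]] .
    have vc: "v j \<in> carrier (R j)" "v j \<notin> P j" "v j \<otimes>\<^bsub>R j\<^esub> r j \<in> P j [^]\<^bsub>ideals_set (R j)\<^esub> a j" if "j \<in> I" for j using v[OF that] by auto
    let ?V = "\<lambda>Y. \<Otimes>\<^bsub>T\<^esub>j\<in>Y. incl j (v j)"
    have V: "?V Y \<in> carrier T \<and> ?V Y \<notin> expand I" if "finite Y" "Y \<subseteq> I" for Y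
      using that
    proof (induction Y)
      case empty
      show ?case using one_notin_expand[OF order_refl] by simp
    next
      case (insert j Y)
      have j: "j \<in> I" using insert by simp
      have c: "incl j (v j) \<in> carrier T" if "j \<in> I" for j using incl_closed[OF that vc(1)[OF that]] .
      have "?V (insert j Y) = incl j (v j) \<otimes>\<^bsub>T\<^esub> ?V Y" using insert(1,2,4) c by (intro T.finprod_insert) auto
      moreover have "incl j (v j) \<notin> expand I" using incl_mem_expand[OF j vc(1)[OF j]] vc(2)[OF j] by blast
      ultimately show ?case using insert c[OF j] Q.I_prime[OF c[OF j], of "?V Y"] by auto
    qed
    have "?V I \<otimes>\<^bsub>T\<^esub> y = (\<Otimes>\<^bsub>T\<^esub>j\<in>I. incl j (v j) \<otimes>\<^bsub>T\<^esub> incl j (r j))"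
      unfolding r(3) using vc(1) rc by (intro T.finprod_multf[symmetric]) auto
    moreover have "\<dots> \<in> (expand I) [^]\<^bsub>ideals_set T\<^esub> (\<Sum>j\<in>I. a j)"
    proof (rule T.finprod_mem_ideal_pow[OF Q.ideal_axioms finite_index])
      fix j assume j: "j \<in> I"
      have "incl j (v j \<otimes>\<^bsub>R j\<^esub> r j) \<in> (expand I) [^]\<^bsub>ideals_set T\<^esub> a j"
        by (rule cring.hom_ideal_pow[OF factor_cring[OF j] T.cring_axioms incl_hom[OF j] P_ideal[OF j] Q.ideal_axioms _ vc(3)[OF j]])
           (use expand_mem[of I j] j in auto)
      thus "incl j (v j) \<otimes>\<^bsub>T\<^esub> incl j (r j) \<in> (expand I) [^]\<^bsub>ideals_set T\<^esub> a j" using incl_mult[OF j vc(1)[OF j] rc[OF j]] by simp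
    qed
    ultimately have "?V I \<otimes>\<^bsub>T\<^esub> y \<in> (expand I) [^]\<^bsub>ideals_set T\<^esub> N"
      using T.ideal_pow_antimono[OF Q.ideal_axioms r(2)] by auto
    moreover have "y \<in> carrier T" using gens_sub_T[of I N] y by auto
    ultimately show "y \<in> symbolic_power T (expand I) N"
      unfolding T.symbolic_power_iff[OF expand_primeideal] using V[OF finite_index order_refl] by blast
  qed
  thus "gens I N \<union> (\<Union>j\<in>{}. incl j ` P j) \<subseteq> symbolic_power T (expand I) N" by simp
qed

text \<open>A multiplier for \<open>f\<close> maps it into a power of the sum, hence into the filtration ideal, where the multiplier can
be cancelled.\<close>
lemma symbolic_power_expand: "symbolic_power T (expand I) N = filt I {} N"
proof
  show "symbolic_power T (expand I) N \<subseteq> filt I {} N"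
  proof
    fix f assume "f \<in> symbolic_power T (expand I) N"
    then obtain u where u: "f \<in> carrier T" "u \<in> carrier T" "u \<notin> expand I" "u \<otimes>\<^bsub>T\<^esub> f \<in> (expand I) [^]\<^bsub>ideals_set T\<^esub> N"
      unfolding T.symbolic_power_iff[OF expand_primeideal] by blast
    have "u \<otimes>\<^bsub>T\<^esub> f \<in> filt I (I - I) N" using u(4) expand_pow_le_filt by auto
    thus "f \<in> filt I {} N" using filt_symbolic[OF u(2,3) finite_index order_refl u(1)] by simp
  qed
qed (rule filt_le_symbolic)

text \<open>The primality assumption follows from the case of a family with only one nonzero prime; it is kept separate
because that case is another instance of the locale.\<close>
theorem symbolic_power_binomial:
  assumes pr: "\<And>i. i \<in> I \<Longrightarrow> primeideal (ext i (P i)) T"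
  shows "symbolic_power T (\<Oplus>\<^bsub>ideals_set T\<^esub>i\<in>I. ext i (P i)) N =
    (\<Oplus>\<^bsub>ideals_set T\<^esub>a\<in>{a \<in> I \<rightarrow>\<^sub>E (UNIV :: nat set). (\<Sum>i\<in>I. a i) = N}.
       \<Otimes>\<^bsub>ideals_set T\<^esub>i\<in>I. symbolic_power T (ext i (P i)) (a i))"
proof -
  define As where "As = {a \<in> I \<rightarrow>\<^sub>E (UNIV :: nat set). (\<Sum>i\<in>I. a i) = N}"
  let ?S = "\<lambda>a i. symbolic_power T (ext i (P i)) (a i)"
  let ?B = "\<lambda>a. finprod (ideals_set T) (?S a) I"
  have "a i \<le> N" if "a \<in> As" "i \<in> I" for a i
    using that member_le_sum[OF that(2), of a] finite_index unfolding As_def by auto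
  moreover have "As \<subseteq> extensional I" unfolding As_def by (auto simp: PiE_iff)
  ultimately have "As \<subseteq> I \<rightarrow>\<^sub>E {..N}" by (auto simp: PiE_iff extensional_def)
  hence fin: "finite As" using finite_index by (meson finite_PiE finite_atMost finite_subset)
  have idS: "ideal (?S a i) T" if "i \<in> I" for a i using T.symbolic_power_ideal[OF pr[OF that]] .
  have idB: "ideal (?B a) T" for a using T.ideals_finprod_closed[OF idS] .
  have "finsum (ideals_set T) ?B As \<subseteq> filt I {} N"
  proof (rule T.ideals_finsum_subset[OF fin _ idB])
    show "?B a \<subseteq> filt I {} N" if "a \<in> As" for a
      using finprod_le_filt[OF pr finite_index order_refl, of a] that unfolding As_def by auto
  qed (use filt_ideal in auto)
  moreover have "filt I {} N \<subseteq> finsum (ideals_set T) ?B As"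
    unfolding filt_def
  proof (rule T.genideal_minimal[OF T.ideals_finsum_closed[OF idB]])
    have "gens I N \<subseteq> finsum (ideals_set T) ?B As"
    proof
      fix y assume y: "y \<in> gens I N"
      obtain r c where r: "\<And>j. j \<in> I \<Longrightarrow> r j \<in> sp j (c j)" "(\<Sum>j\<in>I. c j) \<ge> N"
        "y = (\<Otimes>\<^bsub>T\<^esub>j\<in>I. incl j (r j))" using gensE[OF y] by blast
      \<comment> \<open>The exponents of a generator may add up to more than \<open>N\<close>; they can be lowered, as the symbolic powers decrease.\<close>
      obtain b where b: "\<forall>j\<in>I. b j \<le> c j" "(\<Sum>j\<in>I. b j) = N"
        using exists_smaller_with_sum[OF finite_index r(2)] by blast
      define a where "a = restrict b I"
      have aA: "a \<in> As" unfolding As_def a_def using b(2) by (auto cong: sum.cong)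
      have "incl j (r j) \<in> ?S a j" if j: "j \<in> I" for j
      proof -
        have "r j \<in> sp j (a j)" using r(1)[OF j] sp_antimono[OF j] b(1) j unfolding a_def by auto
        thus ?thesis using incl_sp_mem[OF j pr[OF j]] by blast
      qed
      hence "y \<in> ?B a" unfolding r(3) by (intro T.finprod_mem_ideals_finprod[OF finite_index idS])
      thus "y \<in> finsum (ideals_set T) ?B As" using T.subset_ideals_finsum[of As a ?B, OF fin aA idB] by auto
    qed
    thus "gens I N \<union> (\<Union>j\<in>{}. incl j ` P j) \<subseteq> finsum (ideals_set T) ?B As" by simp
  qed
  ultimately show ?thesis unfolding finsum_ext symbolic_power_expand As_def by blast
qed

end

section \<open>Affine algebras over an algebraically closed field\<close>

text \<open>When all other primes are zero, the sum of the extended primes is a single extended prime; so its primality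
is a case of \<open>expand_primeideal\<close>.\<close>
lemma (in separated_prime_family) expand_eq_ext:
  assumes i: "i \<in> I" and zero: "\<And>j. j \<in> I \<Longrightarrow> j \<noteq> i \<Longrightarrow> P j = {\<zero>\<^bsub>R j\<^esub>}"
  shows "expand I = ext i (P i)"
proof
  interpret W: ideal "ext i (P i)" T using ext_ideal[OF i P_sub[OF i]] .
  show "expand I \<subseteq> ext i (P i)"
    unfolding expand_def
  proof (rule T.genideal_minimal[OF W.ideal_axioms], intro UN_least image_subsetI)
    fix j p assume j: "j \<in> I" and p: "p \<in> P j"
    show "incl j p \<in> ext i (P i)"
    proof (cases "j = i")
      case True
      thus ?thesis using p T.genideal_self[OF ext_sub[OF i P_sub[OF i]]] by blast
    next
      case False
      hence "p = \<zero>\<^bsub>R j\<^esub>" using zero[OF j] p by blast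
      thus ?thesis using incl_zero[OF j] W.zero_closed by simp
    qed
  qed
qed (rule ext_subset_expand[OF i])

lemma separated_prime_family_affine:
  assumes F: "algebraically_closed F" and fin: "finite I" "I \<noteq> {}"
    and R: "\<And>i. i \<in> I \<Longrightarrow> affine_algebra F (R i)" and P: "\<And>i. i \<in> I \<Longrightarrow> primeideal (P i) (R i)"
  shows "separated_prime_family F I R P"
proof -
  interpret F: algebraically_closed F by fact
  interpret algebra_family F I R
  proof (rule algebra_family.intro[OF F.field_axioms algebra_family_axioms.intro])
    show "algebra F (R i)" if "i \<in> I" for i using R[OF that] unfolding affine_algebra_def by (rule conjunct1)
  qed (rule fin)+
  show ?thesis
  proof (rule separated_prime_family.intro[OF algebra_family_axioms separated_prime_family_axioms.intro])
    fix i a assume i: "i \<in> I" and a: "a \<in> carrier (R i)" "a \<notin> P i"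
    obtain \<phi> where "\<phi> \<in> ring_hom (R i) F" "\<forall>c\<in>carrier F. \<phi> (c \<odot>\<^bsub>R i\<^esub> \<one>\<^bsub>R i\<^esub>) = c"
      "\<forall>p\<in>P i. \<phi> p = \<zero>\<^bsub>F\<^esub>" "\<phi> a \<noteq> \<zero>\<^bsub>F\<^esub>"
      using separating_point_of_affine_algebra[OF F R[OF i] P[OF i] a] by blast
    thus "\<exists>\<phi>. character i \<phi> \<and> (\<forall>p\<in>P i. \<phi> p = \<zero>\<^bsub>F\<^esub>) \<and> \<phi> a \<noteq> \<zero>\<^bsub>F\<^esub>"
      unfolding character_def by blast
  qed (rule P)
qed

theorem theorem2p8:
  fixes F :: "'f ring"
    and R :: "nat \<Rightarrow> ('f, 'a) module"
    and P :: "nat \<Rightarrow> 'a set"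
    and n N :: nat
  defines "T \<equiv> tensor_ring F {1..n} R"
    and "P' \<equiv> \<lambda>i. expanded_ideal F {1..n} R i (P i)"
  assumes "algebraically_closed F"
    and "n \<ge> 2"
    and "\<And>i. i \<in> {1..n} \<Longrightarrow> affine_algebra F (R i)"
    and "\<And>i. i \<in> {1..n} \<Longrightarrow> domain (R i)"
    and "\<And>i. i \<in> {1..n} \<Longrightarrow> primeideal (P i) (R i)"
  shows "symbolic_power T (\<Oplus>\<^bsub>ideals_set T\<^esub>i\<in>{1..n}. P' i) N =
    (\<Oplus>\<^bsub>ideals_set T\<^esub>A\<in>{A \<in> {1..n} \<rightarrow>\<^sub>E (UNIV :: nat set). (\<Sum>i\<in>{1..n}. A i) = N}.
       \<Otimes>\<^bsub>ideals_set T\<^esub>i\<in>{1..n}. symbolic_power T (P' i) (A i))"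
proof -
  have fin: "finite {1..n}" "{1..n} \<noteq> {}" using \<open>n \<ge> 2\<close> by auto
  interpret S: separated_prime_family F "{1..n}" R P
    by (rule separated_prime_family_affine[OF assms(3) fin assms(5,7)])
  have P'_eq: "P' = (\<lambda>i. S.ext i (P i))"
    unfolding P'_def expanded_ideal_def S.incl_eq by simp
  have "primeideal (S.ext i (P i)) T" if i: "i \<in> {1..n}" for i
  proof -
    \<comment> \<open>The family in which every prime but the \<open>i\<close>-th is replaced by zero, which is prime in a domain.\<close>
    define P0 where "P0 j = (if j = i then P i else {\<zero>\<^bsub>R j\<^esub>})" for j
    have prime0: "primeideal (P0 j) (R j)" if "j \<in> {1..n}" for j
      unfolding P0_def using assms(7)[OF that] domain.zeroprimeideal[OF assms(6)[OF that]] by auto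
    interpret Z: separated_prime_family F "{1..n}" R P0
      by (rule separated_prime_family_affine[OF assms(3) fin assms(5) prime0])
    have "Z.expand {1..n} = S.ext i (P0 i)" by (rule Z.expand_eq_ext[OF i]) (simp add: P0_def)
    thus ?thesis using Z.expand_primeideal unfolding P0_def T_def by simp
  qed
  thus ?thesis unfolding P'_eq T_def by (rule S.symbolic_power_binomial)
qed

end
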